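(* Let $\mathfrak{A}$ be the smallest C$^*$-subalgebra of $\mathcal{L}(L^2(\mathbb{R}))$ containing all multiplication operators $a(M)$ with $a\in C[-\infty,+\infty]$, all multiplication operators by $2\pi$-periodic continuous functions, and all Fourier multipliers $b(D)=F^{-1}b(M)F$ with $b\in C[-\infty,+\infty]$. Let $\gamma:\mathfrak{A}\to C(\mathbb{S}^1\times\{-1,+1\},\mathfrak{B})$ be the boundary principal symbol homomorphism described in the context, where $\mathfrak{B}=\mathcal{L}(\ell^2(\mathbb{Z}))$. Let $\alpha$ be the translation-by-one automorphism of $C[-\infty,+\infty]$, $[\alpha(f)](x)=f(x-1)$ for $x\in\mathbb{R}$. Then the image of $\gamma$ is isomorphic, as a C$^*$-algebra, to the direct sum of two copies of the crossed product $C[-\infty,+\infty]\times_\alpha\mathbb{Z}$.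
   Context: $[-\infty,+\infty]$ is the two-point compactification of $\mathbb{R}$, so $C[-\infty,+\infty]$ is the algebra of continuous functions on $\mathbb{R}$ having limits at $\pm\infty$. $a(M)$ denotes multiplication by $a$ on $L^2(\mathbb{R})$, and $F$ is the Fourier transform, $Fu(\xi)=(2\pi)^{-1/2}\int e^{-ix\xi}u(x)\,dx$. For $\varphi\in\mathbb{R}$ let $U_\varphi$ be the operator on $L^2(\mathbb{S}^1)$ given by $U_\varphi f(z)=z^{-\varphi}f(z)$ (powers taken with one fixed choice of the argument of $z$), and let $Y_\varphi$ be the unitary operator on $\ell^2(\mathbb{Z})$ obtained by conjugating $U_\varphi$ with the discrete Fourier transform $\sum_k u_kz^k\leftrightarrow (u_k)_{k\in\mathbb{Z}}$; thus $Y_j((u_k)_k)=(u_{j+k})_k$ for $j\in\mathbb{Z}$ and $Y_\varphi Y_\psi=Y_{\varphi+\psi}$. It is known that there is a (unique) C$^*$-algebra homomorphism $\gamma:\mathfrak{A}\to C(\mathbb{S}^1\times\{-1,+1\},\mathfrak{B})$, $A\mapsto\gamma_A$, such that for each $v=(e^{2\pi i\varphi},\pm1)$: (i) $\gamma_{a(M)}(v)=a(\pm\infty)I$ if $a\in C[-\infty,+\infty]$; (ii) $\gamma_{e_k(M)}(v)=Y_{-k}$ for $e_k(x)=e^{ikx}$, $k\in\mathbb{Z}$; (iii) $\gamma_{b(D)}(v)=Y_\varphi M^b_\varphi Y_{-\varphi}$ if $b\in C[-\infty,+\infty]$, where $M^b_\varphi((a_j)_j)=(b(j-\varphi)a_j)_j$.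 For a C$^*$-algebra $A$ and an automorphism $\alpha$ of $A$, $A\times_\alpha\mathbb{Z}$ is the enveloping C$^*$-algebra of the involutive Banach algebra $\ell^1(\mathbb{Z},A)$ with product $(\mathbf{f}\cdot\mathbf{g})(n)=\sum_{k}f_k\alpha^k(g_{n-k})$ and involution $\mathbf{f}^*(n)=\alpha^n(f_{-n}^* )$. *)

theory Defs
  imports "HOL-Analysis.Analysis" "HOL-Algebra.Module"
begin

section \<open>Complex inner product spaces and their bounded operators\<close>

class complex_inner = real_inner +
  fixes scaleC :: "complex \<Rightarrow> 'a \<Rightarrow> 'a" (infixr "*\<^sub>C" 75)
    and cinner :: "'a \<Rightarrow> 'a \<Rightarrow> complex"
  assumes scaleC_add_right: "c *\<^sub>C (x + y) = c *\<^sub>C x + c *\<^sub>C y"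
    and scaleC_add_left: "(c + d) *\<^sub>C x = c *\<^sub>C x + d *\<^sub>C x"
    and scaleC_scaleC: "c *\<^sub>C d *\<^sub>C x = (c * d) *\<^sub>C x"
    and scaleC_of_real: "of_real r *\<^sub>C x = r *\<^sub>R x"
    and cinner_commute: "cinner x y = cnj (cinner y x)"
    and cinner_add_left: "cinner (x + y) z = cinner x z + cinner y z"
    and cinner_scaleC_left: "cinner (c *\<^sub>C x) y = c * cinner x y"
    and inner_eq_Re_cinner: "inner x y = Re (cinner x y)"

lemma cinner_self: "cinner x x = of_real ((norm x)\<^sup>2)"
  for x :: "'a::complex_inner"
proof (rule complex_eqI)
  show "Re (cinner x x) = Re (of_real ((norm x)\<^sup>2))"
    by (simp add: inner_eq_Re_cinner[symmetric] power2_norm_eq_inner)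
  have "Im (cinner x x) = - Im (cinner x x)"
    by (subst cinner_commute) simp
  then show "Im (cinner x x) = Im (of_real ((norm x)\<^sup>2))" by simp
qed

lemma norm_scaleC: "norm (c *\<^sub>C x) = cmod c * norm x"
  for x :: "'a::complex_inner"
proof -
  have "cinner (c *\<^sub>C x) (c *\<^sub>C x) = c * cnj c * cinner x x"
    by (metis cinner_commute cinner_scaleC_left complex_cnj_mult mult.assoc)
  then have "complex_of_real ((norm (c *\<^sub>C x))\<^sup>2) = of_real ((cmod c)\<^sup>2) * of_real ((norm x)\<^sup>2)"
    by (simp only: cinner_self complex_norm_square)
  also have "\<dots> = of_real ((cmod c * norm x)\<^sup>2)"
    by (simp add: power_mult_distrib)
  finally have "complex_of_real ((norm (c *\<^sub>C x))\<^sup>2) = of_real ((cmod c * norm x)\<^sup>2)" .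
  then have "(norm (c *\<^sub>C x))\<^sup>2 = (cmod c * norm x)\<^sup>2"
    using of_real_eq_iff by blast
  then show ?thesis by (simp add: power2_eq_iff_nonneg)
qed

lemma scaleC_zero_right: "c *\<^sub>C (0::'a::complex_inner) = 0"
  by (metis add_cancel_right_right scaleC_add_right)

typedef (overloaded) 'h cbop =
  "{A :: 'h::complex_inner \<Rightarrow>\<^sub>L 'h. \<forall>c x. A (c *\<^sub>C x) = c *\<^sub>C A x}"
  by (rule exI[of _ 0]) (simp add: scaleC_zero_right)

setup_lifting type_definition_cbop

lift_definition cbop_apply :: "'h::complex_inner cbop \<Rightarrow> 'h \<Rightarrow> 'h" (infixr "\<bullet>\<^sub>o" 75)
  is blinfun_apply .

lift_definition cbop_norm :: "'h::complex_inner cbop \<Rightarrow> real" is norm .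

lift_definition cbop_zero :: "'h::complex_inner cbop" is 0
  by (simp add: scaleC_zero_right)

lift_definition cbop_one :: "'h::complex_inner cbop" is id_blinfun
  by (simp add: id_blinfun.rep_eq)

lift_definition cbop_plus :: "'h::complex_inner cbop \<Rightarrow> 'h cbop \<Rightarrow> 'h cbop" is "(+)"
  by (simp add: plus_blinfun.rep_eq scaleC_add_right)

lift_definition cbop_compose :: "'h::complex_inner cbop \<Rightarrow> 'h cbop \<Rightarrow> 'h cbop" (infixl "\<circ>\<^sub>o" 70)
  is "(o\<^sub>L)"
  by simp

lemma bounded_linear_scaleC: "bounded_linear (\<lambda>x :: 'h::complex_inner. c *\<^sub>C x)"
proof (rule bounded_linear_intro[of _ "cmod c"])
  show "c *\<^sub>C r *\<^sub>R x = r *\<^sub>R c *\<^sub>C x" for r and x :: 'h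
    by (metis mult.commute scaleC_of_real scaleC_scaleC)
qed (simp_all add: scaleC_add_right norm_scaleC mult.commute)

lift_definition cbop_scale :: "complex \<Rightarrow> 'h::complex_inner cbop \<Rightarrow> 'h cbop"
  is "\<lambda>c A. Blinfun (\<lambda>x. c *\<^sub>C x) o\<^sub>L A"
  by (simp add: bounded_linear_Blinfun_apply[OF bounded_linear_scaleC] scaleC_scaleC mult.commute)

definition cbop_adjoint :: "'h::complex_inner cbop \<Rightarrow> 'h cbop" where
  "cbop_adjoint A = (THE B. \<forall>x y. cinner (A \<bullet>\<^sub>o x) y = cinner x (B \<bullet>\<^sub>o y))"

definition cbop_inverse :: "'h::complex_inner cbop \<Rightarrow> 'h cbop" where
  "cbop_inverse A = (THE B. A \<circ>\<^sub>o B = cbop_one \<and> B \<circ>\<^sub>o A = cbop_one)"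

definition cbop_of :: "('h::complex_inner \<Rightarrow> 'h) \<Rightarrow> 'h cbop" where
  "cbop_of f = Abs_cbop (Blinfun f)"

lemma cbop_of_apply:
  assumes "\<And>x y. f (x + y) = f x + f y"
    and "\<And>c x. f (c *\<^sub>C x) = c *\<^sub>C f x"
    and "\<And>x. norm (f x) \<le> norm x * K"
  shows "cbop_of f \<bullet>\<^sub>o x = f x"
proof -
  have bl: "bounded_linear f"
    by (rule bounded_linear_intro[of _ K]) (metis assms scaleC_of_real)+
  show ?thesis
    unfolding cbop_of_def cbop_apply.rep_eq
    by (subst Abs_cbop_inverse) (simp_all add: bounded_linear_Blinfun_apply[OF bl] assms(2))
qed


section \<open>The space of square-summable families\<close>

typedef 'a l2 = "{u :: 'a \<Rightarrow> complex. (\<lambda>i. (cmod (u i))\<^sup>2) summable_on UNIV}"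
  by (rule exI[of _ "\<lambda>_. 0"]) simp

setup_lifting type_definition_l2

lemma l2_product_summable:
  assumes "(\<lambda>i. (cmod (u i))\<^sup>2) summable_on UNIV" "(\<lambda>i. (cmod (v i))\<^sup>2) summable_on UNIV"
  shows "(\<lambda>i. u i * cnj (v i)) summable_on UNIV"
  by (rule abs_summable_summable, rule abs_summable_product)
    (use assms in \<open>simp_all add: norm_mult power2_eq_square\<close>)

lemma cmod_sum_square_le: "(cmod (a + b))\<^sup>2 \<le> 2 * (cmod a)\<^sup>2 + 2 * (cmod b)\<^sup>2"
proof -
  have "(cmod (a + b))\<^sup>2 \<le> (cmod a + cmod b)\<^sup>2"
    by (simp add: norm_triangle_ineq power_mono)
  also have "\<dots> \<le> 2 * (cmod a)\<^sup>2 + 2 * (cmod b)\<^sup>2"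
    using zero_le_power2[of "cmod a - cmod b"] by (simp add: power2_eq_square algebra_simps)
  finally show ?thesis .
qed

lemma l2_add_summable:
  assumes "(\<lambda>i. (cmod (u i))\<^sup>2) summable_on UNIV" "(\<lambda>i. (cmod (v i))\<^sup>2) summable_on UNIV"
  shows "(\<lambda>i. (cmod (u i + v i))\<^sup>2) summable_on UNIV"
  by (rule summable_on_comparison_test[of "\<lambda>i. 2 * (cmod (u i))\<^sup>2 + 2 * (cmod (v i))\<^sup>2"])
    (use assms in \<open>auto intro!: summable_on_add summable_on_cmult_right cmod_sum_square_le\<close>)

lemma l2_scale_summable:
  assumes "(\<lambda>i. (cmod (u i))\<^sup>2) summable_on UNIV"
  shows "(\<lambda>i. (cmod (c * u i))\<^sup>2) summable_on UNIV"
  using assms by (simp add: norm_mult power_mult_distrib summable_on_cmult_right)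

instantiation l2 :: (type) complex_inner
begin

lift_definition zero_l2 :: "'a l2" is "\<lambda>_. 0" by simp
lift_definition plus_l2 :: "'a l2 \<Rightarrow> 'a l2 \<Rightarrow> 'a l2" is "\<lambda>u v i. u i + v i"
  by (rule l2_add_summable)
lift_definition uminus_l2 :: "'a l2 \<Rightarrow> 'a l2" is "\<lambda>u i. - u i" by simp
lift_definition minus_l2 :: "'a l2 \<Rightarrow> 'a l2 \<Rightarrow> 'a l2" is "\<lambda>u v i. u i - v i"
  using l2_add_summable[of u "\<lambda>i. - v i" for u v :: "'a \<Rightarrow> complex"] by simp
lift_definition scaleC_l2 :: "complex \<Rightarrow> 'a l2 \<Rightarrow> 'a l2" is "\<lambda>c u i. c * u i"
  by (rule l2_scale_summable)
lift_definition cinner_l2 :: "'a l2 \<Rightarrow> 'a l2 \<Rightarrow> complex"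
  is "\<lambda>u v. \<Sum>\<^sub>\<infinity>i. u i * cnj (v i)" .

definition scaleR_l2 where "scaleR_l2 r (u::'a l2) = of_real r *\<^sub>C u"
definition "inner (u::'a l2) v = Re (cinner u v)"
definition "norm (u::'a l2) = sqrt (inner u u)"
definition "dist (u::'a l2) v = norm (u - v)"
definition "sgn (u::'a l2) = inverse (norm u) *\<^sub>R u"
definition [code del]:
  "(uniformity :: ('a l2 \<times> 'a l2) filter) = (INF e\<in>{0<..}. principal {(x, y). dist x y < e})"
definition [code del]:
  "open (S :: 'a l2 set) = (\<forall>x\<in>S. \<forall>\<^sub>F (x', y) in uniformity. x' = x \<longrightarrow> y \<in> S)"

instance
proof
  fix u v w :: "'a l2" and c d :: complex and r s :: real
  show "u + v + w = u + (v + w)" "u + v = v + u" "0 + u = u" "- u + u = 0" "u - v = u + - v"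
    by (transfer; simp add: add_ac)+
  show c1: "c *\<^sub>C (u + v) = c *\<^sub>C u + c *\<^sub>C v" and c2: "(c + d) *\<^sub>C u = c *\<^sub>C u + d *\<^sub>C u"
    and c3: "c *\<^sub>C d *\<^sub>C u = (c * d) *\<^sub>C u" for c d and u v :: "'a l2"
    by (transfer; simp add: algebra_simps)+
  show "of_real r *\<^sub>C u = r *\<^sub>R u" by (simp add: scaleR_l2_def)
  show "r *\<^sub>R (u + v) = r *\<^sub>R u + r *\<^sub>R v" "(r + s) *\<^sub>R u = r *\<^sub>R u + s *\<^sub>R u"
    "r *\<^sub>R s *\<^sub>R u = (r * s) *\<^sub>R u"
    by (simp_all add: scaleR_l2_def c1 c2 c3)
  show "1 *\<^sub>R u = u" unfolding scaleR_l2_def by transfer simp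
  show i1: "cinner u v = cnj (cinner v u)" for u v :: "'a l2"
    by transfer (simp only: infsum_cnj[symmetric] complex_cnj_mult complex_cnj_cnj mult.commute)
  show i2: "cinner (u + v) w = cinner u w + cinner v w" for u v w :: "'a l2"
    by transfer (simp add: ring_distribs infsum_add l2_product_summable)
  show i3: "cinner (c *\<^sub>C u) v = c * cinner u v" for c and u v :: "'a l2"
    by transfer (simp add: mult.assoc infsum_cmult_right')
  show "inner u v = Re (cinner u v)" by (simp add: inner_l2_def)
  show "inner u v = inner v u"
    unfolding inner_l2_def using i1[of u v] by simp
  show "inner (u + v) w = inner u w + inner v w" by (simp add: inner_l2_def i2)
  show "inner (r *\<^sub>R u) v = r * inner u v" by (simp add: inner_l2_def scaleR_l2_def i3)
  have sq: "inner u u = (\<Sum>\<^sub>\<infinity>i. (cmod (Rep_l2 u i))\<^sup>2)"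
  proof -
    have "(\<lambda>i. Rep_l2 u i * cnj (Rep_l2 u i)) summable_on UNIV"
      using Rep_l2[of u] by (intro l2_product_summable) auto
    then show ?thesis
      unfolding inner_l2_def cinner_l2.rep_eq
      by (subst infsum_Re[symmetric]) (auto intro!: infsum_cong simp: cmod_def power2_eq_square)
  qed
  show "0 \<le> inner u u" by (simp add: sq infsum_nonneg)
  have "u = 0" if "inner u u = 0"
  proof -
    have "(cmod (Rep_l2 u i))\<^sup>2 = 0" for i
      by (rule nonneg_infsum_le_0D[where A=UNIV and f="\<lambda>i. (cmod (Rep_l2 u i))\<^sup>2"])
        (use that Rep_l2[of u] in \<open>auto simp: sq\<close>)
    then have "Rep_l2 u = Rep_l2 0" by (simp add: zero_l2.rep_eq fun_eq_iff)
    then show ?thesis by (simp add: Rep_l2_inject)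
  qed
  moreover have "inner (0::'a l2) 0 = 0"
    unfolding inner_l2_def by transfer simp
  ultimately show "(inner u u = 0) = (u = 0)" by blast
qed (simp_all add: norm_l2_def dist_l2_def sgn_l2_def uniformity_l2_def open_l2_def)

end

lift_definition l2_mult :: "('a \<Rightarrow> complex) \<Rightarrow> 'a l2 \<Rightarrow> 'a l2"
  is "\<lambda>d u. if bounded (range d) then (\<lambda>i. d i * u i) else (\<lambda>_. 0)"
proof -
  fix d u :: "'a \<Rightarrow> complex" assume u: "(\<lambda>i. (cmod (u i))\<^sup>2) summable_on UNIV"
  show "(\<lambda>i. (cmod ((if bounded (range d) then \<lambda>i. d i * u i else (\<lambda>_. 0)) i))\<^sup>2) summable_on UNIV"
  proof (cases "bounded (range d)")
    case True
    then obtain K where "\<And>i. cmod (d i) \<le> K" by (auto simp: bounded_iff)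
    then have "(cmod (d i * u i))\<^sup>2 \<le> (cmod (of_real K * u i))\<^sup>2" for i
      by (intro power_mono) (auto simp: norm_mult intro!: mult_right_mono order_trans[OF _ abs_ge_self])
    then show ?thesis
      using True l2_scale_summable[OF u, of "of_real K"]
      by (auto intro: summable_on_comparison_test[of "\<lambda>i. (cmod (of_real K * u i))\<^sup>2"])
  qed simp
qed

definition diag_op :: "('a \<Rightarrow> complex) \<Rightarrow> 'a l2 cbop" where
  "diag_op d = cbop_of (l2_mult d)"


section \<open>Square-integrable functions on the real line\<close>

definition square_integrable :: "(real \<Rightarrow> complex) \<Rightarrow> bool" where
  "square_integrable f \<longleftrightarrow>
     f \<in> borel_measurable lborel \<and> integrable lborel (\<lambda>x. (cmod (f x))\<^sup>2)"

quotient_type L2R = "real \<Rightarrow> complex" / partial: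
  "\<lambda>f g. square_integrable f \<and> square_integrable g \<and> (AE x in lborel. f x = g x)"
proof (rule part_equivpI)
  show "\<exists>f. square_integrable f \<and> square_integrable f \<and> (AE x in lborel. f x = f x)"
    by (rule exI[of _ "\<lambda>_. 0"]) (simp add: square_integrable_def)
  show "symp (\<lambda>f g. square_integrable f \<and> square_integrable g \<and> (AE x in lborel. f x = g x))"
    by (rule sympI) auto
  show "transp (\<lambda>f g. square_integrable f \<and> square_integrable g \<and> (AE x in lborel. f x = g x))"
    by (rule transpI) auto
qed

lemma square_integrable_product:
  assumes "square_integrable f" "square_integrable g"
  shows "integrable lborel (\<lambda>x. f x * cnj (g x))"
proof (rule Bochner_Integration.integrable_bound)
  show "integrable lborel (\<lambda>x. (cmod (f x))\<^sup>2 + (cmod (g x))\<^sup>2)"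
    using assms by (auto simp: square_integrable_def)
  have "cnj \<in> borel_measurable borel"
    by (intro borel_measurable_continuous_onI continuous_intros)
  then have "(\<lambda>x. cnj (g x)) \<in> borel_measurable lborel"
    using assms by (auto simp: square_integrable_def intro: measurable_compose)
  then show "(\<lambda>x. f x * cnj (g x)) \<in> borel_measurable lborel"
    using assms by (auto simp: square_integrable_def)
  have "cmod a * cmod b \<le> (cmod a)\<^sup>2 + (cmod b)\<^sup>2" for a b
  proof -
    have "0 \<le> (cmod a - cmod b)\<^sup>2" "0 \<le> cmod a * cmod b" by simp_all
    then show ?thesis by (simp only: power2_diff)
  qed
  then show "AE x in lborel. norm (f x * cnj (g x)) \<le> norm ((cmod (f x))\<^sup>2 + (cmod (g x))\<^sup>2)"
    by (simp add: norm_mult)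
qed

lemma square_integrable_add:
  assumes "square_integrable f" "square_integrable g"
  shows "square_integrable (\<lambda>x. f x + g x)"
proof -
  have m: "f \<in> borel_measurable lborel" "g \<in> borel_measurable lborel"
    and i: "integrable lborel (\<lambda>x. (cmod (f x))\<^sup>2)" "integrable lborel (\<lambda>x. (cmod (g x))\<^sup>2)"
    using assms by (simp_all add: square_integrable_def)
  have s: "(\<lambda>x. f x + g x) \<in> borel_measurable lborel"
    using m by (rule borel_measurable_add)
  have "integrable lborel (\<lambda>x. (cmod (f x + g x))\<^sup>2)"
  proof (rule Bochner_Integration.integrable_bound)
    show "integrable lborel (\<lambda>x. 2 * (cmod (f x))\<^sup>2 + 2 * (cmod (g x))\<^sup>2)"
      using i by (intro Bochner_Integration.integrable_add integrable_mult_right)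
    show "(\<lambda>x. (cmod (f x + g x))\<^sup>2) \<in> borel_measurable lborel"
      using s by (intro borel_measurable_power measurable_compose[OF _ borel_measurable_norm])
    show "AE x in lborel. norm ((cmod (f x + g x))\<^sup>2)
        \<le> norm (2 * (cmod (f x))\<^sup>2 + 2 * (cmod (g x))\<^sup>2)"
      by (simp add: cmod_sum_square_le)
  qed
  with s show ?thesis by (simp add: square_integrable_def)
qed

lemma square_integrable_bounded_mult:
  assumes a: "a \<in> borel_measurable lborel" "bounded (range a)" and f: "square_integrable f"
  shows "square_integrable (\<lambda>x. a x * f x)"
proof -
  have fm: "f \<in> borel_measurable lborel" and i: "integrable lborel (\<lambda>x. (cmod (f x))\<^sup>2)"
    using f by (simp_all add: square_integrable_def)
  have m: "(\<lambda>x. a x * f x) \<in> borel_measurable lborel"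
    using a(1) fm by (rule borel_measurable_times)
  obtain K where K: "\<And>i. cmod (a i) \<le> K" using a(2) by (auto simp: bounded_iff)
  have "integrable lborel (\<lambda>x. (cmod (a x * f x))\<^sup>2)"
  proof (rule Bochner_Integration.integrable_bound)
    show "integrable lborel (\<lambda>x. K\<^sup>2 * (cmod (f x))\<^sup>2)"
      using i by (intro integrable_mult_right)
    show "(\<lambda>x. (cmod (a x * f x))\<^sup>2) \<in> borel_measurable lborel"
      using m by (intro borel_measurable_power measurable_compose[OF _ borel_measurable_norm])
    show "AE x in lborel. norm ((cmod (a x * f x))\<^sup>2) \<le> norm (K\<^sup>2 * (cmod (f x))\<^sup>2)"
      by (simp add: norm_mult power_mult_distrib mult_right_mono power_mono K)
  qed
  with m show ?thesis by (simp add: square_integrable_def)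
qed

lemma square_integrable_scale:
  assumes "square_integrable f"
  shows "square_integrable (\<lambda>x. c * f x)"
  by (rule square_integrable_bounded_mult) (use assms in \<open>auto simp: bounded_iff\<close>)

instantiation L2R :: complex_inner
begin

lift_definition zero_L2R :: L2R is "\<lambda>_. 0" by (simp add: square_integrable_def)
lift_definition plus_L2R :: "L2R \<Rightarrow> L2R \<Rightarrow> L2R" is "\<lambda>f g x. f x + g x"
  by (auto intro: square_integrable_add)
lift_definition scaleC_L2R :: "complex \<Rightarrow> L2R \<Rightarrow> L2R" is "\<lambda>c f x. c * f x"
  by (auto intro: square_integrable_scale)
lift_definition cinner_L2R :: "L2R \<Rightarrow> L2R \<Rightarrow> complex"
  is "\<lambda>f g. LINT x|lborel. f x * cnj (g x)"
proof (rule integral_cong_AE)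
  fix f f' g g' :: "real \<Rightarrow> complex"
  assume a: "square_integrable f \<and> square_integrable f' \<and> (AE x in lborel. f x = f' x)"
    "square_integrable g \<and> square_integrable g' \<and> (AE x in lborel. g x = g' x)"
  show "(\<lambda>x. f x * cnj (g x)) \<in> borel_measurable lborel"
    "(\<lambda>x. f' x * cnj (g' x)) \<in> borel_measurable lborel"
    using a square_integrable_product[of f g, THEN borel_measurable_integrable]
      square_integrable_product[of f' g', THEN borel_measurable_integrable] by simp_all
  show "AE x in lborel. f x * cnj (g x) = f' x * cnj (g' x)"
    using a by auto
qed

definition "- (f::L2R) = (- 1) *\<^sub>C f"
definition "(f::L2R) - g = f + - g"
definition scaleR_L2R where "scaleR_L2R r (f::L2R) = of_real r *\<^sub>C f"
definition "inner (f::L2R) g = Re (cinner f g)"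
definition "norm (f::L2R) = sqrt (inner f f)"
definition "dist (f::L2R) g = norm (f - g)"
definition "sgn (f::L2R) = inverse (norm f) *\<^sub>R f"
definition [code del]:
  "(uniformity :: (L2R \<times> L2R) filter) = (INF e\<in>{0<..}. principal {(x, y). dist x y < e})"
definition [code del]:
  "open (S :: L2R set) = (\<forall>x\<in>S. \<forall>\<^sub>F (x', y) in uniformity. x' = x \<longrightarrow> y \<in> S)"

instance
proof
  fix u v w :: L2R and c d :: complex and r s :: real
  show "u + v + w = u + (v + w)"
    by transfer (auto intro!: square_integrable_add simp: add_ac)
  show "u + v = v + u"
    by transfer (auto intro!: square_integrable_add simp: add_ac)
  show "0 + u = u"
    by transfer auto
  show "u - v = u + - v"
    by (simp add: minus_L2R_def)
  show "- u + u = 0"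
    unfolding uminus_L2R_def
    by transfer (auto simp: square_integrable_def)
  show c1: "c *\<^sub>C (u + v) = c *\<^sub>C u + c *\<^sub>C v" for c and u v :: L2R
    by transfer (auto intro!: square_integrable_add square_integrable_scale simp: ring_distribs)
  show c2: "(c + d) *\<^sub>C u = c *\<^sub>C u + d *\<^sub>C u" for c d and u :: L2R
    by transfer (auto intro!: square_integrable_add square_integrable_scale simp: ring_distribs)
  show c3: "c *\<^sub>C d *\<^sub>C u = (c * d) *\<^sub>C u" for c d and u :: L2R
    by transfer (auto intro!: square_integrable_scale simp: mult.assoc)
  show "of_real r *\<^sub>C u = r *\<^sub>R u" by (simp add: scaleR_L2R_def)
  show "r *\<^sub>R (u + v) = r *\<^sub>R u + r *\<^sub>R v" "(r + s) *\<^sub>R u = r *\<^sub>R u + s *\<^sub>R u"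
    "r *\<^sub>R s *\<^sub>R u = (r * s) *\<^sub>R u"
    by (simp_all add: scaleR_L2R_def c1 c2 c3)
  show "1 *\<^sub>R u = u" unfolding scaleR_L2R_def by transfer simp
  show i1: "cinner u v = cnj (cinner v u)" for u v :: L2R
    by transfer (simp only: Bochner_Integration.integral_cnj[symmetric] complex_cnj_mult complex_cnj_cnj mult.commute)
  show i2: "cinner (u + v) w = cinner u w + cinner v w" for u v w :: L2R
    by transfer (simp only: ring_distribs Bochner_Integration.integral_add square_integrable_product)
  show i3: "cinner (c *\<^sub>C u) v = c * cinner u v" for c and u v :: L2R
    by transfer (simp only: mult.assoc integral_mult_right_zero)
  show "inner u v = Re (cinner u v)" by (simp add: inner_L2R_def)
  show "inner u v = inner v u"
    unfolding inner_L2R_def using i1[of u v] by simp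
  show "inner (u + v) w = inner u w + inner v w" by (simp add: inner_L2R_def i2)
  show "inner (r *\<^sub>R u) v = r * inner u v" by (simp add: inner_L2R_def scaleR_L2R_def i3)
  have sq: "Re (LINT x|lborel. f x * cnj (f x)) = (LINT x|lborel. (cmod (f x))\<^sup>2)" for f :: "real \<Rightarrow> complex"
    by (simp only: complex_norm_square[symmetric] integral_complex_of_real Re_complex_of_real)
  show "0 \<le> inner u u"
    unfolding inner_L2R_def
  proof transfer
    show "0 \<le> Re (LINT x|lborel. f x * cnj (f x))" for f :: "real \<Rightarrow> complex"
      by (subst sq, rule Bochner_Integration.integral_nonneg) simp
  qed
  show "(inner u u = 0) = (u = 0)"
    unfolding inner_L2R_def
  proof transfer
    fix f assume "square_integrable f \<and> square_integrable f \<and> (AE x in lborel. f x = f x)"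
    then have f: "square_integrable f" by simp
    have z: "square_integrable (\<lambda>_. 0)"
      by (simp add: square_integrable_def)
    have e: "(LINT x|lborel. (cmod (f x))\<^sup>2) = 0 \<longleftrightarrow> (AE x in lborel. f x = 0)"
      using f integral_nonneg_eq_0_iff_AE[of lborel "\<lambda>x. (cmod (f x))\<^sup>2"]
      by (simp add: square_integrable_def)
    show "(Re (LINT x|lborel. f x * cnj (f x)) = 0) \<longleftrightarrow>
        (square_integrable f \<and> square_integrable (\<lambda>_. 0) \<and> (AE x in lborel. f x = 0))"
      by (subst sq) (simp only: e f z simp_thms)
  qed
qed (rule norm_L2R_def dist_L2R_def sgn_L2R_def uniformity_L2R_def open_L2R_def)+

end

lift_definition L2R_mult :: "(real \<Rightarrow> complex) \<Rightarrow> L2R \<Rightarrow> L2R"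
  is "\<lambda>a f. if a \<in> borel_measurable lborel \<and> bounded (range a) then (\<lambda>x. a x * f x) else (\<lambda>_. 0)"
  by (auto intro: square_integrable_bounded_mult simp: square_integrable_def[of "\<lambda>_. 0"])

definition mult_op :: "(real \<Rightarrow> complex) \<Rightarrow> L2R cbop" where
  "mult_op a = cbop_of (L2R_mult a)"

text \<open>The Fourier transform on the space of square-integrable functions is the bounded
  extension of the integral formula from the dense subspace of integrable ones.\<close>

definition fourier_op :: "L2R cbop" where
  "fourier_op = (THE F. \<forall>f. square_integrable f \<and> integrable lborel f \<longrightarrow>
     F \<bullet>\<^sub>o abs_L2R f =
       abs_L2R (\<lambda>\<xi>. of_real (1 / sqrt (2 * pi)) * (LINT x|lborel. cis (- (x * \<xi>)) * f x)))"

definition fourier_multiplier :: "(real \<Rightarrow> complex) \<Rightarrow> L2R cbop" where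
  "fourier_multiplier b = cbop_inverse fourier_op \<circ>\<^sub>o mult_op b \<circ>\<^sub>o fourier_op"


section \<open>Algebras with involution and norm\<close>

text \<open>The unit field of the ring record is not used in any of the notions below; neither
  homomorphisms nor subalgebras are required to respect it.\<close>

record 'a star_algebra = "(complex, 'a) module" +
  invol :: "'a \<Rightarrow> 'a"
  alg_norm :: "'a \<Rightarrow> real"

definition star_hom :: "'a star_algebra \<Rightarrow> 'b star_algebra \<Rightarrow> ('a \<Rightarrow> 'b) set" where
  "star_hom A B = {h. h \<in> carrier A \<rightarrow> carrier B
     \<and> (\<forall>x\<in>carrier A. \<forall>y\<in>carrier A.
          h (x \<oplus>\<^bsub>A\<^esub> y) = h x \<oplus>\<^bsub>B\<^esub> h y \<and> h (x \<otimes>\<^bsub>A\<^esub> y) = h x \<otimes>\<^bsub>B\<^esub> h y)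
     \<and> (\<forall>c. \<forall>x\<in>carrier A. h (c \<odot>\<^bsub>A\<^esub> x) = c \<odot>\<^bsub>B\<^esub> h x)
     \<and> (\<forall>x\<in>carrier A. h (invol A x) = invol B (h x))}"

definition cstar_isomorphic :: "'a star_algebra \<Rightarrow> 'b star_algebra \<Rightarrow> bool" where
  "cstar_isomorphic A B \<longleftrightarrow>
     (\<exists>h\<in>star_hom A B. bij_betw h (carrier A) (carrier B)
        \<and> (\<forall>x\<in>carrier A. alg_norm B (h x) = alg_norm A x))"

definition cstar_subalgebra :: "'a set \<Rightarrow> 'a star_algebra \<Rightarrow> bool" where
  "cstar_subalgebra S A \<longleftrightarrow> S \<subseteq> carrier A \<and> \<zero>\<^bsub>A\<^esub> \<in> S
     \<and> (\<forall>x\<in>S. \<forall>y\<in>S. x \<oplus>\<^bsub>A\<^esub> y \<in> S \<and> x \<otimes>\<^bsub>A\<^esub> y \<in> S)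
     \<and> (\<forall>c. \<forall>x\<in>S. c \<odot>\<^bsub>A\<^esub> x \<in> S)
     \<and> (\<forall>x\<in>S. invol A x \<in> S)
     \<and> (\<forall>s. \<forall>x\<in>carrier A. range s \<subseteq> S \<and> (\<lambda>n. alg_norm A (s n \<ominus>\<^bsub>A\<^esub> x)) \<longlonglongrightarrow> 0 \<longrightarrow> x \<in> S)"

definition cstar_generated :: "'a star_algebra \<Rightarrow> 'a set \<Rightarrow> 'a star_algebra" where
  "cstar_generated A G = A\<lparr>carrier := \<Inter>{S. cstar_subalgebra S A \<and> G \<subseteq> S}\<rparr>"

definition image_algebra :: "('a \<Rightarrow> 'b) \<Rightarrow> 'a star_algebra \<Rightarrow> 'b star_algebra \<Rightarrow> 'b star_algebra" where
  "image_algebra h A B = B\<lparr>carrier := h ` carrier A\<rparr>"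

definition direct_sum :: "'a star_algebra \<Rightarrow> 'b star_algebra \<Rightarrow> ('a \<times> 'b) star_algebra" where
  "direct_sum A B =
     \<lparr>carrier = carrier A \<times> carrier B,
      mult = (\<lambda>x y. (fst x \<otimes>\<^bsub>A\<^esub> fst y, snd x \<otimes>\<^bsub>B\<^esub> snd y)),
      one = (\<one>\<^bsub>A\<^esub>, \<one>\<^bsub>B\<^esub>),
      zero = (\<zero>\<^bsub>A\<^esub>, \<zero>\<^bsub>B\<^esub>),
      add = (\<lambda>x y. (fst x \<oplus>\<^bsub>A\<^esub> fst y, snd x \<oplus>\<^bsub>B\<^esub> snd y)),
      smult = (\<lambda>c x. (c \<odot>\<^bsub>A\<^esub> fst x, c \<odot>\<^bsub>B\<^esub> snd x)),
      invol = (\<lambda>x. (invol A (fst x), invol B (snd x))),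
      alg_norm = (\<lambda>x. max (alg_norm A (fst x)) (alg_norm B (snd x)))\<rparr>"

definition complex_algebra :: "complex star_algebra" where
  "complex_algebra =
     \<lparr>carrier = UNIV, mult = (*), one = 1, zero = 0, add = (+), smult = (*),
      invol = cnj, alg_norm = cmod\<rparr>"

definition bounded_operators :: "'h::complex_inner cbop star_algebra" where
  "bounded_operators =
     \<lparr>carrier = UNIV, mult = (\<circ>\<^sub>o), one = cbop_one, zero = cbop_zero, add = cbop_plus,
      smult = cbop_scale, invol = cbop_adjoint, alg_norm = cbop_norm\<rparr>"

text \<open>Continuous functions on a compact set with values in a normed algebra; they are
  made undefined outside of that set so that equality is equality on the set.\<close>

definition continuous_algebra ::
    "'x::topological_space set \<Rightarrow> 'a star_algebra \<Rightarrow> ('x \<Rightarrow> 'a) star_algebra" where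
  "continuous_algebra X A =
     \<lparr>carrier = {f \<in> extensional X. \<forall>x\<in>X. f x \<in> carrier A
         \<and> ((\<lambda>y. alg_norm A (f y \<ominus>\<^bsub>A\<^esub> f x)) \<longlongrightarrow> 0) (at x within X)},
      mult = (\<lambda>f g. \<lambda>x\<in>X. f x \<otimes>\<^bsub>A\<^esub> g x),
      one = (\<lambda>x\<in>X. \<one>\<^bsub>A\<^esub>),
      zero = (\<lambda>x\<in>X. \<zero>\<^bsub>A\<^esub>),
      add = (\<lambda>f g. \<lambda>x\<in>X. f x \<oplus>\<^bsub>A\<^esub> g x),
      smult = (\<lambda>c f. \<lambda>x\<in>X. c \<odot>\<^bsub>A\<^esub> f x),
      invol = (\<lambda>f. \<lambda>x\<in>X. invol A (f x)),
      alg_norm = (\<lambda>f. SUP x\<in>X. alg_norm A (f x))\<rparr>"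


section \<open>Enveloping algebras and crossed products by the integers\<close>

text \<open>The supremum is over all representations of \<open>B\<close> on the Hilbert space of
  square-summable families indexed by the element type of \<open>B\<close>. Every cyclic representation
  of \<open>B\<close> acts on a space of dimension at most the cardinality of \<open>B\<close>, hence (extended by zero)
  occurs among them, so this is the supremum over all representations on Hilbert spaces.\<close>

definition representations :: "'b star_algebra \<Rightarrow> ('b \<Rightarrow> 'b l2 cbop) set" where
  "representations B = star_hom B bounded_operators"

definition enveloping_seminorm :: "'b star_algebra \<Rightarrow> 'b \<Rightarrow> real" where
  "enveloping_seminorm B b = (SUP \<pi>\<in>representations B. cbop_norm (\<pi> b))"

text \<open>Hausdorff completion of \<open>B\<close> with respect to a seminorm \<open>p\<close>: classes of
  \<open>p\<close>-Cauchy sequences modulo \<open>p\<close>-null sequences.\<close>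

definition cauchy_seqs :: "'b star_algebra \<Rightarrow> ('b \<Rightarrow> real) \<Rightarrow> (nat \<Rightarrow> 'b) set" where
  "cauchy_seqs B p = {s. range s \<subseteq> carrier B
     \<and> (\<forall>e>0. \<exists>N. \<forall>m\<ge>N. \<forall>n\<ge>N. p (s m \<ominus>\<^bsub>B\<^esub> s n) < e)}"

definition cauchy_class :: "'b star_algebra \<Rightarrow> ('b \<Rightarrow> real) \<Rightarrow> (nat \<Rightarrow> 'b) \<Rightarrow> (nat \<Rightarrow> 'b) set" where
  "cauchy_class B p s = {t \<in> cauchy_seqs B p. (\<lambda>n. p (t n \<ominus>\<^bsub>B\<^esub> s n)) \<longlonglongrightarrow> 0}"

definition class_rep :: "(nat \<Rightarrow> 'b) set \<Rightarrow> nat \<Rightarrow> 'b" where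
  "class_rep S = (SOME s. s \<in> S)"

definition seminorm_completion ::
    "'b star_algebra \<Rightarrow> ('b \<Rightarrow> real) \<Rightarrow> (nat \<Rightarrow> 'b) set star_algebra" where
  "seminorm_completion B p =
     \<lparr>carrier = cauchy_class B p ` cauchy_seqs B p,
      mult = (\<lambda>S T. cauchy_class B p (\<lambda>n. class_rep S n \<otimes>\<^bsub>B\<^esub> class_rep T n)),
      one = cauchy_class B p (\<lambda>_. \<one>\<^bsub>B\<^esub>),
      zero = cauchy_class B p (\<lambda>_. \<zero>\<^bsub>B\<^esub>),
      add = (\<lambda>S T. cauchy_class B p (\<lambda>n. class_rep S n \<oplus>\<^bsub>B\<^esub> class_rep T n)),
      smult = (\<lambda>c S. cauchy_class B p (\<lambda>n. c \<odot>\<^bsub>B\<^esub> class_rep S n)),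
      invol = (\<lambda>S. cauchy_class B p (\<lambda>n. invol B (class_rep S n))),
      alg_norm = (\<lambda>S. lim (\<lambda>n. p (class_rep S n)))\<rparr>"

definition enveloping_algebra :: "'b star_algebra \<Rightarrow> (nat \<Rightarrow> 'b) set star_algebra" where
  "enveloping_algebra B = seminorm_completion B (enveloping_seminorm B)"

definition automorphism_power :: "'a star_algebra \<Rightarrow> ('a \<Rightarrow> 'a) \<Rightarrow> int \<Rightarrow> 'a \<Rightarrow> 'a" where
  "automorphism_power A \<alpha> k =
     (if k \<ge> 0 then \<alpha> ^^ nat k else inv_into (carrier A) \<alpha> ^^ nat (- k))"

text \<open>The unordered, norm convergent sum of a family of elements of \<open>A\<close>.\<close>

definition alg_infsum :: "'a star_algebra \<Rightarrow> ('i \<Rightarrow> 'a) \<Rightarrow> 'a" where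
  "alg_infsum A f = (THE s. s \<in> carrier A
     \<and> ((\<lambda>F. alg_norm A (finsum A f F \<ominus>\<^bsub>A\<^esub> s)) \<longlongrightarrow> 0) (finite_subsets_at_top UNIV))"

definition l1_algebra :: "'a star_algebra \<Rightarrow> ('a \<Rightarrow> 'a) \<Rightarrow> (int \<Rightarrow> 'a) star_algebra" where
  "l1_algebra A \<alpha> =
     \<lparr>carrier = {f. range f \<subseteq> carrier A \<and> (\<lambda>n. alg_norm A (f n)) summable_on UNIV},
      mult = (\<lambda>f g n. alg_infsum A (\<lambda>k. f k \<otimes>\<^bsub>A\<^esub> automorphism_power A \<alpha> k (g (n - k)))),
      one = (\<lambda>n. if n = 0 then \<one>\<^bsub>A\<^esub> else \<zero>\<^bsub>A\<^esub>),
      zero = (\<lambda>n. \<zero>\<^bsub>A\<^esub>),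
      add = (\<lambda>f g n. f n \<oplus>\<^bsub>A\<^esub> g n),
      smult = (\<lambda>c f n. c \<odot>\<^bsub>A\<^esub> f n),
      invol = (\<lambda>f n. automorphism_power A \<alpha> n (invol A (f (- n)))),
      alg_norm = (\<lambda>f. \<Sum>\<^sub>\<infinity>n. alg_norm A (f n))\<rparr>"

definition crossed_product ::
    "'a star_algebra \<Rightarrow> ('a \<Rightarrow> 'a) \<Rightarrow> (nat \<Rightarrow> int \<Rightarrow> 'a) set star_algebra" where
  "crossed_product A \<alpha> = enveloping_algebra (l1_algebra A \<alpha>)"


section \<open>The operator algebra on the line and its boundary principal symbol\<close>

text \<open>The two-point compactification of the line is \<^typ>\<open>ereal\<close>.\<close>

definition C_ext :: "(ereal \<Rightarrow> complex) star_algebra" where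
  "C_ext = continuous_algebra UNIV complex_algebra"

definition translation :: "(ereal \<Rightarrow> complex) \<Rightarrow> ereal \<Rightarrow> complex" where
  "translation f = (\<lambda>x. f (x - 1))"

abbreviation on_line :: "(ereal \<Rightarrow> complex) \<Rightarrow> real \<Rightarrow> complex" where
  "on_line a \<equiv> (\<lambda>x. a (ereal x))"

definition operator_algebra :: "L2R cbop star_algebra" where
  "operator_algebra = cstar_generated bounded_operators
     ({mult_op (on_line a) | a. a \<in> carrier C_ext}
      \<union> {mult_op p | p. continuous_on UNIV p \<and> (\<forall>x. p (x + 2 * pi) = p x)}
      \<union> {fourier_multiplier (on_line b) | b. b \<in> carrier C_ext})"

text \<open>Functions on the circle are functions on \<^typ>\<open>complex\<close> of which only the values at
  the points \<open>cis \<theta>\<close> matter. The discrete Fourier transform maps such a function to the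
  coefficients \<open>u k\<close> of its expansion as the sum of \<open>u k * z powi k\<close>.\<close>

definition circle_square_integrable :: "(complex \<Rightarrow> complex) \<Rightarrow> bool" where
  "circle_square_integrable f \<longleftrightarrow>
     set_borel_measurable lborel {0..2 * pi} (\<lambda>\<theta>. f (cis \<theta>))
     \<and> set_integrable lborel {0..2 * pi} (\<lambda>\<theta>. (cmod (f (cis \<theta>)))\<^sup>2)"

definition discrete_fourier :: "(complex \<Rightarrow> complex) \<Rightarrow> int l2" where
  "discrete_fourier f = Abs_l2 (\<lambda>k. of_real (1 / (2 * pi)) *
     (LINT \<theta>:{0..2 * pi}|lborel. f (cis \<theta>) * cis (- (of_int k * \<theta>))))"

definition argument_choice :: "(complex \<Rightarrow> real) \<Rightarrow> bool" where
  "argument_choice arg \<longleftrightarrow>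
     arg \<in> borel_measurable (restrict_space borel (sphere 0 1))
     \<and> (\<forall>z\<in>sphere 0 1. cis (arg z) = z)"

definition U_op :: "(complex \<Rightarrow> real) \<Rightarrow> real \<Rightarrow> (complex \<Rightarrow> complex) \<Rightarrow> complex \<Rightarrow> complex" where
  "U_op arg \<phi> f = (\<lambda>z. cis (- \<phi> * arg z) * f z)"

definition Y_op :: "(complex \<Rightarrow> real) \<Rightarrow> real \<Rightarrow> int l2 cbop" where
  "Y_op arg \<phi> = (THE T. \<forall>f. circle_square_integrable f \<longrightarrow>
     T \<bullet>\<^sub>o discrete_fourier f = discrete_fourier (U_op arg \<phi> f))"

definition symbol_algebra :: "(complex \<times> int \<Rightarrow> int l2 cbop) star_algebra" where
  "symbol_algebra = continuous_algebra (sphere 0 1 \<times> {- 1, 1}) bounded_operators"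

definition boundary_principal_symbol ::
    "(complex \<Rightarrow> real) \<Rightarrow> (L2R cbop \<Rightarrow> complex \<times> int \<Rightarrow> int l2 cbop) \<Rightarrow> bool" where
  "boundary_principal_symbol arg \<gamma> \<longleftrightarrow>
     \<gamma> \<in> star_hom operator_algebra symbol_algebra
     \<and> (\<forall>\<phi>. \<forall>a\<in>carrier C_ext.
          \<gamma> (mult_op (on_line a)) (cis (2 * pi * \<phi>), 1) = cbop_scale (a \<infinity>) cbop_one
          \<and> \<gamma> (mult_op (on_line a)) (cis (2 * pi * \<phi>), - 1) = cbop_scale (a (- \<infinity>)) cbop_one)
     \<and> (\<forall>\<phi>. \<forall>s\<in>{- 1, 1}. \<forall>k::int.
          \<gamma> (mult_op (\<lambda>x. cis (of_int k * x))) (cis (2 * pi * \<phi>), s) = Y_op arg (- of_int k))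
     \<and> (\<forall>\<phi>. \<forall>s\<in>{- 1, 1}. \<forall>b\<in>carrier C_ext.
          \<gamma> (fourier_multiplier (on_line b)) (cis (2 * pi * \<phi>), s) =
            Y_op arg \<phi> \<circ>\<^sub>o diag_op (\<lambda>j. b (ereal (of_int j - \<phi>))) \<circ>\<^sub>o Y_op arg (- \<phi>))"

end

(* After conjugation with Y_phi, the symbol at (exp(2 pi i phi), +-1) lies in the image of the
   regular representation of l1(Z, C[-oo,+oo]) attached to the orbit of -phi,
     f |-> sum_k diag(f_k(j - phi)) S^k,  S the shift on l2(Z).
   Every representation of l1(Z, C[-oo,+oo]) is dominated in norm by these: Z is amenable, so the
   norm of a finitely supported f can be tested on vectors spread over long intervals, and a fine
   partition of unity on [-oo,+oo] reduces the test to point evaluations. The orbits of the line are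
   dense, so the two fixed points need no representation of their own. Hence the crossed product is
   the uniform closure of the functions z |-> regular representation of f at z on the circle.
   The image of gamma contains, for finitely supported f, the function given by f on one of the two
   circles and by 0 on the other (multiply by a function running from 0 at -oo to 1 at +oo), and all
   generators have symbols of this form on each circle. It is closed under uniform limits, because
   a symbol of norm at most c is the symbol, up to an error c/2, of an operator of norm at most c. *)

theory Submission
  imports Defs "HOL-Probability.Distribution_Functions"
begin

section \<open>Hilbert space operators: adjoints, completeness, contractive homomorphisms and
  lifting\<close>

section \<open>Bounded operators as a normed algebra\<close>

text \<open>The phase phi of a point of the circle cannot be chosen continuously:
  \<open>phase\<close> jumps at 1, and so may z |-> \<open>circle_rep f z\<close>. The model of the
  crossed product therefore consists of functions on the circle without a continuity condition.
  Conjugation with Y_phi is what removes the dependence on the branch, and continuity of a symbol is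
  never computed: it comes with membership in the range of gamma. Spectral arguments rest on one
  device, a quasi-inverse: an element g with g = h + h g. The Neumann series provides it in a closed
  operator algebra and in l1, every star homomorphism transports it, and its existence for T* T /
  r^2 with all r > K forces \<open>norm T \<le> K\<close>. Hence gamma and all representations of l1
  are contractive. The error c/2 stems from the resolvent of a* a, a = x / c, obtained in the same
  manner. Forms with operator entries are compared with scalar ones on finitely many vectors; the
  bounds are additive in the squared norms so that they can be summed over coordinates and over a
  partition of unity.\<close>

lemma cbop_eqI: "(\<And>x. A \<bullet>\<^sub>o x = B \<bullet>\<^sub>o x) \<Longrightarrow> A = B"
  by transfer (rule blinfun_eqI)

lemma cbop_apply_zero [simp]: "cbop_zero \<bullet>\<^sub>o x = 0"
  by transfer simp

lemma cbop_apply_one [simp]: "cbop_one \<bullet>\<^sub>o x = x"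
  by transfer simp

lemma cbop_apply_plus [simp]: "cbop_plus A B \<bullet>\<^sub>o x = A \<bullet>\<^sub>o x + B \<bullet>\<^sub>o x"
  by transfer (simp add: plus_blinfun.rep_eq)

lemma cbop_apply_compose [simp]: "(A \<circ>\<^sub>o B) \<bullet>\<^sub>o x = A \<bullet>\<^sub>o B \<bullet>\<^sub>o x"
  by transfer simp

lemma cbop_apply_scale [simp]: "cbop_scale c A \<bullet>\<^sub>o x = c *\<^sub>C A \<bullet>\<^sub>o x"
  by transfer (simp add: bounded_linear_Blinfun_apply[OF bounded_linear_scaleC])

lemma cbop_apply_add: "A \<bullet>\<^sub>o (x + y) = A \<bullet>\<^sub>o x + A \<bullet>\<^sub>o y"
  by transfer (simp add: blinfun.add_right)

lemma cbop_apply_diff: "A \<bullet>\<^sub>o (x - y) = A \<bullet>\<^sub>o x - A \<bullet>\<^sub>o y"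
  by transfer (simp add: blinfun.diff_right)

lemma cbop_apply_scaleR: "A \<bullet>\<^sub>o (r *\<^sub>R x) = r *\<^sub>R A \<bullet>\<^sub>o x"
  by transfer (simp add: blinfun.scaleR_right)

lemma cbop_apply_scaleC: "A \<bullet>\<^sub>o (c *\<^sub>C x) = c *\<^sub>C A \<bullet>\<^sub>o x"
  by transfer simp

lemma cbop_apply_0_right [simp]: "A \<bullet>\<^sub>o 0 = 0"
  by transfer simp

lemma bounded_linear_cbop_apply: "bounded_linear (cbop_apply A)"
  by transfer (rule blinfun.bounded_linear_right)

lemma scaleC_one [simp]: "(1::complex) *\<^sub>C x = x" for x :: "'h::complex_inner"
  using scaleC_of_real[of 1 x] by simp

lemma scaleC_zero [simp]: "(0::complex) *\<^sub>C x = 0" for x :: "'h::complex_inner"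
  using scaleC_of_real[of 0 x] by simp

lemma scaleC_minus_one: "(- 1 :: complex) *\<^sub>C x = - x" for x :: "'h::complex_inner"
  using scaleC_of_real[of "- 1" x] by simp

lemma scaleC_diff_right: "c *\<^sub>C (x - y) = c *\<^sub>C x - c *\<^sub>C y" for x :: "'h::complex_inner"
  by (rule linear_diff[OF bounded_linear.linear[OF bounded_linear_scaleC]])

text \<open>The type-class structure makes \<open>closed\<close>, \<open>uniform_limit\<close>,
  \<open>infsum\<close> and fixed-point arguments available for operators. Real scalars act through
  \<open>cbop_scale\<close>, so that real and complex identities have one source.\<close>

instantiation cbop :: (complex_inner) real_normed_algebra
begin

definition zero_cbop :: "'a cbop" where "zero_cbop = cbop_zero"
definition plus_cbop :: "'a cbop \<Rightarrow> 'a cbop \<Rightarrow> 'a cbop" where "plus_cbop = cbop_plus"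
definition times_cbop :: "'a cbop \<Rightarrow> 'a cbop \<Rightarrow> 'a cbop" where "times_cbop = (\<circ>\<^sub>o)"
definition scaleR_cbop :: "real \<Rightarrow> 'a cbop \<Rightarrow> 'a cbop" where "scaleR_cbop r A = cbop_scale (of_real r) A"
definition uminus_cbop :: "'a cbop \<Rightarrow> 'a cbop" where "uminus_cbop A = cbop_scale (- 1) A"
definition minus_cbop :: "'a cbop \<Rightarrow> 'a cbop \<Rightarrow> 'a cbop" where "minus_cbop A B = A + - B"
definition norm_cbop :: "'a cbop \<Rightarrow> real" where "norm_cbop = cbop_norm"
definition dist_cbop :: "'a cbop \<Rightarrow> 'a cbop \<Rightarrow> real" where "dist_cbop A B = norm (A - B)"
definition sgn_cbop :: "'a cbop \<Rightarrow> 'a cbop" where "sgn_cbop A = inverse (norm A) *\<^sub>R A"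
definition uniformity_cbop :: "('a cbop \<times> 'a cbop) filter" where
  "uniformity_cbop = (INF e\<in>{0<..}. principal {(x, y). dist x y < e})"
definition open_cbop :: "'a cbop set \<Rightarrow> bool" where
  "open_cbop S = (\<forall>x\<in>S. \<forall>\<^sub>F (x', y) in uniformity. x' = x \<longrightarrow> y \<in> S)"

lemma Rep_cbop_uminus: "Rep_cbop (- A) = - Rep_cbop A"
  by (rule blinfun_eqI)
    (use cbop_apply_scale[of "- 1" A] in
      \<open>simp add: uminus_cbop_def cbop_apply.rep_eq scaleC_minus_one uminus_blinfun.rep_eq\<close>)

lemma Rep_cbop_minus: "Rep_cbop (A - B) = Rep_cbop A - Rep_cbop B"
  by (simp add: minus_cbop_def plus_cbop_def cbop_plus.rep_eq Rep_cbop_uminus)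

lemma Rep_cbop_scaleR: "Rep_cbop (r *\<^sub>R A) = r *\<^sub>R Rep_cbop A"
  by (rule blinfun_eqI)
    (use cbop_apply_scale[of "of_real r" A] in
      \<open>simp add: scaleR_cbop_def cbop_apply.rep_eq scaleC_of_real scaleR_blinfun.rep_eq\<close>)

instance
proof
  fix A B C :: "'a cbop" and r s :: real
  note defs = zero_cbop_def plus_cbop_def times_cbop_def scaleR_cbop_def uminus_cbop_def minus_cbop_def
  show "A + B + C = A + (B + C)" "A + B = B + A" "0 + A = A" "- A + A = 0" "A - B = A + - B"
    by (auto simp: defs scaleC_minus_one intro: cbop_eqI)
  show "A * B * C = A * (B * C)" "(A + B) * C = A * C + B * C" "A * (B + C) = A * B + A * C"
    by (auto simp: defs cbop_apply_add intro: cbop_eqI)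
  show "r *\<^sub>R (A + B) = r *\<^sub>R A + r *\<^sub>R B" "(r + s) *\<^sub>R A = r *\<^sub>R A + s *\<^sub>R A"
    "r *\<^sub>R s *\<^sub>R A = (r * s) *\<^sub>R A" "1 *\<^sub>R A = A" "r *\<^sub>R A * B = r *\<^sub>R (A * B)" "A * r *\<^sub>R B = r *\<^sub>R (A * B)"
    by (auto simp: defs scaleC_of_real scaleR_add_right scaleC_add_left scaleC_scaleC[symmetric] cbop_apply_scaleR
      intro!: cbop_eqI)
  show "dist A B = norm (A - B)" by (rule dist_cbop_def)
  show "sgn A = inverse (norm A) *\<^sub>R A" by (rule sgn_cbop_def)
  show "uniformity = (INF e\<in>{0<..}. principal {(x, y :: 'a cbop). dist x y < e})" by (rule uniformity_cbop_def)
  show "open S = (\<forall>x\<in>S. \<forall>\<^sub>F (x', y) in uniformity. x' = x \<longrightarrow> y \<in> S)" for S :: "'a cbop set"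
    by (rule open_cbop_def)
  show "(norm A = 0) = (A = 0)"
    by (simp add: norm_cbop_def zero_cbop_def cbop_norm.rep_eq cbop_zero.rep_eq[symmetric] Rep_cbop_inject)
  show "norm (A + B) \<le> norm A + norm B"
    by (simp add: norm_cbop_def plus_cbop_def cbop_norm.rep_eq cbop_plus.rep_eq norm_triangle_ineq)
  show "norm (r *\<^sub>R A) = \<bar>r\<bar> * norm A"
    by (simp add: norm_cbop_def cbop_norm.rep_eq Rep_cbop_scaleR)
  show "norm (A * B) \<le> norm A * norm B"
    by (simp add: norm_cbop_def times_cbop_def cbop_norm.rep_eq cbop_compose.rep_eq norm_blinfun_compose)
qed

end

text \<open>The unit lives in \<open>monoid_mult\<close> only: over the zero space the identity has
  norm 0, which excludes \<open>real_normed_algebra_1\<close>.\<close>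

instantiation cbop :: (complex_inner) monoid_mult
begin
definition one_cbop :: "'a cbop" where "one_cbop = cbop_one"
instance
  by standard (auto simp: one_cbop_def times_cbop_def intro: cbop_eqI)
end

lemma cbop_ops:
  "cbop_zero = 0" "cbop_one = 1" "cbop_plus = (+)" "(\<circ>\<^sub>o) = (*)" "cbop_norm = norm"
  by (simp_all add: zero_cbop_def one_cbop_def plus_cbop_def times_cbop_def norm_cbop_def)

lemma apply_simps [simp]:
  fixes A B :: "'h::complex_inner cbop"
  shows "0 \<bullet>\<^sub>o x = 0" "1 \<bullet>\<^sub>o x = x" "(A + B) \<bullet>\<^sub>o x = A \<bullet>\<^sub>o x + B \<bullet>\<^sub>o x" "(A * B) \<bullet>\<^sub>o x = A \<bullet>\<^sub>o B \<bullet>\<^sub>o x"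
    "(r *\<^sub>R A) \<bullet>\<^sub>o x = r *\<^sub>R A \<bullet>\<^sub>o x" "(- A) \<bullet>\<^sub>o x = - (A \<bullet>\<^sub>o x)" "(A - B) \<bullet>\<^sub>o x = A \<bullet>\<^sub>o x - B \<bullet>\<^sub>o x"
  by (simp_all add: zero_cbop_def one_cbop_def plus_cbop_def times_cbop_def scaleR_cbop_def
      uminus_cbop_def minus_cbop_def scaleC_of_real scaleC_minus_one)

lemma cbop_apply_sum: "(\<Sum>i\<in>I. F i) \<bullet>\<^sub>o x = (\<Sum>i\<in>I. F i \<bullet>\<^sub>o x)"
  by (induction I rule: infinite_finite_induct) auto

lemma norm_cbop_apply: "norm (A \<bullet>\<^sub>o x) \<le> norm A * norm x"
  by (simp add: norm_cbop_def cbop_apply.rep_eq cbop_norm.rep_eq norm_blinfun)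

lemma norm_cbop_bound: "0 \<le> K \<Longrightarrow> (\<And>x. norm (A \<bullet>\<^sub>o x) \<le> K * norm x) \<Longrightarrow> norm A \<le> K"
  by (simp add: norm_cbop_def cbop_apply.rep_eq cbop_norm.rep_eq norm_blinfun_bound)

lemma scale_simps:
  fixes A B :: "'h::complex_inner cbop"
  shows "cbop_scale c (A + B) = cbop_scale c A + cbop_scale c B"
    "cbop_scale c A * B = cbop_scale c (A * B)" "A * cbop_scale c B = cbop_scale c (A * B)"
    "cbop_scale c (cbop_scale d A) = cbop_scale (c * d) A" "cbop_scale 1 A = A" "cbop_scale 0 A = 0"
    "cbop_scale c (A - B) = cbop_scale c A - cbop_scale c B"
    "cbop_scale (c + d) A = cbop_scale c A + cbop_scale d A"
  by (auto intro!: cbop_eqI simp: cbop_apply_scaleC scaleC_add_right scaleC_scaleC scaleC_diff_right scaleC_add_left)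

lemma norm_cbop_scale: "norm (cbop_scale c A) = cmod c * norm A"
proof -
  have le: "norm (cbop_scale c A) \<le> cmod c * norm A" for c and A :: "'a cbop"
    by (rule norm_cbop_bound)
      (auto simp: norm_scaleC mult.assoc intro!: mult_left_mono norm_cbop_apply)
  show ?thesis
  proof (cases "c = 0")
    case False
    have "norm A = norm (cbop_scale (1 / c) (cbop_scale c A))"
      using False by (simp add: scale_simps)
    also have "\<dots> \<le> cmod (1 / c) * norm (cbop_scale c A)"
      by (rule le)
    finally have "cmod c * norm A \<le> norm (cbop_scale c A)"
      using False by (simp add: norm_divide field_simps)
    with le[of c A] show ?thesis by simp
  qed (simp add: scale_simps)
qed

lemma Cauchy_limit: "Cauchy X \<Longrightarrow> \<exists>L. X \<longlonglongrightarrow> L"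
  for X :: "nat \<Rightarrow> 'a::complete_space"
  by (simp add: Cauchy_convergent_iff convergent_def)

text \<open>Complex homogeneity survives pointwise limits, so the complex-linear operators are
  closed among the bounded real-linear ones, where the limit is taken.\<close>

instance cbop :: ("{complex_inner,banach}") complete_space
proof
  fix X :: "nat \<Rightarrow> 'a cbop" assume "Cauchy X"
  have nR: "norm (Rep_cbop A) = norm A" for A :: "'a cbop"
    by (simp add: norm_cbop_def cbop_norm.rep_eq)
  have "Cauchy (\<lambda>n. Rep_cbop (X n))"
    using \<open>Cauchy X\<close> by (simp add: Cauchy_def dist_norm Rep_cbop_minus[symmetric] nR)
  then obtain L where L: "(\<lambda>n. Rep_cbop (X n)) \<longlonglongrightarrow> L"
    by (auto dest: Cauchy_limit)
  have "L (c *\<^sub>C x) = c *\<^sub>C L x" for c x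
  proof (rule LIMSEQ_unique)
    show "(\<lambda>n. Rep_cbop (X n) (c *\<^sub>C x)) \<longlonglongrightarrow> L (c *\<^sub>C x)"
      by (intro tendsto_intros L)
    have "(\<lambda>n. c *\<^sub>C Rep_cbop (X n) x) \<longlonglongrightarrow> c *\<^sub>C L x"
      by (intro bounded_linear.tendsto[OF bounded_linear_scaleC] tendsto_intros L)
    moreover have "Rep_cbop (X n) (c *\<^sub>C x) = c *\<^sub>C Rep_cbop (X n) x" for n
      using Rep_cbop[of "X n"] by simp
    ultimately show "(\<lambda>n. Rep_cbop (X n) (c *\<^sub>C x)) \<longlonglongrightarrow> c *\<^sub>C L x"
      by simp
  qed
  then have RL: "Rep_cbop (Abs_cbop L) = L"
    by (simp add: Abs_cbop_inverse)
  have "X \<longlonglongrightarrow> Abs_cbop L"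
    using L by (simp add: tendsto_iff dist_norm nR[symmetric] Rep_cbop_minus RL)
  then show "convergent X" by (auto simp: convergent_def)
qed

instance cbop :: ("{complex_inner,banach}") banach ..


section \<open>Adjoints\<close>

lemma riesz_real:
  fixes f :: "'a::{real_inner,banach} \<Rightarrow> real"
  assumes "bounded_linear f"
  shows "\<exists>w. \<forall>x. f x = inner x w"
proof -
  interpret f: bounded_linear f by fact
  obtain K where K: "\<And>x. \<bar>f x\<bar> \<le> norm x * K"
    using f.bounded by auto
  \<comment> \<open>the representing vector minimises the quadratic functional \<open>J\<close>\<close>
  define J where "J x = (norm x)\<^sup>2 - 2 * f x" for x
  have "- K\<^sup>2 \<le> J x" for x
  proof -
    have "0 \<le> (norm x - K)\<^sup>2" by simp
    then show ?thesis using K[of x] by (simp add: J_def power2_eq_square algebra_simps)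
  qed
  then have bdd: "bdd_below (range J)" by (auto simp: bdd_below_def)
  define m where "m = (INF x. J x)"
  have m: "m \<le> J x" for x unfolding m_def by (rule cINF_lower[OF bdd]) simp
  have "\<exists>x. J x < m + inverse (Suc n)" for n
    using cINF_less_iff[OF _ bdd, of "m + inverse (Suc n)"] unfolding m_def[symmetric] by simp
  then obtain X where X: "\<And>n. J (X n) < m + inverse (Suc n)" by metis
  \<comment> \<open>Parallelogram law for \<open>J\<close>: nearly minimal points are close
    together, since their midpoint cannot fall below \<open>m\<close>.\<close>
  have par: "(norm (x - y))\<^sup>2 \<le> 2 * (J x - m) + 2 * (J y - m)" for x y
  proof -
    have "(norm (x - y))\<^sup>2 = 2 * J x + 2 * J y - 4 * J ((1/2) *\<^sub>R (x + y))"
      by (simp add: J_def power2_norm_eq_inner inner_diff_left inner_diff_right inner_add_left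
          inner_add_right f.scaleR f.add inner_commute[of y x] algebra_simps)
    with m[of "(1/2) *\<^sub>R (x + y)"] show ?thesis by simp
  qed
  have "Cauchy X"
  proof (rule metric_CauchyI)
    fix e :: real assume "0 < e"
    then obtain N where N: "inverse (Suc N) < e\<^sup>2 / 4"
      using reals_Archimedean[of "e\<^sup>2 / 4"] by auto
    have "dist (X i) (X j) < e" if "i \<ge> N" "j \<ge> N" for i j
    proof -
      have "J (X k) - m < e\<^sup>2 / 4" if "k \<ge> N" for k
      proof -
        have "inverse (real (Suc k)) \<le> inverse (Suc N)"
          using that by (auto intro!: le_imp_inverse_le)
        then show ?thesis using X[of k] N by argo
      qed
      then have "J (X i) - m < e\<^sup>2 / 4" "J (X j) - m < e\<^sup>2 / 4"
        using that by blast+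
      then have "2 * (J (X i) - m) + 2 * (J (X j) - m) < 2 * (e\<^sup>2 / 4) + 2 * (e\<^sup>2 / 4)"
        by (intro add_strict_mono mult_strict_left_mono) auto
      with par[of "X i" "X j"] have "(norm (X i - X j))\<^sup>2 < e\<^sup>2"
        by simp
      then show ?thesis using \<open>0 < e\<close> by (simp add: dist_norm power_less_imp_less_base)
    qed
    then show "\<exists>M. \<forall>m\<ge>M. \<forall>n\<ge>M. dist (X m) (X n) < e" by blast
  qed
  then obtain w where w: "X \<longlonglongrightarrow> w" by (auto dest: Cauchy_limit)
  have "(\<lambda>n. J (X n)) \<longlonglongrightarrow> J w"
    unfolding J_def by (intro tendsto_intros w f.tendsto)
  moreover have "(\<lambda>n. m + inverse (Suc n)) \<longlonglongrightarrow> m + 0"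
    by (intro tendsto_intros LIMSEQ_inverse_real_of_nat)
  ultimately have "J w \<le> m + 0"
    by (rule LIMSEQ_le) (use X in \<open>auto intro: less_imp_le\<close>)
  then have min: "J w \<le> J x" for x using m[of x] by simp
  have "f v = inner v w" for v
  proof -
    define d where "d = inner v w - f v"
    have q: "0 \<le> 2 * t * d + t\<^sup>2 * (norm v)\<^sup>2" for t
    proof -
      have "J (w + t *\<^sub>R v) = J w + 2 * t * d + t\<^sup>2 * (norm v)\<^sup>2"
        unfolding J_def d_def power2_norm_eq_inner
        by (simp add: inner_add_left inner_add_right f.add f.scaleR inner_commute[of w v]
            power2_eq_square algebra_simps)
      then show ?thesis using min[of "w + t *\<^sub>R v"] by simp
    qed
    \<comment> \<open>The quadratic in t is nonnegative; at its minimum t = - d / |v|^2 it equals -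
      d^2 / |v|^2, so d must vanish.\<close>
    have "d = 0"
    proof (cases "norm v = 0")
      case True
      then show ?thesis by (simp add: d_def)
    next
      case False
      have "0 \<le> - (d\<^sup>2) / (norm v)\<^sup>2"
        using q[of "- d / (norm v)\<^sup>2"] False by (simp add: power2_eq_square field_simps)
      then have "d\<^sup>2 \<le> 0" using False by (simp add: field_simps)
      then show ?thesis by simp
    qed
    then show ?thesis by (simp add: d_def)
  qed
  then show ?thesis by blast
qed

lemma cinner_add_right: "cinner x (y + z) = cinner x y + cinner x z"
  by (metis cinner_add_left cinner_commute complex_cnj_add)

lemma cinner_scaleC_right: "cinner x (c *\<^sub>C y) = cnj c * cinner x y"
  by (metis cinner_commute cinner_scaleC_left complex_cnj_mult)

lemma cinner_zero [simp]: "cinner 0 x = 0" "cinner x 0 = 0"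
  using cinner_scaleC_left[of 0 x x] cinner_scaleC_right[of x 0 x] by simp_all

lemma cinner_minus_left: "cinner (- x) y = - cinner x y"
  using cinner_scaleC_left[of "- 1" x y] by (simp add: scaleC_minus_one)

lemma cinner_minus_right: "cinner x (- y) = - cinner x y"
  using cinner_scaleC_right[of x "- 1" y] by (simp add: scaleC_minus_one)

lemma cinner_diff_left: "cinner (x - y) z = cinner x z - cinner y z"
  using cinner_add_left[of x "- y" z] by (simp add: cinner_minus_left)

lemma cinner_diff_right: "cinner x (y - z) = cinner x y - cinner x z"
  using cinner_add_right[of x y "- z"] by (simp add: cinner_minus_right)

lemma cinner_sum_left: "cinner (\<Sum>i\<in>I. f i) y = (\<Sum>i\<in>I. cinner (f i) y)"
  by (induction I rule: infinite_finite_induct) (auto simp: cinner_add_left)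

lemma cinner_sum_right: "cinner y (\<Sum>i\<in>I. f i) = (\<Sum>i\<in>I. cinner y (f i))"
  by (induction I rule: infinite_finite_induct) (auto simp: cinner_add_right)

lemma norm_eq_cinner: "(norm x)\<^sup>2 = Re (cinner x x)"
  by (simp add: cinner_self)

text \<open>A unimodular factor c makes the pairing real and nonnegative; the real inequality then
  applies to c x, whose norm is that of x.\<close>

lemma cinner_cauchy_schwarz: "cmod (cinner x y) \<le> norm x * norm y"
proof (cases "cinner x y = 0")
  case False
  define c where "c = cnj (cinner x y) / cmod (cinner x y)"
  have "cmod c = 1" using False by (simp add: c_def norm_divide)
  have "cinner x y * cnj (cinner x y) = of_real (cmod (cinner x y) * cmod (cinner x y))"
    using complex_norm_square[of "cinner x y"] by (simp add: power2_eq_square)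
  then have "c * cinner x y = of_real (cmod (cinner x y))"
    using False by (simp add: c_def mult.commute)
  then have "cmod (cinner x y) = Re (cinner (c *\<^sub>C x) y)"
    by (simp add: cinner_scaleC_left)
  also have "\<dots> = inner (c *\<^sub>C x) y" by (simp add: inner_eq_Re_cinner)
  also have "\<dots> \<le> norm (c *\<^sub>C x) * norm y" by (rule norm_cauchy_schwarz)
  finally show ?thesis using \<open>cmod c = 1\<close> by (simp add: norm_scaleC)
qed simp

lemma cinner_eqI: "(\<And>z. cinner z x = cinner z y) \<Longrightarrow> x = y"
proof -
  assume "\<And>z. cinner z x = cinner z y"
  then have "cinner (x - y) (x - y) = 0" by (simp add: cinner_diff_right)
  then show "x = y" by (simp add: cinner_self)
qed

lemma bounded_linear_cinner_left: "bounded_linear (\<lambda>x. cinner x y)"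
proof (rule bounded_linear_intro[of _ "norm y"])
  show "cinner (r *\<^sub>R x) y = r *\<^sub>R cinner x y" for r x
    using cinner_scaleC_left[of "of_real r" x y] by (simp add: scaleC_of_real scaleR_conv_of_real)
qed (simp_all add: cinner_add_left cinner_cauchy_schwarz)

text \<open>The vector representing the real part already represents f: Im (f x) is - Re (f (i x)),
  and \<open>cinner\<close> obeys the same rule.\<close>

lemma riesz_complex:
  fixes f :: "'a::{complex_inner,banach} \<Rightarrow> complex"
  assumes "bounded_linear f" and c: "\<And>c x. f (c *\<^sub>C x) = c * f x"
  shows "\<exists>w. \<forall>x. f x = cinner x w"
proof -
  have "bounded_linear (\<lambda>x. Re (f x))"
    using bounded_linear_compose[OF bounded_linear_Re assms(1)] .
  then obtain w where w: "\<And>x. Re (f x) = inner x w" using riesz_real by blast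
  have "f x = cinner x w" for x
  proof (rule complex_eqI)
    show "Re (f x) = Re (cinner x w)" by (simp add: w inner_eq_Re_cinner)
    have "Im (f x) = - Re (f (\<i> *\<^sub>C x))" by (simp add: c)
    also have "\<dots> = Im (cinner x w)" by (simp add: w inner_eq_Re_cinner cinner_scaleC_left)
    finally show "Im (f x) = Im (cinner x w)" .
  qed
  then show ?thesis by blast
qed

lemma cbop_of_bounded:
  assumes "\<And>x y. f (x + y) = f x + f y" "\<And>c x. f (c *\<^sub>C x) = c *\<^sub>C f x"
    and "\<And>x. norm (f x) \<le> K * norm x"
  shows "cbop_of f \<bullet>\<^sub>o x = f x"
  using cbop_of_apply[of f K x] assms by (simp add: mult.commute)

text \<open>Adjoints are identified through this lemma throughout: exhibiting one candidate decides
  the \<open>THE\<close> in \<open>cbop_adjoint\<close>, since the pairing determines the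
  solution.\<close>

lemma cbop_adjoint_unique:
  assumes "\<And>x y. cinner (A \<bullet>\<^sub>o x) y = cinner x (B \<bullet>\<^sub>o y)"
  shows "cbop_adjoint A = B"
  unfolding cbop_adjoint_def
proof (rule the_equality)
  show "C = B" if "\<forall>x y. cinner (A \<bullet>\<^sub>o x) y = cinner x (C \<bullet>\<^sub>o y)" for C
    using that assms by (intro cbop_eqI cinner_eqI) metis
qed (use assms in auto)

text \<open>Riesz supplies a vector g y for every y. Inserting x = g y gives |g y|^2 <= |A| |g y|
  |y|, which makes g a bounded operator and hence a legitimate candidate.\<close>

lemma cinner_adjoint:
  fixes A :: "'h::{complex_inner,banach} cbop"
  shows "cinner (A \<bullet>\<^sub>o x) y = cinner x (cbop_adjoint A \<bullet>\<^sub>o y)"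
proof -
  have "\<exists>w. \<forall>x. cinner (A \<bullet>\<^sub>o x) y = cinner x w" for y
    by (rule riesz_complex)
      (auto intro: bounded_linear_compose[OF bounded_linear_cinner_left bounded_linear_cbop_apply]
        simp: cbop_apply_scaleC cinner_scaleC_left)
  then obtain g where g: "\<And>x y. cinner (A \<bullet>\<^sub>o x) y = cinner x (g y)" by metis
  have "norm (g y) \<le> norm A * norm y" for y
  proof -
    have "(norm (g y))\<^sup>2 = cmod (cinner (A \<bullet>\<^sub>o g y) y)" by (simp add: g cinner_self norm_power)
    also have "\<dots> \<le> norm (A \<bullet>\<^sub>o g y) * norm y" by (rule cinner_cauchy_schwarz)
    also have "\<dots> \<le> norm A * norm (g y) * norm y" by (intro mult_right_mono norm_cbop_apply) auto
    finally show ?thesis by (cases "norm (g y) = 0") (auto simp: power2_eq_square)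
  qed
  moreover have "g (x + y) = g x + g y" for x y
    by (rule cinner_eqI) (simp flip: g add: cinner_add_right)
  moreover have "g (c *\<^sub>C y) = c *\<^sub>C g y" for c y
    by (rule cinner_eqI) (simp flip: g add: cinner_scaleC_right)
  ultimately have "cbop_of g \<bullet>\<^sub>o y = g y" for y by (intro cbop_of_bounded)
  then have "cbop_adjoint A = cbop_of g" by (intro cbop_adjoint_unique) (simp add: g)
  then show ?thesis by (simp add: g \<open>\<And>y. cbop_of g \<bullet>\<^sub>o y = g y\<close>)
qed

lemma cinner_adjoint':
  fixes A :: "'h::{complex_inner,banach} cbop"
  shows "cinner x (A \<bullet>\<^sub>o y) = cinner (cbop_adjoint A \<bullet>\<^sub>o x) y"
  by (metis cinner_adjoint cinner_commute)

context
  fixes A B :: "'h::{complex_inner,banach} cbop"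
begin

lemma adjoint_adjoint [simp]: "cbop_adjoint (cbop_adjoint A) = A"
  by (rule cbop_adjoint_unique) (simp add: cinner_adjoint')

lemma adjoint_add: "cbop_adjoint (A + B) = cbop_adjoint A + cbop_adjoint B"
  by (rule cbop_adjoint_unique) (simp add: cinner_adjoint cinner_add_left cinner_add_right)

lemma adjoint_mult: "cbop_adjoint (A * B) = cbop_adjoint B * cbop_adjoint A"
  by (rule cbop_adjoint_unique) (simp add: cinner_adjoint)

lemma adjoint_scale: "cbop_adjoint (cbop_scale c A) = cbop_scale (cnj c) (cbop_adjoint A)"
  by (rule cbop_adjoint_unique) (simp add: cinner_adjoint cinner_scaleC_left cinner_scaleC_right)

lemma norm_adjoint_square: "(norm (A \<bullet>\<^sub>o x))\<^sup>2 = Re (cinner x ((cbop_adjoint A * A) \<bullet>\<^sub>o x))"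
  by (simp add: norm_eq_cinner cinner_adjoint)

end

lemma norm_adjoint [simp]: "norm (cbop_adjoint A) = norm (A :: 'h::{complex_inner,banach} cbop)"
proof -
  have le: "norm (cbop_adjoint A) \<le> norm A" for A :: "'h cbop"
  proof (rule norm_cbop_bound)
    fix y
    have "(norm (cbop_adjoint A \<bullet>\<^sub>o y))\<^sup>2 = cmod (cinner (A \<bullet>\<^sub>o cbop_adjoint A \<bullet>\<^sub>o y) y)"
      by (simp add: cinner_adjoint cinner_self norm_power)
    also have "\<dots> \<le> norm (A \<bullet>\<^sub>o cbop_adjoint A \<bullet>\<^sub>o y) * norm y" by (rule cinner_cauchy_schwarz)
    also have "\<dots> \<le> norm A * norm (cbop_adjoint A \<bullet>\<^sub>o y) * norm y"
      by (intro mult_right_mono norm_cbop_apply) auto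
    finally show "norm (cbop_adjoint A \<bullet>\<^sub>o y) \<le> norm A * norm y"
      by (cases "norm (cbop_adjoint A \<bullet>\<^sub>o y) = 0") (auto simp: power2_eq_square)
  qed simp
  show ?thesis using le[of A] le[of "cbop_adjoint A"] by simp
qed

lemma bounded_operators_simps [simp]:
  "carrier bounded_operators = UNIV" "x \<otimes>\<^bsub>bounded_operators\<^esub> y = x * y" "\<one>\<^bsub>bounded_operators\<^esub> = 1"
  "\<zero>\<^bsub>bounded_operators\<^esub> = 0" "x \<oplus>\<^bsub>bounded_operators\<^esub> y = x + y" "c \<odot>\<^bsub>bounded_operators\<^esub> x = cbop_scale c x"
  "invol bounded_operators = cbop_adjoint" "alg_norm bounded_operators = norm"
  by (simp_all add: bounded_operators_def cbop_ops)

text \<open>\<open>a_minus\<close> is built from a \<open>THE\<close> over inverses in the additive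
  monoid; it must be evaluated before the closedness condition stated with it can be read as a norm
  condition.\<close>

lemma bounded_operators_minus [simp]: "x \<ominus>\<^bsub>bounded_operators\<^esub> y = x - (y :: 'h::complex_inner cbop)"
proof -
  have "\<ominus>\<^bsub>bounded_operators\<^esub> y = - y"
    unfolding a_inv_def m_inv_def
    by (rule the_equality) (auto simp: eq_neg_iff_add_eq_0 add.commute)
  then show ?thesis by (simp add: a_minus_def)
qed


section \<open>Completeness of the two Hilbert spaces\<close>

lemma l2_summable: "(\<lambda>i. (cmod (Rep_l2 u i))\<^sup>2) summable_on UNIV"
  using Rep_l2[of u] unfolding mem_Collect_eq .

lemma l2_norm_has_sum: "((\<lambda>i. (cmod (Rep_l2 u i))\<^sup>2) has_sum (norm u)\<^sup>2) UNIV"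
proof -
  have "((\<lambda>i. Rep_l2 u i * cnj (Rep_l2 u i)) has_sum cinner u u) UNIV"
    unfolding cinner_l2.rep_eq by (intro has_sum_infsum l2_product_summable l2_summable)
  then have "((\<lambda>i. complex_of_real ((cmod (Rep_l2 u i))\<^sup>2)) has_sum complex_of_real ((norm u)\<^sup>2)) UNIV"
    by (simp only: cinner_self complex_norm_square[symmetric])
  then have "((\<lambda>i. Re (complex_of_real ((cmod (Rep_l2 u i))\<^sup>2))) has_sum Re (complex_of_real ((norm u)\<^sup>2))) UNIV"
    by (rule has_sum_Re)
  then show ?thesis by simp
qed

lemma l2_norm_sum_le: "finite F \<Longrightarrow> (\<Sum>i\<in>F. (cmod (Rep_l2 u i))\<^sup>2) \<le> (norm u)\<^sup>2"
  by (rule has_sum_mono2[OF has_sum_finite l2_norm_has_sum]) auto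

text \<open>Bounds on finite partial sums deliver both membership in l2 and the norm estimate for
  \<open>Abs_l2\<close>, so vectors may be given by formulas for their coordinates.\<close>

lemma l2_norm_leI:
  assumes "0 \<le> K" "\<And>F. finite F \<Longrightarrow> (\<Sum>i\<in>F. (cmod (f i))\<^sup>2) \<le> K\<^sup>2"
  shows "(\<lambda>i. (cmod (f i))\<^sup>2) summable_on UNIV" and "norm (Abs_l2 f) \<le> K"
proof -
  show s: "(\<lambda>i. (cmod (f i))\<^sup>2) summable_on UNIV"
    by (rule nonneg_bdd_above_summable_on) (use assms in \<open>auto simp: bdd_above_def\<close>)
  then have R: "Rep_l2 (Abs_l2 f) = f" by (simp add: Abs_l2_inverse)
  have "(norm (Abs_l2 f))\<^sup>2 \<le> K\<^sup>2"
    by (rule has_sum_le_finite_sums[OF l2_norm_has_sum]) (simp add: R assms)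
  then show "norm (Abs_l2 f) \<le> K" using assms(1) by (rule power2_le_imp_le)
qed

lemma l2_coord_le: "cmod (Rep_l2 u i) \<le> norm u"
  by (rule power2_le_imp_le) (use l2_norm_sum_le[of "{i}" u] in simp_all)

instance l2 :: (type) banach
proof
  fix X :: "nat \<Rightarrow> 'a l2" assume "Cauchy X"
  have "Cauchy (\<lambda>n. Rep_l2 (X n) i)" for i
  proof (rule metric_CauchyI)
    fix e :: real assume "0 < e"
    then obtain N where N: "\<And>m n. m \<ge> N \<Longrightarrow> n \<ge> N \<Longrightarrow> norm (X m - X n) < e"
      using CauchyD[OF \<open>Cauchy X\<close> \<open>0 < e\<close>] by auto
    have d: "dist (Rep_l2 (X m) i) (Rep_l2 (X n) i) \<le> norm (X m - X n)" for m n
      using l2_coord_le[of "X m - X n" i] by (simp add: dist_norm minus_l2.rep_eq)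
    then show "\<exists>M. \<forall>m\<ge>M. \<forall>n\<ge>M. dist (Rep_l2 (X m) i) (Rep_l2 (X n) i) < e"
      by (intro exI[of _ N] allI impI le_less_trans[OF d N])
  qed
  then have "\<exists>l. (\<lambda>n. Rep_l2 (X n) i) \<longlonglongrightarrow> l" for i
    by (rule Cauchy_limit)
  then obtain f where f: "\<And>i. (\<lambda>n. Rep_l2 (X n) i) \<longlonglongrightarrow> f i"
    using choice[of "\<lambda>i l. (\<lambda>n. Rep_l2 (X n) i) \<longlonglongrightarrow> l"] by blast
  \<comment> \<open>In a finite sum the limit over n is harmless, and the bound does not depend on
    F. With e = 1 it shows that the limit is square summable, with e / 2 that the convergence is in
    norm.\<close>
  have bound: "(\<Sum>i\<in>F. (cmod (f i - Rep_l2 (X m) i))\<^sup>2) \<le> e\<^sup>2"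
    if e: "\<And>n. n \<ge> N \<Longrightarrow> norm (X n - X m) \<le> e" and "finite F" for F e m N
  proof (rule LIMSEQ_le_const2)
    show "(\<lambda>n. \<Sum>i\<in>F. (cmod (Rep_l2 (X n) i - Rep_l2 (X m) i))\<^sup>2)
        \<longlonglongrightarrow> (\<Sum>i\<in>F. (cmod (f i - Rep_l2 (X m) i))\<^sup>2)"
      by (intro tendsto_intros f)
    have "(\<Sum>i\<in>F. (cmod (Rep_l2 (X n) i - Rep_l2 (X m) i))\<^sup>2) \<le> e\<^sup>2" if "n \<ge> N" for n
    proof -
      have "(\<Sum>i\<in>F. (cmod (Rep_l2 (X n) i - Rep_l2 (X m) i))\<^sup>2) \<le> (norm (X n - X m))\<^sup>2"
        using l2_norm_sum_le[OF \<open>finite F\<close>, of "X n - X m"] by (simp add: minus_l2.rep_eq)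
      also have "\<dots> \<le> e\<^sup>2" using e[OF that] by (intro power_mono) auto
      finally show ?thesis .
    qed
    then show "\<exists>N. \<forall>n\<ge>N. (\<Sum>i\<in>F. (cmod (Rep_l2 (X n) i - Rep_l2 (X m) i))\<^sup>2) \<le> e\<^sup>2" by blast
  qed
  have sm: "(\<lambda>i. (cmod (f i))\<^sup>2) summable_on UNIV"
  proof -
    obtain N where N: "\<And>m n. m \<ge> N \<Longrightarrow> n \<ge> N \<Longrightarrow> norm (X m - X n) < 1"
      using CauchyD[OF \<open>Cauchy X\<close>, of 1] by auto
    then have "(\<lambda>i. (cmod (f i - Rep_l2 (X N) i))\<^sup>2) summable_on UNIV"
      by (intro l2_norm_leI(1)[of 1] bound[where N = N]) (auto intro: less_imp_le)
    from l2_add_summable[OF this l2_summable[of "X N"]] show ?thesis by simp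
  qed
  have "X \<longlonglongrightarrow> Abs_l2 f"
  proof (rule metric_LIMSEQ_I)
    fix e :: real assume "0 < e"
    then obtain N where N: "\<And>m n. m \<ge> N \<Longrightarrow> n \<ge> N \<Longrightarrow> norm (X m - X n) < e / 2"
      using CauchyD[OF \<open>Cauchy X\<close>, of "e / 2"] \<open>0 < e\<close> by auto
    have "dist (X m) (Abs_l2 f) < e" if "m \<ge> N" for m
    proof -
      have eq: "Abs_l2 f - X m = Abs_l2 (\<lambda>i. f i - Rep_l2 (X m) i)"
        using sm by (simp add: minus_l2_def Abs_l2_inverse)
      have "norm (Abs_l2 f - X m) \<le> e / 2"
        unfolding eq using \<open>0 < e\<close> N that
        by (intro l2_norm_leI(2) bound[where N = N]) (auto intro: less_imp_le)
      then show ?thesis using \<open>0 < e\<close> by (simp add: dist_norm norm_minus_commute)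
    qed
    then show "\<exists>N. \<forall>m\<ge>N. dist (X m) (Abs_l2 f) < e" by blast
  qed
  then show "convergent X" by (auto simp: convergent_def)
qed

definition rep_L2R' :: "L2R \<Rightarrow> real \<Rightarrow> complex" where
  "rep_L2R' x = rep_L2R x"

lemma abs_rep_L2R: "abs_L2R (rep_L2R' x) = x"
  unfolding rep_L2R'_def using Quotient3_L2R by (rule Quotient3_abs_rep)

lemma square_integrable_rep: "square_integrable (rep_L2R' x)"
  unfolding rep_L2R'_def using Quotient3_rep_reflp[OF Quotient3_L2R] by blast

lemma abs_L2R_eq_iff:
  assumes "square_integrable f" "square_integrable g"
  shows "abs_L2R f = abs_L2R g \<longleftrightarrow> (AE x in lborel. f x = g x)"
  using Quotient3_rel[OF Quotient3_L2R, of f g] assms by auto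

lemma abs_L2R_diff:
  assumes "square_integrable f" "square_integrable g"
  shows "abs_L2R f - abs_L2R g = abs_L2R (\<lambda>x. f x - g x)"
  using assms square_integrable_scale[OF assms(2), of "- 1"]
  by (simp add: minus_L2R_def uminus_L2R_def scaleC_L2R.abs_eq plus_L2R.abs_eq)

lemma cinner_abs_L2R:
  assumes "square_integrable f" "square_integrable g"
  shows "cinner (abs_L2R f) (abs_L2R g) = (LINT x|lborel. f x * cnj (g x))"
  using assms by (simp add: cinner_L2R.abs_eq)

lemma norm_abs_L2R:
  assumes "square_integrable f"
  shows "(norm (abs_L2R f))\<^sup>2 = (LINT x|lborel. (cmod (f x))\<^sup>2)"
proof -
  have "complex_of_real ((norm (abs_L2R f))\<^sup>2) = of_real (LINT x|lborel. (cmod (f x))\<^sup>2)"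
    unfolding cinner_self[symmetric] cinner_abs_L2R[OF assms assms]
    by (simp only: complex_norm_square[symmetric] integral_complex_of_real)
  then show ?thesis using of_real_eq_iff by blast
qed

lemma nn_integral_abs_L2R:
  assumes "square_integrable f"
  shows "(\<integral>\<^sup>+x. ennreal ((cmod (f x))\<^sup>2) \<partial>lborel) = ennreal ((norm (abs_L2R f))\<^sup>2)"
  using assms unfolding norm_abs_L2R[OF assms]
  by (intro nn_integral_eq_integral) (auto simp: square_integrable_def)

lemma square_integrable_diff:
  "square_integrable f \<Longrightarrow> square_integrable g \<Longrightarrow> square_integrable (\<lambda>x. f x - g x)"
  using square_integrable_add[of f "\<lambda>x. - 1 * g x"] square_integrable_scale[of g "- 1"] by simp

lemma Cauchy_fast_subseq:
  fixes X :: "nat \<Rightarrow> 'a::real_normed_vector"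
  assumes "Cauchy X" and "\<And>n. 0 < e n"
  shows "\<exists>r. strict_mono (r :: nat \<Rightarrow> nat) \<and> (\<forall>n. norm (X (r (Suc n)) - X (r n)) < e n)"
proof -
  have "\<forall>n. \<exists>N. \<forall>i\<ge>N. \<forall>j\<ge>N. norm (X i - X j) < e n"
    using CauchyD[OF assms(1) assms(2)] by blast
  from choice[OF this] obtain N where N: "\<And>n i j. i \<ge> N n \<Longrightarrow> j \<ge> N n \<Longrightarrow> norm (X i - X j) < e n"
    by blast
  define r where "r = rec_nat (N 0) (\<lambda>n k. max (N (Suc n)) (Suc k))"
  have r: "r n \<ge> N n" "r (Suc n) > r n" for n
    unfolding r_def by (cases n, simp_all)+
  then have "norm (X (r (Suc n)) - X (r n)) < e n" for n
    by (intro N r(1) order_trans[OF r(1) less_imp_le[OF r(2)]])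
  with r(2) show ?thesis by (auto simp: strict_mono_Suc_iff)
qed

text \<open>Riesz-Fischer: a rapidly Cauchy subsequence converges almost everywhere by Chebyshev and
  Borel-Cantelli, Fatou turns the pointwise limit into an L2 limit, and a Cauchy sequence follows
  its subsequence.\<close>

instance L2R :: banach
proof
  fix X :: "nat \<Rightarrow> L2R" assume "Cauchy X"
  obtain r where r: "strict_mono (r :: nat \<Rightarrow> nat)" "\<And>n. norm (X (r (Suc n)) - X (r n)) < (1/4)^n"
    using Cauchy_fast_subseq[OF \<open>Cauchy X\<close>, of "\<lambda>n. (1/4)^n"] by auto
  define f where "f n = rep_L2R' (X (r n))" for n
  have sq: "square_integrable (f n)" for n by (simp add: f_def square_integrable_rep)
  have Xf: "X (r n) = abs_L2R (f n)" for n by (simp add: f_def abs_rep_L2R)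
  have [measurable]: "f n \<in> borel_measurable lborel" for n using sq[of n] by (simp add: square_integrable_def)
  define A where "A n = {x \<in> space lborel. cmod (f (Suc n) x - f n x) > (1/2)^n}" for n
  have [measurable]: "A n \<in> sets lborel" for n unfolding A_def by measurable
  \<comment> \<open>Chebyshev with threshold 2^(-n) against increments below 4^(-n): the measure is
    at most 4^n times 16^(-n), that is 4^(-n). This is summable, and so are the increments off
    \<open>A n\<close>.\<close>
  have emA: "emeasure lborel (A n) \<le> ennreal ((1/4)^n)" for n
  proof -
    let ?d = "\<lambda>x. f (Suc n) x - f n x"
    have sd: "square_integrable ?d" by (intro square_integrable_diff sq)
    have "emeasure lborel (A n) = (\<integral>\<^sup>+x. indicator (A n) x \<partial>lborel)"
      by (rule nn_integral_indicator[symmetric]) measurable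
    also have "\<dots> \<le> (\<integral>\<^sup>+x. ennreal (4^n) * ennreal ((cmod (?d x))\<^sup>2) \<partial>lborel)"
    proof (rule nn_integral_mono)
      fix x :: real
      show "indicator (A n) x \<le> ennreal (4^n) * ennreal ((cmod (?d x))\<^sup>2)"
      proof (cases "x \<in> A n")
        case True
        then have "((1/2)^n)\<^sup>2 \<le> (cmod (?d x))\<^sup>2" unfolding A_def by (intro power_mono) auto
        then have "4^n * ((1/2)^n)\<^sup>2 \<le> 4^n * (cmod (?d x))\<^sup>2" by (rule mult_left_mono) simp
        moreover have "4^n * ((1/2)^n)\<^sup>2 = (1 :: real)"
          by (simp add: power2_eq_square flip: power_mult_distrib)
        ultimately have "1 \<le> 4^n * (cmod (?d x))\<^sup>2" by simp
        then show ?thesis using True by (simp add: ennreal_mult'[symmetric])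
      qed simp
    qed
    also have "\<dots> = ennreal (4^n) * ennreal ((norm (X (r (Suc n)) - X (r n)))\<^sup>2)"
      by (subst nn_integral_cmult) (auto simp: nn_integral_abs_L2R[OF sd] Xf abs_L2R_diff sq)
    also have "\<dots> = ennreal (4^n * (norm (X (r (Suc n)) - X (r n)))\<^sup>2)"
      by (simp add: ennreal_mult')
    also have "\<dots> \<le> ennreal (4^n * ((1/4)^n)\<^sup>2)"
      using r(2)[of n] by (intro ennreal_leI mult_left_mono power_mono) auto
    also have "4^n * ((1/4)^n)\<^sup>2 = (1/4 :: real)^n"
      by (simp add: power2_eq_square flip: power_mult_distrib)
    finally show ?thesis .
  qed
  have "AE x in lborel. eventually (\<lambda>n. x \<in> space lborel - A n) sequentially"
  proof (rule borel_cantelli_AE1)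
    show "emeasure lborel (A n) < \<infinity>" for n using le_less_trans[OF emA[of n] ennreal_less_top] by simp
    have "measure lborel (A n) \<le> (1/4)^n" for n
      unfolding measure_def by (intro enn2real_leI emA) simp
    then show "summable (\<lambda>n. measure lborel (A n))"
      by (intro summable_comparison_test'[OF summable_geometric[of "1/4 :: real"]]) auto
    show "A n \<in> sets lborel" for n by fact
  qed
  then have conv: "AE x in lborel. convergent (\<lambda>n. f n x)"
  proof eventually_elim
    fix x assume "eventually (\<lambda>n. x \<in> space lborel - A n) sequentially"
    then have "eventually (\<lambda>n. norm (f (Suc n) x - f n x) \<le> (1/2)^n) sequentially"
      by eventually_elim (auto simp: A_def)
    then have "summable (\<lambda>n. f (Suc n) x - f n x)"
      by (rule summable_comparison_test_ev) (simp add: summable_geometric)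
    then have "convergent (\<lambda>n. f n x - f 0 x)"
      using sum_lessThan_telescope[of "\<lambda>n. f n x"] by (simp add: summable_iff_convergent)
    from convergent_add[OF this convergent_const[of "f 0 x"]]
    show "convergent (\<lambda>n. f n x)" by simp
  qed
  define g where "g x = lim (\<lambda>n. f n x)" for x
  have [measurable]: "g \<in> borel_measurable lborel"
    unfolding g_def by (rule borel_measurable_lim_metric) fact
  have lim: "AE x in lborel. (\<lambda>n. f n x) \<longlonglongrightarrow> g x"
    using conv by eventually_elim (auto simp: g_def convergent_LIMSEQ_iff)
  \<comment> \<open>The distances to a fixed member of the sequence are eventually at most e; Fatou
    hands that bound to the limit. It serves the integrability of g and then the
    convergence.\<close>
  have fatou: "(\<integral>\<^sup>+x. ennreal ((cmod (g x - f m x))\<^sup>2) \<partial>lborel) \<le> ennreal (e\<^sup>2)"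
    if e: "\<And>n. n \<ge> N \<Longrightarrow> norm (X (r n) - X (r m)) \<le> e" for m N e
  proof -
    have "(\<integral>\<^sup>+x. ennreal ((cmod (g x - f m x))\<^sup>2) \<partial>lborel) =
        (\<integral>\<^sup>+x. liminf (\<lambda>n. ennreal ((cmod (f n x - f m x))\<^sup>2)) \<partial>lborel)"
    proof (rule nn_integral_cong_AE)
      show "AE x in lborel. ennreal ((cmod (g x - f m x))\<^sup>2) = liminf (\<lambda>n. ennreal ((cmod (f n x - f m x))\<^sup>2))"
        using lim
      proof eventually_elim
        case (elim x)
        have "(\<lambda>n. ennreal ((cmod (f n x - f m x))\<^sup>2)) \<longlonglongrightarrow> ennreal ((cmod (g x - f m x))\<^sup>2)"
          by (intro tendsto_intros elim)
        from lim_imp_Liminf[OF sequentially_bot this] show ?case by (rule sym)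
      qed
    qed
    also have "\<dots> \<le> liminf (\<lambda>n. \<integral>\<^sup>+x. ennreal ((cmod (f n x - f m x))\<^sup>2) \<partial>lborel)"
      by (rule nn_integral_liminf[where u = "\<lambda>n x. ennreal ((cmod (f n x - f m x))\<^sup>2)"]) simp
    also have "\<dots> \<le> ennreal (e\<^sup>2)"
    proof (rule Liminf_le)
      show "\<forall>\<^sub>F n in sequentially. (\<integral>\<^sup>+x. ennreal ((cmod (f n x - f m x))\<^sup>2) \<partial>lborel) \<le> ennreal (e\<^sup>2)"
        using eventually_ge_at_top[of N]
      proof eventually_elim
        case (elim n)
        have "(\<integral>\<^sup>+x. ennreal ((cmod (f n x - f m x))\<^sup>2) \<partial>lborel) = ennreal ((norm (X (r n) - X (r m)))\<^sup>2)"
          unfolding Xf abs_L2R_diff[OF sq sq]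
          by (rule nn_integral_abs_L2R[OF square_integrable_diff[OF sq sq]])
        also have "\<dots> \<le> ennreal (e\<^sup>2)" using e[OF elim] by (intro ennreal_leI power_mono) auto
        finally show ?case .
      qed
    qed simp
    finally show ?thesis .
  qed
  have sqI: "square_integrable (\<lambda>x. g x - f m x)"
    if e: "\<And>n. n \<ge> N \<Longrightarrow> norm (X (r n) - X (r m)) \<le> e" for m N e
  proof -
    have "(\<integral>\<^sup>+x. ennreal ((cmod (g x - f m x))\<^sup>2) \<partial>lborel) < \<infinity>"
      using le_less_trans[OF fatou[OF e] ennreal_less_top] by simp
    then have "integrable lborel (\<lambda>x. (cmod (g x - f m x))\<^sup>2)"
      by (intro integrableI_bounded) simp_all
    then show ?thesis by (simp add: square_integrable_def)
  qed
  have cau: "\<exists>N. \<forall>m\<ge>N. \<forall>n\<ge>N. norm (X (r n) - X (r m)) < e" if "0 < e" for e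
    using CauchyD[OF Cauchy_subseq_Cauchy[OF \<open>Cauchy X\<close> r(1)] that] by (auto simp: o_def)
  obtain N where N: "\<And>m n. m \<ge> N \<Longrightarrow> n \<ge> N \<Longrightarrow> norm (X (r n) - X (r m)) < 1"
    using cau[of 1] by auto
  have "square_integrable (\<lambda>x. (g x - f N x) + f N x)"
    by (intro square_integrable_add sq sqI[where N = N and e = 1]) (use N in \<open>auto intro: less_imp_le\<close>)
  then have sg: "square_integrable g" by simp
  have "(\<lambda>n. X (r n)) \<longlonglongrightarrow> abs_L2R g"
  proof (rule metric_LIMSEQ_I)
    fix e :: real assume "0 < e"
    then obtain N where N: "\<And>m n. m \<ge> N \<Longrightarrow> n \<ge> N \<Longrightarrow> norm (X (r n) - X (r m)) < e / 2"
      using cau[of "e / 2"] by auto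
    have "dist (X (r m)) (abs_L2R g) < e" if "m \<ge> N" for m
    proof -
      have "ennreal ((norm (abs_L2R g - X (r m)))\<^sup>2) \<le> ennreal ((e / 2)\<^sup>2)"
        unfolding Xf abs_L2R_diff[OF sg sq]
          nn_integral_abs_L2R[OF square_integrable_diff[OF sg sq], symmetric]
      proof (rule fatou[where N = N])
        show "norm (X (r n) - X (r m)) \<le> e / 2" if "n \<ge> N" for n
          using N[OF \<open>m \<ge> N\<close> that] by (rule less_imp_le)
      qed
      then have "(norm (abs_L2R g - X (r m)))\<^sup>2 \<le> (e / 2)\<^sup>2"
        by (subst (asm) ennreal_le_iff) auto
      then have "norm (abs_L2R g - X (r m)) \<le> e / 2"
        by (rule power2_le_imp_le) (use \<open>0 < e\<close> in simp)
      then show ?thesis using \<open>0 < e\<close> by (simp add: dist_norm norm_minus_commute)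
    qed
    then show "\<exists>N. \<forall>m\<ge>N. dist (X (r m)) (abs_L2R g) < e" by blast
  qed
  then have "X \<longlonglongrightarrow> abs_L2R g"
    using Cauchy_converges_subseq[OF \<open>Cauchy X\<close> r(1), of "abs_L2R g"] by (simp add: o_def)
  then show "convergent X" by (auto simp: convergent_def)
qed


section \<open>Homomorphisms of operator algebras\<close>

lemma norm_adjoint_mult_self: "norm (cbop_adjoint T * T) \<le> (norm T)\<^sup>2"
  for T :: "'h::{complex_inner,banach} cbop"
  using norm_mult_ineq[of "cbop_adjoint T" T] by (simp add: power2_eq_square)

lemma cbop_almost_norming:
  fixes T :: "'h::complex_inner cbop"
  assumes "T \<noteq> 0" "0 < \<delta>"
  shows "\<exists>x. norm x \<le> 1 \<and> (norm T)\<^sup>2 * (1 - \<delta>) \<le> (norm (T \<bullet>\<^sub>o x))\<^sup>2"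
proof (rule ccontr)
  assume n: "\<not> ?thesis"
  have less: "(norm (T \<bullet>\<^sub>o x))\<^sup>2 < (norm T)\<^sup>2 * (1 - \<delta>)" if "norm x \<le> 1" for x
    using n that by (meson not_le)
  define c where "c = norm T * sqrt (1 - \<delta>)"
  have "0 \<le> (norm (T \<bullet>\<^sub>o 0))\<^sup>2" by simp
  also have "\<dots> < (norm T)\<^sup>2 * (1 - \<delta>)" by (rule less) simp
  finally have "0 < 1 - \<delta>" using assms by (simp add: zero_less_mult_iff)
  have c2: "c\<^sup>2 = (norm T)\<^sup>2 * (1 - \<delta>)"
    using \<open>0 < 1 - \<delta>\<close> by (simp add: c_def power_mult_distrib)
  have "0 \<le> c" using \<open>0 < 1 - \<delta>\<close> by (simp add: c_def)
  have "norm (T \<bullet>\<^sub>o x) \<le> c * norm x" for x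
  proof (cases "x = 0")
    case False
    have "(norm (T \<bullet>\<^sub>o ((1 / norm x) *\<^sub>R x)))\<^sup>2 < c\<^sup>2"
      unfolding c2 using False by (intro less) simp
    then have "norm (T \<bullet>\<^sub>o ((1 / norm x) *\<^sub>R x)) < c"
      using \<open>0 \<le> c\<close> by (rule power_less_imp_less_base)
    then show ?thesis using False by (simp add: cbop_apply_scaleR field_simps)
  qed simp
  then have "norm T \<le> c" by (rule norm_cbop_bound[OF \<open>0 \<le> c\<close>])
  then have "(norm T)\<^sup>2 \<le> c\<^sup>2" by (intro power_mono) auto
  then show False
    using \<open>T \<noteq> 0\<close> \<open>0 < \<delta>\<close> by (simp add: c2 mult_le_cancel_left1)
qed

text \<open>If \<open>\<parallel>T\<parallel> = r > K\<close>, then \<open>1\<close> is an approximate eigenvalue of \<open>T\<^sup>*T / r\<^sup>2\<close>, which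
  contradicts the existence of a quasi-inverse.\<close>

lemma norm_le_of_quasi_inverse:
  fixes T :: "'h::{complex_inner,banach} cbop"
  assumes "0 \<le> K"
    and qi: "\<And>r. K < r \<Longrightarrow> \<exists>G. G = (1 / r\<^sup>2) *\<^sub>R (cbop_adjoint T * T) + (1 / r\<^sup>2) *\<^sub>R (cbop_adjoint T * T) * G"
  shows "norm T \<le> K"
proof (rule ccontr)
  assume "\<not> norm T \<le> K"
  define r where "r = norm T"
  have r: "K < r" "0 < r" "T \<noteq> 0" using \<open>\<not> norm T \<le> K\<close> \<open>0 \<le> K\<close> by (auto simp: r_def)
  define H where "H = (1 / r\<^sup>2) *\<^sub>R (cbop_adjoint T * T)"
  obtain G' where G': "G' = H + H * G'" using qi[OF r(1)] by (auto simp: H_def)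
  have "cbop_adjoint H = H"
    by (simp add: H_def scaleR_cbop_def adjoint_scale adjoint_mult)
  \<comment> \<open>Taking adjoints turns the right quasi-inverse into a left one, (1 + G)(1 - H) =
    1, so 1 - H is bounded below by 1 / (norm G + 1).\<close>
  define G where "G = cbop_adjoint G'"
  have G: "G = H + G * H"
    using arg_cong[OF G', of cbop_adjoint] \<open>cbop_adjoint H = H\<close>
    by (simp add: G_def adjoint_add adjoint_mult)
  have "norm H \<le> 1"
    using norm_adjoint_mult_self[of T] r by (simp add: H_def r_def divide_simps)
  define C where "C = (norm G + 1)\<^sup>2"
  \<comment> \<open>Chosen so that (2 C + 1) \<delta> < 1: the almost norming x will satisfy both
    |x|^2 >= 1 - \<delta> and |x|^2 <= 2 C \<delta>.\<close>
  define \<delta> where "\<delta> = 1 / (2 * C + 2)"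
  have "1 \<le> C" unfolding C_def by (rule one_le_power) simp
  then have "0 < \<delta>" and \<delta>: "2 * C * \<delta> + \<delta> < 1" by (auto simp: \<delta>_def field_simps)
  obtain x where x: "norm x \<le> 1" "r\<^sup>2 * (1 - \<delta>) \<le> (norm (T \<bullet>\<^sub>o x))\<^sup>2"
    using cbop_almost_norming[OF r(3) \<open>0 < \<delta>\<close>] by (auto simp: r_def)
  have inner: "inner x (H \<bullet>\<^sub>o x) = (norm (T \<bullet>\<^sub>o x))\<^sup>2 / r\<^sup>2"
    by (simp add: H_def norm_adjoint_square[of T x] inner_eq_Re_cinner[symmetric])
  have ge: "1 - \<delta> \<le> inner x (H \<bullet>\<^sub>o x)"
    unfolding inner using x(2) r(2) by (simp add: pos_le_divide_eq mult.commute)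
  have nH: "norm (H \<bullet>\<^sub>o x) \<le> 1"
    using norm_cbop_apply[of H x] mult_mono[OF \<open>norm H \<le> 1\<close> x(1)] by simp
  have "(norm (x - H \<bullet>\<^sub>o x))\<^sup>2 = (norm x)\<^sup>2 - 2 * inner x (H \<bullet>\<^sub>o x) + (norm (H \<bullet>\<^sub>o x))\<^sup>2"
    unfolding power2_norm_eq_inner by (simp add: inner_diff_left inner_diff_right inner_commute)
  also have "\<dots> \<le> 1 - 2 * (1 - \<delta>) + 1"
    using ge x(1) nH by (intro add_mono diff_mono) (auto simp: power_le_one)
  finally have d: "(norm (x - H \<bullet>\<^sub>o x))\<^sup>2 \<le> 2 * \<delta>" by simp
  have "x = (x - H \<bullet>\<^sub>o x) + G \<bullet>\<^sub>o (x - H \<bullet>\<^sub>o x)"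
    using arg_cong[OF G, of "\<lambda>A. A \<bullet>\<^sub>o x"] by (simp add: cbop_apply_diff)
  then have "norm x \<le> norm (x - H \<bullet>\<^sub>o x) + norm (G \<bullet>\<^sub>o (x - H \<bullet>\<^sub>o x))"
    by (metis norm_triangle_ineq)
  also have "\<dots> \<le> (norm G + 1) * norm (x - H \<bullet>\<^sub>o x)"
    using norm_cbop_apply[of G "x - H \<bullet>\<^sub>o x"] by (simp add: algebra_simps)
  finally have "(norm x)\<^sup>2 \<le> ((norm G + 1) * norm (x - H \<bullet>\<^sub>o x))\<^sup>2"
    by (intro power_mono) auto
  also have "\<dots> \<le> C * (2 * \<delta>)"
    unfolding power_mult_distrib C_def using d by (intro mult_left_mono) auto
  finally have "(norm x)\<^sup>2 \<le> 2 * C * \<delta>" by simp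
  moreover have "1 - \<delta> \<le> (norm x)\<^sup>2"
  proof -
    have "r\<^sup>2 * (1 - \<delta>) \<le> (r * norm x)\<^sup>2"
      using x(2) norm_cbop_apply[of T x] by (auto simp: r_def intro: order_trans power_mono)
    then show ?thesis using r(2) by (simp add: power_mult_distrib)
  qed
  ultimately show False using \<delta> by linarith
qed

lemma cstar_subalgebra_bounded_operators_iff:
  "cstar_subalgebra S bounded_operators \<longleftrightarrow>
    0 \<in> S \<and> (\<forall>x\<in>S. \<forall>y\<in>S. x + y \<in> S \<and> x * y \<in> S) \<and> (\<forall>c. \<forall>x\<in>S. cbop_scale c x \<in> S)
    \<and> (\<forall>x\<in>S. cbop_adjoint x \<in> S) \<and> closed S"
proof -
  have "(\<forall>s x. range s \<subseteq> S \<and> (\<lambda>n. norm (s n - x)) \<longlonglongrightarrow> 0 \<longrightarrow> x \<in> S) \<longleftrightarrow> closed S"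
    unfolding closed_sequential_limits
    by (simp add: image_subset_iff tendsto_norm_zero_iff LIM_zero_iff)
  then show ?thesis by (simp add: cstar_subalgebra_def)
qed

lemma cstar_subalgebra_generated:
  "cstar_subalgebra (carrier (cstar_generated bounded_operators G)) bounded_operators"
  unfolding cstar_generated_def cstar_subalgebra_bounded_operators_iff
  by (auto simp: cstar_subalgebra_bounded_operators_iff intro!: closed_Inter)

lemma cstar_generated_superset: "G \<subseteq> carrier (cstar_generated bounded_operators G)"
  by (auto simp: cstar_generated_def)

lemma cstar_generated_least:
  "cstar_subalgebra S bounded_operators \<Longrightarrow> G \<subseteq> S \<Longrightarrow> carrier (cstar_generated bounded_operators G) \<subseteq> S"
  by (auto simp: cstar_generated_def)

text \<open>The abstract form of gamma: a unital star homomorphism at each point of V, with no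
  topology on V. Contractivity and a uniformly closed range are consequences.\<close>

locale operator_family_hom =
  fixes S :: "'h::{complex_inner,banach} cbop set" and V :: "'v set"
    and \<gamma> :: "'h cbop \<Rightarrow> 'v \<Rightarrow> 'k::{complex_inner,banach} cbop"
  assumes subalgebra: "cstar_subalgebra S bounded_operators"
    and one_mem: "1 \<in> S"
    and hom_add: "\<And>x y v. x \<in> S \<Longrightarrow> y \<in> S \<Longrightarrow> v \<in> V \<Longrightarrow> \<gamma> (x + y) v = \<gamma> x v + \<gamma> y v"
    and hom_mult: "\<And>x y v. x \<in> S \<Longrightarrow> y \<in> S \<Longrightarrow> v \<in> V \<Longrightarrow> \<gamma> (x * y) v = \<gamma> x v * \<gamma> y v"
    and hom_scale: "\<And>c x v. x \<in> S \<Longrightarrow> v \<in> V \<Longrightarrow> \<gamma> (cbop_scale c x) v = cbop_scale c (\<gamma> x v)"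
    and hom_adjoint: "\<And>x v. x \<in> S \<Longrightarrow> v \<in> V \<Longrightarrow> \<gamma> (cbop_adjoint x) v = cbop_adjoint (\<gamma> x v)"
    and hom_one: "\<And>v. v \<in> V \<Longrightarrow> \<gamma> 1 v = 1"
begin

lemma mem:
  shows "0 \<in> S" "x \<in> S \<Longrightarrow> y \<in> S \<Longrightarrow> x + y \<in> S" "x \<in> S \<Longrightarrow> y \<in> S \<Longrightarrow> x * y \<in> S"
    "x \<in> S \<Longrightarrow> cbop_scale c x \<in> S" "x \<in> S \<Longrightarrow> cbop_adjoint x \<in> S" "x \<in> S \<Longrightarrow> r *\<^sub>R x \<in> S"
    "x \<in> S \<Longrightarrow> - x \<in> S" "x \<in> S \<Longrightarrow> y \<in> S \<Longrightarrow> x - y \<in> S"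
  using subalgebra
  by (auto simp: cstar_subalgebra_bounded_operators_iff scaleR_cbop_def uminus_cbop_def minus_cbop_def)

lemma closed_S: "closed S"
  using subalgebra by (auto simp: cstar_subalgebra_bounded_operators_iff)

lemma hom_scaleR: "x \<in> S \<Longrightarrow> v \<in> V \<Longrightarrow> \<gamma> (r *\<^sub>R x) v = r *\<^sub>R \<gamma> x v"
  by (simp add: scaleR_cbop_def hom_scale)

lemma hom_diff: "x \<in> S \<Longrightarrow> y \<in> S \<Longrightarrow> v \<in> V \<Longrightarrow> \<gamma> (x - y) v = \<gamma> x v - \<gamma> y v"
  by (simp add: minus_cbop_def uminus_cbop_def hom_add hom_scale mem)

text \<open>The map G |-> X + X G contracts with factor \<open>norm X\<close> and preserves the
  closed set S, so its fixed point, the Neumann series, lies in S.\<close>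

lemma quasi_inverse_mem:
  assumes "X \<in> S" "norm X < 1"
  shows "\<exists>G\<in>S. G = X + X * G"
proof -
  have "\<exists>!G\<in>S. X + X * G = G"
  proof (rule Banach_fix)
    show "complete S" using closed_S by (simp add: complete_eq_closed)
    show "S \<noteq> {}" using one_mem by blast
    show "(\<lambda>G. X + X * G) ` S \<subseteq> S" using assms(1) by (auto intro!: mem)
    show "dist (X + X * G) (X + X * G') \<le> norm X * dist G G'" if "G \<in> S" "G' \<in> S" for G G'
      using norm_mult_ineq[of X "G - G'"] by (simp add: dist_norm right_diff_distrib)
  qed (use assms(2) in auto)
  then show ?thesis by metis
qed

text \<open>For r > |x| the element x* x / r^2 has a quasi-inverse in S, and gamma carries it to one
  for the corresponding symbol; that is what \<open>norm_le_of_quasi_inverse\<close> asks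
  for.\<close>

lemma norm_hom_le:
  assumes "x \<in> S" "v \<in> V"
  shows "norm (\<gamma> x v) \<le> norm x"
proof (rule norm_le_of_quasi_inverse)
  fix r assume r: "norm x < r"
  then have "0 < r" using norm_ge_zero[of x] by linarith
  define h where "h = (1 / r\<^sup>2) *\<^sub>R (cbop_adjoint x * x)"
  have hS: "h \<in> S" unfolding h_def using assms(1) by (intro mem)
  have "norm (cbop_adjoint x * x) < r\<^sup>2"
    using norm_adjoint_mult_self[of x] power_strict_mono[OF r, of 2] by simp
  then have "norm h < 1" using \<open>0 < r\<close> by (simp add: h_def)
  then obtain g where g: "g \<in> S" "g = h + h * g" using quasi_inverse_mem[OF hS] by blast
  have "\<gamma> g v = \<gamma> h v + \<gamma> h v * \<gamma> g v"
    by (subst g(2)) (simp add: hom_add hom_mult mem hS g(1) assms)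
  moreover have "\<gamma> h v = (1 / r\<^sup>2) *\<^sub>R (cbop_adjoint (\<gamma> x v) * \<gamma> x v)"
    by (simp add: h_def hom_scaleR hom_mult hom_adjoint mem assms)
  ultimately show "\<exists>G. G = (1 / r\<^sup>2) *\<^sub>R (cbop_adjoint (\<gamma> x v) * \<gamma> x v) +
      (1 / r\<^sup>2) *\<^sub>R (cbop_adjoint (\<gamma> x v) * \<gamma> x v) * G" by metis
qed simp

text \<open>Invertibility of 1 + T/2 inside S. As T lies between 0 and M = |a|^2, centring gives 1 +
  T/2 = l (1 - X) with l = 1 + M/2 and X = (M - T) / (2 l), of norm at most M / (2 l) < 1.\<close>

lemma resolvent:
  assumes a: "a \<in> S" and T: "T = cbop_adjoint a * a"
  shows "\<exists>R\<in>S. R + (1/2) *\<^sub>R (T * R) = 1"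
proof -
  define M where "M = (norm a)\<^sup>2"
  define l where "l = 1 + M / 2"
  have "0 \<le> M" "0 < l" by (auto simp: M_def l_def intro: add_pos_nonneg)
  define X where "X = (1 / (2 * l)) *\<^sub>R (M *\<^sub>R 1 - T)"
  have TS: "T \<in> S" unfolding T using a by (intro mem)
  have XS: "X \<in> S" unfolding X_def by (intro mem one_mem TS)
  \<comment> \<open>From |T x| <= |a| |a x| comes |T x|^2 <= M <x, T x>. In the expansion of |M x -
    T x|^2 the last term is thus absorbed by half of the mixed one, and the other half has the right
    sign.\<close>
  have "norm (M *\<^sub>R 1 - T) \<le> M"
  proof (rule norm_cbop_bound[OF \<open>0 \<le> M\<close>])
    fix x
    have "norm (T \<bullet>\<^sub>o x) \<le> norm a * norm (a \<bullet>\<^sub>o x)"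
      using norm_cbop_apply[of "cbop_adjoint a" "a \<bullet>\<^sub>o x"] by (simp add: T)
    then have "(norm (T \<bullet>\<^sub>o x))\<^sup>2 \<le> (norm a * norm (a \<bullet>\<^sub>o x))\<^sup>2" by (intro power_mono) auto
    also have "\<dots> = M * inner x (T \<bullet>\<^sub>o x)"
      by (simp add: power_mult_distrib M_def norm_adjoint_square[of a x] T inner_eq_Re_cinner)
    finally have le: "(norm (T \<bullet>\<^sub>o x))\<^sup>2 \<le> M * inner x (T \<bullet>\<^sub>o x)" .
    have pos: "0 \<le> M * inner x (T \<bullet>\<^sub>o x)"
      using le by (rule order_trans[OF zero_le_power2])
    have "(norm ((M *\<^sub>R 1 - T) \<bullet>\<^sub>o x))\<^sup>2 = M\<^sup>2 * (norm x)\<^sup>2 - 2 * (M * inner x (T \<bullet>\<^sub>o x)) + (norm (T \<bullet>\<^sub>o x))\<^sup>2"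
      unfolding power2_norm_eq_inner
      by (simp add: inner_diff_left inner_diff_right inner_commute power2_eq_square)
    also have "\<dots> \<le> (M * norm x)\<^sup>2"
      using le pos by (simp add: power_mult_distrib)
    finally show "norm ((M *\<^sub>R 1 - T) \<bullet>\<^sub>o x) \<le> M * norm x"
      by (rule power2_le_imp_le) (simp add: \<open>0 \<le> M\<close>)
  qed
  moreover have "norm X = norm (M *\<^sub>R 1 - T) / (2 * l)"
    unfolding X_def norm_scaleR using \<open>0 < l\<close> by simp
  ultimately have "norm X \<le> M / (2 * l)"
    using \<open>0 < l\<close> by (simp add: divide_right_mono)
  also have "\<dots> < 1" using \<open>0 \<le> M\<close> by (simp add: l_def field_simps)
  finally obtain G where G: "G \<in> S" "G = X + X * G" using quasi_inverse_mem[OF XS] by blast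
  define R where "R = (1 / l) *\<^sub>R (1 + G)"
  have RS: "R \<in> S" unfolding R_def by (intro mem one_mem G)
  have "l *\<^sub>R X = (1/2) *\<^sub>R (M *\<^sub>R 1 - T)"
    using \<open>0 < l\<close> by (simp add: X_def)
  then have "1 + (1/2) *\<^sub>R T = l *\<^sub>R (1 - X)"
    by (simp add: scaleR_diff_right l_def scaleR_add_left)
  then have "R + (1/2) *\<^sub>R (T * R) = (l *\<^sub>R (1 - X)) * R"
    by (metis distrib_right mult_1 mult_scaleR_left)
  also have "\<dots> = (1 - X) * (1 + G)"
    using \<open>0 < l\<close> by (simp add: R_def)
  also have "\<dots> = 1"
    using G(2) by (simp add: algebra_simps)
  finally show ?thesis using RS by blast
qed

text \<open>The lift is y = x R with R = (1 + a* a / 2)^(-1) and a = x / c. Since |(1 + a* a / 2)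
  w|^2 dominates |w|^2 + |a w|^2, the operator a R and the symbol of R are contractions. So |y| <=
  c, while x - y = x (a* a / 2) R has a symbol of norm at most c / 2.\<close>

lemma approximate_lift:
  assumes x: "x \<in> S" and "0 < c" and bound: "\<And>v. v \<in> V \<Longrightarrow> norm (\<gamma> x v) \<le> c"
  shows "\<exists>y\<in>S. norm y \<le> c \<and> (\<forall>v\<in>V. norm (\<gamma> x v - \<gamma> y v) \<le> c / 2)"
proof -
  define a where "a = (1 / c) *\<^sub>R x"
  have aS: "a \<in> S" unfolding a_def by (intro mem x)
  define T where "T = cbop_adjoint a * a"
  have TS: "T \<in> S" unfolding T_def by (intro mem aS)
  obtain R where R: "R \<in> S" "R + (1/2) *\<^sub>R (T * R) = 1" using resolvent[OF aS T_def] by blast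
  have lower: "(norm w)\<^sup>2 + (norm (A \<bullet>\<^sub>o w))\<^sup>2 \<le> (norm (w + (1/2) *\<^sub>R ((cbop_adjoint A * A) \<bullet>\<^sub>o w)))\<^sup>2"
    for A :: "'z::{complex_inner,banach} cbop" and w
  proof -
    let ?t = "(cbop_adjoint A * A) \<bullet>\<^sub>o w"
    have "(norm (w + (1/2) *\<^sub>R ?t))\<^sup>2 = (norm w)\<^sup>2 + inner w ?t + (norm ((1/2) *\<^sub>R ?t))\<^sup>2"
      unfolding power2_norm_eq_inner by (simp add: inner_add_left inner_add_right inner_commute)
    moreover have "inner w ?t = (norm (A \<bullet>\<^sub>o w))\<^sup>2"
      by (simp only: norm_adjoint_square[of A w] inner_eq_Re_cinner)
    ultimately show ?thesis by simp
  qed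
  define y where "y = x * R"
  have yS: "y \<in> S" unfolding y_def by (intro mem x R)
  have "norm (y \<bullet>\<^sub>o z) \<le> c * norm z" for z
  proof -
    let ?w = "R \<bullet>\<^sub>o z"
    have "?w + (1/2) *\<^sub>R (T \<bullet>\<^sub>o ?w) = z"
      using arg_cong[OF R(2), of "\<lambda>A. A \<bullet>\<^sub>o z"] by simp
    then have "(norm ?w)\<^sup>2 + (norm (a \<bullet>\<^sub>o ?w))\<^sup>2 \<le> (norm z)\<^sup>2"
      using lower[of ?w a] by (simp only: T_def)
    then have "(norm (a \<bullet>\<^sub>o ?w))\<^sup>2 \<le> (norm z)\<^sup>2"
      using zero_le_power2[of "norm ?w"] by linarith
    then have "norm (a \<bullet>\<^sub>o ?w) \<le> norm z" by (rule power2_le_imp_le) simp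
    then show ?thesis using \<open>0 < c\<close> by (simp add: a_def y_def field_simps)
  qed
  then have "norm y \<le> c" using \<open>0 < c\<close> by (intro norm_cbop_bound) auto
  moreover have "norm (\<gamma> x v - \<gamma> y v) \<le> c / 2" if v: "v \<in> V" for v
  proof -
    have Tv: "\<gamma> T v = cbop_adjoint (\<gamma> a v) * \<gamma> a v"
      unfolding T_def by (simp add: hom_mult hom_adjoint mem aS v)
    have Rv: "\<gamma> R v + (1/2) *\<^sub>R (\<gamma> T v * \<gamma> R v) = 1"
      using arg_cong[OF R(2), of "\<lambda>A. \<gamma> A v"]
      by (simp add: hom_add hom_mult hom_scaleR hom_one mem R(1) TS v)
    have "norm (\<gamma> R v) \<le> 1"
    proof (rule norm_cbop_bound)
      fix z
      let ?w = "\<gamma> R v \<bullet>\<^sub>o z"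
      have "?w + (1/2) *\<^sub>R (\<gamma> T v \<bullet>\<^sub>o ?w) = z"
        using arg_cong[OF Rv, of "\<lambda>A. A \<bullet>\<^sub>o z"] by simp
      then have "(norm ?w)\<^sup>2 + (norm (\<gamma> a v \<bullet>\<^sub>o ?w))\<^sup>2 \<le> (norm z)\<^sup>2"
        using lower[of ?w "\<gamma> a v"] by (simp only: Tv)
      then have "(norm ?w)\<^sup>2 \<le> (norm z)\<^sup>2"
        using zero_le_power2[of "norm (\<gamma> a v \<bullet>\<^sub>o ?w)"] by linarith
      then have "norm ?w \<le> norm z" by (rule power2_le_imp_le) simp
      then show "norm ?w \<le> 1 * norm z" by simp
    qed simp
    have "norm (\<gamma> a v) \<le> 1"
      using bound[OF v] \<open>0 < c\<close> by (simp add: a_def hom_scaleR x v)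
    then have "norm (\<gamma> T v) \<le> 1"
      unfolding Tv using norm_adjoint_mult_self[of "\<gamma> a v"] power_le_one[of "norm (\<gamma> a v)" 2] by simp
    have "\<gamma> x v - \<gamma> y v = \<gamma> x v * (1 - \<gamma> R v)"
      by (simp add: y_def hom_mult x R(1) v right_diff_distrib)
    also have "1 - \<gamma> R v = (1/2) *\<^sub>R (\<gamma> T v * \<gamma> R v)"
      using Rv by (simp add: algebra_simps)
    finally have "norm (\<gamma> x v - \<gamma> y v) \<le> norm (\<gamma> x v) * ((1/2) * norm (\<gamma> T v * \<gamma> R v))"
      using norm_mult_ineq[of "\<gamma> x v" "(1/2) *\<^sub>R (\<gamma> T v * \<gamma> R v)"] by simp
    also have "\<dots> \<le> c * ((1/2) * (1 * 1))"
      using bound[OF v] \<open>norm (\<gamma> T v) \<le> 1\<close> \<open>norm (\<gamma> R v) \<le> 1\<close> \<open>0 < c\<close>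
      by (intro mult_mono order_trans[OF norm_mult_ineq]) auto
    finally show ?thesis by simp
  qed
  ultimately show ?thesis using yS by blast
qed

text \<open>Successive approximate lifts, with errors decreasing geometrically, add up to an exact
  one; so the image is closed under uniform limits.\<close>

lemma image_closed:
  assumes G: "\<And>e. 0 < e \<Longrightarrow> \<exists>x\<in>S. \<forall>v\<in>V. norm (G v - \<gamma> x v) \<le> e"
  shows "\<exists>x\<in>S. \<forall>v\<in>V. G v = \<gamma> x v"
proof -
  \<comment> \<open>The rate 3/4: if the errors of x and z are at most q^n and q^n / 8, the symbol
    of z - x is at most 9/8 q^n; the approximate lift halves it, and 1/8 + 9/16 = 11/16 is below
    3/4.\<close>
  let ?q = "3/4 :: real"
  define P where "P n x \<longleftrightarrow> x \<in> S \<and> (\<forall>v\<in>V. norm (G v - \<gamma> x v) \<le> ?q ^ n)" for n x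
  have step: "\<exists>x'. P (Suc n) x' \<and> norm (x' - x) \<le> 2 * ?q ^ n" if "P n x" for n x
  proof -
    have q: "0 < ?q ^ n" by simp
    have x: "x \<in> S" "\<And>v. v \<in> V \<Longrightarrow> norm (G v - \<gamma> x v) \<le> ?q ^ n" using that by (auto simp: P_def)
    obtain z where z: "z \<in> S" "\<And>v. v \<in> V \<Longrightarrow> norm (G v - \<gamma> z v) \<le> ?q ^ n / 8"
      using G[of "?q ^ n / 8"] by auto
    have "norm (\<gamma> (z - x) v) \<le> 9/8 * ?q ^ n" if "v \<in> V" for v
    proof -
      have "\<gamma> (z - x) v = (G v - \<gamma> x v) - (G v - \<gamma> z v)" by (simp add: hom_diff x z that)
      then have "norm (\<gamma> (z - x) v) \<le> norm (G v - \<gamma> x v) + norm (G v - \<gamma> z v)"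
        by (simp only: norm_triangle_ineq4)
      then show ?thesis using x(2)[OF that] z(2)[OF that] by linarith
    qed
    then obtain y where y: "y \<in> S" "norm y \<le> 9/8 * ?q ^ n"
      "\<And>v. v \<in> V \<Longrightarrow> norm (\<gamma> (z - x) v - \<gamma> y v) \<le> 9/8 * ?q ^ n / 2"
      using approximate_lift[of "z - x" "9/8 * ?q ^ n"] mem(8)[OF z(1) x(1)] by auto
    have "norm (G v - \<gamma> (x + y) v) \<le> ?q ^ Suc n" if v: "v \<in> V" for v
    proof -
      have "G v - \<gamma> (x + y) v = (G v - \<gamma> z v) + (\<gamma> (z - x) v - \<gamma> y v)"
        by (simp add: hom_add hom_diff x z y v)
      then have "norm (G v - \<gamma> (x + y) v) \<le> ?q ^ n / 8 + 9/8 * ?q ^ n / 2"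
        using norm_triangle_le[OF add_mono[OF z(2)[OF v] y(3)[OF v]]] by (simp only:)
      also have "\<dots> \<le> ?q ^ Suc n" by simp
      finally show ?thesis .
    qed
    moreover have "norm y \<le> 2 * ?q ^ n" using y(2) q by linarith
    ultimately show ?thesis using y(1) x(1)
      by (intro exI[of _ "x + y"]) (simp add: P_def mem)
  qed
  have "\<exists>x. P 0 x" using G[of 1] by (auto simp: P_def)
  then obtain X where X: "\<And>n. P n (X n)" "\<And>n. norm (X (Suc n) - X n) \<le> 2 * ?q ^ n"
    using dependent_nat_choice[of P "\<lambda>n x x'. norm (x' - x) \<le> 2 * ?q ^ n"] step by auto
  have "summable (\<lambda>n. X (Suc n) - X n)"
    by (rule summable_comparison_test'[of "\<lambda>n. 2 * ?q ^ n" 0])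
      (use X(2) in \<open>auto intro!: summable_mult summable_geometric\<close>)
  then have "convergent (\<lambda>n. X n - X 0)"
    using sum_lessThan_telescope[of X] by (simp add: summable_iff_convergent)
  from convergent_add[OF this convergent_const[of "X 0"]]
  obtain x where lim: "X \<longlonglongrightarrow> x" by (auto simp: convergent_def)
  have xS: "x \<in> S"
    using closed_sequentially[OF closed_S _ lim] X(1) by (simp add: P_def)
  have "G v = \<gamma> x v" if v: "v \<in> V" for v
  proof -
    have "(\<lambda>n. norm (G v - \<gamma> x v)) \<longlonglongrightarrow> 0"
    proof (rule tendsto_sandwich[of "\<lambda>_. 0"])
      have "norm (G v - \<gamma> x v) \<le> ?q ^ n + norm (X n - x)" for n
      proof -
        have "X n \<in> S" "norm (G v - \<gamma> (X n) v) \<le> ?q ^ n" using X(1)[of n] v by (auto simp: P_def)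
        moreover have "norm (\<gamma> (X n) v - \<gamma> x v) \<le> norm (X n - x)"
          using norm_hom_le[OF mem(8)[OF \<open>X n \<in> S\<close> xS] v] by (simp add: hom_diff \<open>X n \<in> S\<close> xS v)
        ultimately show ?thesis
          using norm_triangle_ineq[of "G v - \<gamma> (X n) v" "\<gamma> (X n) v - \<gamma> x v"] by simp
      qed
      then show "\<forall>\<^sub>F n in sequentially. norm (G v - \<gamma> x v) \<le> ?q ^ n + norm (X n - x)" by simp
      have "(\<lambda>n. norm (X n - x)) \<longlonglongrightarrow> 0"
        using lim by (simp add: tendsto_norm_zero_iff LIM_zero_iff)
      then show "(\<lambda>n. ?q ^ n + norm (X n - x)) \<longlonglongrightarrow> 0"
        using tendsto_add[OF LIMSEQ_realpow_zero[of ?q]] by fastforce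
    qed auto
    then show ?thesis by (simp add: LIMSEQ_const_iff)
  qed
  then show ?thesis using xS by blast
qed

end


section \<open>Fourier series on the circle and the unitaries Y_phi\<close>

section \<open>Trigonometric polynomials\<close>

text \<open>Laurent polynomials without coefficient bookkeeping: measurability, boundedness,
  vanishing integrals and the existence of symbols all follow by the two-case induction.\<close>

inductive trig :: "(complex \<Rightarrow> complex) \<Rightarrow> bool" where
  monomial: "trig (\<lambda>z. c * z powi k)"
| add: "trig f \<Longrightarrow> trig g \<Longrightarrow> trig (\<lambda>z. f z + g z)"

text \<open>Agreement on the circle only: the exponent law for \<open>powi\<close> fails at 0, and
  Re z is a Laurent polynomial only where 1/z is the conjugate of z.\<close>

definition trig_on_circle :: "(complex \<Rightarrow> complex) \<Rightarrow> bool" where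
  "trig_on_circle f \<longleftrightarrow> (\<exists>t. trig t \<and> (\<forall>z\<in>sphere 0 1. f z = t z))"

lemma trig_on_circle_monomial: "trig_on_circle (\<lambda>z. c * z powi k)"
  unfolding trig_on_circle_def using trig.monomial by blast

lemma trig_on_circle_const: "trig_on_circle (\<lambda>z. c)"
  using trig_on_circle_monomial[of c 0] by simp

lemma trig_on_circle_cong:
  "trig_on_circle f \<Longrightarrow> (\<And>z. z \<in> sphere 0 1 \<Longrightarrow> g z = f z) \<Longrightarrow> trig_on_circle g"
  unfolding trig_on_circle_def by metis

lemma trig_on_circle_add:
  "trig_on_circle f \<Longrightarrow> trig_on_circle g \<Longrightarrow> trig_on_circle (\<lambda>z. f z + g z)"
  unfolding trig_on_circle_def by (metis trig.add)

lemma trig_on_circle_mult: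
  assumes "trig_on_circle f" "trig_on_circle g"
  shows "trig_on_circle (\<lambda>z. f z * g z)"
proof -
  have mono: "trig_on_circle (\<lambda>z. c * z powi k * g z)" if "trig g" for c k g
    using that
  proof induction
    case (monomial d l)
    have "c * z powi k * (d * z powi l) = c * d * z powi (k + l)" if "z \<in> sphere 0 1" for z
    proof -
      have "z \<noteq> 0" using that by auto
      then show ?thesis by (simp add: power_int_add)
    qed
    then show ?case
      by (rule trig_on_circle_cong[OF trig_on_circle_monomial])
  next
    case (add f g)
    then show ?case
      by (auto intro: trig_on_circle_cong[OF trig_on_circle_add] simp: ring_distribs)
  qed
  obtain s t where s: "trig s" "\<forall>z\<in>sphere 0 1. f z = s z" and t: "trig t" "\<forall>z\<in>sphere 0 1. g z = t z"
    using assms by (auto simp: trig_on_circle_def)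
  have "trig_on_circle (\<lambda>z. s z * t z)"
    using s(1)
  proof induction
    case (monomial c k)
    show ?case by (rule mono[OF t(1)])
  next
    case (add f g)
    then show ?case
      by (auto intro: trig_on_circle_cong[OF trig_on_circle_add] simp: ring_distribs)
  qed
  then show ?thesis by (rule trig_on_circle_cong) (simp add: s t)
qed

lemma trig_on_circle_Re: "trig_on_circle (\<lambda>z. of_real (Re z))"
  and trig_on_circle_Im: "trig_on_circle (\<lambda>z. of_real (Im z))"
proof -
  have cnj: "z powi (- 1) = cnj z" if "z \<in> sphere 0 1" for z
    using that divide_conv_cnj[of z 1] by (simp add: power_int_minus inverse_eq_divide)
  have eq: "complex_of_real (Re z) = 1/2 * z powi 1 + 1/2 * z powi (- 1)"
    "complex_of_real (Im z) = - \<i> / 2 * z powi 1 + \<i> / 2 * z powi (- 1)" if "z \<in> sphere 0 1" for z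
    unfolding cnj[OF that] power_int_1_right by (simp_all add: complex_eq_iff)
  show "trig_on_circle (\<lambda>z. of_real (Re z))"
    by (rule trig_on_circle_cong[OF trig_on_circle_add[OF trig_on_circle_monomial trig_on_circle_monomial] eq(1)])
  show "trig_on_circle (\<lambda>z. of_real (Im z))"
    by (rule trig_on_circle_cong[OF trig_on_circle_add[OF trig_on_circle_monomial trig_on_circle_monomial] eq(2)])
qed

lemma trig_on_circle_real_polynomial:
  "real_polynomial_function (p :: complex \<Rightarrow> real) \<Longrightarrow> trig_on_circle (\<lambda>z. of_real (p z))"
proof (induction rule: real_polynomial_function.induct)
  case (linear f)
  have eq: "f z = Re z * f 1 + Im z * f \<i>" for z
  proof -
    have "z = Re z *\<^sub>R 1 + Im z *\<^sub>R \<i>" by (simp add: complex_eq_iff)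
    then have "f z = f (Re z *\<^sub>R 1 + Im z *\<^sub>R \<i>)" by (rule arg_cong)
    also have "\<dots> = Re z * f 1 + Im z * f \<i>"
      using bounded_linear.linear[OF linear] by (simp only: linear_add linear_scale real_scaleR_def)
    finally show ?thesis .
  qed
  have c: "complex_of_real (f z) = of_real (Re z) * of_real (f 1) + of_real (Im z) * of_real (f \<i>)" for z
    by (subst eq) (simp only: of_real_add of_real_mult)
  have "trig_on_circle (\<lambda>z. of_real (Re z) * of_real (f 1) + of_real (Im z) * of_real (f \<i>))"
    by (intro trig_on_circle_add trig_on_circle_mult trig_on_circle_Re trig_on_circle_Im trig_on_circle_const)
  then show ?case by (rule trig_on_circle_cong) (rule c)
next
  case (const c)
  show ?case by (rule trig_on_circle_const)
next
  case (add f g)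
  then show ?case unfolding of_real_add by (intro trig_on_circle_add)
next
  case (mult f g)
  then show ?case unfolding of_real_mult by (intro trig_on_circle_mult)
qed

text \<open>Stone-Weierstrass provides a polynomial in Re z and Im z; on the circle these two are
  Laurent polynomials, and the sums and products that build the polynomial stay in that
  class.\<close>

lemma trig_approximation:
  assumes "continuous_on (sphere 0 1) q" "0 < e"
  shows "\<exists>t. trig t \<and> (\<forall>z\<in>sphere 0 1. cmod (q z - t z) < e)"
proof -
  obtain g :: "complex \<Rightarrow> complex" where g: "polynomial_function g" "\<And>z. z \<in> sphere 0 1 \<Longrightarrow> cmod (q z - g z) < e"
    using Stone_Weierstrass_polynomial_function[OF compact_sphere assms] by blast
  have "real_polynomial_function (\<lambda>z. Re (g z))" "real_polynomial_function (\<lambda>z. Im (g z))"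
    using g(1) bounded_linear_Re bounded_linear_Im unfolding polynomial_function_def o_def by blast+
  then have "trig_on_circle (\<lambda>z. of_real (Re (g z)) + \<i> * of_real (Im (g z)))"
    by (intro trig_on_circle_add trig_on_circle_mult trig_on_circle_const trig_on_circle_real_polynomial)
  then have "trig_on_circle g" by (simp add: complex_eq[symmetric])
  then show ?thesis using g(2) by (auto simp: trig_on_circle_def)
qed

lemma cis_measurable: "cis \<in> borel_measurable borel"
  by (intro borel_measurable_continuous_onI continuous_on_cis continuous_on_id)

lemma trig_measurable:
  assumes "trig t"
  shows "(\<lambda>\<theta>. t (cis \<theta>)) \<in> borel_measurable borel"
  using assms
proof induction
  case (monomial c k)
  show ?case unfolding cis_power_int
    by (intro borel_measurable_continuous_onI continuous_intros)
next
  case (add f g)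
  from borel_measurable_add[OF add.IH] show ?case .
qed

lemma periodic_cis_eq:
  fixes p :: "real \<Rightarrow> 'a"
  assumes "\<And>x. p (x + 2 * pi) = p x" and "cis a = cis b"
  shows "p a = p b"
proof -
  have nat: "p (x + 2 * pi * real n) = p x" for x n
  proof (induction n)
    case (Suc n)
    have "p (x + 2 * pi * real (Suc n)) = p ((x + 2 * pi * real n) + 2 * pi)"
      by (simp add: algebra_simps)
    then show ?case using assms(1) Suc by simp
  qed simp
  obtain n :: int where n: "a = b + 2 * pi * n"
    using assms(2) sin_cos_eq_iff[of a b] by (auto simp: complex_eq_iff mult_ac)
  show ?thesis
  proof (cases "n \<ge> 0")
    case True
    then show ?thesis using nat[of b "nat n"] n by simp
  next
    case False
    then show ?thesis using nat[of a "nat (- n)"] n by simp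
  qed
qed

lemma cis_Arg2pi: "z \<in> sphere 0 1 \<Longrightarrow> cis (Arg2pi z) = z"
  using complex_norm_eq_1_exp[of z] by (simp add: cis_conv_exp)

lemma Arg2pi_cis: "0 \<le> x \<Longrightarrow> x < 2 * pi \<Longrightarrow> Arg2pi (cis x) = x"
  by (rule Arg2pi_unique[of 1]) (auto simp: cis_conv_exp)

text \<open>A periodic function is a function on the circle, z |-> p (Arg2pi z); once this is known
  to be continuous, approximation on the circle applies.\<close>

lemma periodic_trig_approximation:
  fixes p :: "real \<Rightarrow> complex"
  assumes p: "continuous_on UNIV p" "\<And>x. p (x + 2 * pi) = p x" and "0 < e"
  shows "\<exists>t. trig t \<and> (\<forall>x. cmod (p x - t (cis x)) < e)"
proof -
  have pA: "isCont (\<lambda>z. p (Arg2pi z + c)) z" if "z \<notin> \<real>\<^sub>\<ge>\<^sub>0" for z c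
  proof -
    have "isCont p y" for y
      using p(1) by (simp add: continuous_on_eq_continuous_at)
    then show ?thesis
      using continuous_at_Arg2pi[OF that] isCont_o2[of z "\<lambda>z. Arg2pi z + c" p] by (auto intro: continuous_intros)
  qed
  have "continuous_on (sphere 0 1) (\<lambda>z. p (Arg2pi z))"
  proof -
    have 1: "continuous_on (sphere 0 1 \<inter> - \<real>\<^sub>\<ge>\<^sub>0) (\<lambda>z. p (Arg2pi z))"
      using pA[of _ 0] by (intro continuous_at_imp_continuous_on) auto
    \<comment> \<open>\<open>Arg2pi\<close> jumps on the positive axis. The argument of - z, shifted
      by pi, is a second chart that is continuous there, and periodicity makes the two descriptions
      of p agree.\<close>
    have shift: "p (Arg2pi z) = p (Arg2pi (- z) + pi)" if "z \<in> sphere 0 1" for z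
      by (rule periodic_cis_eq[of p, OF p(2)])
        (use that in \<open>simp add: cis_Arg2pi cis_mult[of "Arg2pi (- z)" pi, symmetric]\<close>)
    have "isCont (\<lambda>z. p (Arg2pi (- z) + pi)) z" if "- z \<notin> \<real>\<^sub>\<ge>\<^sub>0" for z
      using pA[OF that, of pi] isCont_o2[where f = uminus and g = "\<lambda>z. p (Arg2pi z + pi)" and a = z] by simp
    then have "continuous_on (sphere 0 1 \<inter> - \<real>\<^sub>\<le>\<^sub>0) (\<lambda>z. p (Arg2pi (- z) + pi))"
      by (intro continuous_at_imp_continuous_on) (auto simp: complex_nonneg_Reals_iff complex_nonpos_Reals_iff)
    then have 2: "continuous_on (sphere 0 1 \<inter> - \<real>\<^sub>\<le>\<^sub>0) (\<lambda>z. p (Arg2pi z))"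
      by (rule continuous_on_eq) (simp add: shift)
    have un: "sphere 0 1 \<inter> - \<real>\<^sub>\<ge>\<^sub>0 \<union> sphere 0 1 \<inter> - \<real>\<^sub>\<le>\<^sub>0 = sphere (0::complex) 1"
      by (auto simp: complex_nonneg_Reals_iff complex_nonpos_Reals_iff cmod_def)
    have "continuous_on (sphere 0 1 \<inter> - \<real>\<^sub>\<ge>\<^sub>0 \<union> sphere 0 1 \<inter> - \<real>\<^sub>\<le>\<^sub>0)
        (\<lambda>z. if True then p (Arg2pi z) else p (Arg2pi z))"
      by (rule continuous_on_cases_local_open[OF _ _ 1 2]) (simp_all add: un openin_open_Int open_Compl)
    then show ?thesis by (simp add: un)
  qed
  from trig_approximation[OF this \<open>0 < e\<close>]
  obtain t where t: "trig t" "\<And>z. z \<in> sphere 0 1 \<Longrightarrow> cmod (p (Arg2pi z) - t z) < e" by auto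
  have "p (Arg2pi (cis x)) = p x" for x
    by (rule periodic_cis_eq[of p, OF p(2)]) (simp add: cis_Arg2pi)
  then show ?thesis using t(1) t(2)[of "cis x" for x] by (intro exI[of _ t]) simp
qed

section \<open>Completeness of the trigonometric system\<close>

text \<open>The positive and the negative part of f are densities of two finite measures with the
  same distribution function; such measures coincide, and so do their densities.\<close>

lemma AE_zero_of_cumulative_integral_real:
  fixes f :: "real \<Rightarrow> real"
  assumes f: "integrable lborel f" and z: "\<And>t. (LINT x|lborel. indicator {..t} x * f x) = 0"
  shows "AE x in lborel. f x = 0"
proof -
  define P where "P = density lborel (\<lambda>x. ennreal (f x))"
  define N where "N = density lborel (\<lambda>x. ennreal (- f x))"
  have [measurable]: "f \<in> borel_measurable borel" using f by auto
  have fin: "integral\<^sup>N lborel (\<lambda>x. ennreal (f x)) < \<infinity>" "integral\<^sup>N lborel (\<lambda>x. ennreal (- f x)) < \<infinity>"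
  proof -
    have "(\<integral>\<^sup>+x. ennreal (norm (f x)) \<partial>lborel) < \<infinity>" using f by (simp add: integrable_iff_bounded)
    then show "integral\<^sup>N lborel (\<lambda>x. ennreal (f x)) < \<infinity>" "integral\<^sup>N lborel (\<lambda>x. ennreal (- f x)) < \<infinity>"
      by (rule le_less_trans[rotated]; auto intro!: nn_integral_mono ennreal_leI)+
  qed
  have eP: "emeasure P A = (\<integral>\<^sup>+x. ennreal (indicator A x * f x) \<partial>lborel)"
    and eN: "emeasure N A = (\<integral>\<^sup>+x. ennreal (- (indicator A x * f x)) \<partial>lborel)" if "A \<in> sets borel" for A
    using that unfolding P_def N_def
    by (auto simp: emeasure_density intro!: nn_integral_cong split: split_indicator)
  have "measure P {..t} = measure N {..t}" for t
  proof -
    let ?g = "\<lambda>x. indicator {..t} x * f x"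
    have g: "integrable lborel ?g" 
      using integrable_real_mult_indicator[of "{..t}" lborel f] f by (simp add: mult.commute)
    show ?thesis
      using real_lebesgue_integral_def[OF g] z[of t] by (simp add: eP eN measure_def)
  qed
  then have "cdf P = cdf N" by (simp add: cdf_def fun_eq_iff)
  moreover have "finite_borel_measure P" "finite_borel_measure N"
    using fin by (auto intro!: finite_borel_measure.intro finite_measureI
        simp: finite_borel_measure_axioms_def P_def N_def emeasure_density)
  ultimately have "P = N" by (intro cdf_unique')
  then have "AE x in lborel. ennreal (f x) = ennreal (- f x)"
    using finite_density_unique[of "\<lambda>x. ennreal (f x)" lborel "\<lambda>x. ennreal (- f x)"] fin(1)
    by (auto simp: P_def N_def)
  then show ?thesis
    by eventually_elim (metis ennreal_eq_0_iff ennreal_neg linorder_le_cases neg_0_le_iff_le neg_le_0_iff_le order_antisym)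
qed

lemma AE_zero_of_cumulative_integral:
  fixes f :: "real \<Rightarrow> complex"
  assumes f: "integrable lborel f" and z: "\<And>t. (LINT x|lborel. indicator {..t} x * f x) = 0"
  shows "AE x in lborel. f x = 0"
proof -
  have i: "integrable lborel (\<lambda>x. indicator {..t} x * f x)" for t
  proof -
    have "integrable lborel (\<lambda>x. indicator {..t} x *\<^sub>R f x)"
      using f by (intro integrable_mult_indicator) auto
    moreover have "(\<lambda>x. indicator {..t} x *\<^sub>R f x) = (\<lambda>x. indicator {..t} x * f x)"
      by (auto simp: fun_eq_iff split: split_indicator)
    ultimately show ?thesis by simp
  qed
  have "(LINT x|lborel. indicator {..t} x * Re (f x)) = Re (LINT x|lborel. indicator {..t} x * f x)"
    "(LINT x|lborel. indicator {..t} x * Im (f x)) = Im (LINT x|lborel. indicator {..t} x * f x)" for t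
    using i[of t] by (auto simp flip: integral_Re integral_Im intro!: Bochner_Integration.integral_cong split: split_indicator)
  then have "AE x in lborel. Re (f x) = 0" "AE x in lborel. Im (f x) = 0"
    using f z by (auto intro!: AE_zero_of_cumulative_integral_real)
  then show ?thesis by eventually_elim (simp add: complex_eq_iff)
qed

text \<open>The class of functions annihilated by F grows in stages: trigonometric polynomials,
  continuous functions by uniform approximation, indicators of closed sets by dominated convergence.
  Closed arcs starting at 1 are enough to make the cumulative integral of F vanish.\<close>

lemma trigonometric_system_total:
  fixes F :: "real \<Rightarrow> complex"
  assumes F: "integrable lborel F" and supp: "\<And>\<theta>. \<theta> \<notin> {0..2 * pi} \<Longrightarrow> F \<theta> = 0"
    and z: "\<And>k::int. (LINT \<theta>|lborel. F \<theta> * cis (of_int k * \<theta>)) = 0"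
  shows "AE \<theta> in lborel. F \<theta> = 0"
proof -
  have [measurable]: "F \<in> borel_measurable borel" using F by auto
  have bmult: "integrable lborel (\<lambda>\<theta>. F \<theta> * b \<theta>)"
    if [measurable]: "b \<in> borel_measurable borel" and "\<And>\<theta>. cmod (b \<theta>) \<le> B" for b B
  proof (rule Bochner_Integration.integrable_bound)
    show "integrable lborel (\<lambda>\<theta>. B * cmod (F \<theta>))" using F by auto
    show "AE \<theta> in lborel. norm (F \<theta> * b \<theta>) \<le> norm (B * cmod (F \<theta>))"
    proof (rule AE_I2)
      fix \<theta>
      have "0 \<le> B" using order_trans[OF norm_ge_zero that(2)] .
      then show "norm (F \<theta> * b \<theta>) \<le> norm (B * cmod (F \<theta>))"
        using mult_left_mono[OF that(2) norm_ge_zero[of "F \<theta>"]] by (simp add: norm_mult mult.commute)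
    qed
  qed simp
  have trig: "integrable lborel (\<lambda>\<theta>. F \<theta> * t (cis \<theta>)) \<and> (LINT \<theta>|lborel. F \<theta> * t (cis \<theta>)) = 0" if "trig t" for t
    using that
  proof induction
    case (monomial c k)
    have "integrable lborel (\<lambda>\<theta>. F \<theta> * cis (of_int k * \<theta>))"
      by (rule bmult[of _ 1]) (auto intro!: borel_measurable_continuous_onI continuous_intros)
    moreover have "(\<lambda>\<theta>. F \<theta> * (c * cis \<theta> powi k)) = (\<lambda>\<theta>. c * (F \<theta> * cis (of_int k * \<theta>)))"
      by (simp only: cis_power_int mult_ac)
    ultimately show ?case using z[of k] by (simp only:) simp
  next
    case (add f g)
    then show ?case by (simp add: ring_distribs)
  qed
  have cont: "(LINT \<theta>|lborel. F \<theta> * q (cis \<theta>)) = 0"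
    if q: "continuous_on UNIV q" for q
  proof -
    have [measurable]: "(\<lambda>\<theta>. q (cis \<theta>)) \<in> borel_measurable borel"
      by (intro borel_measurable_continuous_onI continuous_on_compose2[OF q] continuous_intros) auto
    have "cmod (LINT \<theta>|lborel. F \<theta> * q (cis \<theta>)) \<le> e * (LINT \<theta>|lborel. cmod (F \<theta>))" if "0 < e" for e
    proof -
      obtain t where t: "trig t" "\<And>z. z \<in> sphere 0 1 \<Longrightarrow> cmod (q z - t z) < e"
        using trig_approximation[OF continuous_on_subset[OF q] \<open>0 < e\<close>] by auto
      have [measurable]: "(\<lambda>\<theta>. t (cis \<theta>)) \<in> borel_measurable borel" by (rule trig_measurable[OF t(1)])
      have te: "cmod (q (cis \<theta>) - t (cis \<theta>)) \<le> e" for \<theta> using t(2)[of "cis \<theta>"] by simp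
      have "integrable lborel (\<lambda>\<theta>. F \<theta> * (q (cis \<theta>) - t (cis \<theta>)))"
        by (rule bmult[OF _ te]) measurable
      note d = this
      have "(LINT \<theta>|lborel. F \<theta> * q (cis \<theta>)) = (LINT \<theta>|lborel. F \<theta> * (q (cis \<theta>) - t (cis \<theta>)) + F \<theta> * t (cis \<theta>))"
        by (simp add: algebra_simps)
      also have "\<dots> = (LINT \<theta>|lborel. F \<theta> * (q (cis \<theta>) - t (cis \<theta>)))"
        using trig[OF t(1)] d by simp
      also have "cmod \<dots> \<le> (LINT \<theta>|lborel. cmod (F \<theta> * (q (cis \<theta>) - t (cis \<theta>))))"
        by (rule integral_norm_bound)
      also have "\<dots> \<le> (LINT \<theta>|lborel. e * cmod (F \<theta>))"
      proof (rule integral_mono)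
        show "integrable lborel (\<lambda>\<theta>. cmod (F \<theta> * (q (cis \<theta>) - t (cis \<theta>))))" using d by (rule integrable_norm)
        show "integrable lborel (\<lambda>\<theta>. e * cmod (F \<theta>))" using F by simp
        show "cmod (F \<theta> * (q (cis \<theta>) - t (cis \<theta>))) \<le> e * cmod (F \<theta>)" for \<theta>
          using mult_right_mono[OF te norm_ge_zero[of "F \<theta>"]] by (simp add: norm_mult mult.commute)
      qed
      finally show ?thesis by simp
    qed
    note le = this
    have "cmod (LINT \<theta>|lborel. F \<theta> * q (cis \<theta>)) \<le> 0 + e" if "0 < e" for e
    proof -
      define I where "I = (LINT \<theta>|lborel. cmod (F \<theta>))"
      have "0 \<le> I" unfolding I_def by simp
      then have "e / (I + 1) * I \<le> e" using \<open>0 < e\<close> by (simp add: field_simps)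
      then show ?thesis using le[of "e / (I + 1)"] \<open>0 < e\<close> \<open>0 \<le> I\<close> unfolding I_def by simp
    qed
    from field_le_epsilon[OF this] show ?thesis by simp
  qed
  have closed: "(LINT \<theta>|lborel. F \<theta> * indicator C (cis \<theta>)) = 0" if C: "closed C" "C \<noteq> {}" for C
  proof -
    \<comment> \<open>Continuous functions decreasing to the indicator of C; closedness makes the
      distance positive outside C.\<close>
    define q where "q n z = complex_of_real (max 0 (1 - real n * infdist z C))" for n z
    have qc: "continuous_on UNIV (q n)" for n
      unfolding q_def by (intro continuous_intros)
    have "(\<lambda>n. LINT \<theta>|lborel. F \<theta> * q n (cis \<theta>)) \<longlonglongrightarrow> (LINT \<theta>|lborel. F \<theta> * indicator C (cis \<theta>))"
    proof (rule integral_dominated_convergence)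
      show "integrable lborel (\<lambda>\<theta>. cmod (F \<theta>))" using F by simp
      show m: "(\<lambda>\<theta>. F \<theta> * q n (cis \<theta>)) \<in> borel_measurable lborel" for n
      proof -
        have "(\<lambda>\<theta>. q n (cis \<theta>)) \<in> borel_measurable borel"
          by (intro borel_measurable_continuous_onI continuous_on_compose2[OF qc] continuous_intros) auto
        then show ?thesis by simp
      qed
      show lim: "AE \<theta> in lborel. (\<lambda>n. F \<theta> * q n (cis \<theta>)) \<longlonglongrightarrow> F \<theta> * indicator C (cis \<theta>)"
      proof (rule AE_I2)
        fix \<theta>
        have "(\<lambda>n. q n w) \<longlonglongrightarrow> indicator C w" for w
        proof (cases "w \<in> C")
          case True
          then show ?thesis by (simp add: q_def infdist_zero)
        next
          case False
          then have "0 < infdist w C" using C by (metis in_closed_iff_infdist_zero infdist_nonneg order_le_less)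
          then obtain N where N: "1 < real N * infdist w C" using ex_less_of_nat_mult by blast
          have "q n w = 0" if "n \<ge> N" for n
          proof -
            have "real N * infdist w C \<le> real n * infdist w C" using that by (intro mult_right_mono infdist_nonneg) auto
            then show ?thesis using N by (simp add: q_def)
          qed
          then show ?thesis using False by (auto intro!: tendsto_eventually eventually_sequentiallyI)
        qed
        then show "(\<lambda>n. F \<theta> * q n (cis \<theta>)) \<longlonglongrightarrow> F \<theta> * indicator C (cis \<theta>)" by (intro tendsto_intros)
      qed
      have "C \<in> sets borel" using C by simp
      then have "(\<lambda>\<theta>. indicator C (cis \<theta>) :: complex) \<in> borel_measurable borel"
        by (rule measurable_compose[OF cis_measurable borel_measurable_indicator])
      then show "(\<lambda>\<theta>. F \<theta> * indicator C (cis \<theta>)) \<in> borel_measurable lborel" by simp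
      have "cmod (q n w) \<le> 1" for n w
        using infdist_nonneg[of w C] by (simp add: q_def)
      then show "AE \<theta> in lborel. norm (F \<theta> * q n (cis \<theta>)) \<le> cmod (F \<theta>)" for n
        by (intro AE_I2) (simp add: norm_mult mult_left_le)
    qed
    then show ?thesis using cont[OF qc] by (simp add: LIMSEQ_const_iff)
  qed
  \<comment> \<open>\<open>cis\<close> takes the endpoint 2 pi to the same point as 0, which lies in
    every arc; that single value of \<theta> is discarded.\<close>
  have ne: "AE \<theta> in lborel. \<theta> \<noteq> 2 * pi" by (rule AE_lborel_singleton)
  have "(LINT \<theta>|lborel. indicator {..t} \<theta> * F \<theta>) = 0" for t
  proof (cases "t < 0")
    case True
    then have "(\<lambda>\<theta>. indicator {..t} \<theta> * F \<theta>) = (\<lambda>_. 0)" using supp by (auto simp: indicator_def fun_eq_iff)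
    then show ?thesis by simp
  next
    case False
    define s where "s = min t (2 * pi)"
    have "0 \<le> s" using False by (simp add: s_def)
    have "(LINT \<theta>|lborel. indicator {..t} \<theta> * F \<theta>) = (LINT \<theta>|lborel. F \<theta> * indicator (cis ` {0..s}) (cis \<theta>))"
    proof (rule integral_cong_AE)
      have "cis ` {0..s} \<in> sets borel"
        by (intro borel_closed compact_imp_closed compact_continuous_image continuous_intros compact_Icc)
      then have "(\<lambda>\<theta>. indicator (cis ` {0..s}) (cis \<theta>) :: complex) \<in> borel_measurable borel"
        by (rule measurable_compose[OF cis_measurable borel_measurable_indicator])
      then show "(\<lambda>\<theta>. F \<theta> * indicator (cis ` {0..s}) (cis \<theta>)) \<in> borel_measurable lborel" by simp
      show "AE \<theta> in lborel. indicator {..t} \<theta> * F \<theta> = F \<theta> * indicator (cis ` {0..s}) (cis \<theta>)"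
        using ne
      proof eventually_elim
        case (elim \<theta>)
        show ?case
        proof (cases "\<theta> \<in> {0..<2 * pi}")
          case True
          have "cis \<theta> \<in> cis ` {0..s} \<longleftrightarrow> \<theta> \<le> t"
          proof
            assume "cis \<theta> \<in> cis ` {0..s}"
            then obtain u where u: "0 \<le> u" "u \<le> s" "cis \<theta> = cis u" by auto
            show "\<theta> \<le> t"
            proof (cases "u = 2 * pi")
              case True
              then show ?thesis using u \<open>\<theta> \<in> _\<close> by (auto simp: s_def)
            next
              case False
              then have "u < 2 * pi" using u by (auto simp: s_def)
              have "\<theta> = Arg2pi (cis \<theta>)"
                by (rule Arg2pi_cis[symmetric]) (use \<open>\<theta> \<in> _\<close> in auto)
              also have "\<dots> = u"
                unfolding u(3) by (rule Arg2pi_cis) (fact u(1) \<open>u < 2 * pi\<close>)+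
              finally have "\<theta> = u" .
              then show ?thesis using u by (auto simp: s_def)
            qed
          qed (use True in \<open>auto simp: s_def\<close>)
          then show ?thesis by (auto simp: indicator_def)
        next
          case False
          then show ?thesis using elim supp[of \<theta>] by (cases "\<theta> \<in> {0..2 * pi}") auto
        qed
      qed
    qed simp
    also have "\<dots> = 0"
      using \<open>0 \<le> s\<close>
      by (intro closed compact_imp_closed compact_continuous_image continuous_intros compact_Icc) auto
    finally show ?thesis .
  qed
  then show ?thesis using F by (intro AE_zero_of_cumulative_integral)
qed


section \<open>Orthonormal families\<close>

lemma l2_eqI: "(\<And>i. Rep_l2 u i = Rep_l2 v i) \<Longrightarrow> u = v"
  using Rep_l2_inject[of u v] by (simp add: fun_eq_iff)

lemma Abs_l2_scale: "Abs_l2 (\<lambda>i. c * Rep_l2 u i) = c *\<^sub>C u"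
  unfolding scaleC_l2.rep_eq[symmetric] by (rule Rep_l2_inverse)

definition analysis :: "('i \<Rightarrow> 'h::complex_inner) \<Rightarrow> 'h \<Rightarrow> 'i l2" where
  "analysis e x = Abs_l2 (\<lambda>k. cinner x (e k))"

locale orthonormal =
  fixes e :: "'i \<Rightarrow> 'h::{complex_inner,banach}"
  assumes orth: "\<And>k l. cinner (e k) (e l) = (if k = l then 1 else 0)"
begin

lemma bessel:
  assumes "finite F"
  shows "(\<Sum>k\<in>F. (cmod (cinner x (e k)))\<^sup>2) \<le> (norm x)\<^sup>2"
proof -
  define c where "c k = cinner x (e k)" for k
  define s where "s = (\<Sum>k\<in>F. c k *\<^sub>C e k)"
  define N where "N = (\<Sum>k\<in>F. (cmod (c k))\<^sup>2)"
  have N: "complex_of_real N = (\<Sum>k\<in>F. c k * cnj (c k))"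
    unfolding N_def of_real_sum by (intro sum.cong refl complex_norm_square)
  have es: "cinner (e l) s = cnj (c l)" if "l \<in> F" for l
  proof -
    have "cinner (e l) s = (\<Sum>k\<in>F. if l = k then cnj (c k) else 0)"
      unfolding s_def cinner_sum_right cinner_scaleC_right orth by (intro sum.cong) auto
    then show ?thesis using that assms by (simp add: sum.delta')
  qed
  have ss: "cinner s s = of_real N"
  proof -
    have "cinner s s = (\<Sum>k\<in>F. c k * cinner (e k) s)"
      by (subst s_def) (simp add: cinner_sum_left cinner_scaleC_left)
    also have "\<dots> = (\<Sum>k\<in>F. c k * cnj (c k))" by (intro sum.cong refl) (simp add: es)
    finally show ?thesis by (simp add: N)
  qed
  have xs: "cinner x s = of_real N"
    unfolding s_def cinner_sum_right cinner_scaleC_right N c_def[symmetric] by (simp add: mult.commute)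
  have sx: "cinner s x = of_real N"
    by (subst cinner_commute) (simp add: xs)
  have "(norm (x - s))\<^sup>2 = (norm x)\<^sup>2 - N"
    unfolding norm_eq_cinner by (simp add: cinner_diff_left cinner_diff_right xs sx ss)
  then show ?thesis using zero_le_power2[of "norm (x - s)"] unfolding N_def c_def by linarith
qed

lemma Rep_analysis: "Rep_l2 (analysis e x) k = cinner x (e k)"
  unfolding analysis_def
  by (subst Abs_l2_inverse) (use l2_norm_leI(1)[OF norm_ge_zero bessel] in auto)

lemma norm_analysis_le: "norm (analysis e x) \<le> norm x"
  unfolding analysis_def by (rule l2_norm_leI(2)[OF norm_ge_zero bessel])

lemma analysis_add: "analysis e (x + y) = analysis e x + analysis e y"
  by (rule l2_eqI) (simp add: Rep_analysis plus_l2.rep_eq cinner_add_left)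

lemma analysis_diff: "analysis e (x - y) = analysis e x - analysis e y"
  by (rule l2_eqI) (simp add: Rep_analysis minus_l2.rep_eq cinner_diff_left)

lemma analysis_scale: "analysis e (c *\<^sub>C x) = c *\<^sub>C analysis e x"
  by (rule l2_eqI) (simp add: Rep_analysis scaleC_l2.rep_eq cinner_scaleC_left)

text \<open>The adjoint of \<open>analysis\<close>, obtained from Riesz rather than by summing a
  series of basis vectors.\<close>

lemma synthesis: "\<exists>y. \<forall>x. cinner x y = cinner (analysis e x) u"
proof -
  have "\<exists>y. \<forall>x. cinner (analysis e x) u = cinner x y"
  proof (rule riesz_complex)
    show "bounded_linear (\<lambda>x. cinner (analysis e x) u)"
    proof (rule bounded_linear_intro[of _ "norm u"])
      show "cinner (analysis e (r *\<^sub>R x)) u = r *\<^sub>R cinner (analysis e x) u" for r x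
        using analysis_scale[of "of_real r" x]
        by (simp add: scaleC_of_real[symmetric] cinner_scaleC_left scaleR_conv_of_real)
      show "norm (cinner (analysis e x) u) \<le> norm x * norm u" for x
        using cinner_cauchy_schwarz[of "analysis e x" u] mult_right_mono[OF norm_analysis_le[of x], of "norm u"]
        by simp
    qed (simp add: analysis_add cinner_add_left)
  qed (simp add: analysis_scale cinner_scaleC_left)
  then show ?thesis by (auto simp: eq_commute)
qed

text \<open>Testing against basis vectors: the coefficients of \<open>e m\<close> form the m-th unit
  vector, so the adjoint of \<open>analysis\<close> is a right inverse of it.\<close>

lemma analysis_synthesis:
  assumes "\<And>x. cinner x y = cinner (analysis e x) u"
  shows "analysis e y = u"
proof (rule l2_eqI)
  fix m
  have "cinner (analysis e (e m)) u = (\<Sum>\<^sub>\<infinity>k\<in>{m}. cnj (Rep_l2 u k))"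
    unfolding cinner_l2.rep_eq by (rule infsum_cong_neutral) (auto simp: Rep_analysis orth)
  then have "cinner (e m) y = cnj (Rep_l2 u m)" by (simp add: assms)
  then show "Rep_l2 (analysis e y) m = Rep_l2 u m"
    by (subst Rep_analysis, subst cinner_commute) simp
qed

end

section \<open>The discrete Fourier transform\<close>

abbreviation arc :: "real \<Rightarrow> complex" where
  "arc \<equiv> indicator {0..2 * pi}"

lemma cis_int_2pi: "cis (of_int m * (2 * pi)) = 1"
  by (simp add: complex_eq_iff sin_int_2pin[of m, simplified mult_ac] cos_int_2pin[of m, simplified mult_ac] mult_ac)

lemma integral_cis:
  "(LINT \<theta>|lborel. indicator {0..2 * pi} \<theta> *\<^sub>R cis (of_int m * \<theta>)) = (if m = 0 then 2 * pi else 0)"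
proof (cases "m = 0")
  case True
  have "(LINT \<theta>|lborel. indicator {0..2 * pi} \<theta> *\<^sub>R (1::complex)) = of_real (2 * pi)"
    by (subst integral_scaleR_left) (auto simp: scaleR_conv_of_real)
  then show ?thesis using True by simp
next
  case False
  define G where "G = (\<lambda>\<theta> :: real. cis (of_int m * \<theta>) / (\<i> * of_int m))"
  have "(LINT \<theta>|lborel. indicator {0..2 * pi} \<theta> *\<^sub>R cis (of_int m * \<theta>)) = G (2 * pi) - G 0"
  proof (rule integral_FTC_Icc)
    fix \<theta> :: real
    have "((\<lambda>x. cis (of_int m * x)) has_vector_derivative of_int m *\<^sub>R (\<i> * cis (of_int m * \<theta>))) (at \<theta> within {0..2 * pi})"
      unfolding has_vector_derivative_def
      by (rule has_derivative_eq_rhs, rule has_derivative_cis, rule has_derivative_mult_right, rule has_derivative_ident)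
        (auto simp: fun_eq_iff)
    from has_vector_derivative_divide[OF this, of "\<i> * of_int m"]
    show "(G has_vector_derivative cis (of_int m * \<theta>)) (at \<theta> within {0..2 * pi})"
      using False by (simp add: G_def scaleR_conv_of_real)
  qed (auto intro!: continuous_intros)
  also have "\<dots> = 0" by (simp add: G_def cis_int_2pi)
  finally show ?thesis using False by simp
qed

lemma square_integrable_arc: "square_integrable arc"
proof -
  have "(\<lambda>x. (cmod (arc x))\<^sup>2) = indicator {0..2 * pi}" by (auto simp: fun_eq_iff indicator_def)
  then show ?thesis unfolding square_integrable_def by simp
qed

lemma cis_mult_measurable: "(\<lambda>\<theta>. cis (c * \<theta>)) \<in> borel_measurable borel"
  by (intro borel_measurable_continuous_onI continuous_intros)

text \<open>L2 of the circle is modelled inside L2(R), as the functions supported on [0, 2 pi]; the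
  root of 2 pi normalises with respect to d\<theta>.\<close>

definition fourier_basis :: "int \<Rightarrow> L2R" where
  "fourier_basis k = abs_L2R (\<lambda>\<theta>. cis (of_int k * \<theta>) / of_real (sqrt (2 * pi)) * arc \<theta>)"

lemma square_integrable_fourier_basis:
  "square_integrable (\<lambda>\<theta>. cis (of_int k * \<theta>) / of_real (sqrt (2 * pi)) * arc \<theta>)"
  by (rule square_integrable_bounded_mult[OF _ _ square_integrable_arc])
    (auto simp: bounded_iff norm_divide cis_mult_measurable intro!: borel_measurable_divide)

lemma cinner_fourier_basis:
  assumes "square_integrable f"
  shows "cinner (abs_L2R f) (fourier_basis k) =
    of_real (1 / sqrt (2 * pi)) * (LINT \<theta>|lborel. indicator {0..2 * pi} \<theta> *\<^sub>R (f \<theta> * cis (- (of_int k * \<theta>))))"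
proof -
  have "cinner (abs_L2R f) (fourier_basis k) = (LINT \<theta>|lborel. of_real (1 / sqrt (2 * pi)) *
      (indicator {0..2 * pi} \<theta> *\<^sub>R (f \<theta> * cis (- (of_int k * \<theta>)))))"
    unfolding fourier_basis_def cinner_abs_L2R[OF assms square_integrable_fourier_basis]
    by (rule Bochner_Integration.integral_cong) (auto simp: cis_cnj split: split_indicator)
  then show ?thesis by (simp only: integral_mult_right_zero)
qed

interpretation fb: orthonormal fourier_basis
proof
  fix k l :: int
  have "cinner (fourier_basis k) (fourier_basis l) = of_real (1 / sqrt (2 * pi)) *
      (LINT \<theta>|lborel. indicator {0..2 * pi} \<theta> *\<^sub>R
        (cis (of_int k * \<theta>) / of_real (sqrt (2 * pi)) * arc \<theta> * cis (- (of_int l * \<theta>))))"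
    by (subst fourier_basis_def) (rule cinner_fourier_basis[OF square_integrable_fourier_basis])
  also have "(LINT \<theta>|lborel. indicator {0..2 * pi} \<theta> *\<^sub>R
        (cis (of_int k * \<theta>) / of_real (sqrt (2 * pi)) * arc \<theta> * cis (- (of_int l * \<theta>)))) =
      (LINT \<theta>|lborel. of_real (1 / sqrt (2 * pi)) * (indicator {0..2 * pi} \<theta> *\<^sub>R cis (of_int (k - l) * \<theta>)))"
    by (rule Bochner_Integration.integral_cong)
      (auto simp: cis_mult left_diff_distrib split: split_indicator)
  also have "\<dots> = of_real (1 / sqrt (2 * pi)) * complex_of_real (if k - l = 0 then 2 * pi else 0)"
    by (simp only: integral_mult_right_zero integral_cis)
  finally have eq: "cinner (fourier_basis k) (fourier_basis l) =
      of_real (1 / sqrt (2 * pi)) * (of_real (1 / sqrt (2 * pi)) * complex_of_real (if k - l = 0 then 2 * pi else 0))" .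
  have "1 / sqrt (2 * pi) * (1 / sqrt (2 * pi) * (2 * pi)) = 1"
    using real_sqrt_mult_self[of "2 * pi"] by (simp add: field_simps)
  then have "complex_of_real (1 / sqrt (2 * pi)) * (of_real (1 / sqrt (2 * pi)) * of_real (2 * pi)) = 1"
    unfolding of_real_mult[symmetric] by (simp only: of_real_1)
  then show "cinner (fourier_basis k) (fourier_basis l) = (if k = l then 1 else 0)"
    unfolding eq by (cases "k = l") simp_all
qed

text \<open>The orthogonal projection of L2(R) onto the functions on [0, 2 pi]; its range is where
  the basis is complete.\<close>

definition cutoff :: "L2R \<Rightarrow> L2R" where "cutoff = L2R_mult arc"

lemma cutoff_abs:
  assumes "square_integrable f"
  shows "cutoff (abs_L2R f) = abs_L2R (\<lambda>\<theta>. arc \<theta> * f \<theta>)" "square_integrable (\<lambda>\<theta>. arc \<theta> * f \<theta>)"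
proof -
  have b: "arc \<in> borel_measurable lborel" "bounded (range arc)"
    by (auto simp: bounded_iff indicator_def intro!: exI[of _ 1])
  show "cutoff (abs_L2R f) = abs_L2R (\<lambda>\<theta>. arc \<theta> * f \<theta>)"
    using b assms by (simp add: cutoff_def L2R_mult.abs_eq)
  show "square_integrable (\<lambda>\<theta>. arc \<theta> * f \<theta>)"
    by (rule square_integrable_bounded_mult[OF b assms])
qed

lemma cinner_cutoff: "cinner (cutoff x) y = cinner x (cutoff y)"
proof -
  define f g where "f = rep_L2R' x" and "g = rep_L2R' y"
  have sf: "square_integrable f" "square_integrable g" by (simp_all add: f_def g_def square_integrable_rep)
  have "cinner (cutoff (abs_L2R f)) (abs_L2R g) = cinner (abs_L2R f) (cutoff (abs_L2R g))"
    unfolding cutoff_abs(1)[OF sf(1)] cutoff_abs(1)[OF sf(2)]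
      cinner_abs_L2R[OF cutoff_abs(2)[OF sf(1)] sf(2)] cinner_abs_L2R[OF sf(1) cutoff_abs(2)[OF sf(2)]]
    by (rule Bochner_Integration.integral_cong) (auto split: split_indicator)
  then show ?thesis by (simp add: f_def g_def abs_rep_L2R)
qed

lemma cutoff_fourier_basis: "cutoff (fourier_basis k) = fourier_basis k"
  unfolding fourier_basis_def cutoff_abs(1)[OF square_integrable_fourier_basis]
  by (rule arg_cong[of _ _ abs_L2R]) (auto simp: fun_eq_iff split: split_indicator)

lemma analysis_cutoff: "analysis fourier_basis (cutoff x) = analysis fourier_basis x"
  by (rule l2_eqI) (simp add: fb.Rep_analysis cinner_cutoff cutoff_fourier_basis)

lemma fourier_basis_total:
  assumes x: "cutoff x = x" and z: "analysis fourier_basis x = 0"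
  shows "x = 0"
proof -
  define f where "f = rep_L2R' x"
  have sf: "square_integrable f" by (simp add: f_def square_integrable_rep)
  have xf: "x = abs_L2R f" by (simp add: f_def abs_rep_L2R)
  let ?F = "\<lambda>\<theta>. arc \<theta> * f \<theta>"
  have "AE \<theta> in lborel. ?F \<theta> = 0"
  proof (rule trigonometric_system_total)
    have "(\<lambda>\<theta>. f \<theta> * cnj (arc \<theta>)) = ?F" by (auto simp: fun_eq_iff split: split_indicator)
    then show "integrable lborel ?F"
      using square_integrable_product[OF sf square_integrable_arc] by simp
    show "(LINT \<theta>|lborel. ?F \<theta> * cis (of_int k * \<theta>)) = 0" for k
    proof -
      have "of_real (1 / sqrt (2 * pi)) * (LINT \<theta>|lborel. indicator {0..2 * pi} \<theta> *\<^sub>R (f \<theta> * cis (- (of_int (- k) * \<theta>)))) = 0"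
        unfolding cinner_fourier_basis[OF sf, symmetric] xf[symmetric] fb.Rep_analysis[symmetric] z
        by (simp add: zero_l2.rep_eq)
      then have "(LINT \<theta>|lborel. indicator {0..2 * pi} \<theta> *\<^sub>R (f \<theta> * cis (- (of_int (- k) * \<theta>)))) = 0"
        by simp
      moreover have "(LINT \<theta>|lborel. indicator {0..2 * pi} \<theta> *\<^sub>R (f \<theta> * cis (- (of_int (- k) * \<theta>)))) =
          (LINT \<theta>|lborel. ?F \<theta> * cis (of_int k * \<theta>))"
        by (rule Bochner_Integration.integral_cong) (auto split: split_indicator)
      ultimately show ?thesis by simp
    qed
  qed simp
  then have "abs_L2R ?F = abs_L2R (\<lambda>_. 0)"
    by (subst abs_L2R_eq_iff) (auto simp: cutoff_abs(2)[OF sf] square_integrable_def[of "\<lambda>_. 0"])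
  then have "cutoff x = 0" by (simp add: xf cutoff_abs(1)[OF sf] zero_L2R_def)
  then show ?thesis by (simp add: x)
qed

text \<open>Synthesise w from the coefficients of y. It lies in the range of \<open>cutoff\<close>
  and has the coefficients of y, so totality gives w = y, and the defining property of w is the
  identity sought.\<close>

lemma fourier_basis_parseval:
  assumes "cutoff x = x" "cutoff y = y"
  shows "cinner (analysis fourier_basis x) (analysis fourier_basis y) = cinner x y"
proof -
  obtain w where w: "\<And>z. cinner z w = cinner (analysis fourier_basis z) (analysis fourier_basis y)"
    using fb.synthesis by blast
  have "cutoff w = w"
    by (rule cinner_eqI) (simp add: cinner_cutoff[symmetric] w analysis_cutoff)
  have lin: "cutoff (y - w) = cutoff y - cutoff w"
    by (rule cinner_eqI) (simp add: cinner_cutoff[symmetric] cinner_diff_right)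
  have "y - w = 0"
    by (rule fourier_basis_total)
      (simp_all add: lin assms \<open>cutoff w = w\<close> fb.analysis_diff fb.analysis_synthesis[OF w])
  then show ?thesis using w[of x] by simp
qed

lemma fourier_basis_synthesis: "\<exists>y. cutoff y = y \<and> analysis fourier_basis y = u"
proof -
  obtain w where w: "\<And>z. cinner z w = cinner (analysis fourier_basis z) u"
    using fb.synthesis by blast
  have "cutoff w = w"
    by (rule cinner_eqI) (simp add: cinner_cutoff[symmetric] w analysis_cutoff)
  then show ?thesis using fb.analysis_synthesis[OF w] by blast
qed

definition circle_fun :: "(complex \<Rightarrow> complex) \<Rightarrow> L2R" where
  "circle_fun f = abs_L2R (\<lambda>\<theta>. indicator {0..2 * pi} \<theta> *\<^sub>R f (cis \<theta>))"

lemma circle_square_integrable_iff: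
  "circle_square_integrable f \<longleftrightarrow> square_integrable (\<lambda>\<theta>. indicator {0..2 * pi} \<theta> *\<^sub>R f (cis \<theta>))"
proof -
  have "(\<lambda>\<theta>. (cmod (indicator {0..2 * pi} \<theta> *\<^sub>R f (cis \<theta>)))\<^sup>2) =
      (\<lambda>\<theta>. indicator {0..2 * pi} \<theta> *\<^sub>R (cmod (f (cis \<theta>)))\<^sup>2)"
    by (auto simp: fun_eq_iff split: split_indicator)
  then show ?thesis
    by (simp add: circle_square_integrable_def square_integrable_def set_borel_measurable_def set_integrable_def)
qed

lemma cutoff_circle_fun:
  assumes "circle_square_integrable f"
  shows "cutoff (circle_fun f) = circle_fun f"
  unfolding circle_fun_def cutoff_abs(1)[OF assms[unfolded circle_square_integrable_iff]]
  by (rule arg_cong[of _ _ abs_L2R]) (auto simp: fun_eq_iff split: split_indicator)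

text \<open>The coefficients of z^k carry the factor 1 / (2 pi), those of the orthonormal basis only
  its square root; the quotient is left over, so \<open>discrete_fourier\<close> is a multiple of an
  isometry.\<close>

lemma discrete_fourier_eq:
  assumes "circle_square_integrable f"
  shows "discrete_fourier f = of_real (1 / sqrt (2 * pi)) *\<^sub>C analysis fourier_basis (circle_fun f)"
proof -
  have "of_real (1 / (2 * pi)) * (LINT \<theta>:{0..2 * pi}|lborel. f (cis \<theta>) * cis (- (of_int k * \<theta>))) =
      of_real (1 / sqrt (2 * pi)) * Rep_l2 (analysis fourier_basis (circle_fun f)) k" for k
  proof -
    have "Rep_l2 (analysis fourier_basis (circle_fun f)) k = of_real (1 / sqrt (2 * pi)) *
        (LINT \<theta>|lborel. indicator {0..2 * pi} \<theta> *\<^sub>R (indicator {0..2 * pi} \<theta> *\<^sub>R f (cis \<theta>) * cis (- (of_int k * \<theta>))))"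
      unfolding fb.Rep_analysis circle_fun_def
      by (rule cinner_fourier_basis[OF assms[unfolded circle_square_integrable_iff]])
    also have "(LINT \<theta>|lborel. indicator {0..2 * pi} \<theta> *\<^sub>R (indicator {0..2 * pi} \<theta> *\<^sub>R f (cis \<theta>) * cis (- (of_int k * \<theta>)))) =
        (LINT \<theta>:{0..2 * pi}|lborel. f (cis \<theta>) * cis (- (of_int k * \<theta>)))"
      unfolding set_lebesgue_integral_def
      by (rule Bochner_Integration.integral_cong) (auto split: split_indicator)
    finally have "of_real (1 / sqrt (2 * pi)) * Rep_l2 (analysis fourier_basis (circle_fun f)) k =
        of_real (1 / sqrt (2 * pi)) * of_real (1 / sqrt (2 * pi)) *
        (LINT \<theta>:{0..2 * pi}|lborel. f (cis \<theta>) * cis (- (of_int k * \<theta>)))" by simp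
    also have "complex_of_real (1 / sqrt (2 * pi)) * of_real (1 / sqrt (2 * pi)) = of_real (1 / (2 * pi))"
      unfolding of_real_mult[symmetric] by (simp add: real_sqrt_mult_self)
    finally show ?thesis by simp
  qed
  then show ?thesis unfolding discrete_fourier_def by (simp only: Abs_l2_scale)
qed

lemma Rep_discrete_fourier:
  assumes "circle_square_integrable f"
  shows "Rep_l2 (discrete_fourier f) k =
    of_real (1 / (2 * pi)) * (LINT \<theta>:{0..2 * pi}|lborel. f (cis \<theta>) * cis (- (of_int k * \<theta>)))"
proof -
  let ?g = "\<lambda>k. of_real (1 / (2 * pi)) * (LINT \<theta>:{0..2 * pi}|lborel. f (cis \<theta>) * cis (- (of_int k * \<theta>)))"
  have a: "circle_fun f = abs_L2R (\<lambda>\<theta>. indicator {0..2 * pi} \<theta> *\<^sub>R f (cis \<theta>))" by (rule circle_fun_def)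
  have "Rep_l2 (discrete_fourier f) k = of_real (1 / sqrt (2 * pi)) * (of_real (1 / sqrt (2 * pi)) *
        (LINT \<theta>|lborel. indicator {0..2 * pi} \<theta> *\<^sub>R (indicator {0..2 * pi} \<theta> *\<^sub>R f (cis \<theta>) * cis (- (of_int k * \<theta>)))))"
    unfolding discrete_fourier_eq[OF assms] scaleC_l2.rep_eq fb.Rep_analysis a
    by (subst cinner_fourier_basis[OF assms[unfolded circle_square_integrable_iff]]) (rule refl)
  also have "(LINT \<theta>|lborel. indicator {0..2 * pi} \<theta> *\<^sub>R (indicator {0..2 * pi} \<theta> *\<^sub>R f (cis \<theta>) * cis (- (of_int k * \<theta>)))) =
      (LINT \<theta>:{0..2 * pi}|lborel. f (cis \<theta>) * cis (- (of_int k * \<theta>)))"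
    unfolding set_lebesgue_integral_def
    by (rule Bochner_Integration.integral_cong) (auto split: split_indicator)
  also have "of_real (1 / sqrt (2 * pi)) * (of_real (1 / sqrt (2 * pi)) * z) = of_real (1 / (2 * pi)) * z" for z :: complex
    unfolding mult.assoc[symmetric] of_real_mult[symmetric] by (simp add: real_sqrt_mult_self)
  finally show ?thesis .
qed

lemma discrete_fourier_isometric:
  assumes "circle_square_integrable f" "circle_square_integrable g"
  shows "cinner (discrete_fourier f) (discrete_fourier g) = of_real (1 / (2 * pi)) * cinner (circle_fun f) (circle_fun g)"
proof -
  have "complex_of_real (1 / sqrt (2 * pi)) * of_real (1 / sqrt (2 * pi)) = of_real (1 / (2 * pi))"
    unfolding of_real_mult[symmetric] by (simp add: real_sqrt_mult_self)
  then show ?thesis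
    unfolding discrete_fourier_eq[OF assms(1)] discrete_fourier_eq[OF assms(2)] cinner_scaleC_left cinner_scaleC_right
    by (simp only: fourier_basis_parseval cutoff_circle_fun assms complex_cnj_complex_of_real mult.assoc[symmetric])
qed

text \<open>Injectivity up to null sets; it makes the operators Y well defined on coefficient
  sequences.\<close>

lemma discrete_fourier_eq_iff:
  assumes "circle_square_integrable f" "circle_square_integrable g"
  shows "discrete_fourier f = discrete_fourier g \<longleftrightarrow>
    (AE \<theta> in lborel. indicator {0..2 * pi} \<theta> *\<^sub>R f (cis \<theta>) = indicator {0..2 * pi} \<theta> *\<^sub>R g (cis \<theta>))"
proof -
  have "discrete_fourier f = discrete_fourier g \<longleftrightarrow>
      analysis fourier_basis (circle_fun f) = analysis fourier_basis (circle_fun g)"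
  proof
    assume "discrete_fourier f = discrete_fourier g"
    then have "of_real (sqrt (2 * pi)) *\<^sub>C of_real (1 / sqrt (2 * pi)) *\<^sub>C analysis fourier_basis (circle_fun f) =
      of_real (sqrt (2 * pi)) *\<^sub>C of_real (1 / sqrt (2 * pi)) *\<^sub>C analysis fourier_basis (circle_fun g)"
      by (simp only: discrete_fourier_eq assms)
    then show "analysis fourier_basis (circle_fun f) = analysis fourier_basis (circle_fun g)"
      by (simp add: scaleC_scaleC flip: of_real_mult)
  qed (simp only: discrete_fourier_eq assms)
  also have "\<dots> \<longleftrightarrow> circle_fun f = circle_fun g"
  proof
    assume a: "analysis fourier_basis (circle_fun f) = analysis fourier_basis (circle_fun g)"
    show "circle_fun f = circle_fun g"
    proof -
      have "cutoff (circle_fun f - circle_fun g) = cutoff (circle_fun f) - cutoff (circle_fun g)"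
        by (rule cinner_eqI) (simp add: cinner_cutoff[symmetric] cinner_diff_right)
      then have "circle_fun f - circle_fun g = 0"
        by (intro fourier_basis_total) (simp_all add: cutoff_circle_fun assms fb.analysis_diff a)
      then show ?thesis by simp
    qed
  qed simp
  also have "\<dots> \<longleftrightarrow> (AE \<theta> in lborel. indicator {0..2 * pi} \<theta> *\<^sub>R f (cis \<theta>) = indicator {0..2 * pi} \<theta> *\<^sub>R g (cis \<theta>))"
    unfolding circle_fun_def using assms by (intro abs_L2R_eq_iff) (simp_all add: circle_square_integrable_iff)
  finally show ?thesis .
qed

lemma discrete_fourier_surj: "\<exists>f. circle_square_integrable f \<and> discrete_fourier f = u"
proof -
  obtain y where y: "cutoff y = y" "analysis fourier_basis y = of_real (sqrt (2 * pi)) *\<^sub>C u"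
    using fourier_basis_synthesis by blast
  define g where "g = rep_L2R' y"
  have sg: "square_integrable g" by (simp add: g_def square_integrable_rep)
  have yg: "y = abs_L2R g" by (simp add: g_def abs_rep_L2R)
  define f where "f z = g (Arg2pi z)" for z
  let ?F = "\<lambda>\<theta>. indicator {0..2 * pi} \<theta> *\<^sub>R f (cis \<theta>)"
  \<comment> \<open>The point 1 has argument 0, so at \<theta> = 2 pi the function takes the value g
    0; elsewhere in the interval \<open>Arg2pi\<close> recovers \<theta>.\<close>
  have F: "?F = (\<lambda>\<theta>. if \<theta> = 2 * pi then g 0 else arc \<theta> * g \<theta>)"
  proof
    fix \<theta>
    have "Arg2pi 1 = 0" using Arg2pi_cis[of 0] by simp
    then show "?F \<theta> = (if \<theta> = 2 * pi then g 0 else arc \<theta> * g \<theta>)"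
      using Arg2pi_cis[of \<theta>] by (auto simp: f_def indicator_def)
  qed
  have ne: "AE \<theta> in lborel. \<theta> \<noteq> 2 * pi" by (rule AE_lborel_singleton)
  have gm: "(\<lambda>\<theta>. arc \<theta> * g \<theta>) \<in> borel_measurable lborel"
    using cutoff_abs(2)[OF sg] by (simp add: square_integrable_def)
  have Fm: "?F \<in> borel_measurable lborel"
    unfolding F using gm by (intro measurable_If) auto
  have ae: "AE \<theta> in lborel. arc \<theta> * g \<theta> = ?F \<theta>"
    using ne
  proof eventually_elim
    case (elim \<theta>)
    show ?case unfolding fun_cong[OF F] using elim by simp
  qed
  have "integrable lborel (\<lambda>\<theta>. (cmod (?F \<theta>))\<^sup>2) \<longleftrightarrow> integrable lborel (\<lambda>\<theta>. (cmod (arc \<theta> * g \<theta>))\<^sup>2)"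
  proof (rule integrable_cong_AE)
    show "AE \<theta> in lborel. (cmod (?F \<theta>))\<^sup>2 = (cmod (arc \<theta> * g \<theta>))\<^sup>2"
      using ae by eventually_elim (simp only:)
    show "(\<lambda>\<theta>. (cmod (?F \<theta>))\<^sup>2) \<in> borel_measurable lborel"
      by (intro borel_measurable_power measurable_compose[OF Fm borel_measurable_norm])
    show "(\<lambda>\<theta>. (cmod (arc \<theta> * g \<theta>))\<^sup>2) \<in> borel_measurable lborel"
      by (intro borel_measurable_power measurable_compose[OF gm borel_measurable_norm])
  qed
  then have sF: "square_integrable ?F"
    using Fm cutoff_abs(2)[OF sg] unfolding square_integrable_def by blast
  then have csf: "circle_square_integrable f" by (simp only: circle_square_integrable_iff)
  have "abs_L2R (\<lambda>\<theta>. arc \<theta> * g \<theta>) = circle_fun f"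
    unfolding circle_fun_def using ae by (subst abs_L2R_eq_iff) (auto intro: sF cutoff_abs(2)[OF sg])
  then have "circle_fun f = y" using y(1) by (simp only: yg cutoff_abs(1)[OF sg])
  then have "discrete_fourier f = of_real (1 / sqrt (2 * pi)) *\<^sub>C of_real (sqrt (2 * pi)) *\<^sub>C u"
    by (simp only: discrete_fourier_eq[OF csf] y(2))
  also have "\<dots> = u" unfolding scaleC_scaleC of_real_mult[symmetric] by simp
  finally show ?thesis using csf by blast
qed

lemma circle_square_integrable_add:
  assumes "circle_square_integrable f" "circle_square_integrable g"
  shows "circle_square_integrable (\<lambda>z. f z + g z)"
    "discrete_fourier (\<lambda>z. f z + g z) = discrete_fourier f + discrete_fourier g"
proof -
  note a = assms[unfolded circle_square_integrable_iff]
  note s = square_integrable_add[OF a]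
  show c: "circle_square_integrable (\<lambda>z. f z + g z)"
    unfolding circle_square_integrable_iff using s by (simp add: scaleR_add_right)
  have "circle_fun (\<lambda>z. f z + g z) = circle_fun f + circle_fun g"
    unfolding circle_fun_def using a by (simp add: plus_L2R.abs_eq scaleR_add_right)
  then show "discrete_fourier (\<lambda>z. f z + g z) = discrete_fourier f + discrete_fourier g"
    by (simp only: discrete_fourier_eq assms c fb.analysis_add scaleC_add_right)
qed

lemma circle_square_integrable_scale:
  assumes "circle_square_integrable f"
  shows "circle_square_integrable (\<lambda>z. c * f z)" "discrete_fourier (\<lambda>z. c * f z) = c *\<^sub>C discrete_fourier f"
proof -
  note a = assms[unfolded circle_square_integrable_iff]
  have e: "(\<lambda>\<theta>. indicator {0..2 * pi} \<theta> *\<^sub>R (c * f (cis \<theta>))) = (\<lambda>\<theta>. c * (indicator {0..2 * pi} \<theta> *\<^sub>R f (cis \<theta>)))"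
    by (simp add: fun_eq_iff)
  show s: "circle_square_integrable (\<lambda>z. c * f z)"
    unfolding circle_square_integrable_iff e by (rule square_integrable_scale[OF a])
  have "circle_fun (\<lambda>z. c * f z) = c *\<^sub>C circle_fun f"
    unfolding circle_fun_def e using a by (simp add: scaleC_L2R.abs_eq)
  then show "discrete_fourier (\<lambda>z. c * f z) = c *\<^sub>C discrete_fourier f"
    by (simp only: discrete_fourier_eq assms s fb.analysis_scale scaleC_scaleC mult.commute)
qed


section \<open>The unitaries \<open>Y\<close>\<close>

context
  fixes arg :: "complex \<Rightarrow> real"
  assumes arg: "argument_choice arg"
begin

lemma arg_cis_measurable: "(\<lambda>\<theta>. arg (cis \<theta>)) \<in> borel_measurable borel"
proof -
  have "cis \<in> measurable borel (restrict_space borel (sphere 0 1))"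
    by (rule measurable_restrict_space2) (auto intro: cis_measurable)
  then show ?thesis using arg by (auto simp: argument_choice_def intro: measurable_compose)
qed

lemma circle_square_integrable_U:
  assumes "circle_square_integrable f"
  shows "circle_square_integrable (U_op arg \<phi> f)"
proof -
  note a = assms[unfolded circle_square_integrable_iff]
  have m: "(\<lambda>\<theta>. cis (- \<phi> * arg (cis \<theta>))) \<in> borel_measurable lborel"
    using measurable_compose[OF arg_cis_measurable cis_mult_measurable[of "- \<phi>"]] by simp
  have "square_integrable (\<lambda>\<theta>. cis (- \<phi> * arg (cis \<theta>)) * (indicator {0..2 * pi} \<theta> *\<^sub>R f (cis \<theta>)))"
    by (rule square_integrable_bounded_mult[OF m _ a]) (auto simp: bounded_iff)
  moreover have "(\<lambda>\<theta>. cis (- \<phi> * arg (cis \<theta>)) * (indicator {0..2 * pi} \<theta> *\<^sub>R f (cis \<theta>))) =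
      (\<lambda>\<theta>. indicator {0..2 * pi} \<theta> *\<^sub>R U_op arg \<phi> f (cis \<theta>))"
    by (simp add: fun_eq_iff U_op_def)
  ultimately show ?thesis by (simp only: circle_square_integrable_iff)
qed

lemma cinner_discrete_fourier_U:
  assumes "circle_square_integrable f" "circle_square_integrable g"
  shows "cinner (discrete_fourier (U_op arg \<phi> f)) (discrete_fourier (U_op arg \<phi> g)) =
    cinner (discrete_fourier f) (discrete_fourier g)"
proof -
  note cU = circle_square_integrable_U[OF assms(1), of \<phi>] circle_square_integrable_U[OF assms(2), of \<phi>]
  have "cinner (circle_fun (U_op arg \<phi> f)) (circle_fun (U_op arg \<phi> g)) = cinner (circle_fun f) (circle_fun g)"
    unfolding circle_fun_def
      cinner_abs_L2R[OF cU(1)[unfolded circle_square_integrable_iff] cU(2)[unfolded circle_square_integrable_iff]]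
      cinner_abs_L2R[OF assms(1)[unfolded circle_square_integrable_iff] assms(2)[unfolded circle_square_integrable_iff]]
  proof (rule Bochner_Integration.integral_cong)
    fix \<theta>
    have "cis (- \<phi> * arg (cis \<theta>)) * cnj (cis (- \<phi> * arg (cis \<theta>))) = 1"
      by (simp add: cis_cnj cis_mult)
    then show "indicator {0..2 * pi} \<theta> *\<^sub>R U_op arg \<phi> f (cis \<theta>) * cnj (indicator {0..2 * pi} \<theta> *\<^sub>R U_op arg \<phi> g (cis \<theta>)) =
        indicator {0..2 * pi} \<theta> *\<^sub>R f (cis \<theta>) * cnj (indicator {0..2 * pi} \<theta> *\<^sub>R g (cis \<theta>))"
      unfolding U_op_def by (auto simp: mult_ac split: split_indicator)
  qed simp
  then show ?thesis by (simp only: discrete_fourier_isometric assms cU)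
qed

text \<open>Surjectivity lets the multiplication be carried to all of l2 by choosing preimages; two
  preimages differ on a null set only, and |z^(- phi)| = 1 makes the result isometric.\<close>

lemma Y_op_exists:
  "\<exists>T. \<forall>f. circle_square_integrable f \<longrightarrow> T \<bullet>\<^sub>o discrete_fourier f = discrete_fourier (U_op arg \<phi> f)"
proof -
  define Y where "Y u = discrete_fourier (U_op arg \<phi> (SOME f. circle_square_integrable f \<and> discrete_fourier f = u))" for u
  have Y: "Y (discrete_fourier f) = discrete_fourier (U_op arg \<phi> f)" if f: "circle_square_integrable f" for f
  proof -
    define g where "g = (SOME g. circle_square_integrable g \<and> discrete_fourier g = discrete_fourier f)"
    have g: "circle_square_integrable g" "discrete_fourier g = discrete_fourier f"
      using someI_ex[OF discrete_fourier_surj[of "discrete_fourier f"]] by (simp_all add: g_def)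
    have "AE \<theta> in lborel. indicator {0..2 * pi} \<theta> *\<^sub>R U_op arg \<phi> g (cis \<theta>) = indicator {0..2 * pi} \<theta> *\<^sub>R U_op arg \<phi> f (cis \<theta>)"
      using g(2) unfolding discrete_fourier_eq_iff[OF g(1) f]
      by eventually_elim (auto simp: U_op_def split: split_indicator)
    then have "discrete_fourier (U_op arg \<phi> g) = discrete_fourier (U_op arg \<phi> f)"
      by (simp only: discrete_fourier_eq_iff circle_square_integrable_U g(1) f)
    then show ?thesis by (simp only: Y_def g_def)
  qed
  have "cbop_of Y \<bullet>\<^sub>o u = Y u" for u
  proof (rule cbop_of_bounded[where K = 1])
    fix u v and c :: complex
    obtain f g where f: "circle_square_integrable f" "discrete_fourier f = u"
      and g: "circle_square_integrable g" "discrete_fourier g = v"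
      using discrete_fourier_surj by blast
    have U1: "U_op arg \<phi> (\<lambda>z. f z + g z) = (\<lambda>z. U_op arg \<phi> f z + U_op arg \<phi> g z)"
      and U2: "U_op arg \<phi> (\<lambda>z. c * f z) = (\<lambda>z. c * U_op arg \<phi> f z)"
      by (simp_all add: U_op_def fun_eq_iff ring_distribs)
    note Yu = Y[OF f(1), unfolded f(2)] and Yv = Y[OF g(1), unfolded g(2)]
    have "Y (u + v) = Y (discrete_fourier (\<lambda>z. f z + g z))"
      unfolding circle_square_integrable_add(2)[OF f(1) g(1)] f(2) g(2) ..
    also have "\<dots> = discrete_fourier (\<lambda>z. U_op arg \<phi> f z + U_op arg \<phi> g z)"
      unfolding Y[OF circle_square_integrable_add(1)[OF f(1) g(1)]] U1 ..
    also have "\<dots> = Y u + Y v"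
      unfolding Yu Yv
      by (rule circle_square_integrable_add(2)[OF circle_square_integrable_U[OF f(1)] circle_square_integrable_U[OF g(1)]])
    finally show "Y (u + v) = Y u + Y v" .
    have "Y (c *\<^sub>C u) = Y (discrete_fourier (\<lambda>z. c * f z))"
      unfolding circle_square_integrable_scale(2)[OF f(1)] f(2) ..
    also have "\<dots> = discrete_fourier (\<lambda>z. c * U_op arg \<phi> f z)"
      unfolding Y[OF circle_square_integrable_scale(1)[OF f(1)]] U2 ..
    also have "\<dots> = c *\<^sub>C Y u"
      unfolding Yu by (rule circle_square_integrable_scale(2)[OF circle_square_integrable_U[OF f(1)]])
    finally show "Y (c *\<^sub>C u) = c *\<^sub>C Y u" .
    have "(norm (Y u))\<^sup>2 = (norm u)\<^sup>2"
      unfolding norm_eq_cinner f(2)[symmetric] Y[OF f(1)] cinner_discrete_fourier_U[OF f(1) f(1)] ..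
    then show "norm (Y u) \<le> 1 * norm u" by (simp add: power2_eq_iff_nonneg)
  qed
  then show ?thesis using Y by (intro exI[of _ "cbop_of Y"]) simp
qed

lemma Y_op_apply:
  assumes "circle_square_integrable f"
  shows "Y_op arg \<phi> \<bullet>\<^sub>o discrete_fourier f = discrete_fourier (U_op arg \<phi> f)"
proof -
  let ?P = "\<lambda>T. \<forall>f. circle_square_integrable f \<longrightarrow> T \<bullet>\<^sub>o discrete_fourier f = discrete_fourier (U_op arg \<phi> f)"
  have "\<exists>!T. ?P T"
  proof (rule ex_ex1I[OF Y_op_exists])
    fix T S assume a: "?P T" "?P S"
    show "T = S"
    proof (rule cbop_eqI)
      fix u
      obtain f where f: "circle_square_integrable f" "discrete_fourier f = u"
        using discrete_fourier_surj by blast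
      show "T \<bullet>\<^sub>o u = S \<bullet>\<^sub>o u" unfolding f(2)[symmetric] using a f(1) by simp
    qed
  qed
  from theI'[OF this] show ?thesis unfolding Y_op_def using assms by simp
qed

lemma Y_op_add: "Y_op arg (\<phi> + \<psi>) = Y_op arg \<phi> * Y_op arg \<psi>"
proof (rule cbop_eqI)
  fix u
  obtain f where f: "circle_square_integrable f" "discrete_fourier f = u"
    using discrete_fourier_surj by blast
  have "U_op arg (\<phi> + \<psi>) f = U_op arg \<phi> (U_op arg \<psi> f)"
    unfolding U_op_def fun_eq_iff mult.assoc[symmetric] cis_mult by (simp add: ring_distribs)
  then show "Y_op arg (\<phi> + \<psi>) \<bullet>\<^sub>o u = (Y_op arg \<phi> * Y_op arg \<psi>) \<bullet>\<^sub>o u"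
    unfolding f(2)[symmetric] by (simp add: Y_op_apply f(1) circle_square_integrable_U)
qed

lemma Y_op_0: "Y_op arg 0 = 1"
proof (rule cbop_eqI)
  fix u
  obtain f where f: "circle_square_integrable f" "discrete_fourier f = u"
    using discrete_fourier_surj by blast
  show "Y_op arg 0 \<bullet>\<^sub>o u = 1 \<bullet>\<^sub>o u"
    unfolding f(2)[symmetric] Y_op_apply[OF f(1)] by (simp add: U_op_def)
qed

lemma Y_op_adjoint: "cbop_adjoint (Y_op arg \<phi>) = Y_op arg (- \<phi>)"
proof (rule cbop_adjoint_unique)
  fix u v
  obtain f where f: "circle_square_integrable f" "discrete_fourier f = u"
    using discrete_fourier_surj by blast
  obtain g where g: "circle_square_integrable g" "discrete_fourier g = Y_op arg (- \<phi>) \<bullet>\<^sub>o v"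
    using discrete_fourier_surj by blast
  have "v = (Y_op arg \<phi> * Y_op arg (- \<phi>)) \<bullet>\<^sub>o v"
    by (simp add: Y_op_add[symmetric] Y_op_0)
  also have "\<dots> = discrete_fourier (U_op arg \<phi> g)"
    unfolding apply_simps g(2)[symmetric] by (rule Y_op_apply[OF g(1)])
  finally have v: "v = discrete_fourier (U_op arg \<phi> g)" .
  have "cinner (Y_op arg \<phi> \<bullet>\<^sub>o u) v = cinner (discrete_fourier f) (discrete_fourier g)"
    unfolding v f(2)[symmetric] Y_op_apply[OF f(1)] by (rule cinner_discrete_fourier_U[OF f(1) g(1)])
  then show "cinner (Y_op arg \<phi> \<bullet>\<^sub>o u) v = cinner u (Y_op arg (- \<phi>) \<bullet>\<^sub>o v)"
    unfolding f(2) g(2) .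
qed

text \<open>An integral power does not see the branch of the argument, since
  \<open>cis (arg z) = z\<close>; so the j-th coefficient of z^(- k) f is the (j + k)-th one of
  f.\<close>

lemma Y_op_int: "Rep_l2 (Y_op arg (of_int k) \<bullet>\<^sub>o u) j = Rep_l2 u (j + k)"
proof -
  obtain f where f: "circle_square_integrable f" "discrete_fourier f = u"
    using discrete_fourier_surj by blast
  have U: "U_op arg (of_int k) f (cis \<theta>) * cis (- (of_int j * \<theta>)) = f (cis \<theta>) * cis (- (of_int (j + k) * \<theta>))" for \<theta>
  proof -
    have "cis (arg (cis \<theta>)) = cis \<theta>" using arg by (auto simp: argument_choice_def)
    then have "cis (of_int (- k) * arg (cis \<theta>)) = cis (of_int (- k) * \<theta>)"
      unfolding cis_power_int[symmetric] by simp
    then have "cis (- of_int k * arg (cis \<theta>)) * cis (- (of_int j * \<theta>)) = cis (- (of_int (j + k) * \<theta>))"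
      by (simp add: cis_mult algebra_simps)
    then show ?thesis unfolding U_op_def by (simp only: mult_ac)
  qed
  show ?thesis
    unfolding f(2)[symmetric] Y_op_apply[OF f(1)] Rep_discrete_fourier[OF f(1)]
      Rep_discrete_fourier[OF circle_square_integrable_U[OF f(1)]] U ..
qed

end


section \<open>The convolution algebra over C[-oo,+oo] and its regular representations\<close>

section \<open>Continuous functions on the extended real line\<close>

definition supnorm :: "(ereal \<Rightarrow> complex) \<Rightarrow> real" where
  "supnorm a = (SUP x. cmod (a x))"

lemma complex_algebra_minus: "x \<ominus>\<^bsub>complex_algebra\<^esub> y = x - y"
proof -
  have "\<ominus>\<^bsub>complex_algebra\<^esub> y = - y"
    unfolding a_inv_def m_inv_def
    by (rule the_equality) (auto simp: complex_algebra_def eq_neg_iff_add_eq_0 add.commute)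
  then show ?thesis by (simp add: a_minus_def complex_algebra_def)
qed

lemma C_ext_carrier: "a \<in> carrier C_ext \<longleftrightarrow> continuous_on UNIV a"
proof -
  have "a \<in> carrier C_ext \<longleftrightarrow> (\<forall>x. ((\<lambda>y. cmod (a y - a x)) \<longlongrightarrow> 0) (at x))"
    by (simp add: C_ext_def continuous_algebra_def complex_algebra_minus)
      (simp add: complex_algebra_def)
  also have "\<dots> \<longleftrightarrow> continuous_on UNIV a"
    by (simp add: continuous_on_def tendsto_norm_zero_iff LIM_zero_iff)
  finally show ?thesis .
qed

lemma C_ext_simps [simp]:
  "f \<otimes>\<^bsub>C_ext\<^esub> g = (\<lambda>x. f x * g x)" "\<one>\<^bsub>C_ext\<^esub> = (\<lambda>_. 1)" "\<zero>\<^bsub>C_ext\<^esub> = (\<lambda>_. 0)"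
  "f \<oplus>\<^bsub>C_ext\<^esub> g = (\<lambda>x. f x + g x)" "c \<odot>\<^bsub>C_ext\<^esub> f = (\<lambda>x. c * f x)"
  "invol C_ext f = (\<lambda>x. cnj (f x))" "alg_norm C_ext = supnorm"
  by (auto simp: C_ext_def continuous_algebra_def complex_algebra_def fun_eq_iff supnorm_def)

lemma C_ext_minus:
  assumes "continuous_on UNIV g"
  shows "f \<ominus>\<^bsub>C_ext\<^esub> g = (\<lambda>x. f x - g x)"
proof -
  have "\<ominus>\<^bsub>C_ext\<^esub> g = (\<lambda>x. - g x)"
    unfolding a_inv_def m_inv_def
  proof (rule the_equality)
    show "y = (\<lambda>x. - g x)" if "y \<in> carrier (add_monoid C_ext) \<and> g \<otimes>\<^bsub>add_monoid C_ext\<^esub> y = \<one>\<^bsub>add_monoid C_ext\<^esub> \<and>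
        y \<otimes>\<^bsub>add_monoid C_ext\<^esub> g = \<one>\<^bsub>add_monoid C_ext\<^esub>" for y
      using that by (auto simp: fun_eq_iff eq_neg_iff_add_eq_0 add.commute)
    show "(\<lambda>x. - g x) \<in> carrier (add_monoid C_ext) \<and> g \<otimes>\<^bsub>add_monoid C_ext\<^esub> (\<lambda>x. - g x) = \<one>\<^bsub>add_monoid C_ext\<^esub> \<and>
        (\<lambda>x. - g x) \<otimes>\<^bsub>add_monoid C_ext\<^esub> g = \<one>\<^bsub>add_monoid C_ext\<^esub>"
      using assms by (auto simp: C_ext_carrier intro!: continuous_intros)
  qed
  then show ?thesis by (simp add: a_minus_def)
qed

text \<open>The logit function, extended by its limits outside (0, 1). It carries facts about an
  interval to the extended line: density of the interior, Bernstein polynomials, a function joining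
  the two ends.\<close>

definition ereal_param :: "real \<Rightarrow> ereal" where
  "ereal_param t = (if t \<le> 0 then - \<infinity> else if 1 \<le> t then \<infinity> else ereal (ln (t / (1 - t))))"

lemma ereal_param_surj: "\<exists>t\<in>{0..1}. ereal_param t = x"
proof (cases x)
  case (real r)
  define t where "t = exp r / (1 + exp r)"
  have "0 < t" "t < 1" by (auto simp: t_def field_simps add_pos_pos)
  moreover have "t / (1 - t) = exp r"
  proof -
    have "1 + exp r \<noteq> 0" using exp_gt_zero[of r] by linarith
    then have "1 - t = 1 / (1 + exp r)" by (simp add: t_def field_simps)
    then show ?thesis using \<open>1 + exp r \<noteq> 0\<close> by (simp add: t_def)
  qed
  ultimately show ?thesis using real by (intro bexI[of _ t]) (auto simp: ereal_param_def)
next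
  case PInf
  then show ?thesis by (intro bexI[of _ 1]) (auto simp: ereal_param_def)
next
  case MInf
  then show ?thesis by (intro bexI[of _ 0]) (auto simp: ereal_param_def)
qed

text \<open>Monotone with open range, hence continuous; no limit has to be computed at the infinite
  points.\<close>

lemma continuous_on_ereal_param: "continuous_on UNIV ereal_param"
proof (rule continuous_onI_mono)
  have "range ereal_param = UNIV" using ereal_param_surj by (metis surjI surj_def)
  then show "open (range ereal_param)" by simp
  show "ereal_param s \<le> ereal_param t" if "s \<le> t" for s t
  proof -
    have "ln (s / (1 - s)) \<le> ln (t / (1 - t))" if "0 < s" "t < 1"
      using \<open>s \<le> t\<close> that by (subst ln_le_cancel_iff) (auto intro!: frac_le divide_pos_pos)
    then show ?thesis using \<open>s \<le> t\<close> by (auto simp: ereal_param_def)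
  qed
qed

lemma supnorm_bdd:
  fixes a :: "ereal \<Rightarrow> complex"
  assumes "continuous_on UNIV a"
  shows "bdd_above (range (\<lambda>x. cmod (a x)))"
proof -
  have "compact (range (\<lambda>x. cmod (a x)))"
    by (rule compact_continuous_image[OF continuous_on_norm[OF assms] Extended_Real_Limits.compact_UNIV])
  then show ?thesis by (intro bounded_imp_bdd_above compact_imp_bounded)
qed

lemma cmod_le_supnorm: "continuous_on UNIV a \<Longrightarrow> cmod (a x) \<le> supnorm a"
  unfolding supnorm_def by (rule cSUP_upper[OF UNIV_I supnorm_bdd])

lemma supnorm_le: "(\<And>x. cmod (a x) \<le> K) \<Longrightarrow> supnorm a \<le> K"
  unfolding supnorm_def by (rule cSUP_least) auto

lemma supnorm_nonneg: "continuous_on UNIV a \<Longrightarrow> 0 \<le> supnorm a"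
  using order_trans[OF norm_ge_zero cmod_le_supnorm] .

lemma supnorm_zero: "supnorm (\<lambda>_. 0) = 0"
  by (simp add: supnorm_def)

lemma continuous_on_shift: "continuous_on UNIV (\<lambda>x. x - ereal t)"
proof (rule continuous_onI_mono)
  have "x = (x + ereal t) - ereal t" for x by (cases x) auto
  then have "range (\<lambda>x. x - ereal t) = UNIV" by (metis surjI)
  then show "open (range (\<lambda>x. x - ereal t))" by simp
qed (auto intro: ereal_minus_mono)

lemma continuous_on_compose_shift:
  "continuous_on UNIV a \<Longrightarrow> continuous_on UNIV (\<lambda>x. a (x - ereal t))"
  by (rule continuous_on_compose2[OF _ continuous_on_shift]) auto

lemma supnorm_shift:
  assumes "continuous_on UNIV a"
  shows "supnorm (\<lambda>x. a (x - ereal t)) = supnorm a"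
proof (rule antisym)
  show "supnorm (\<lambda>x. a (x - ereal t)) \<le> supnorm a"
    by (intro supnorm_le cmod_le_supnorm assms)
  show "supnorm a \<le> supnorm (\<lambda>x. a (x - ereal t))"
  proof (rule supnorm_le)
    fix x
    have "x = (x + ereal t) - ereal t" by (cases x) auto
    then show "cmod (a x) \<le> supnorm (\<lambda>x. a (x - ereal t))"
      using cmod_le_supnorm[OF continuous_on_compose_shift[OF assms, of t], of "x + ereal t"] by simp
  qed
qed

text \<open>For negative k the definition takes \<open>inv_into\<close> on the carrier, so the
  inverse translation must be seen to preserve continuity; the infinite points are fixed
  throughout.\<close>

lemma automorphism_power_translation:
  assumes "continuous_on UNIV g"
  shows "automorphism_power C_ext translation k g = (\<lambda>x. g (x - ereal (of_int k)))"
proof (cases "k \<ge> 0")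
  case True
  have "(translation ^^ n) g = (\<lambda>x. g (x - ereal (real n)))" for n
  proof (induction n)
    case (Suc n)
    have x: "(x - 1) - ereal (real n) = x - ereal (real (Suc n))" for x
      by (cases x) (auto simp: one_ereal_def)
    have "(translation ^^ Suc n) g = translation (\<lambda>x. g (x - ereal (real n)))"
      by (simp only: funpow.simps o_apply Suc)
    also have "\<dots> = (\<lambda>x. g (x - ereal (real (Suc n))))" unfolding translation_def by (simp only: x)
    finally show ?case .
  qed (simp add: zero_ereal_def[symmetric])
  from this[of "nat k"] show ?thesis using True by (simp add: automorphism_power_def)
next
  case False
  have x: "x + 1 - 1 = x" "x - 1 + 1 = x" for x :: ereal by (cases x; simp add: one_ereal_def)+
  have inj: "inj_on translation (carrier C_ext)"
  proof (rule inj_onI)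
    fix a b assume "translation a = translation b"
    then have "a (x + 1 - 1) = b (x + 1 - 1)" for x by (simp add: translation_def fun_eq_iff)
    then show "a = b" by (simp add: x fun_eq_iff)
  qed
  have inv: "inv_into (carrier C_ext) translation h = (\<lambda>x. h (x + 1))" if "continuous_on UNIV h" for h
  proof (rule inv_into_f_eq[OF inj])
    show "(\<lambda>x. h (x + 1)) \<in> carrier C_ext"
      using continuous_on_compose_shift[OF that, of "- 1"] by (simp add: C_ext_carrier one_ereal_def minus_ereal_def)
    show "translation (\<lambda>x. h (x + 1)) = h" by (simp add: translation_def x)
  qed
  have "(inv_into (carrier C_ext) translation ^^ n) g = (\<lambda>x. g (x + ereal (real n)))" for n
  proof (induction n)
    case (Suc n)
    have "x + 1 + ereal (real n) = x + ereal (real (Suc n))" for x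
      by (cases x) (auto simp: one_ereal_def)
    moreover have "continuous_on UNIV (\<lambda>x. g (x + ereal (real n)))"
      using continuous_on_compose_shift[OF assms, of "- real n"] by (simp add: minus_ereal_def)
    ultimately show ?case by (simp add: Suc inv)
  qed (simp add: zero_ereal_def[symmetric])
  from this[of "nat (- k)"] show ?thesis using False by (simp add: automorphism_power_def minus_ereal_def)
qed


lemma C_ext_finsum:
  assumes "finite F" "\<And>i. i \<in> F \<Longrightarrow> continuous_on UNIV (h i)"
  shows "finsum C_ext h F = (\<lambda>x. \<Sum>i\<in>F. h i x)"
proof -
  have "abelian_monoid C_ext"
    by (rule abelian_monoidI) (auto simp: C_ext_carrier add_ac intro!: continuous_intros)
  then interpret abelian_monoid C_ext .
  show ?thesis using assms
  proof (induction F)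
    case (insert i F)
    then show ?case
      by (subst finsum_insert) (auto simp: C_ext_carrier)
  qed (simp add: finsum_empty)
qed

context
  fixes h :: "'i \<Rightarrow> ereal \<Rightarrow> complex"
  assumes h: "\<And>i. continuous_on UNIV (h i)" and sum: "(\<lambda>i. supnorm (h i)) summable_on UNIV"
begin

lemma C_ext_series_abs_summable: "(\<lambda>i. cmod (h i x)) summable_on A"
  by (rule summable_on_comparison_test[OF summable_on_subset_banach[OF sum subset_UNIV]])
    (auto intro: cmod_le_supnorm h)

lemma C_ext_series_summable: "(\<lambda>i. h i x) summable_on A"
  using C_ext_series_abs_summable by (rule abs_summable_summable)

text \<open>Weierstrass test in quantitative form. The bound is independent of x, and continuity of
  the sum, its norm and the value of \<open>alg_infsum\<close> are read off from it.\<close>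

lemma C_ext_series_tail:
  assumes "finite F"
  shows "cmod ((\<Sum>i\<in>F. h i x) - (\<Sum>\<^sub>\<infinity>i. h i x)) \<le> (\<Sum>\<^sub>\<infinity>i. supnorm (h i)) - (\<Sum>i\<in>F. supnorm (h i))"
proof -
  have UN: "F \<union> - F = UNIV" by auto
  have s: "(\<lambda>i. supnorm (h i)) summable_on A" for A by (rule summable_on_subset_banach[OF sum subset_UNIV])
  have 1: "(\<Sum>\<^sub>\<infinity>i. h i x) = (\<Sum>i\<in>F. h i x) + (\<Sum>\<^sub>\<infinity>i\<in>-F. h i x)"
    using infsum_Un_disjoint[of "\<lambda>i. h i x" F "- F", OF C_ext_series_summable C_ext_series_summable] assms by (simp add: UN)
  have 2: "(\<Sum>\<^sub>\<infinity>i. supnorm (h i)) = (\<Sum>i\<in>F. supnorm (h i)) + (\<Sum>\<^sub>\<infinity>i\<in>-F. supnorm (h i))"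
    using infsum_Un_disjoint[of "\<lambda>i. supnorm (h i)" F "- F", OF s s] assms by (simp add: UN)
  have "cmod (\<Sum>\<^sub>\<infinity>i\<in>-F. h i x) \<le> (\<Sum>\<^sub>\<infinity>i\<in>-F. cmod (h i x))"
    by (rule norm_infsum_bound[OF C_ext_series_abs_summable])
  also have "\<dots> \<le> (\<Sum>\<^sub>\<infinity>i\<in>-F. supnorm (h i))"
    by (rule infsum_mono[OF C_ext_series_abs_summable s]) (rule cmod_le_supnorm[OF h])
  finally show ?thesis by (simp add: 1 2)
qed

lemma C_ext_series_tail_tendsto:
  "((\<lambda>F. (\<Sum>\<^sub>\<infinity>i. supnorm (h i)) - (\<Sum>i\<in>F. supnorm (h i))) \<longlongrightarrow> 0) (finite_subsets_at_top UNIV)"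
proof -
  have "((\<lambda>F. \<Sum>i\<in>F. supnorm (h i)) \<longlongrightarrow> (\<Sum>\<^sub>\<infinity>i. supnorm (h i))) (finite_subsets_at_top UNIV)"
    using sum by (rule infsum_tendsto)
  from tendsto_diff[OF tendsto_const[of "\<Sum>\<^sub>\<infinity>i. supnorm (h i)"] this] show ?thesis by simp
qed

lemma C_ext_series_continuous: "continuous_on UNIV (\<lambda>x. \<Sum>\<^sub>\<infinity>i. h i x)"
proof (rule uniform_limit_theorem[where f = "\<lambda>F x. \<Sum>i\<in>F. h i x" and F = "finite_subsets_at_top UNIV"])
  show "\<forall>\<^sub>F F in finite_subsets_at_top UNIV. continuous_on UNIV (\<lambda>x. \<Sum>i\<in>F. h i x)"
    by (intro always_eventually allI continuous_on_sum h)
  show "uniform_limit UNIV (\<lambda>F x. \<Sum>i\<in>F. h i x) (\<lambda>x. \<Sum>\<^sub>\<infinity>i. h i x) (finite_subsets_at_top UNIV)"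
  proof (rule uniform_limitI)
    fix e :: real assume "0 < e"
    have "\<forall>\<^sub>F F in finite_subsets_at_top UNIV. (\<Sum>\<^sub>\<infinity>i. supnorm (h i)) - (\<Sum>i\<in>F. supnorm (h i)) < e"
      using order_tendstoD(2)[OF C_ext_series_tail_tendsto \<open>0 < e\<close>] .
    moreover have "\<forall>\<^sub>F F in finite_subsets_at_top UNIV. finite (F :: 'i set)"
      by (rule eventually_finite_subsets_at_top_weakI) simp
    ultimately show "\<forall>\<^sub>F F in finite_subsets_at_top UNIV. \<forall>x\<in>UNIV. dist (\<Sum>i\<in>F. h i x) (\<Sum>\<^sub>\<infinity>i. h i x) < e"
    proof eventually_elim
      case (elim F)
      then show ?case using C_ext_series_tail[of F] by (auto simp: dist_norm intro: le_less_trans)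
    qed
  qed
qed (rule finite_subsets_at_top_neq_bot)

lemma supnorm_series_le: "supnorm (\<lambda>x. \<Sum>\<^sub>\<infinity>i. h i x) \<le> (\<Sum>\<^sub>\<infinity>i. supnorm (h i))"
  using C_ext_series_tail[of "{}"] by (intro supnorm_le) simp

text \<open>Turns the abstract norm-convergent sum into a pointwise one. Existence is the uniform
  tail estimate; uniqueness holds because norm convergence implies convergence at each x.\<close>

lemma alg_infsum_C_ext: "alg_infsum C_ext h = (\<lambda>x. \<Sum>\<^sub>\<infinity>i. h i x)"
  unfolding alg_infsum_def C_ext_simps
proof (rule the_equality)
  let ?s = "\<lambda>x. \<Sum>\<^sub>\<infinity>i. h i x"
  let ?N = "\<lambda>s F. supnorm (finsum C_ext h F \<ominus>\<^bsub>C_ext\<^esub> s)"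
  have N: "?N s F = supnorm (\<lambda>x. (\<Sum>i\<in>F. h i x) - s x)" if "continuous_on UNIV s" "finite F" for s F
    using that h by (simp add: C_ext_minus C_ext_finsum)
  have fin: "\<forall>\<^sub>F F in finite_subsets_at_top UNIV. finite (F :: 'i set)"
    by (rule eventually_finite_subsets_at_top_weakI) simp
  have lim: "((\<lambda>F. ?N ?s F) \<longlongrightarrow> 0) (finite_subsets_at_top UNIV)"
  proof (rule tendsto_sandwich[OF _ _ tendsto_const C_ext_series_tail_tendsto])
    show "\<forall>\<^sub>F F in finite_subsets_at_top UNIV. 0 \<le> ?N ?s F"
      using fin by eventually_elim
        (auto simp: N C_ext_series_continuous intro!: supnorm_nonneg continuous_intros h)
    show "\<forall>\<^sub>F F in finite_subsets_at_top UNIV. ?N ?s F \<le> (\<Sum>\<^sub>\<infinity>i. supnorm (h i)) - (\<Sum>i\<in>F. supnorm (h i))"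
      using fin by eventually_elim
        (simp add: N C_ext_series_continuous supnorm_le C_ext_series_tail)
  qed
  show "?s \<in> carrier C_ext \<and> ((\<lambda>F. ?N ?s F) \<longlongrightarrow> 0) (finite_subsets_at_top UNIV)"
    using lim by (simp add: C_ext_carrier C_ext_series_continuous)
  fix s assume s: "s \<in> carrier C_ext \<and> ((\<lambda>F. ?N s F) \<longlongrightarrow> 0) (finite_subsets_at_top UNIV)"
  then have sc: "continuous_on UNIV s" by (simp add: C_ext_carrier)
  show "s = ?s"
  proof
    fix x
    have "((\<lambda>F. (\<Sum>i\<in>F. h i x) - s x) \<longlongrightarrow> 0) (finite_subsets_at_top UNIV)"
    proof (rule Lim_null_comparison)
      show "\<forall>\<^sub>F F in finite_subsets_at_top UNIV. norm ((\<Sum>i\<in>F. h i x) - s x) \<le> ?N s F"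
        using fin
      proof eventually_elim
        case (elim F)
        show ?case unfolding N[OF sc elim]
          by (rule cmod_le_supnorm[of "\<lambda>x. (\<Sum>i\<in>F. h i x) - s x"]) (intro continuous_intros h sc)
      qed
    qed (use s in blast)
    from tendsto_add[OF this tendsto_const[of "s x"]]
    have "((\<lambda>F. \<Sum>i\<in>F. h i x) \<longlongrightarrow> s x) (finite_subsets_at_top UNIV)" by simp
    from tendsto_unique[OF finite_subsets_at_top_neq_bot this infsum_tendsto[OF C_ext_series_summable]]
    show "s x = ?s x" .
  qed
qed

end

section \<open>The algebra \<open>\<ell>\<^sup>1(\<int>, C[-\<infinity>, \<infinity>])\<close>\<close>

abbreviation l1Z :: "(int \<Rightarrow> ereal \<Rightarrow> complex) star_algebra" where
  "l1Z \<equiv> l1_algebra C_ext translation"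

definition l1norm :: "(int \<Rightarrow> ereal \<Rightarrow> complex) \<Rightarrow> real" where
  "l1norm f = (\<Sum>\<^sub>\<infinity>n. supnorm (f n))"

lemma l1Z_carrier:
  "f \<in> carrier l1Z \<longleftrightarrow> (\<forall>n. continuous_on UNIV (f n)) \<and> (\<lambda>n. supnorm (f n)) summable_on UNIV"
  unfolding l1_algebra_def by (auto simp: C_ext_carrier image_subset_iff)

lemma l1Z_continuous: "f \<in> carrier l1Z \<Longrightarrow> continuous_on UNIV (f n)"
  and l1Z_summable: "f \<in> carrier l1Z \<Longrightarrow> (\<lambda>n. supnorm (f n)) summable_on UNIV"
  by (simp_all add: l1Z_carrier)

lemma supnorm_le_l1norm: "f \<in> carrier l1Z \<Longrightarrow> supnorm (f n) \<le> l1norm f"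
  using infsum_mono2[of "\<lambda>n. supnorm (f n)" "{n}" UNIV] unfolding l1norm_def
  by (simp add: supnorm_nonneg l1Z_continuous l1Z_summable)

lemma l1norm_nonneg: "f \<in> carrier l1Z \<Longrightarrow> 0 \<le> l1norm f"
  unfolding l1norm_def by (intro infsum_nonneg supnorm_nonneg) (simp add: l1Z_continuous)

lemma l1Z_simps:
  "alg_norm l1Z = l1norm"
  "\<one>\<^bsub>l1Z\<^esub> = (\<lambda>n x. if n = 0 then 1 else 0)"
  "\<zero>\<^bsub>l1Z\<^esub> = (\<lambda>n x. 0)"
  "f \<oplus>\<^bsub>l1Z\<^esub> g = (\<lambda>n x. f n x + g n x)"
  "c \<odot>\<^bsub>l1Z\<^esub> f = (\<lambda>n x. c * f n x)"
  by (auto simp: l1_algebra_def fun_eq_iff l1norm_def)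

lemma l1Z_invol:
  assumes "f \<in> carrier l1Z"
  shows "invol l1Z f = (\<lambda>n x. cnj (f (- n) (x - ereal (of_int n))))"
proof
  fix n
  have "continuous_on UNIV (\<lambda>x. cnj (f (- n) x))"
    by (intro continuous_on_cnj l1Z_continuous assms)
  then show "invol l1Z f n = (\<lambda>x. cnj (f (- n) (x - ereal (of_int n))))"
    unfolding l1_algebra_def by (simp add: automorphism_power_translation)
qed

lemma l1Z_product_summable:
  assumes "f \<in> carrier l1Z" "g \<in> carrier l1Z"
  shows "(\<lambda>k. supnorm (\<lambda>x. f k x * g (n - k) (x - ereal (of_int k)))) summable_on UNIV"
    and "continuous_on UNIV (\<lambda>x. f k x * g (n - k) (x - ereal (of_int k)))"
    and "supnorm (\<lambda>x. f k x * g (n - k) (x - ereal (of_int k))) \<le> supnorm (f k) * supnorm (g (n - k))"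
proof -
  show c: "continuous_on UNIV (\<lambda>x. f k x * g (n - k) (x - ereal (of_int k)))" for k
    by (intro continuous_on_mult continuous_on_compose_shift l1Z_continuous assms)
  show le: "supnorm (\<lambda>x. f k x * g (n - k) (x - ereal (of_int k))) \<le> supnorm (f k) * supnorm (g (n - k))" for k
    by (rule supnorm_le)
      (auto simp: norm_mult intro!: mult_mono cmod_le_supnorm supnorm_nonneg l1Z_continuous assms)
  have le2: "supnorm (\<lambda>x. f k x * g (n - k) (x - ereal (of_int k))) \<le> supnorm (f k) * l1norm g" for k
    using le by (rule order_trans)
      (intro mult_left_mono supnorm_le_l1norm supnorm_nonneg l1Z_continuous assms)
  show "(\<lambda>k. supnorm (\<lambda>x. f k x * g (n - k) (x - ereal (of_int k)))) summable_on UNIV"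
    by (rule summable_on_comparison_test[OF summable_on_cmult_left[OF l1Z_summable[OF assms(1)], of "l1norm g"]])
      (auto intro: le2 supnorm_nonneg c)
qed

lemma l1Z_mult:
  assumes "f \<in> carrier l1Z" "g \<in> carrier l1Z"
  shows "f \<otimes>\<^bsub>l1Z\<^esub> g = (\<lambda>n x. \<Sum>\<^sub>\<infinity>k. f k x * g (n - k) (x - ereal (of_int k)))"
proof
  fix n
  have "(f \<otimes>\<^bsub>l1Z\<^esub> g) n = alg_infsum C_ext (\<lambda>k x. f k x * g (n - k) (x - ereal (of_int k)))"
    unfolding l1_algebra_def by (simp add: automorphism_power_translation l1Z_continuous assms)
  also have "\<dots> = (\<lambda>x. \<Sum>\<^sub>\<infinity>k. f k x * g (n - k) (x - ereal (of_int k)))"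
    by (rule alg_infsum_C_ext) (rule l1Z_product_summable[OF assms])+
  finally show "(f \<otimes>\<^bsub>l1Z\<^esub> g) n = (\<lambda>x. \<Sum>\<^sub>\<infinity>k. f k x * g (n - k) (x - ereal (of_int k)))" .
qed

text \<open>Tonelli on Z x Z: for fixed k the sum over n of b (n - k) is the total of b, by
  translation; the order of summation is then exchanged.\<close>

lemma convolution_has_sum:
  fixes a b :: "int \<Rightarrow> real"
  assumes "a summable_on UNIV" "b summable_on UNIV" "\<And>n. 0 \<le> a n" "\<And>n. 0 \<le> b n"
  shows "(\<lambda>k. a k * b (n - k)) summable_on UNIV"
    and "((\<lambda>n. \<Sum>\<^sub>\<infinity>k. a k * b (n - k)) has_sum (infsum a UNIV * infsum b UNIV)) UNIV"
proof -
  have col: "((\<lambda>n. a k * b (n - k)) has_sum a k * infsum b UNIV) UNIV" for k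
  proof -
    have "((\<lambda>n. b (n - k)) has_sum infsum b UNIV) UNIV \<longleftrightarrow> (b has_sum infsum b UNIV) UNIV"
      by (rule has_sum_reindex_bij_witness[of _ "\<lambda>n. n + k" "\<lambda>n. n - k"]) auto
    then show ?thesis using assms(2) by (intro has_sum_cmult_right) simp
  qed
  have tot: "((\<lambda>k. a k * infsum b UNIV) has_sum (infsum a UNIV * infsum b UNIV)) UNIV"
    using assms(1) by (intro has_sum_cmult_left) simp
  have "(\<lambda>(k, n). a k * b (n - k)) summable_on UNIV \<times> UNIV"
    by (rule summable_on_SigmaI[where g = "\<lambda>k. a k * infsum b UNIV"])
      (use col tot assms(3,4) in \<open>auto simp: summable_on_def\<close>)
  with col tot have S: "((\<lambda>(k, n). a k * b (n - k)) has_sum (infsum a UNIV * infsum b UNIV)) (UNIV \<times> UNIV)"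
    by (intro has_sum_SigmaI[where g = "\<lambda>k. a k * infsum b UNIV"]) auto
  then have S': "((\<lambda>(n, k). a k * b (n - k)) has_sum (infsum a UNIV * infsum b UNIV)) (UNIV \<times> UNIV)"
    by (subst (asm) has_sum_swap) simp
  show row: "(\<lambda>k. a k * b (n - k)) summable_on UNIV" for n
    using summable_on_SigmaD1[of "\<lambda>n k. a k * b (n - k)" UNIV "\<lambda>_. UNIV" n] S' by (auto simp: summable_on_def)
  show "((\<lambda>n. \<Sum>\<^sub>\<infinity>k. a k * b (n - k)) has_sum (infsum a UNIV * infsum b UNIV)) UNIV"
    by (rule has_sum_SigmaD[OF S']) (use row in simp)
qed

lemma l1Z_mult_closed:
  assumes "f \<in> carrier l1Z" "g \<in> carrier l1Z"
  shows "f \<otimes>\<^bsub>l1Z\<^esub> g \<in> carrier l1Z" "l1norm (f \<otimes>\<^bsub>l1Z\<^esub> g) \<le> l1norm f * l1norm g"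
proof -
  note conv = convolution_has_sum[OF l1Z_summable[OF assms(1)] l1Z_summable[OF assms(2)]
      supnorm_nonneg[OF l1Z_continuous[OF assms(1)]] supnorm_nonneg[OF l1Z_continuous[OF assms(2)]]]
  note ps = l1Z_product_summable[OF assms]
  have c: "continuous_on UNIV ((f \<otimes>\<^bsub>l1Z\<^esub> g) n)" for n
    unfolding l1Z_mult[OF assms] by (rule C_ext_series_continuous[OF ps(2) ps(1)])
  have le: "supnorm ((f \<otimes>\<^bsub>l1Z\<^esub> g) n) \<le> (\<Sum>\<^sub>\<infinity>k. supnorm (f k) * supnorm (g (n - k)))" for n
    unfolding l1Z_mult[OF assms]
    by (rule order_trans[OF supnorm_series_le[OF ps(2) ps(1)]]) (rule infsum_mono[OF ps(1) conv(1) ps(3)])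
  have s: "(\<lambda>n. supnorm ((f \<otimes>\<^bsub>l1Z\<^esub> g) n)) summable_on UNIV"
    by (rule summable_on_comparison_test[OF has_sum_imp_summable[OF conv(2)]]) (auto intro: le supnorm_nonneg c)
  then show "f \<otimes>\<^bsub>l1Z\<^esub> g \<in> carrier l1Z" using c by (simp add: l1Z_carrier)
  show "l1norm (f \<otimes>\<^bsub>l1Z\<^esub> g) \<le> l1norm f * l1norm g"
    using infsum_mono[OF s has_sum_imp_summable[OF conv(2)] le] infsumI[OF conv(2)]
    by (simp add: l1norm_def)
qed

lemma l1Z_add_closed:
  assumes "f \<in> carrier l1Z" "g \<in> carrier l1Z"
  shows "(\<lambda>n x. f n x + g n x) \<in> carrier l1Z" "l1norm (\<lambda>n x. f n x + g n x) \<le> l1norm f + l1norm g"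
proof -
  have c: "continuous_on UNIV (\<lambda>x. f n x + g n x)" for n
    by (intro continuous_on_add l1Z_continuous assms)
  have le: "supnorm (\<lambda>x. f n x + g n x) \<le> supnorm (f n) + supnorm (g n)" for n
    by (rule supnorm_le)
      (intro order_trans[OF norm_triangle_ineq] add_mono cmod_le_supnorm l1Z_continuous assms)
  note s = summable_on_add[OF l1Z_summable[OF assms(1)] l1Z_summable[OF assms(2)]]
  have s': "(\<lambda>n. supnorm (\<lambda>x. f n x + g n x)) summable_on UNIV"
    by (rule summable_on_comparison_test[OF s]) (auto intro: le supnorm_nonneg c)
  then show "(\<lambda>n x. f n x + g n x) \<in> carrier l1Z" using c by (simp add: l1Z_carrier)
  show "l1norm (\<lambda>n x. f n x + g n x) \<le> l1norm f + l1norm g"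
    using infsum_mono[OF s' s le] infsum_add[OF l1Z_summable[OF assms(1)] l1Z_summable[OF assms(2)]]
    by (simp add: l1norm_def)
qed

lemma supnorm_scale:
  assumes "continuous_on UNIV a"
  shows "supnorm (\<lambda>x. c * a x) = cmod c * supnorm a"
proof (cases "c = 0")
  case False
  have le: "supnorm (\<lambda>x. c * a x) \<le> cmod c * supnorm a" if "continuous_on UNIV a" for c a
    by (rule supnorm_le) (auto simp: norm_mult intro!: mult_left_mono cmod_le_supnorm that)
  have "(\<lambda>x. inverse c * (c * a x)) = a" using False by (simp add: fun_eq_iff mult.assoc[symmetric])
  then have "supnorm a \<le> cmod (inverse c) * supnorm (\<lambda>x. c * a x)"
    using le[of "\<lambda>x. c * a x" "inverse c"] assms by (simp add: continuous_on_mult_left)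
  then have "cmod c * supnorm a \<le> cmod c * (cmod (inverse c) * supnorm (\<lambda>x. c * a x))"
    by (rule mult_left_mono) simp
  also have "\<dots> = supnorm (\<lambda>x. c * a x)"
    using False by (simp add: norm_inverse)
  finally show ?thesis using le[OF assms, of c] by (rule antisym[rotated])
qed (simp add: supnorm_zero)

lemma l1Z_scale_closed:
  assumes "f \<in> carrier l1Z"
  shows "(\<lambda>n x. c * f n x) \<in> carrier l1Z" "l1norm (\<lambda>n x. c * f n x) = cmod c * l1norm f"
  using assms unfolding l1norm_def
  by (auto simp: l1Z_carrier supnorm_scale infsum_cmult_right' intro!: continuous_intros summable_on_cmult_right)

lemma l1Z_diff_closed:
  assumes "f \<in> carrier l1Z" "g \<in> carrier l1Z"
  shows "(\<lambda>n x. f n x - g n x) \<in> carrier l1Z"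
  using l1Z_add_closed(1)[OF assms(1) l1Z_scale_closed(1)[OF assms(2), of "- 1"]] by simp

lemma l1Z_zero_closed: "(\<lambda>n x. 0) \<in> carrier l1Z"
  by (auto simp: l1Z_carrier supnorm_zero)

lemma l1Z_minus:
  assumes "g \<in> carrier l1Z"
  shows "f \<ominus>\<^bsub>l1Z\<^esub> g = (\<lambda>n x. f n x - g n x)"
proof -
  have "\<ominus>\<^bsub>l1Z\<^esub> g = (\<lambda>n x. - g n x)"
    unfolding a_inv_def m_inv_def
  proof (rule the_equality)
    show "y = (\<lambda>n x. - g n x)" if "y \<in> carrier (add_monoid l1Z) \<and> g \<otimes>\<^bsub>add_monoid l1Z\<^esub> y = \<one>\<^bsub>add_monoid l1Z\<^esub> \<and>
        y \<otimes>\<^bsub>add_monoid l1Z\<^esub> g = \<one>\<^bsub>add_monoid l1Z\<^esub>" for y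
      using that by (auto simp: l1Z_simps fun_eq_iff eq_neg_iff_add_eq_0 add.commute)
    show "(\<lambda>n x. - g n x) \<in> carrier (add_monoid l1Z) \<and> g \<otimes>\<^bsub>add_monoid l1Z\<^esub> (\<lambda>n x. - g n x) = \<one>\<^bsub>add_monoid l1Z\<^esub> \<and>
        (\<lambda>n x. - g n x) \<otimes>\<^bsub>add_monoid l1Z\<^esub> g = \<one>\<^bsub>add_monoid l1Z\<^esub>"
      using l1Z_diff_closed[OF l1Z_zero_closed assms] by (simp add: l1Z_simps)
  qed
  then show ?thesis by (simp add: a_minus_def l1Z_simps)
qed

lemma l1Z_invol_closed:
  assumes "f \<in> carrier l1Z"
  shows "invol l1Z f \<in> carrier l1Z" "l1norm (invol l1Z f) = l1norm f"
proof -
  have c: "continuous_on UNIV (invol l1Z f n)" for n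
    unfolding l1Z_invol[OF assms] by (intro continuous_on_cnj continuous_on_compose_shift l1Z_continuous assms)
  have s: "supnorm (invol l1Z f n) = supnorm (f (- n))" for n
    unfolding l1Z_invol[OF assms]
    using supnorm_shift[OF l1Z_continuous[OF assms, of "- n"], of "of_int n"] by (simp add: supnorm_def)
  have bij: "bij_betw uminus UNIV (UNIV :: int set)"
    by (rule bij_betwI[of _ _ _ uminus]) auto
  show "invol l1Z f \<in> carrier l1Z"
    using summable_on_reindex_bij_betw[OF bij, of "\<lambda>n. supnorm (f n)"] c l1Z_summable[OF assms]
    by (simp add: l1Z_carrier s)
  show "l1norm (invol l1Z f) = l1norm f"
    using infsum_reindex_bij_betw[OF bij, of "\<lambda>n. supnorm (f n)"] by (simp add: l1norm_def s)
qed

text \<open>The quasi-inverse is the pointwise sum of the powers of \<open>h\<close>.\<close>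

lemma l1Z_quasi_inverse:
  assumes h: "h \<in> carrier l1Z" "l1norm h < 1"
  shows "\<exists>g\<in>carrier l1Z. g = h \<oplus>\<^bsub>l1Z\<^esub> (h \<otimes>\<^bsub>l1Z\<^esub> g)"
proof -
  \<comment> \<open>\<open>u k\<close> is the power of exponent k + 1, so the series starts with h
    itself and its norms are bounded by a geometric series.\<close>
  define u where "u = rec_nat h (\<lambda>_ v. h \<otimes>\<^bsub>l1Z\<^esub> v)"
  have u0: "u 0 = h" and uS: "u (Suc k) = h \<otimes>\<^bsub>l1Z\<^esub> u k" for k by (simp_all add: u_def)
  have h0: "0 \<le> l1norm h" by (rule l1norm_nonneg[OF h(1)])
  have u: "u k \<in> carrier l1Z \<and> l1norm (u k) \<le> l1norm h ^ Suc k" for k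
  proof (induction k)
    case (Suc k)
    have "l1norm (u (Suc k)) \<le> l1norm h * l1norm (u k)"
      unfolding uS using Suc h(1) by (intro l1Z_mult_closed) auto
    also have "\<dots> \<le> l1norm h * l1norm h ^ Suc k" using Suc h0 by (intro mult_left_mono) auto
    finally show ?case using Suc h(1) unfolding uS by (auto intro: l1Z_mult_closed)
  qed (simp add: u0 h)
  have uc: "continuous_on UNIV (u k n)" for k n using u[of k] by (simp add: l1Z_carrier)
  have un0: "0 \<le> supnorm (u k n)" for k n by (rule supnorm_nonneg[OF uc])
  have sumU: "(\<lambda>k. l1norm (u k)) summable_on UNIV"
  proof -
    have "summable (\<lambda>k. l1norm h ^ Suc k)"
      using h(2) h0 by (subst summable_Suc_iff) (simp add: summable_geometric)
    then have "(\<lambda>k. l1norm h ^ Suc k) summable_on UNIV"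
      using h0 by (intro norm_summable_imp_summable_on) simp
    then show ?thesis
      by (rule summable_on_comparison_test) (use u l1norm_nonneg in auto)
  qed
  have "((\<lambda>n. supnorm (u k n)) has_sum l1norm (u k)) UNIV" for k
    unfolding l1norm_def using u[of k] by (intro has_sum_infsum l1Z_summable) auto
  then have S: "(\<lambda>(k, n). supnorm (u k n)) summable_on UNIV \<times> UNIV"
    by (intro summable_on_SigmaI[where g = "\<lambda>k. l1norm (u k)"]) (use sumU un0 in auto)
  then have S': "(\<lambda>(n, k). supnorm (u k n)) summable_on UNIV \<times> UNIV"
    by (subst (asm) summable_on_swap) simp
  have row: "(\<lambda>k. supnorm (u k n)) summable_on UNIV" for n
    using summable_on_SigmaD1[OF S'] by simp
  define g where "g n x = (\<Sum>\<^sub>\<infinity>k. u k n x)" for n x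
  have gc: "continuous_on UNIV (g n)" for n
    unfolding g_def[abs_def] by (rule C_ext_series_continuous[OF uc row])
  have gs: "supnorm (g n) \<le> (\<Sum>\<^sub>\<infinity>k. supnorm (u k n))" for n
    unfolding g_def[abs_def] by (rule supnorm_series_le[OF uc row])
  have "(\<lambda>n. \<Sum>\<^sub>\<infinity>k. supnorm (u k n)) summable_on UNIV"
    using summable_on_SigmaD[OF S'] row by simp
  then have "(\<lambda>n. supnorm (g n)) summable_on UNIV"
    by (rule summable_on_comparison_test) (auto intro: gs supnorm_nonneg gc)
  then have gl: "g \<in> carrier l1Z" using gc by (simp add: l1Z_carrier)
  have usum: "(\<lambda>k. u k n x) summable_on A" for n x A
    by (rule C_ext_series_summable[OF uc row])
  have "(h \<otimes>\<^bsub>l1Z\<^esub> g) n x = (\<Sum>\<^sub>\<infinity>k. u (Suc k) n x)" for n x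
  proof -
    let ?t = "\<lambda>m k. h m x * u k (n - m) (x - ereal (of_int m))"
    \<comment> \<open>Dominates the double series over m and k, so that left multiplication by h may
      be applied term by term.\<close>
    have "(\<lambda>(m, k). supnorm (h m) * l1norm (u k)) summable_on UNIV \<times> UNIV"
      by (rule summable_on_SigmaI[where g = "\<lambda>m. supnorm (h m) * (\<Sum>\<^sub>\<infinity>k. l1norm (u k))"])
        (use u in \<open>auto intro!: has_sum_cmult_right has_sum_infsum sumU summable_on_cmult_left
          l1Z_summable h(1) mult_nonneg_nonneg supnorm_nonneg l1norm_nonneg l1Z_continuous\<close>)
    then have "(\<lambda>p. cmod (?t (fst p) (snd p))) summable_on UNIV \<times> UNIV"
      by (rule summable_on_comparison_test)
        (use u in \<open>auto simp: norm_mult intro!: mult_mono cmod_le_supnorm l1Z_continuous h(1) supnorm_nonneg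
          order_trans[OF cmod_le_supnorm supnorm_le_l1norm]\<close>)
    then have sm: "(\<lambda>(m, k). ?t m k) summable_on UNIV \<times> UNIV"
      by (subst split_def) (rule abs_summable_summable)
    have "(h \<otimes>\<^bsub>l1Z\<^esub> g) n x = (\<Sum>\<^sub>\<infinity>m. h m x * (\<Sum>\<^sub>\<infinity>k. u k (n - m) (x - ereal (of_int m))))"
      unfolding l1Z_mult[OF h(1) gl] g_def ..
    also have "\<dots> = (\<Sum>\<^sub>\<infinity>m. \<Sum>\<^sub>\<infinity>k. ?t m k)"
      by (intro infsum_cong infsum_cmult_right[symmetric] usum)
    also have "\<dots> = (\<Sum>\<^sub>\<infinity>k. \<Sum>\<^sub>\<infinity>m. ?t m k)"
      by (rule infsum_swap_banach[OF sm])
    also have "\<dots> = (\<Sum>\<^sub>\<infinity>k. u (Suc k) n x)"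
      unfolding uS using u l1Z_mult[OF h(1)] by simp
    finally show ?thesis .
  qed
  moreover have "g n x = h n x + (\<Sum>\<^sub>\<infinity>k. u (Suc k) n x)" for n x
  proof -
    have U: "UNIV = {0} \<union> range Suc" by (auto simp: image_iff) (metis not0_implies_Suc)
    have "g n x = (\<Sum>\<^sub>\<infinity>k\<in>{0}. u k n x) + (\<Sum>\<^sub>\<infinity>k\<in>range Suc. u k n x)"
      unfolding g_def by (subst U, rule infsum_Un_disjoint) (auto intro: usum)
    also have "(\<Sum>\<^sub>\<infinity>k\<in>range Suc. u k n x) = (\<Sum>\<^sub>\<infinity>k. u (Suc k) n x)"
      by (subst infsum_reindex) (auto simp: o_def)
    finally show ?thesis by (simp add: u0)
  qed
  ultimately have "g = h \<oplus>\<^bsub>l1Z\<^esub> (h \<otimes>\<^bsub>l1Z\<^esub> g)" by (simp add: l1Z_simps fun_eq_iff)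
  then show ?thesis using gl by blast
qed


section \<open>Operators on spaces of square-summable families\<close>

lemma l2_norm_mono:
  assumes "0 \<le> K" "\<And>i. cmod (Rep_l2 v i) \<le> K * cmod (Rep_l2 u i)"
  shows "norm v \<le> K * norm u"
proof -
  have "(norm v)\<^sup>2 \<le> K\<^sup>2 * (norm u)\<^sup>2"
  proof (rule has_sum_mono[OF l2_norm_has_sum has_sum_cmult_right[OF l2_norm_has_sum]])
    show "(cmod (Rep_l2 v i))\<^sup>2 \<le> K\<^sup>2 * (cmod (Rep_l2 u i))\<^sup>2" for i
      using power_mono[OF assms(2)[of i], of 2] by (simp add: power_mult_distrib)
  qed
  then have "(norm v)\<^sup>2 \<le> (K * norm u)\<^sup>2" by (simp add: power_mult_distrib)
  then show ?thesis by (rule power2_le_imp_le) (simp add: assms(1))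
qed

lemma Rep_l2_mult: "bounded (range d) \<Longrightarrow> Rep_l2 (l2_mult d u) i = d i * Rep_l2 u i"
  by (simp add: l2_mult.rep_eq)

lemma
  assumes "\<And>i. cmod (d i) \<le> K"
  shows Rep_diag_op: "Rep_l2 (diag_op d \<bullet>\<^sub>o u) i = d i * Rep_l2 u i"
    and norm_diag_op_le: "norm (diag_op d) \<le> K"
proof -
  have "0 \<le> K" using order_trans[OF norm_ge_zero assms] .
  have bd: "bounded (range d)" using assms by (auto simp: bounded_iff)
  have nm: "norm (l2_mult d u) \<le> K * norm u" for u
    by (rule l2_norm_mono[OF \<open>0 \<le> K\<close>])
      (auto simp: Rep_l2_mult[OF bd] norm_mult intro!: mult_right_mono assms)
  have ap: "diag_op d \<bullet>\<^sub>o u = l2_mult d u" for u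
    unfolding diag_op_def
    by (rule cbop_of_bounded[OF _ _ nm])
      (auto intro!: l2_eqI simp: Rep_l2_mult[OF bd] plus_l2.rep_eq scaleC_l2.rep_eq ring_distribs)
  show "Rep_l2 (diag_op d \<bullet>\<^sub>o u) i = d i * Rep_l2 u i" by (simp add: ap Rep_l2_mult[OF bd])
  show "norm (diag_op d) \<le> K" by (rule norm_cbop_bound[OF \<open>0 \<le> K\<close>]) (simp add: ap nm)
qed

definition l2_pull :: "('i \<Rightarrow> 'j) \<Rightarrow> 'j l2 \<Rightarrow> 'i l2" where
  "l2_pull \<iota> v = Abs_l2 (\<lambda>i. Rep_l2 v (\<iota> i))"

definition l2_push :: "('i \<Rightarrow> 'j) \<Rightarrow> 'i l2 \<Rightarrow> 'j l2" where
  "l2_push \<iota> u = Abs_l2 (\<lambda>j. if j \<in> range \<iota> then Rep_l2 u (inv_into UNIV \<iota> j) else 0)"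

context
  fixes \<iota> :: "'i \<Rightarrow> 'j"
  assumes inj: "inj \<iota>"
begin

lemma l2_pull_bound: "finite F \<Longrightarrow> (\<Sum>i\<in>F. (cmod (Rep_l2 v (\<iota> i)))\<^sup>2) \<le> (norm v)\<^sup>2"
  using l2_norm_sum_le[of "\<iota> ` F" v] inj by (simp add: sum.reindex inj_on_def)

lemma Rep_l2_pull: "Rep_l2 (l2_pull \<iota> v) i = Rep_l2 v (\<iota> i)"
  unfolding l2_pull_def
  by (subst Abs_l2_inverse) (use l2_norm_leI(1)[OF norm_ge_zero l2_pull_bound] in auto)

lemma norm_l2_pull_le: "norm (l2_pull \<iota> v) \<le> norm v"
  unfolding l2_pull_def by (rule l2_norm_leI(2)[OF norm_ge_zero l2_pull_bound])

lemma l2_push_bound: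
  assumes "finite F"
  shows "(\<Sum>j\<in>F. (cmod (if j \<in> range \<iota> then Rep_l2 u (inv_into UNIV \<iota> j) else 0))\<^sup>2) \<le> (norm u)\<^sup>2"
proof -
  have "(\<Sum>j\<in>F. (cmod (if j \<in> range \<iota> then Rep_l2 u (inv_into UNIV \<iota> j) else 0))\<^sup>2) =
      (\<Sum>j\<in>F \<inter> range \<iota>. (cmod (Rep_l2 u (inv_into UNIV \<iota> j)))\<^sup>2)"
    by (rule sum.mono_neutral_cong_right) (use assms in auto)
  also have "\<dots> = (\<Sum>i\<in>inv_into UNIV \<iota> ` (F \<inter> range \<iota>). (cmod (Rep_l2 u i))\<^sup>2)"
    by (subst sum.reindex) (auto intro: inj_on_subset[OF inj_on_inv_into[OF order_refl]])
  also have "\<dots> \<le> (norm u)\<^sup>2" by (rule l2_norm_sum_le) (use assms in simp)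
  finally show ?thesis .
qed

lemma Rep_l2_push: "Rep_l2 (l2_push \<iota> u) j = (if j \<in> range \<iota> then Rep_l2 u (inv_into UNIV \<iota> j) else 0)"
  unfolding l2_push_def
  by (subst Abs_l2_inverse) (use l2_norm_leI(1)[OF norm_ge_zero l2_push_bound] in auto)

lemma norm_l2_push_le: "norm (l2_push \<iota> u) \<le> norm u"
  unfolding l2_push_def by (rule l2_norm_leI(2)[OF norm_ge_zero l2_push_bound])

lemma l2_pull_push: "l2_pull \<iota> (l2_push \<iota> u) = u"
  by (rule l2_eqI) (simp add: Rep_l2_pull Rep_l2_push inv_f_f[OF inj])

lemma l2_pull_linear:
  "l2_pull \<iota> (v + w) = l2_pull \<iota> v + l2_pull \<iota> w" "l2_pull \<iota> (c *\<^sub>C v) = c *\<^sub>C l2_pull \<iota> v"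
  by (auto intro!: l2_eqI simp: Rep_l2_pull plus_l2.rep_eq scaleC_l2.rep_eq)

lemma l2_push_linear:
  "l2_push \<iota> (v + w) = l2_push \<iota> v + l2_push \<iota> w" "l2_push \<iota> (c *\<^sub>C v) = c *\<^sub>C l2_push \<iota> v"
  by (auto intro!: l2_eqI simp: Rep_l2_push plus_l2.rep_eq scaleC_l2.rep_eq)

lemma cinner_l2_push: "cinner (l2_push \<iota> u) v = cinner u (l2_pull \<iota> v)"
proof -
  have "cinner (l2_push \<iota> u) v = (\<Sum>\<^sub>\<infinity>j\<in>range \<iota>. Rep_l2 u (inv_into UNIV \<iota> j) * cnj (Rep_l2 v j))"
    unfolding cinner_l2.rep_eq by (rule infsum_cong_neutral) (auto simp: Rep_l2_push)
  also have "\<dots> = cinner u (l2_pull \<iota> v)"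
    unfolding cinner_l2.rep_eq
    by (subst infsum_reindex[OF inj]) (auto simp: o_def inv_f_f[OF inj] Rep_l2_pull)
  finally show ?thesis .
qed

lemma cinner_l2_push': "cinner v (l2_push \<iota> u) = cinner (l2_pull \<iota> v) u"
  by (subst cinner_commute, subst cinner_l2_push, subst cinner_commute) simp

text \<open>Conjugation with the isometry \<open>l2_push\<close>. The unit becomes the projection
  onto its range, so representations obtained in this way are degenerate in general.\<close>

definition l2_transport :: "'i l2 cbop \<Rightarrow> 'j l2 cbop" where
  "l2_transport T = cbop_of (\<lambda>v. l2_push \<iota> (T \<bullet>\<^sub>o l2_pull \<iota> v))"

lemma l2_transport_apply: "l2_transport T \<bullet>\<^sub>o v = l2_push \<iota> (T \<bullet>\<^sub>o l2_pull \<iota> v)"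
  and norm_l2_transport: "norm (l2_transport T) = norm T"
proof -
  have b: "norm (l2_push \<iota> (T \<bullet>\<^sub>o l2_pull \<iota> v)) \<le> norm T * norm v" for v
    by (rule order_trans[OF norm_l2_push_le order_trans[OF norm_cbop_apply]])
      (intro mult_left_mono norm_l2_pull_le norm_ge_zero)
  show ap: "l2_transport T \<bullet>\<^sub>o v = l2_push \<iota> (T \<bullet>\<^sub>o l2_pull \<iota> v)" for v
    unfolding l2_transport_def
    by (rule cbop_of_bounded[OF _ _ b]) (simp_all add: l2_pull_linear l2_push_linear cbop_apply_add cbop_apply_scaleC)
  have "norm (l2_transport T) \<le> norm T" by (rule norm_cbop_bound) (simp_all add: ap b)
  moreover have "norm T \<le> norm (l2_transport T)"
  proof (rule norm_cbop_bound)
    fix u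
    have "T \<bullet>\<^sub>o u = l2_pull \<iota> (l2_transport T \<bullet>\<^sub>o l2_push \<iota> u)" by (simp only: ap l2_pull_push)
    then have "norm (T \<bullet>\<^sub>o u) \<le> norm (l2_transport T \<bullet>\<^sub>o l2_push \<iota> u)" by (simp only: norm_l2_pull_le)
    also have "\<dots> \<le> norm (l2_transport T) * norm u"
      by (rule order_trans[OF norm_cbop_apply]) (intro mult_left_mono norm_l2_push_le norm_ge_zero)
    finally show "norm (T \<bullet>\<^sub>o u) \<le> norm (l2_transport T) * norm u" .
  qed simp
  ultimately show "norm (l2_transport T) = norm T" by simp
qed

lemma l2_transport_simps:
  "l2_transport (S + T) = l2_transport S + l2_transport T"
  "l2_transport (S * T) = l2_transport S * l2_transport T"
  "l2_transport (cbop_scale c T) = cbop_scale c (l2_transport T)"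
  "l2_transport (cbop_adjoint T) = cbop_adjoint (l2_transport T)"
proof -
  show "l2_transport (S + T) = l2_transport S + l2_transport T"
    "l2_transport (S * T) = l2_transport S * l2_transport T"
    "l2_transport (cbop_scale c T) = cbop_scale c (l2_transport T)"
    by (rule cbop_eqI, simp add: l2_transport_apply l2_push_linear l2_pull_push)+
  show "l2_transport (cbop_adjoint T) = cbop_adjoint (l2_transport T)"
    by (rule cbop_adjoint_unique[symmetric])
      (simp add: l2_transport_apply cinner_l2_push cinner_l2_push' cinner_adjoint)
qed

end

definition shift_op :: "int \<Rightarrow> int l2 cbop" where
  "shift_op k = cbop_of (l2_pull (\<lambda>j. j - k))"

lemma Rep_shift_op: "Rep_l2 (shift_op k \<bullet>\<^sub>o u) j = Rep_l2 u (j - k)"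
  and norm_shift_op_le: "norm (shift_op k) \<le> 1"
proof -
  have inj: "inj (\<lambda>j. j - k)" by (simp add: inj_on_def)
  have ap: "shift_op k \<bullet>\<^sub>o u = l2_pull (\<lambda>j. j - k) u" for u
    unfolding shift_op_def
    by (rule cbop_of_bounded[where K = 1]) (simp_all add: l2_pull_linear[OF inj] norm_l2_pull_le[OF inj])
  show "Rep_l2 (shift_op k \<bullet>\<^sub>o u) j = Rep_l2 u (j - k)" by (simp add: ap Rep_l2_pull[OF inj])
  show "norm (shift_op k) \<le> 1" by (rule norm_cbop_bound) (simp_all add: ap norm_l2_pull_le[OF inj])
qed


section \<open>The regular representations\<close>

definition regular_term :: "real \<Rightarrow> (int \<Rightarrow> ereal \<Rightarrow> complex) \<Rightarrow> int \<Rightarrow> int l2 cbop" where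
  "regular_term \<phi> f k = diag_op (\<lambda>j. f k (ereal (of_int j - \<phi>))) * shift_op k"

definition regular_rep :: "real \<Rightarrow> (int \<Rightarrow> ereal \<Rightarrow> complex) \<Rightarrow> int l2 cbop" where
  "regular_rep \<phi> f = (\<Sum>\<^sub>\<infinity>k. regular_term \<phi> f k)"

lemma bounded_linear_cbop_eval: "bounded_linear (\<lambda>A. A \<bullet>\<^sub>o x)"
  by (rule bounded_linear_intro[of _ "norm x"]) (auto intro: norm_cbop_apply)

lemma bounded_linear_Rep_l2: "bounded_linear (\<lambda>u. Rep_l2 u j)"
proof (rule bounded_linear_intro[of _ 1])
  show "Rep_l2 (r *\<^sub>R u) j = r *\<^sub>R Rep_l2 u j" for r u
    by (simp add: scaleC_of_real[symmetric] scaleC_l2.rep_eq scaleR_conv_of_real)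
qed (auto simp: plus_l2.rep_eq l2_coord_le)

lemma bounded_linear_adjoint:
  "bounded_linear (cbop_adjoint :: 'h::{complex_inner,banach} cbop \<Rightarrow> 'h cbop)"
  by (rule bounded_linear_intro[of _ 1]) (auto simp: adjoint_add scaleR_cbop_def adjoint_scale)

context
  fixes f assumes f: "f \<in> carrier l1Z"
begin

lemma Rep_regular_term: "Rep_l2 (regular_term \<phi> f k \<bullet>\<^sub>o u) j = f k (ereal (of_int j - \<phi>)) * Rep_l2 u (j - k)"
  by (simp add: regular_term_def Rep_diag_op[OF cmod_le_supnorm[OF l1Z_continuous[OF f]]] Rep_shift_op)

lemma norm_regular_term_le: "norm (regular_term \<phi> f k) \<le> supnorm (f k)"
proof -
  have "norm (regular_term \<phi> f k) \<le> supnorm (f k) * 1"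
    unfolding regular_term_def
    by (rule order_trans[OF norm_mult_ineq])
      (intro mult_mono norm_shift_op_le norm_diag_op_le cmod_le_supnorm supnorm_nonneg l1Z_continuous f norm_ge_zero)
  then show ?thesis by simp
qed

lemma regular_term_summable: "regular_term \<phi> f summable_on A"
proof (rule abs_summable_summable)
  show "(\<lambda>k. norm (regular_term \<phi> f k)) summable_on A"
    by (rule summable_on_comparison_test[OF summable_on_subset_banach[OF l1Z_summable[OF f] subset_UNIV]])
      (auto intro: norm_regular_term_le)
qed

text \<open>Coordinates are continuous functionals, so the norm-convergent operator series may be
  read entry by entry; sums, multiples and products are checked on these scalar series.\<close>

lemma regular_rep_has_sum:
  "((\<lambda>k. f k (ereal (of_int j - \<phi>)) * Rep_l2 u (j - k)) has_sum Rep_l2 (regular_rep \<phi> f \<bullet>\<^sub>o u) j) UNIV"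
proof -
  have "(regular_term \<phi> f has_sum regular_rep \<phi> f) UNIV"
    unfolding regular_rep_def by (rule has_sum_infsum[OF regular_term_summable])
  from has_sum_bounded_linear[OF bounded_linear_compose[OF bounded_linear_Rep_l2 bounded_linear_cbop_eval] this]
  show ?thesis by (simp add: o_def Rep_regular_term)
qed

lemma Rep_regular_rep:
  "Rep_l2 (regular_rep \<phi> f \<bullet>\<^sub>o u) j = (\<Sum>\<^sub>\<infinity>k. f k (ereal (of_int j - \<phi>)) * Rep_l2 u (j - k))"
  using infsumI[OF regular_rep_has_sum] by simp

lemma norm_regular_rep_le: "norm (regular_rep \<phi> f) \<le> l1norm f"
  unfolding l1norm_def
  by (rule norm_infsum_le[OF has_sum_infsum[OF regular_term_summable] has_sum_infsum[OF l1Z_summable[OF f]],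
        folded regular_rep_def]) (rule norm_regular_term_le)

text \<open>The adjoint of the k-th term is the term of index - k of the involuted element: the
  shift is inverted and the conjugated coefficient translated, as in the formula for the
  involution.\<close>

lemma regular_rep_adjoint: "regular_rep \<phi> (invol l1Z f) = cbop_adjoint (regular_rep \<phi> f)"
proof -
  have t: "cbop_adjoint (regular_term \<phi> f k) = regular_term \<phi> (invol l1Z f) (- k)" for k
  proof (rule cbop_adjoint_unique)
    fix u v
    let ?a = "\<lambda>j. f k (ereal (of_int j - \<phi>)) * Rep_l2 u (j - k) * cnj (Rep_l2 v j)"
    have b: "cmod (invol l1Z f (- k) y) \<le> supnorm (invol l1Z f (- k))" for y
      by (intro cmod_le_supnorm l1Z_continuous l1Z_invol_closed f)
    have r: "Rep_l2 (regular_term \<phi> (invol l1Z f) (- k) \<bullet>\<^sub>o v) j = cnj (f k (ereal (of_int (j + k) - \<phi>))) * Rep_l2 v (j + k)" for j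
    proof -
      have "Rep_l2 (regular_term \<phi> (invol l1Z f) (- k) \<bullet>\<^sub>o v) j = invol l1Z f (- k) (ereal (of_int j - \<phi>)) * Rep_l2 v (j + k)"
        by (simp add: regular_term_def Rep_diag_op[OF b] Rep_shift_op)
      then show ?thesis by (simp add: l1Z_invol[OF f] algebra_simps)
    qed
    have "cinner (regular_term \<phi> f k \<bullet>\<^sub>o u) v = (\<Sum>\<^sub>\<infinity>j. ?a j)"
      by (simp add: cinner_l2.rep_eq Rep_regular_term)
    also have "\<dots> = (\<Sum>\<^sub>\<infinity>j. ?a (j + k))"
      by (rule infsum_reindex_bij_betw[symmetric], rule bij_betwI[of _ _ _ "\<lambda>j. j - k"]) auto
    also have "\<dots> = cinner u (regular_term \<phi> (invol l1Z f) (- k) \<bullet>\<^sub>o v)"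
      by (simp add: cinner_l2.rep_eq r mult_ac)
    finally show "cinner (regular_term \<phi> f k \<bullet>\<^sub>o u) v = cinner u (regular_term \<phi> (invol l1Z f) (- k) \<bullet>\<^sub>o v)" .
  qed
  have "cbop_adjoint (regular_rep \<phi> f) = (\<Sum>\<^sub>\<infinity>k. cbop_adjoint (regular_term \<phi> f k))"
    unfolding regular_rep_def
    using infsumI[OF has_sum_bounded_linear[OF bounded_linear_adjoint has_sum_infsum[OF regular_term_summable[of \<phi> UNIV]]]]
    by (simp add: o_def)
  also have "\<dots> = regular_rep \<phi> (invol l1Z f)"
    unfolding t regular_rep_def
    by (rule infsum_reindex_bij_betw, rule bij_betwI[of _ _ _ uminus]) auto
  finally show ?thesis ..
qed

end

lemma regular_rep_add:
  assumes "f \<in> carrier l1Z" "g \<in> carrier l1Z"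
  shows "regular_rep \<phi> (\<lambda>n x. f n x + g n x) = regular_rep \<phi> f + regular_rep \<phi> g"
proof (rule cbop_eqI, rule l2_eqI)
  fix u j
  show "Rep_l2 (regular_rep \<phi> (\<lambda>n x. f n x + g n x) \<bullet>\<^sub>o u) j = Rep_l2 ((regular_rep \<phi> f + regular_rep \<phi> g) \<bullet>\<^sub>o u) j"
    using infsumI[OF has_sum_add[OF regular_rep_has_sum[OF assms(1), of j \<phi> u] regular_rep_has_sum[OF assms(2), of j \<phi> u]]]
    by (simp add: Rep_regular_rep[OF l1Z_add_closed(1)[OF assms]] plus_l2.rep_eq ring_distribs)
qed

lemma regular_rep_scale:
  assumes "f \<in> carrier l1Z"
  shows "regular_rep \<phi> (\<lambda>n x. c * f n x) = cbop_scale c (regular_rep \<phi> f)"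
proof (rule cbop_eqI, rule l2_eqI)
  fix u j
  show "Rep_l2 (regular_rep \<phi> (\<lambda>n x. c * f n x) \<bullet>\<^sub>o u) j = Rep_l2 (cbop_scale c (regular_rep \<phi> f) \<bullet>\<^sub>o u) j"
    using infsumI[OF has_sum_cmult_right[OF regular_rep_has_sum[OF assms, of j \<phi> u], of c]]
    by (simp add: Rep_regular_rep[OF l1Z_scale_closed(1)[OF assms]] scaleC_l2.rep_eq mult.assoc)
qed

lemma regular_rep_diff:
  assumes "f \<in> carrier l1Z" "g \<in> carrier l1Z"
  shows "regular_rep \<phi> (\<lambda>n x. f n x - g n x) = regular_rep \<phi> f - regular_rep \<phi> g"
  using regular_rep_add[OF assms(1) l1Z_scale_closed(1)[OF assms(2), of "- 1"], of \<phi>]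
    regular_rep_scale[OF assms(2), of \<phi> "- 1"]
  by (simp add: minus_cbop_def uminus_cbop_def)

lemma convolution_summable:
  fixes a b :: "int \<Rightarrow> real"
  assumes "a summable_on UNIV" "b summable_on UNIV" "\<And>n. 0 \<le> a n" "\<And>n. 0 \<le> b n"
  shows "(\<lambda>(k, n). a k * b (n - k)) summable_on UNIV \<times> UNIV"
proof (rule summable_on_SigmaI[where g = "\<lambda>k. a k * infsum b UNIV"])
  fix k
  have "((\<lambda>n. b (n - k)) has_sum infsum b UNIV) UNIV \<longleftrightarrow> (b has_sum infsum b UNIV) UNIV"
    by (rule has_sum_reindex_bij_witness[of _ "\<lambda>n. n + k" "\<lambda>n. n - k"]) auto
  then show "((\<lambda>n. case (k, n) of (k, n) \<Rightarrow> a k * b (n - k)) has_sum a k * infsum b UNIV) UNIV"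
    using assms(2) by (auto intro!: has_sum_cmult_right)
qed (use assms in \<open>auto intro!: summable_on_cmult_left\<close>)

text \<open>Passing from row j to row j - k moves the sampling point by k, which is the translation
  \<alpha>^k in the convolution. Absolute summability over k and n justifies the exchange of
  sums.\<close>

lemma regular_rep_mult:
  assumes f: "f \<in> carrier l1Z" and g: "g \<in> carrier l1Z"
  shows "regular_rep \<phi> (f \<otimes>\<^bsub>l1Z\<^esub> g) = regular_rep \<phi> f * regular_rep \<phi> g"
proof (rule cbop_eqI, rule l2_eqI)
  fix u j
  let ?x = "ereal (of_int j - \<phi>)"
  let ?t = "\<lambda>k n. f k ?x * g (n - k) (?x - ereal (of_int k)) * Rep_l2 u (j - n)"
  have x: "?x - ereal (of_int k) = ereal (of_int (j - k) - \<phi>)" for k by simp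
  have "(\<lambda>(k, n). supnorm (f k) * supnorm (g (n - k))) summable_on UNIV \<times> UNIV"
    by (intro convolution_summable l1Z_summable supnorm_nonneg l1Z_continuous f g)
  from summable_on_cmult_left[OF this, of "norm u"]
  have "(\<lambda>p. cmod (?t (fst p) (snd p))) summable_on UNIV \<times> UNIV"
    by (rule summable_on_comparison_test)
      (auto simp: norm_mult intro!: mult_mono cmod_le_supnorm l2_coord_le l1Z_continuous f g mult_nonneg_nonneg supnorm_nonneg)
  then have sm: "(\<lambda>(k, n). ?t k n) summable_on UNIV \<times> UNIV"
    by (subst split_def) (rule abs_summable_summable)
  have ps: "(\<lambda>k. f k ?x * g (n - k) (?x - ereal (of_int k))) summable_on UNIV" for n
    by (rule C_ext_series_summable[OF l1Z_product_summable(2)[OF f g] l1Z_product_summable(1)[OF f g]])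
  have "Rep_l2 (regular_rep \<phi> (f \<otimes>\<^bsub>l1Z\<^esub> g) \<bullet>\<^sub>o u) j = (\<Sum>\<^sub>\<infinity>n. (f \<otimes>\<^bsub>l1Z\<^esub> g) n ?x * Rep_l2 u (j - n))"
    by (rule Rep_regular_rep[OF l1Z_mult_closed(1)[OF f g]])
  also have "\<dots> = (\<Sum>\<^sub>\<infinity>n. \<Sum>\<^sub>\<infinity>k. ?t k n)"
    unfolding l1Z_mult[OF f g]
    by (intro infsum_cong infsum_cmult_left[symmetric] ps)
  also have "\<dots> = (\<Sum>\<^sub>\<infinity>k. \<Sum>\<^sub>\<infinity>n. ?t k n)"
    by (rule infsum_swap_banach[OF sm, symmetric])
  also have "\<dots> = (\<Sum>\<^sub>\<infinity>k. f k ?x * Rep_l2 (regular_rep \<phi> g \<bullet>\<^sub>o u) (j - k))"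
  proof (rule infsum_cong)
    fix k
    have "((\<lambda>n. g (n - k) (ereal (of_int (j - k) - \<phi>)) * Rep_l2 u (j - k - (n - k))) has_sum
        Rep_l2 (regular_rep \<phi> g \<bullet>\<^sub>o u) (j - k)) UNIV \<longleftrightarrow>
      ((\<lambda>n. g n (ereal (of_int (j - k) - \<phi>)) * Rep_l2 u (j - k - n)) has_sum
        Rep_l2 (regular_rep \<phi> g \<bullet>\<^sub>o u) (j - k)) UNIV"
      by (rule has_sum_reindex_bij_witness[of _ "\<lambda>n. n + k" "\<lambda>n. n - k"]) auto
    with regular_rep_has_sum[OF g, of "j - k" \<phi> u]
    have "((\<lambda>n. g (n - k) (ereal (of_int (j - k) - \<phi>)) * Rep_l2 u (j - n)) has_sum
        Rep_l2 (regular_rep \<phi> g \<bullet>\<^sub>o u) (j - k)) UNIV" by simp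
    from infsumI[OF has_sum_cmult_right[OF this, of "f k ?x"]]
    show "(\<Sum>\<^sub>\<infinity>n. ?t k n) = f k ?x * Rep_l2 (regular_rep \<phi> g \<bullet>\<^sub>o u) (j - k)"
      unfolding x by (simp only: mult.assoc)
  qed
  also have "\<dots> = Rep_l2 ((regular_rep \<phi> f * regular_rep \<phi> g) \<bullet>\<^sub>o u) j"
    by (simp add: Rep_regular_rep[OF f])
  finally show "Rep_l2 (regular_rep \<phi> (f \<otimes>\<^bsub>l1Z\<^esub> g) \<bullet>\<^sub>o u) j = Rep_l2 ((regular_rep \<phi> f * regular_rep \<phi> g) \<bullet>\<^sub>o u) j" .
qed

lemma regular_rep_star_hom: "regular_rep \<phi> \<in> star_hom l1Z bounded_operators"
  unfolding star_hom_def
  by (auto simp: l1Z_simps(4,5) regular_rep_add regular_rep_mult regular_rep_scale regular_rep_adjoint)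


section \<open>The enveloping seminorm is the supremum of the regular representation norms\<close>

section \<open>Amenability of the integers\<close>

text \<open>Bounds of sesquilinear forms are stated additively: by homogeneity this is the same as
  the bound by a product of norms, but it is stable under sums without the Cauchy--Schwarz inequality.\<close>

definition form_bound :: "real \<Rightarrow> int set \<Rightarrow> int set \<Rightarrow> (int \<Rightarrow> int \<Rightarrow> complex) \<Rightarrow> bool" where
  "form_bound c J M a \<longleftrightarrow> (\<forall>u v. cmod (\<Sum>j\<in>J. \<Sum>m\<in>M. a j m * (u m * cnj (v j))) \<le>
     c / 2 * ((\<Sum>m\<in>M. (cmod (u m))\<^sup>2) + (\<Sum>j\<in>J. (cmod (v j))\<^sup>2)))"

lemma l2_cinner_has_sum: "((\<lambda>i. Rep_l2 u i * cnj (Rep_l2 v i)) has_sum cinner u v) UNIV"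
  unfolding cinner_l2.rep_eq by (intro has_sum_infsum l2_product_summable l2_summable)

lemma has_sum_finite_sum:
  fixes f :: "'k \<Rightarrow> 'i \<Rightarrow> 'a::{topological_comm_monoid_add}"
  assumes "finite K" "\<And>k. k \<in> K \<Longrightarrow> (f k has_sum s k) A"
  shows "((\<lambda>i. \<Sum>k\<in>K. f k i) has_sum (\<Sum>k\<in>K. s k)) A"
  using assms by (induction K) (auto intro!: has_sum_add)

text \<open>Amplification to l2-valued vectors keeps the bound of a scalar matrix: apply the scalar
  bound to each coordinate and sum. The additive form is what survives this summation.\<close>

lemma form_bound_vectors:
  fixes \<xi> \<eta> :: "int \<Rightarrow> 'i l2"
  assumes "form_bound c J M a" "finite J" "finite M"
  shows "cmod (\<Sum>j\<in>J. \<Sum>m\<in>M. a j m * cinner (\<xi> m) (\<eta> j)) \<le>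
    c / 2 * ((\<Sum>m\<in>M. (norm (\<xi> m))\<^sup>2) + (\<Sum>j\<in>J. (norm (\<eta> j))\<^sup>2))"
proof (rule norm_infsum_le)
  show "((\<lambda>i. \<Sum>j\<in>J. \<Sum>m\<in>M. a j m * (Rep_l2 (\<xi> m) i * cnj (Rep_l2 (\<eta> j) i))) has_sum
      (\<Sum>j\<in>J. \<Sum>m\<in>M. a j m * cinner (\<xi> m) (\<eta> j))) UNIV"
    by (intro has_sum_finite_sum assms has_sum_cmult_right l2_cinner_has_sum)
  show "((\<lambda>i. c / 2 * ((\<Sum>m\<in>M. (cmod (Rep_l2 (\<xi> m) i))\<^sup>2) + (\<Sum>j\<in>J. (cmod (Rep_l2 (\<eta> j) i))\<^sup>2))) has_sum
      c / 2 * ((\<Sum>m\<in>M. (norm (\<xi> m))\<^sup>2) + (\<Sum>j\<in>J. (norm (\<eta> j))\<^sup>2))) UNIV"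
    by (intro has_sum_cmult_right has_sum_add has_sum_finite_sum assms l2_norm_has_sum)
qed (use assms(1) in \<open>simp add: form_bound_def\<close>)

text \<open>Recovers an operator bound from the additive form: take \<eta> in the direction of T
  \<xi> and rescale it to the length of \<xi>, where the mean of the squares equals the product of
  the norms.\<close>

lemma norm_le_of_form:
  fixes T :: "'h::complex_inner cbop"
  assumes "0 \<le> c" "\<And>\<xi> \<eta>. cmod (cinner (T \<bullet>\<^sub>o \<xi>) \<eta>) \<le> c / 2 * ((norm \<xi>)\<^sup>2 + (norm \<eta>)\<^sup>2)"
  shows "norm T \<le> c"
proof (rule norm_cbop_bound[OF assms(1)])
  fix \<xi>
  show "norm (T \<bullet>\<^sub>o \<xi>) \<le> c * norm \<xi>"
  proof (cases "T \<bullet>\<^sub>o \<xi> = 0")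
    case True
    then show ?thesis using assms(1) by simp
  next
    case False
    then have t: "0 < norm (T \<bullet>\<^sub>o \<xi>)" by simp
    have "\<xi> \<noteq> 0" using False by auto
    define s where "s = norm \<xi> / norm (T \<bullet>\<^sub>o \<xi>)"
    define \<eta> where "\<eta> = of_real s *\<^sub>C (T \<bullet>\<^sub>o \<xi>)"
    have "norm \<eta> = norm \<xi>" using t by (simp add: \<eta>_def norm_scaleC s_def norm_divide)
    moreover have "cinner (T \<bullet>\<^sub>o \<xi>) \<eta> = of_real (s * (norm (T \<bullet>\<^sub>o \<xi>))\<^sup>2)"
      by (simp add: \<eta>_def cinner_scaleC_right cinner_self)
    moreover have "s * (norm (T \<bullet>\<^sub>o \<xi>))\<^sup>2 = norm \<xi> * norm (T \<bullet>\<^sub>o \<xi>)"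
      using t by (simp add: s_def power2_eq_square)
    ultimately have "norm \<xi> * norm (T \<bullet>\<^sub>o \<xi>) \<le> c * (norm \<xi>)\<^sup>2"
      using assms(2)[of \<xi> \<eta>] by (simp add: norm_mult)
    then have "norm \<xi> * norm (T \<bullet>\<^sub>o \<xi>) \<le> norm \<xi> * (c * norm \<xi>)"
      by (simp add: power2_eq_square mult_ac)
    then show ?thesis using \<open>\<xi> \<noteq> 0\<close> by simp
  qed
qed

definition finite_vector :: "'i set \<Rightarrow> ('i \<Rightarrow> complex) \<Rightarrow> 'i l2" where
  "finite_vector M u = Abs_l2 (\<lambda>i. if i \<in> M then u i else 0)"

lemma
  assumes "finite M"
  shows Rep_finite_vector: "Rep_l2 (finite_vector M u) i = (if i \<in> M then u i else 0)"
    and norm_finite_vector: "(norm (finite_vector M u))\<^sup>2 = (\<Sum>m\<in>M. (cmod (u m))\<^sup>2)"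
proof -
  have s: "((\<lambda>i. (cmod (if i \<in> M then u i else 0))\<^sup>2) has_sum (\<Sum>m\<in>M. (cmod (u m))\<^sup>2)) UNIV"
    by (rule has_sum_finite_neutralI[OF assms]) auto
  show R: "Rep_l2 (finite_vector M u) i = (if i \<in> M then u i else 0)" for i
    unfolding finite_vector_def by (subst Abs_l2_inverse) (use s in \<open>auto simp: summable_on_def\<close>)
  show "(norm (finite_vector M u))\<^sup>2 = (\<Sum>m\<in>M. (cmod (u m))\<^sup>2)"
    using has_sum_unique[OF l2_norm_has_sum[of "finite_vector M u"]] s by (simp add: R)
qed

context
  fixes f and c :: real
  assumes f: "f \<in> carrier l1Z"
begin

text \<open>The form is a finite compression of \<open>regular_rep\<close>: row j, column m holds
  the coefficient of index j - m, sampled at j - phi.\<close>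

lemma form_bound_regular_rep:
  assumes "norm (regular_rep \<phi> f) \<le> c" "finite J" "finite M"
  shows "form_bound c J M (\<lambda>j m. f (j - m) (ereal (of_int j - \<phi>)))"
  unfolding form_bound_def
proof (intro allI)
  fix u v :: "int \<Rightarrow> complex"
  define U V where "U = finite_vector M u" and "V = finite_vector J v"
  have "Rep_l2 (regular_rep \<phi> f \<bullet>\<^sub>o U) j = (\<Sum>m\<in>M. f (j - m) (ereal (of_int j - \<phi>)) * u m)" for j
  proof -
    have "Rep_l2 (regular_rep \<phi> f \<bullet>\<^sub>o U) j = (\<Sum>\<^sub>\<infinity>k. f k (ereal (of_int j - \<phi>)) * Rep_l2 U (j - k))"
      by (rule Rep_regular_rep[OF f])
    also have "\<dots> = (\<Sum>\<^sub>\<infinity>m. f (j - m) (ereal (of_int j - \<phi>)) * Rep_l2 U (j - (j - m)))"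
      by (rule infsum_reindex_bij_betw[symmetric], rule bij_betwI[of _ _ _ "\<lambda>k. j - k"]) auto
    also have "\<dots> = (\<Sum>\<^sub>\<infinity>m\<in>M. f (j - m) (ereal (of_int j - \<phi>)) * u m)"
      by (rule infsum_cong_neutral) (auto simp: U_def Rep_finite_vector[OF assms(3)])
    finally show ?thesis using assms(3) by simp
  qed
  note R = this
  have "cinner (regular_rep \<phi> f \<bullet>\<^sub>o U) V = (\<Sum>\<^sub>\<infinity>j\<in>J. (\<Sum>m\<in>M. f (j - m) (ereal (of_int j - \<phi>)) * u m) * cnj (v j))"
    unfolding cinner_l2.rep_eq R by (rule infsum_cong_neutral) (auto simp: V_def Rep_finite_vector[OF assms(2)])
  then have "cinner (regular_rep \<phi> f \<bullet>\<^sub>o U) V = (\<Sum>j\<in>J. \<Sum>m\<in>M. f (j - m) (ereal (of_int j - \<phi>)) * (u m * cnj (v j)))"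
    using assms(2) by (simp add: sum_distrib_right mult.assoc)
  moreover have "cmod (cinner (regular_rep \<phi> f \<bullet>\<^sub>o U) V) \<le> c / 2 * ((norm U)\<^sup>2 + (norm V)\<^sup>2)"
  proof -
    have "0 \<le> c" using order_trans[OF norm_ge_zero assms(1)] .
    have "cmod (cinner (regular_rep \<phi> f \<bullet>\<^sub>o U) V) \<le> norm (regular_rep \<phi> f \<bullet>\<^sub>o U) * norm V"
      by (rule cinner_cauchy_schwarz)
    also have "\<dots> \<le> (c * norm U) * norm V"
      by (intro mult_right_mono order_trans[OF norm_cbop_apply] assms(1) norm_ge_zero)
    also have "\<dots> = c / 2 * (2 * norm U * norm V)" by simp
    also have "\<dots> \<le> c / 2 * ((norm U)\<^sup>2 + (norm V)\<^sup>2)"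
      using \<open>0 \<le> c\<close> by (intro mult_left_mono sum_squares_bound) simp
    finally show ?thesis .
  qed
  ultimately show "cmod (\<Sum>j\<in>J. \<Sum>m\<in>M. f (j - m) (ereal (of_int j - \<phi>)) * (u m * cnj (v j))) \<le>
      c / 2 * ((\<Sum>m\<in>M. (cmod (u m))\<^sup>2) + (\<Sum>j\<in>J. (cmod (v j))\<^sup>2))"
    by (simp add: U_def V_def norm_finite_vector assms(2,3))
qed

text \<open>Only one phi in each class modulo 1 is controlled; translating both index sets by p
  compensates for that choice. This covers all real base points, and as the left side is continuous
  in x, density extends the bound to the infinite ones.\<close>

lemma form_bound_all_points:
  assumes "\<And>r. \<exists>p::int. norm (regular_rep (of_int p - r) f) \<le> c" "finite J" "finite M"
  shows "form_bound c J M (\<lambda>j m. f (j - m) (x + ereal (of_int j)))"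
proof -
  have real: "form_bound c J M (\<lambda>j m. f (j - m) (ereal r + ereal (of_int j)))" for r
    unfolding form_bound_def
  proof (intro allI)
    fix u v :: "int \<Rightarrow> complex"
    obtain p :: int where p: "norm (regular_rep (of_int p - r) f) \<le> c" using assms(1) by blast
    have inj: "inj_on (\<lambda>j. j + p) S" for S by (simp add: inj_on_def)
    have "form_bound c ((\<lambda>j. j + p) ` J) ((\<lambda>j. j + p) ` M) (\<lambda>j m. f (j - m) (ereal (of_int j - (of_int p - r))))"
      by (rule form_bound_regular_rep[OF p]) (use assms in auto)
    then have "cmod (\<Sum>j\<in>(\<lambda>j. j + p) ` J. \<Sum>m\<in>(\<lambda>j. j + p) ` M. f (j - m) (ereal (of_int j - (of_int p - r))) *
          (u (m - p) * cnj (v (j - p)))) \<le>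
        c / 2 * ((\<Sum>m\<in>(\<lambda>j. j + p) ` M. (cmod (u (m - p)))\<^sup>2) + (\<Sum>j\<in>(\<lambda>j. j + p) ` J. (cmod (v (j - p)))\<^sup>2))"
      unfolding form_bound_def by (elim allE)
    then show "cmod (\<Sum>j\<in>J. \<Sum>m\<in>M. f (j - m) (ereal r + ereal (of_int j)) * (u m * cnj (v j))) \<le>
        c / 2 * ((\<Sum>m\<in>M. (cmod (u m))\<^sup>2) + (\<Sum>j\<in>J. (cmod (v j))\<^sup>2))"
      by (simp add: sum.reindex[OF inj] add.commute)
  qed
  show ?thesis
    unfolding form_bound_def
  proof (intro allI)
    fix u v :: "int \<Rightarrow> complex"
    let ?L = "\<lambda>x. cmod (\<Sum>j\<in>J. \<Sum>m\<in>M. f (j - m) (x + ereal (of_int j)) * (u m * cnj (v j)))"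
    let ?R = "c / 2 * ((\<Sum>m\<in>M. (cmod (u m))\<^sup>2) + (\<Sum>j\<in>J. (cmod (v j))\<^sup>2))"
    have "continuous_on UNIV (\<lambda>x. f (j - m) (x + ereal (of_int j)))" for j m
      using continuous_on_compose_shift[OF l1Z_continuous[OF f], of "j - m" "- of_int j"] by (simp add: minus_ereal_def)
    then have cont: "continuous_on UNIV ?L"
      by (intro continuous_on_norm continuous_on_sum continuous_on_mult continuous_on_const)
    then have "continuous_on {0..1} (\<lambda>t. ?L (ereal_param t))"
      by (rule continuous_on_compose2[OF _ continuous_on_subset[OF continuous_on_ereal_param]]) auto
    moreover have "?L (ereal_param t) \<le> ?R" if "t \<in> {0<..<1}" for t
    proof -
      have "ereal_param t = ereal (ln (t / (1 - t)))" using that by (simp add: ereal_param_def)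
      then show ?thesis using real[of "ln (t / (1 - t))"] unfolding form_bound_def by simp
    qed
    moreover obtain t where "t \<in> {0..1}" "ereal_param t = x" using ereal_param_surj by blast
    ultimately show "?L x \<le> ?R"
      using continuous_le_on_closure[of "{0<..<1}" "\<lambda>t. ?L (ereal_param t)" t ?R] by auto
  qed
qed

end

text \<open>A continuous bijection from a compact interval onto a Hausdorff space has a continuous
  inverse.\<close>

lemma ereal_param_inverse: "\<exists>\<tau>. continuous_on UNIV \<tau> \<and> (\<forall>x. \<tau> x \<in> {0..1} \<and> ereal_param (\<tau> x) = x)"
proof -
  define \<tau> where "\<tau> = inv_into {0..1} ereal_param"
  have inj: "inj_on ereal_param {0..1}"
  proof (rule inj_onI)
    fix s t assume st: "s \<in> {0..1}" "t \<in> {0..1}" "ereal_param s = ereal_param t"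
    show "s = t"
    proof (cases "0 < s \<and> s < 1 \<and> 0 < t \<and> t < 1")
      case True
      then have "ln (s / (1 - s)) = ln (t / (1 - t))" using st(3) by (simp add: ereal_param_def)
      then have "s / (1 - s) = t / (1 - t)" using True by (subst (asm) ln_inj_iff) auto
      then show ?thesis using True by (simp add: field_simps)
    next
      case False
      then show ?thesis using st by (auto simp: ereal_param_def split: if_splits)
    qed
  qed
  have im: "ereal_param ` {0..1} = UNIV"
  proof -
    have "x \<in> ereal_param ` {0..1}" for x
      using ereal_param_surj[of x] by (auto simp: image_iff)
    then show ?thesis by blast
  qed
  have "continuous_on (ereal_param ` {0..1}) \<tau>"
    by (rule continuous_on_inv[OF continuous_on_subset[OF continuous_on_ereal_param]])
      (auto simp: \<tau>_def inv_into_f_f[OF inj])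
  moreover have "\<tau> x \<in> {0..1}" "ereal_param (\<tau> x) = x" for x
    unfolding \<tau>_def using im by (auto intro: inv_into_into f_inv_into_f simp del: atLeastAtMost_iff)
  ultimately show ?thesis unfolding im by blast
qed

text \<open>Bernstein polynomials, transported by the inverse of \<open>ereal_param\<close>, are
  nonnegative and add up to 1, and one degree n serves all functions of a finite family. Real and
  imaginary part each get e / 2.\<close>

lemma C_ext_partition_of_unity:
  fixes a :: "'k \<Rightarrow> ereal \<Rightarrow> complex"
  assumes "finite I" "\<And>k. k \<in> I \<Longrightarrow> continuous_on UNIV (a k)" "0 < e"
  shows "\<exists>(n::nat) h y. (\<forall>l. continuous_on UNIV (h l) \<and> (\<forall>x. 0 \<le> h l x)) \<and> (\<forall>x::ereal. (\<Sum>l\<le>n. h l x) = (1::real)) \<and>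
    (\<forall>k\<in>I. \<forall>x. cmod (a k x - (\<Sum>l\<le>n. of_real (h l x) * a k (y l))) \<le> e)"
proof -
  obtain \<tau> where \<tau>: "continuous_on UNIV \<tau>" "\<And>x. \<tau> x \<in> {0..1}" "\<And>x. ereal_param (\<tau> x) = x"
    using ereal_param_inverse by blast
  have B: "\<forall>\<^sub>F n in sequentially. \<forall>t\<in>{0..1}. \<bar>g t - (\<Sum>l\<le>n. g (l / n) * Bernstein n l t)\<bar> < e / 2"
    if g: "continuous_on {0..1} g" for g
  proof -
    obtain N where "\<forall>n x. N \<le> n \<and> x \<in> {0..1} \<longrightarrow> \<bar>g x - (\<Sum>k\<le>n. g (k / n) * Bernstein n k x)\<bar> < e / 2"
      using Bernstein_Weierstrass[OF g, of "e / 2"] \<open>0 < e\<close> by auto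
    then show ?thesis unfolding eventually_sequentially by blast
  qed
  have "\<forall>\<^sub>F n in sequentially. \<forall>k\<in>I.
      (\<forall>t\<in>{0..1}. \<bar>Re (a k (ereal_param t)) - (\<Sum>l\<le>n. Re (a k (ereal_param (l / n))) * Bernstein n l t)\<bar> < e / 2) \<and>
      (\<forall>t\<in>{0..1}. \<bar>Im (a k (ereal_param t)) - (\<Sum>l\<le>n. Im (a k (ereal_param (l / n))) * Bernstein n l t)\<bar> < e / 2)"
  proof (intro eventually_ball_finite[OF assms(1)] ballI eventually_conj)
    fix k assume "k \<in> I"
    have "continuous_on {0..1} (\<lambda>t. a k (ereal_param t))"
      by (rule continuous_on_compose2[OF assms(2)[OF \<open>k \<in> I\<close>] continuous_on_subset[OF continuous_on_ereal_param]]) auto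
    then show "\<forall>\<^sub>F n in sequentially. \<forall>t\<in>{0..1}. \<bar>Re (a k (ereal_param t)) - (\<Sum>l\<le>n. Re (a k (ereal_param (l / n))) * Bernstein n l t)\<bar> < e / 2"
      "\<forall>\<^sub>F n in sequentially. \<forall>t\<in>{0..1}. \<bar>Im (a k (ereal_param t)) - (\<Sum>l\<le>n. Im (a k (ereal_param (l / n))) * Bernstein n l t)\<bar> < e / 2"
      by (intro B continuous_on_Re continuous_on_Im; assumption)+
  qed
  then obtain n where n: "\<And>k t. k \<in> I \<Longrightarrow> t \<in> {0..1} \<Longrightarrow>
      \<bar>Re (a k (ereal_param t)) - (\<Sum>l\<le>n. Re (a k (ereal_param (l / n))) * Bernstein n l t)\<bar> < e / 2 \<and>
      \<bar>Im (a k (ereal_param t)) - (\<Sum>l\<le>n. Im (a k (ereal_param (l / n))) * Bernstein n l t)\<bar> < e / 2"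
    unfolding eventually_sequentially by blast
  have "cmod (a k x - (\<Sum>l\<le>n. of_real (Bernstein n l (\<tau> x)) * a k (ereal_param (l / n)))) \<le> e" if "k \<in> I" for k x
  proof -
    let ?z = "a k x - (\<Sum>l\<le>n. of_real (Bernstein n l (\<tau> x)) * a k (ereal_param (l / n)))"
    have "\<bar>Re ?z\<bar> < e / 2" "\<bar>Im ?z\<bar> < e / 2"
      using n[OF that \<tau>(2)[of x]] unfolding \<tau>(3) by (simp_all add: mult.commute)
    then show ?thesis using cmod_le[of ?z] by linarith
  qed
  moreover have "continuous_on UNIV (\<lambda>x. Bernstein n l (\<tau> x))" for l
    unfolding Bernstein_def by (intro continuous_intros \<tau>(1))
  moreover have "0 \<le> Bernstein n l (\<tau> x)" for l x
    using \<tau>(2)[of x] by (intro Bernstein_nonneg) auto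
  ultimately show ?thesis
    by (intro exI[of _ n] exI[of _ "\<lambda>l x. Bernstein n l (\<tau> x)"] exI[of _ "\<lambda>l. ereal_param (real l / real n)"]) simp
qed

text \<open>The element usually written a U^k, with U the canonical unitary that implements the
  translation.\<close>

definition single :: "int \<Rightarrow> (ereal \<Rightarrow> complex) \<Rightarrow> int \<Rightarrow> ereal \<Rightarrow> complex" where
  "single k a = (\<lambda>n x. if n = k then a x else 0)"

lemma single_closed:
  assumes "continuous_on UNIV a"
  shows "single k a \<in> carrier l1Z" "l1norm (single k a) = supnorm a"
proof -
  have s: "((\<lambda>n. supnorm (single k a n)) has_sum supnorm a) UNIV"
    by (rule has_sum_finite_neutralI[of "{k}"]) (auto simp: single_def supnorm_zero)
  have "continuous_on UNIV (single k a n)" for n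
    using assms by (cases "n = k") (auto simp: single_def)
  then show "single k a \<in> carrier l1Z" using s by (auto simp: l1Z_carrier summable_on_def)
  show "l1norm (single k a) = supnorm a" using infsumI[OF s] by (simp add: l1norm_def)
qed

lemma single_mult:
  assumes "continuous_on UNIV a" "continuous_on UNIV b"
  shows "single j a \<otimes>\<^bsub>l1Z\<^esub> single k b = single (j + k) (\<lambda>x. a x * b (x - ereal (of_int j)))"
proof (intro ext)
  fix n x
  have "(single j a \<otimes>\<^bsub>l1Z\<^esub> single k b) n x = (\<Sum>\<^sub>\<infinity>i. single j a i x * single k b (n - i) (x - ereal (of_int i)))"
    by (simp only: l1Z_mult[OF single_closed(1)[OF assms(1)] single_closed(1)[OF assms(2)]])
  also have "\<dots> = (\<Sum>\<^sub>\<infinity>i\<in>{j}. single j a i x * single k b (n - i) (x - ereal (of_int i)))"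
    by (rule infsum_cong_neutral) (auto simp: single_def)
  also have "\<dots> = single (j + k) (\<lambda>x. a x * b (x - ereal (of_int j))) n x"
    by (auto simp: single_def)
  finally show "(single j a \<otimes>\<^bsub>l1Z\<^esub> single k b) n x = single (j + k) (\<lambda>x. a x * b (x - ereal (of_int j))) n x" .
qed

lemma single_invol:
  assumes "continuous_on UNIV a"
  shows "invol l1Z (single k a) = single (- k) (\<lambda>x. cnj (a (x + ereal (of_int k))))"
  unfolding l1Z_invol[OF single_closed(1)[OF assms]]
  by (auto simp: single_def fun_eq_iff minus_ereal_def)

locale l1Z_rep =
  fixes \<pi> :: "(int \<Rightarrow> ereal \<Rightarrow> complex) \<Rightarrow> 'i l2 cbop"
  assumes rep: "\<pi> \<in> star_hom l1Z bounded_operators"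
begin

lemma rep_add: "f \<in> carrier l1Z \<Longrightarrow> g \<in> carrier l1Z \<Longrightarrow> \<pi> (\<lambda>n x. f n x + g n x) = \<pi> f + \<pi> g"
  and rep_mult: "f \<in> carrier l1Z \<Longrightarrow> g \<in> carrier l1Z \<Longrightarrow> \<pi> (f \<otimes>\<^bsub>l1Z\<^esub> g) = \<pi> f * \<pi> g"
  and rep_scale: "f \<in> carrier l1Z \<Longrightarrow> \<pi> (\<lambda>n x. c * f n x) = cbop_scale c (\<pi> f)"
  and rep_adjoint: "f \<in> carrier l1Z \<Longrightarrow> \<pi> (invol l1Z f) = cbop_adjoint (\<pi> f)"
  using rep by (auto simp: star_hom_def l1Z_simps(4,5))

lemma rep_zero: "\<pi> (\<lambda>n x. 0) = 0"
  using rep_add[OF l1Z_zero_closed l1Z_zero_closed] by simp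

lemma rep_diff:
  assumes "f \<in> carrier l1Z" "g \<in> carrier l1Z"
  shows "\<pi> (\<lambda>n x. f n x - g n x) = \<pi> f - \<pi> g"
  using rep_add[OF assms(1) l1Z_scale_closed(1)[OF assms(2), of "- 1"]] rep_scale[OF assms(2), of "- 1"]
  by (simp add: minus_cbop_def uminus_cbop_def)

text \<open>Automatic continuity by the quasi-inverse argument, with the Neumann series now summed
  in l1. It also bounds the supremum that defines the enveloping seminorm.\<close>

lemma norm_rep_le_l1norm:
  assumes f: "f \<in> carrier l1Z"
  shows "norm (\<pi> f) \<le> l1norm f"
proof (rule norm_le_of_quasi_inverse[OF l1norm_nonneg[OF f]])
  fix r assume r: "l1norm f < r"
  then have "0 < r" using l1norm_nonneg[OF f] by linarith
  note s = l1Z_invol_closed[OF f]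
  note p = l1Z_mult_closed[OF s(1) f]
  define h where "h = (\<lambda>n x. of_real (1 / r\<^sup>2) * (invol l1Z f \<otimes>\<^bsub>l1Z\<^esub> f) n x)"
  have h: "h \<in> carrier l1Z" unfolding h_def by (rule l1Z_scale_closed(1)[OF p(1)])
  have "l1norm (invol l1Z f \<otimes>\<^bsub>l1Z\<^esub> f) < r\<^sup>2"
    using p(2) mult_strict_mono'[OF r r l1norm_nonneg[OF f] l1norm_nonneg[OF f]]
    by (simp add: s(2) power2_eq_square)
  moreover have "l1norm h = (1 / r\<^sup>2) * l1norm (invol l1Z f \<otimes>\<^bsub>l1Z\<^esub> f)"
    unfolding h_def l1Z_scale_closed(2)[OF p(1)] by (simp only: norm_of_real) simp
  ultimately have "l1norm h < 1" using \<open>0 < r\<close> by simp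
  from l1Z_quasi_inverse[OF h this] obtain g where g: "g \<in> carrier l1Z" "g = h \<oplus>\<^bsub>l1Z\<^esub> (h \<otimes>\<^bsub>l1Z\<^esub> g)" by blast
  have "\<pi> g = \<pi> h + \<pi> h * \<pi> g"
    using arg_cong[OF g(2), of \<pi>] rep_add[OF h l1Z_mult_closed(1)[OF h g(1)]]
    by (simp add: l1Z_simps(4) rep_mult[OF h g(1)])
  moreover have "\<pi> h = (1 / r\<^sup>2) *\<^sub>R (cbop_adjoint (\<pi> f) * \<pi> f)"
    unfolding h_def scaleR_cbop_def rep_scale[OF p(1)] rep_mult[OF s(1) f] rep_adjoint[OF f] ..
  ultimately show "\<exists>G. G = (1 / r\<^sup>2) *\<^sub>R (cbop_adjoint (\<pi> f) * \<pi> f) + (1 / r\<^sup>2) *\<^sub>R (cbop_adjoint (\<pi> f) * \<pi> f) * G"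
    by metis
qed

definition \<rho> :: "(ereal \<Rightarrow> complex) \<Rightarrow> 'i l2 cbop" where
  "\<rho> a = \<pi> (single 0 a)"

lemma rho_norm: "continuous_on UNIV a \<Longrightarrow> norm (\<rho> a) \<le> supnorm a"
  unfolding \<rho>_def using norm_rep_le_l1norm[OF single_closed(1)] single_closed(2) by metis

lemma rho_mult: "continuous_on UNIV a \<Longrightarrow> continuous_on UNIV b \<Longrightarrow> \<rho> (\<lambda>x. a x * b x) = \<rho> a * \<rho> b"
  unfolding \<rho>_def by (simp add: rep_mult[symmetric] single_closed single_mult zero_ereal_def[symmetric])

lemma rho_add: "continuous_on UNIV a \<Longrightarrow> continuous_on UNIV b \<Longrightarrow> \<rho> (\<lambda>x. a x + b x) = \<rho> a + \<rho> b"
proof -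
  have "single 0 (\<lambda>x. a x + b x) = (\<lambda>n x. single 0 a n x + single 0 b n x)" by (auto simp: single_def fun_eq_iff)
  then show "continuous_on UNIV a \<Longrightarrow> continuous_on UNIV b \<Longrightarrow> ?thesis"
    unfolding \<rho>_def by (simp only: rep_add single_closed(1))
qed

lemma rho_scale: "continuous_on UNIV a \<Longrightarrow> \<rho> (\<lambda>x. c * a x) = cbop_scale c (\<rho> a)"
proof -
  have "single 0 (\<lambda>x. c * a x) = (\<lambda>n x. c * single 0 a n x)" by (auto simp: single_def fun_eq_iff)
  then show "continuous_on UNIV a \<Longrightarrow> ?thesis"
    unfolding \<rho>_def by (simp only: rep_scale single_closed(1))
qed

lemma rho_adjoint: "continuous_on UNIV a \<Longrightarrow> cbop_adjoint (\<rho> a) = \<rho> (\<lambda>x. cnj (a x))"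
  unfolding \<rho>_def by (simp add: rep_adjoint[symmetric] single_closed single_invol zero_ereal_def[symmetric])

lemma rho_sum:
  "finite L \<Longrightarrow> (\<And>l. l \<in> L \<Longrightarrow> continuous_on UNIV (h l)) \<Longrightarrow> \<rho> (\<lambda>x. \<Sum>l\<in>L. h l x) = (\<Sum>l\<in>L. \<rho> (h l))"
proof (induction L rule: finite_induct)
  case empty
  have "single 0 (\<lambda>x. 0) = (\<lambda>n x. 0)" by (auto simp: single_def fun_eq_iff)
  then show ?case by (simp add: \<rho>_def rep_zero)
next
  case (insert l L)
  then show ?case by (simp add: rho_add continuous_on_sum)
qed

text \<open>Square roots of the partition functions distribute each piece over both arguments,
  giving scalar forms in \<rho>(sqrt h) \<xi> and \<rho>(sqrt h) \<eta>; the squared norms of these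
  vectors add up to at most those of the original ones. The approximation error e Q disappears at
  the end.\<close>

lemma rho_form_bound:
  fixes a :: "int \<Rightarrow> int \<Rightarrow> ereal \<Rightarrow> complex"
  assumes fin: "finite J" "finite M" and a: "\<And>j m. continuous_on UNIV (a j m)" and "0 \<le> c"
    and bound: "\<And>x. form_bound c J M (\<lambda>j m. a j m x)"
  shows "cmod (\<Sum>j\<in>J. \<Sum>m\<in>M. cinner (\<rho> (a j m) \<bullet>\<^sub>o \<xi> m) (\<eta> j)) \<le>
    c / 2 * ((\<Sum>m\<in>M. (norm (\<xi> m))\<^sup>2) + (\<Sum>j\<in>J. (norm (\<eta> j))\<^sup>2))"
    (is "?L \<le> ?R")
proof -
  define Q where "Q = (\<Sum>j\<in>J. \<Sum>m\<in>M. norm (\<xi> m) * norm (\<eta> j))"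
  have "0 \<le> Q" unfolding Q_def by (intro sum_nonneg mult_nonneg_nonneg norm_ge_zero)
  have le: "?L \<le> e * Q + ?R" if "0 < e" for e
  proof -
    obtain n :: nat and h y where hy: "\<forall>l. continuous_on UNIV (h l) \<and> (\<forall>x. 0 \<le> h l x)"
        "\<forall>x::ereal. (\<Sum>l\<le>n. h l x) = (1::real)"
        "\<forall>k\<in>J \<times> M. \<forall>x. cmod (a (fst k) (snd k) x - (\<Sum>l\<le>n. of_real (h l x) * a (fst k) (snd k) (y l))) \<le> e"
      using C_ext_partition_of_unity[of "J \<times> M" "\<lambda>k. a (fst k) (snd k)" e, OF finite_cartesian_product[OF fin] a \<open>0 < e\<close>]
      by blast
    have h: "continuous_on UNIV (h l)" "0 \<le> h l x" "(\<Sum>l\<le>n. h l x) = 1" for l x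
      using hy(1,2) by auto
    note y = hy(3)[rule_format]
    define r where "r l x = complex_of_real (sqrt (h l x))" for l x
    have rc: "continuous_on UNIV (r l)" for l
      unfolding r_def[abs_def] by (intro continuous_on_of_real continuous_on_real_sqrt h(1))
    have rr: "r l x * r l x = of_real (h l x)" for l x
      unfolding r_def of_real_mult[symmetric] by (simp add: h(2))
    have hc: "continuous_on UNIV (\<lambda>x. complex_of_real (h l x))" for l
      by (intro continuous_on_of_real h(1))
    have rho_h: "\<rho> (\<lambda>x. of_real (h l x)) = \<rho> (r l) * \<rho> (r l)" for l
      unfolding rr[symmetric] by (rule rho_mult[OF rc rc])
    have radj: "cbop_adjoint (\<rho> (r l)) = \<rho> (r l)" for l
    proof -
      have "(\<lambda>x. cnj (r l x)) = r l" by (simp add: r_def fun_eq_iff)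
      then show ?thesis by (simp only: rho_adjoint[OF rc])
    qed
    have rcin: "cinner (\<rho> (\<lambda>x. of_real (h l x)) \<bullet>\<^sub>o u) v = cinner (\<rho> (r l) \<bullet>\<^sub>o u) (\<rho> (r l) \<bullet>\<^sub>o v)" for l u v
      using cinner_adjoint[of "\<rho> (r l)" "\<rho> (r l) \<bullet>\<^sub>o u" v] by (simp add: rho_h radj)
    \<comment> \<open>An inequality only: the representation may be degenerate, so \<rho>(1) is a
      contraction and not necessarily the identity.\<close>
    have sq: "(\<Sum>l\<le>n. (norm (\<rho> (r l) \<bullet>\<^sub>o u))\<^sup>2) \<le> (norm u)\<^sup>2" for u
    proof -
      have "(\<Sum>l\<le>n. (norm (\<rho> (r l) \<bullet>\<^sub>o u))\<^sup>2) = Re (cinner ((\<Sum>l\<le>n. \<rho> (\<lambda>x. of_real (h l x))) \<bullet>\<^sub>o u) u)"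
        by (simp add: norm_eq_cinner cbop_apply_sum cinner_sum_left rcin)
      also have "(\<Sum>l\<le>n. \<rho> (\<lambda>x. of_real (h l x))) = \<rho> (\<lambda>x. 1)"
        using rho_sum[of "{..n}" "\<lambda>l x. of_real (h l x)"] hc by (simp add: h(3) flip: of_real_sum)
      also have "Re (cinner (\<rho> (\<lambda>x. 1) \<bullet>\<^sub>o u) u) \<le> norm (\<rho> (\<lambda>x. 1) \<bullet>\<^sub>o u) * norm u"
        using complex_Re_le_cmod cinner_cauchy_schwarz by (rule order_trans)
      also have "\<dots> \<le> (1 * norm u) * norm u"
      proof (intro mult_right_mono norm_ge_zero order_trans[OF norm_cbop_apply])
        show "norm (\<rho> (\<lambda>x. 1)) \<le> 1"
          using rho_norm[of "\<lambda>x. 1"] supnorm_le[of "\<lambda>x. 1" 1] by simp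
      qed
      finally show ?thesis by (simp add: power2_eq_square)
    qed
    define b where "b j m x = (\<Sum>l\<le>n. of_real (h l x) * a j m (y l))" for j m x
    have bc: "continuous_on UNIV (b j m)" for j m
      unfolding b_def[abs_def] by (intro continuous_on_sum continuous_on_mult hc continuous_on_const)
    have rho_b: "\<rho> (b j m) = (\<Sum>l\<le>n. cbop_scale (a j m (y l)) (\<rho> (\<lambda>x. of_real (h l x))))" for j m
    proof -
      have "b j m = (\<lambda>x. \<Sum>l\<le>n. a j m (y l) * of_real (h l x))" by (simp add: b_def fun_eq_iff mult.commute)
      then show ?thesis using rho_sum[of "{..n}" "\<lambda>l x. a j m (y l) * of_real (h l x)"] hc
        by (simp add: rho_scale continuous_on_mult_left)
    qed
    have split: "\<rho> (a j m) = \<rho> (\<lambda>x. a j m x - b j m x) + \<rho> (b j m)" for j m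
      using rho_add[of "\<lambda>x. a j m x - b j m x" "b j m"] a bc by (simp add: continuous_on_diff)
    have part1: "cmod (\<Sum>j\<in>J. \<Sum>m\<in>M. cinner (\<rho> (\<lambda>x. a j m x - b j m x) \<bullet>\<^sub>o \<xi> m) (\<eta> j)) \<le> e * Q"
    proof -
      have "cmod (cinner (\<rho> (\<lambda>x. a j m x - b j m x) \<bullet>\<^sub>o \<xi> m) (\<eta> j)) \<le> e * (norm (\<xi> m) * norm (\<eta> j))"
        if "j \<in> J" "m \<in> M" for j m
      proof -
        have "norm (\<rho> (\<lambda>x. a j m x - b j m x)) \<le> supnorm (\<lambda>x. a j m x - b j m x)"
          by (rule rho_norm) (intro continuous_on_diff a bc)
        also have "\<dots> \<le> e" by (rule supnorm_le) (use y[of "(j, m)"] that in \<open>simp add: b_def\<close>)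
        finally have "norm (\<rho> (\<lambda>x. a j m x - b j m x) \<bullet>\<^sub>o \<xi> m) \<le> e * norm (\<xi> m)"
          by (intro order_trans[OF norm_cbop_apply] mult_right_mono) auto
        then have "norm (\<rho> (\<lambda>x. a j m x - b j m x) \<bullet>\<^sub>o \<xi> m) * norm (\<eta> j) \<le> e * norm (\<xi> m) * norm (\<eta> j)"
          by (rule mult_right_mono) simp
        then show ?thesis using cinner_cauchy_schwarz order_trans by (simp add: mult.assoc) blast
      qed
      then show ?thesis unfolding Q_def sum_distrib_left by (intro order_trans[OF norm_sum] sum_mono)
    qed
    have part2: "cmod (\<Sum>j\<in>J. \<Sum>m\<in>M. cinner (\<rho> (b j m) \<bullet>\<^sub>o \<xi> m) (\<eta> j)) \<le> ?R"
    proof -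
      have "(\<Sum>j\<in>J. \<Sum>m\<in>M. cinner (\<rho> (b j m) \<bullet>\<^sub>o \<xi> m) (\<eta> j)) =
          (\<Sum>j\<in>J. \<Sum>m\<in>M. \<Sum>l\<le>n. a j m (y l) * cinner (\<rho> (r l) \<bullet>\<^sub>o \<xi> m) (\<rho> (r l) \<bullet>\<^sub>o \<eta> j))"
        by (simp add: rho_b cbop_apply_sum cinner_sum_left cinner_scaleC_left rcin)
      also have "\<dots> = (\<Sum>j\<in>J. \<Sum>l\<le>n. \<Sum>m\<in>M. a j m (y l) * cinner (\<rho> (r l) \<bullet>\<^sub>o \<xi> m) (\<rho> (r l) \<bullet>\<^sub>o \<eta> j))"
        by (rule sum.cong[OF refl]) (rule sum.swap)
      also have "\<dots> = (\<Sum>l\<le>n. \<Sum>j\<in>J. \<Sum>m\<in>M. a j m (y l) * cinner (\<rho> (r l) \<bullet>\<^sub>o \<xi> m) (\<rho> (r l) \<bullet>\<^sub>o \<eta> j))"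
        by (rule sum.swap)
      also have "cmod \<dots> \<le> (\<Sum>l\<le>n. c / 2 * ((\<Sum>m\<in>M. (norm (\<rho> (r l) \<bullet>\<^sub>o \<xi> m))\<^sup>2) + (\<Sum>j\<in>J. (norm (\<rho> (r l) \<bullet>\<^sub>o \<eta> j))\<^sup>2)))"
        by (intro order_trans[OF norm_sum] sum_mono form_bound_vectors bound fin)
      also have "\<dots> = c / 2 * ((\<Sum>m\<in>M. \<Sum>l\<le>n. (norm (\<rho> (r l) \<bullet>\<^sub>o \<xi> m))\<^sup>2) + (\<Sum>j\<in>J. \<Sum>l\<le>n. (norm (\<rho> (r l) \<bullet>\<^sub>o \<eta> j))\<^sup>2))"
        unfolding sum_distrib_left[symmetric] sum.distrib
        by (simp only: sum.swap[of _ "{..n}" M] sum.swap[of _ "{..n}" J])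
      also have "\<dots> \<le> ?R" using \<open>0 \<le> c\<close> by (intro mult_left_mono add_mono sum_mono sq) simp
      finally show ?thesis .
    qed
    have "(\<Sum>j\<in>J. \<Sum>m\<in>M. cinner (\<rho> (a j m) \<bullet>\<^sub>o \<xi> m) (\<eta> j)) =
        (\<Sum>j\<in>J. \<Sum>m\<in>M. cinner (\<rho> (\<lambda>x. a j m x - b j m x) \<bullet>\<^sub>o \<xi> m) (\<eta> j)) +
        (\<Sum>j\<in>J. \<Sum>m\<in>M. cinner (\<rho> (b j m) \<bullet>\<^sub>o \<xi> m) (\<eta> j))"
      unfolding split by (simp only: apply_simps cinner_add_left sum.distrib)
    then show ?thesis using norm_triangle_mono[OF part1 part2] by simp
  qed
  show ?thesis
  proof (rule field_le_epsilon)
    fix e :: real assume "0 < e"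
    then have "?L \<le> e / (Q + 1) * Q + ?R" using le[of "e / (Q + 1)"] \<open>0 \<le> Q\<close> by simp
    moreover have "e / (Q + 1) * Q \<le> e" using \<open>0 < e\<close> \<open>0 \<le> Q\<close> by (simp add: field_simps)
    ultimately show "?L \<le> ?R + e" by linarith
  qed
qed

lemma rep_finite_support_sum:
  assumes "finite F" "f \<in> carrier l1Z"
  shows "(\<lambda>n x. \<Sum>k\<in>F. single k (f k) n x) \<in> carrier l1Z \<and>
    \<pi> (\<lambda>n x. \<Sum>k\<in>F. single k (f k) n x) = (\<Sum>k\<in>F. \<pi> (single k (f k)))"
  using assms(1)
proof (induction F rule: finite_induct)
  case empty
  then show ?case by (simp add: l1Z_zero_closed rep_zero)
next
  case (insert k F)
  note s = single_closed(1)[OF l1Z_continuous[OF assms(2)], of k k]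
  show ?case using insert rep_add[OF s, of "\<lambda>n x. \<Sum>k\<in>F. single k (f k) n x"]
      l1Z_add_closed(1)[OF s, of "\<lambda>n x. \<Sum>k\<in>F. single k (f k) n x"] by simp
qed

text \<open>The vectors \<open>\<xi>\<close> and \<open>\<eta>\<close> are spread over long intervals of \<open>\<int>\<close> (a Folner sequence).\<close>

lemma norm_rep_le_finite_support:
  fixes K :: nat
  assumes f: "f \<in> carrier l1Z" and supp: "\<And>n. n \<notin> {- int K..int K} \<Longrightarrow> f n = (\<lambda>_. 0)" and "0 \<le> c"
    and bound: "\<And>J M x. finite J \<Longrightarrow> finite M \<Longrightarrow> form_bound c J M (\<lambda>j m. f (j - m) (x + ereal (of_int j)))"
  shows "norm (\<pi> f) \<le> c"
proof (rule norm_le_of_form[OF \<open>0 \<le> c\<close>])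
  fix \<xi> \<eta>
  \<comment> \<open>Images of the canonical unitaries. In a degenerate representation they need not
    be unitary; they are used as contractions whose adjoint is the one of index - k.\<close>
  define V where "V k = \<pi> (single k (\<lambda>_. 1))" for k
  have one: "continuous_on UNIV (\<lambda>_::ereal. 1::complex)" by simp
  have nV: "norm (V k) \<le> 1" for k
    unfolding V_def
    using norm_rep_le_l1norm[OF single_closed(1)[OF one]] single_closed(2)[OF one] supnorm_le[of "\<lambda>_. 1" 1] order_trans by fastforce
  have Vadj: "cbop_adjoint (V k) = V (- k)" for k
    unfolding V_def by (simp add: rep_adjoint[symmetric] single_closed(1)[OF one] single_invol[OF one])
  define g where "g k = cinner (\<pi> (single k (f k)) \<bullet>\<^sub>o \<xi>) \<eta>" for k
  have g0: "g k = 0" if "k \<notin> {- int K..int K}" for k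
  proof -
    have "single k (f k) = (\<lambda>n x. 0)" using supp[OF that] by (auto simp: single_def fun_eq_iff)
    then show ?thesis by (simp add: g_def rep_zero)
  qed
  have fsum: "f = (\<lambda>n x. \<Sum>k\<in>{- int K..int K}. single k (f k) n x)"
  proof (intro ext)
    fix n x
    have "(\<Sum>k\<in>{- int K..int K}. single k (f k) n x) = (\<Sum>k\<in>{- int K..int K}. if n = k then f n x else 0)"
      by (intro sum.cong) (auto simp: single_def)
    also have "\<dots> = f n x"
      using supp[of n] by (cases "n \<in> {- int K..int K}") simp_all
    finally show "f n x = (\<Sum>k\<in>{- int K..int K}. single k (f k) n x)" ..
  qed
  have "\<pi> f = (\<Sum>k\<in>{- int K..int K}. \<pi> (single k (f k)))"
    using rep_finite_support_sum[of "{- int K..int K}" f] f fsum by simp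
  then have gsum: "(\<Sum>k\<in>{- int K..int K}. g k) = cinner (\<pi> f \<bullet>\<^sub>o \<xi>) \<eta>"
    by (simp add: g_def cbop_apply_sum cinner_sum_left)
  define a where "a j m x = f (j - m) (x + ereal (of_int j))" for j m x
  have ac: "continuous_on UNIV (a j m)" for j m
    using continuous_on_compose_shift[OF l1Z_continuous[OF f], of "j - m" "- of_int j"]
    by (simp add: a_def[abs_def] minus_ereal_def)
  \<comment> \<open>Moving V_(-j) to the other side gives V_j \<rho>(a j m) V_(-m); V_j translates
    the coefficient by j, which undoes the shift x + j built into \<open>a\<close>. Every entry thus
    depends on j - m alone.\<close>
  have entry: "cinner (\<rho> (a j m) \<bullet>\<^sub>o V (- m) \<bullet>\<^sub>o \<xi>) (V (- j) \<bullet>\<^sub>o \<eta>) = g (j - m)" for j m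
  proof -
    have x: "x - ereal (of_int j) + ereal (of_int j) = x" for x by (cases x) auto
    have sh: "continuous_on UNIV (\<lambda>x. a j m (x - ereal (of_int j)))" by (rule continuous_on_compose_shift[OF ac])
    have "V j * \<rho> (a j m) * V (- m) = \<pi> ((single j (\<lambda>_. 1) \<otimes>\<^bsub>l1Z\<^esub> single 0 (a j m)) \<otimes>\<^bsub>l1Z\<^esub> single (- m) (\<lambda>_. 1))"
      unfolding V_def \<rho>_def
      by (simp only: rep_mult single_closed(1) one ac l1Z_mult_closed(1))
    also have "(single j (\<lambda>_. 1) \<otimes>\<^bsub>l1Z\<^esub> single 0 (a j m)) \<otimes>\<^bsub>l1Z\<^esub> single (- m) (\<lambda>_. 1) = single (j - m) (f (j - m))"
      using single_mult[OF one ac, of j 0 j m] single_mult[OF sh one, of j "- m"] by (simp add: a_def x)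
    finally have "V j * \<rho> (a j m) * V (- m) = \<pi> (single (j - m) (f (j - m)))" .
    then have "g (j - m) = cinner (V j \<bullet>\<^sub>o \<rho> (a j m) \<bullet>\<^sub>o V (- m) \<bullet>\<^sub>o \<xi>) \<eta>"
      unfolding g_def by (simp flip: apply_simps(4) add: mult.assoc)
    then show ?thesis by (simp add: cinner_adjoint Vadj)
  qed
  have main: "real N * cmod (cinner (\<pi> f \<bullet>\<^sub>o \<xi>) \<eta>) \<le> c / 2 * (real N * (norm \<xi>)\<^sup>2 + (real N + 2 * real K) * (norm \<eta>)\<^sup>2)" for N
  proof -
    \<comment> \<open>J exceeds M by K on both sides, so each m in M meets all differences in
      [-K, K] and the double sum counts the form of \<open>f\<close> exactly N times. The price is
      the ratio (N + 2 K) / N, which tends to 1.\<close>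
    define M where "M = {0..<int N}"
    define J where "J = {- int K..<int N + int K}"
    have "(\<Sum>j\<in>J. \<Sum>m\<in>M. g (j - m)) = (\<Sum>m\<in>M. \<Sum>j\<in>J. g (j - m))" by (rule sum.swap)
    also have "\<dots> = (\<Sum>m\<in>M. \<Sum>k\<in>{- int K..int K}. g k)"
    proof (rule sum.cong[OF refl])
      fix m assume m: "m \<in> M"
      have "(\<Sum>j\<in>J. g (j - m)) = (\<Sum>k\<in>(\<lambda>j. j - m) ` J. g k)"
        by (subst sum.reindex) (auto simp: inj_on_def)
      also have "\<dots> = (\<Sum>k\<in>{- int K..int K}. g k)"
      proof (rule sum.mono_neutral_right)
        show "{- int K..int K} \<subseteq> (\<lambda>j. j - m) ` J"
        proof
          fix k assume "k \<in> {- int K..int K}"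
          then show "k \<in> (\<lambda>j. j - m) ` J"
            using m by (intro image_eqI[of _ _ "k + m"]) (auto simp: J_def M_def)
        qed
      qed (auto simp: J_def g0)
      finally show "(\<Sum>j\<in>J. g (j - m)) = (\<Sum>k\<in>{- int K..int K}. g k)" .
    qed
    also have "\<dots> = of_nat N * cinner (\<pi> f \<bullet>\<^sub>o \<xi>) \<eta>"
      by (simp add: gsum M_def)
    finally have "real N * cmod (cinner (\<pi> f \<bullet>\<^sub>o \<xi>) \<eta>) = cmod (\<Sum>j\<in>J. \<Sum>m\<in>M. cinner (\<rho> (a j m) \<bullet>\<^sub>o V (- m) \<bullet>\<^sub>o \<xi>) (V (- j) \<bullet>\<^sub>o \<eta>))"
      by (simp add: entry norm_mult)
    also have "\<dots> \<le> c / 2 * ((\<Sum>m\<in>M. (norm (V (- m) \<bullet>\<^sub>o \<xi>))\<^sup>2) + (\<Sum>j\<in>J. (norm (V (- j) \<bullet>\<^sub>o \<eta>))\<^sup>2))"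
      unfolding a_def
      by (rule rho_form_bound[OF _ _ ac[unfolded a_def] \<open>0 \<le> c\<close> bound]) (auto simp: J_def M_def)
    also have "\<dots> \<le> c / 2 * ((\<Sum>m\<in>M. (norm \<xi>)\<^sup>2) + (\<Sum>j\<in>J. (norm \<eta>)\<^sup>2))"
    proof -
      have "norm (V k \<bullet>\<^sub>o z) \<le> norm z" for k z
        using order_trans[OF norm_cbop_apply mult_right_mono[OF nV norm_ge_zero]] by simp
      then show ?thesis using \<open>0 \<le> c\<close> by (intro mult_left_mono add_mono sum_mono power_mono) auto
    qed
    also have "\<dots> = c / 2 * (real N * (norm \<xi>)\<^sup>2 + (real N + 2 * real K) * (norm \<eta>)\<^sup>2)"
      by (simp add: M_def J_def)
    finally show ?thesis .
  qed
  show "cmod (cinner (\<pi> f \<bullet>\<^sub>o \<xi>) \<eta>) \<le> c / 2 * ((norm \<xi>)\<^sup>2 + (norm \<eta>)\<^sup>2)"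
  proof (rule LIMSEQ_le_const)
    have "(\<lambda>N. c / 2 * ((norm \<xi>)\<^sup>2 + (1 + 2 * real K * inverse (real N)) * (norm \<eta>)\<^sup>2)) \<longlonglongrightarrow>
        c / 2 * ((norm \<xi>)\<^sup>2 + (1 + 2 * real K * 0) * (norm \<eta>)\<^sup>2)"
      by (intro tendsto_intros lim_inverse_n)
    then show "(\<lambda>N. c / 2 * ((norm \<xi>)\<^sup>2 + (1 + 2 * real K * inverse (real N)) * (norm \<eta>)\<^sup>2)) \<longlonglongrightarrow>
        c / 2 * ((norm \<xi>)\<^sup>2 + (norm \<eta>)\<^sup>2)" by simp
    have "cmod (cinner (\<pi> f \<bullet>\<^sub>o \<xi>) \<eta>) \<le> c / 2 * ((norm \<xi>)\<^sup>2 + (1 + 2 * real K * inverse (real N)) * (norm \<eta>)\<^sup>2)"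
      if "N \<ge> 1" for N
    proof -
      have "real N * cmod (cinner (\<pi> f \<bullet>\<^sub>o \<xi>) \<eta>) \<le>
          real N * (c / 2 * ((norm \<xi>)\<^sup>2 + (1 + 2 * real K * inverse (real N)) * (norm \<eta>)\<^sup>2))"
      proof -
        have "real N * (c / 2 * ((norm \<xi>)\<^sup>2 + (1 + 2 * real K * inverse (real N)) * (norm \<eta>)\<^sup>2)) =
            c / 2 * (real N * (norm \<xi>)\<^sup>2 + (real N + 2 * real K) * (norm \<eta>)\<^sup>2)"
          using that by (simp add: field_simps)
        then show ?thesis using main[of N] by (simp only:)
      qed
      then show ?thesis using that by simp
    qed
    then show "\<exists>N. \<forall>n\<ge>N. cmod (cinner (\<pi> f \<bullet>\<^sub>o \<xi>) \<eta>) \<le>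
        c / 2 * ((norm \<xi>)\<^sup>2 + (1 + 2 * real K * inverse (real n)) * (norm \<eta>)\<^sup>2)" by blast
  qed
qed

end


section \<open>The norm of the crossed product\<close>

lemma finite_support_approximation:
  assumes f: "f \<in> carrier l1Z" and "0 < e"
  shows "\<exists>K::nat. let g = (\<lambda>n x. if n \<in> {- int K..int K} then f n x else 0) in
    g \<in> carrier l1Z \<and> l1norm (\<lambda>n x. f n x - g n x) < e"
proof -
  have s: "(\<lambda>n. supnorm (f n)) summable_on A" for A
    by (rule summable_on_subset_banach[OF l1Z_summable[OF f] subset_UNIV])
  have "((\<lambda>F. \<Sum>n\<in>F. supnorm (f n)) \<longlongrightarrow> l1norm f) (finite_subsets_at_top UNIV)"
    unfolding l1norm_def by (rule infsum_tendsto[OF s])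
  from order_tendstoD(1)[OF this, of "l1norm f - e"] \<open>0 < e\<close>
  obtain F where F: "finite F" "l1norm f - e < (\<Sum>n\<in>F. supnorm (f n))"
    unfolding eventually_finite_subsets_at_top by auto
  define K where "K = nat (Max (insert 0 (abs ` F)))"
  define I where "I = {- int K..int K}"
  have "F \<subseteq> I"
  proof
    fix n assume "n \<in> F"
    then have "\<bar>n\<bar> \<le> Max (insert 0 (abs ` F))" using F(1) by (intro Max_ge) auto
    then show "n \<in> I" by (auto simp: I_def K_def)
  qed
  define g where "g = (\<lambda>n x. if n \<in> I then f n x else 0)"
  have gn: "g n = (if n \<in> I then f n else (\<lambda>_. 0))" for n by (simp add: g_def)
  have c: "continuous_on UNIV (g n)" for n using l1Z_continuous[OF f, of n] by (simp add: gn)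
  have gl: "g \<in> carrier l1Z"
    unfolding l1Z_carrier
    by (intro conjI allI c summable_on_comparison_test[OF s[of UNIV]])
      (auto simp: gn supnorm_zero supnorm_nonneg l1Z_continuous[OF f])
  have "l1norm (\<lambda>n x. f n x - g n x) = (\<Sum>\<^sub>\<infinity>n\<in>- I. supnorm (f n))"
    unfolding l1norm_def by (rule infsum_cong_neutral) (auto simp: gn supnorm_zero)
  also have "\<dots> = l1norm f - (\<Sum>n\<in>I. supnorm (f n))"
    using infsum_Un_disjoint[of "\<lambda>n. supnorm (f n)" I "- I", OF s s] by (simp add: l1norm_def I_def)
  also have "\<dots> \<le> l1norm f - (\<Sum>n\<in>F. supnorm (f n))"
    using \<open>F \<subseteq> I\<close> by (intro diff_left_mono sum_mono2) (auto simp: I_def supnorm_nonneg l1Z_continuous[OF f])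
  also have "\<dots> < e" using F(2) by simp
  finally show ?thesis using gl unfolding g_def I_def Let_def by blast
qed

text \<open>The representative of phi in [0, 1), with a jump at z = 1. For norms the branch is
  immaterial: phi and phi + 1 give unitarily equivalent regular representations.\<close>

definition phase :: "complex \<Rightarrow> real" where
  "phase z = Arg2pi z / (2 * pi)"

lemma cis_phase: "z \<in> sphere 0 1 \<Longrightarrow> cis (2 * pi * phase z) = z"
  using cis_Arg2pi[of z] by (simp add: phase_def)

text \<open>The orbit r + Z passes through - \<open>phase z\<close> for z = exp(- 2 pi i r), so
  bounds at the chosen phases control every real orbit.\<close>

lemma phase_covers: "\<exists>p::int. \<exists>z\<in>sphere 0 1. of_int p - r = phase z"
proof -
  define z where "z = cis (2 * pi * (- r))"
  have z: "z \<in> sphere 0 1" by (simp add: z_def)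
  have "cis (2 * pi * phase z) = cis (2 * pi * (- r))" using cis_phase[OF z] by (simp only: z_def)
  then obtain n :: int where "2 * pi * phase z = 2 * pi * (- r) + 2 * pi * n"
    using sin_cos_eq_iff[of "2 * pi * phase z" "2 * pi * (- r)"] by (auto simp: complex_eq_iff mult_ac)
  then have "2 * pi * phase z = 2 * pi * (of_int n - r)" by (simp add: algebra_simps)
  then have "phase z = of_int n - r" using pi_gt_zero by simp
  then show ?thesis using z by (intro exI[of _ n] bexI[of _ z]) simp_all
qed

text \<open>Truncation to finite support costs d = e / 2 twice, once in the regular representations
  and once in \<pi>, both being bounded by the l1 norm.\<close>

lemma (in l1Z_rep) norm_rep_le:
  assumes f: "f \<in> carrier l1Z" and c: "\<And>z. z \<in> sphere 0 1 \<Longrightarrow> norm (regular_rep (phase z) f) \<le> c"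
  shows "norm (\<pi> f) \<le> c"
proof (rule field_le_epsilon)
  fix e :: real assume "0 < e"
  define d where "d = e / 2"
  have "0 < d" using \<open>0 < e\<close> by (simp add: d_def)
  obtain K :: nat where K: "(\<lambda>n x. if n \<in> {- int K..int K} then f n x else 0) \<in> carrier l1Z"
    "l1norm (\<lambda>n x. f n x - (if n \<in> {- int K..int K} then f n x else 0)) < d"
    using finite_support_approximation[OF f \<open>0 < d\<close>] unfolding Let_def by blast
  define g where "g = (\<lambda>n x. if n \<in> {- int K..int K} then f n x else 0)"
  have g: "g \<in> carrier l1Z" "l1norm (\<lambda>n x. f n x - g n x) < d" using K unfolding g_def by blast+
  note fg = l1Z_diff_closed[OF f g(1)]
  have "0 \<le> c" using order_trans[OF norm_ge_zero c[of 1]] by simp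
  have "norm (regular_rep (phase z) g) \<le> c + d" if "z \<in> sphere 0 1" for z
  proof -
    have "regular_rep (phase z) g = regular_rep (phase z) f - regular_rep (phase z) (\<lambda>n x. f n x - g n x)"
      by (simp add: regular_rep_diff[OF f g(1)])
    then have "norm (regular_rep (phase z) g) \<le> norm (regular_rep (phase z) f) + norm (regular_rep (phase z) (\<lambda>n x. f n x - g n x))"
      by (simp only: norm_triangle_ineq4)
    then show ?thesis using c[OF that] norm_regular_rep_le[OF fg, of "phase z"] g(2) by linarith
  qed
  then have all: "\<exists>p::int. norm (regular_rep (of_int p - r) g) \<le> c + d" for r
  proof -
    obtain p :: int and z where "z \<in> sphere 0 1" "of_int p - r = phase z" using phase_covers[of r] by blast
    then show ?thesis using \<open>\<And>z. z \<in> sphere 0 1 \<Longrightarrow> norm (regular_rep (phase z) g) \<le> c + d\<close>[of z]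
      by (intro exI[of _ p]) (simp only:)
  qed
  have "norm (\<pi> g) \<le> c + d"
  proof (rule norm_rep_le_finite_support[OF g(1)])
    show "g n = (\<lambda>_. 0)" if "n \<notin> {- int K..int K}" for n using that by (auto simp: g_def)
    show "0 \<le> c + d" using \<open>0 \<le> c\<close> \<open>0 < d\<close> by simp
    show "form_bound (c + d) J M (\<lambda>j m. g (j - m) (x + ereal (of_int j)))" if "finite J" "finite M" for J M x
      by (rule form_bound_all_points[OF g(1) all that])
  qed
  moreover have "norm (\<pi> f) \<le> norm (\<pi> g) + norm (\<pi> (\<lambda>n x. f n x - g n x))"
    unfolding rep_diff[OF f g(1)] using norm_triangle_ineq[of "\<pi> g" "\<pi> f - \<pi> g"] by simp
  ultimately show "norm (\<pi> f) \<le> c + e"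
    using norm_rep_le_l1norm[OF fg] g(2) by (simp add: d_def)
qed

abbreviation Env :: "(int \<Rightarrow> ereal \<Rightarrow> complex) \<Rightarrow> real" where
  "Env \<equiv> enveloping_seminorm l1Z"

lemma representations_l1Z: "\<pi> \<in> representations l1Z \<longleftrightarrow> l1Z_rep \<pi>"
  by (simp add: representations_def l1Z_rep_def)

text \<open>The enveloping seminorm sees representations on l2 over the element type; an injection
  of Z places the regular representation there without changing norms.\<close>

lemma regular_rep_transport_mem:
  "inj (\<iota> :: int \<Rightarrow> int \<Rightarrow> ereal \<Rightarrow> complex) \<Longrightarrow> (\<lambda>f. l2_transport \<iota> (regular_rep \<phi> f)) \<in> representations l1Z"
  using regular_rep_star_hom[of \<phi>]
  by (simp add: representations_def star_hom_def l2_transport_simps)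

text \<open>The index set is the entire type, so constant functions with integer values serve as the
  copy of Z, whether or not they lie in the carrier.\<close>

lemma inj_constants: "inj (\<lambda>n::int. \<lambda>(_::int) (_::ereal). complex_of_int n)"
  by (auto simp: inj_def fun_eq_iff)

text \<open>Together with \<open>Env_ge\<close> this identifies the enveloping seminorm with the
  supremum of the regular representation norms over the circle.\<close>

lemma Env_le:
  assumes "f \<in> carrier l1Z" "\<And>z. z \<in> sphere 0 1 \<Longrightarrow> norm (regular_rep (phase z) f) \<le> c"
  shows "Env f \<le> c"
  unfolding enveloping_seminorm_def
proof (rule cSUP_least)
  show "representations l1Z \<noteq> {}" using regular_rep_transport_mem[OF inj_constants] by blast
  fix \<pi> assume "\<pi> \<in> representations l1Z"
  then interpret l1Z_rep \<pi> by (simp add: representations_l1Z)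
  show "cbop_norm (\<pi> f) \<le> c" using norm_rep_le[OF assms] by (simp add: cbop_ops)
qed

lemma Env_ge:
  assumes "f \<in> carrier l1Z"
  shows "norm (regular_rep \<phi> f) \<le> Env f"
proof -
  have "cbop_norm (l2_transport (\<lambda>n::int. \<lambda>(_::int) (_::ereal). complex_of_int n) (regular_rep \<phi> f)) \<le> Env f"
    unfolding enveloping_seminorm_def
  proof (rule cSUP_upper[OF regular_rep_transport_mem[OF inj_constants]])
    show "bdd_above ((\<lambda>\<pi>. cbop_norm (\<pi> f)) ` representations l1Z)"
      using l1Z_rep.norm_rep_le_l1norm[OF _ assms]
      by (intro bdd_aboveI2[where M = "l1norm f"]) (simp add: representations_l1Z cbop_ops)
  qed
  then show ?thesis by (simp add: cbop_ops norm_l2_transport[OF inj_constants])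
qed


section \<open>Elements of the completion as uniform limits on the circle\<close>

section \<open>The crossed product as an algebra of functions on the circle\<close>

abbreviation CP :: "(nat \<Rightarrow> int \<Rightarrow> ereal \<Rightarrow> complex) set star_algebra" where
  "CP \<equiv> crossed_product C_ext translation"

abbreviation circle_rep :: "(int \<Rightarrow> ereal \<Rightarrow> complex) \<Rightarrow> complex \<Rightarrow> int l2 cbop" where
  "circle_rep f z \<equiv> regular_rep (phase z) f"

text \<open>The invariant that names an element of the completion: Cauchy sequences for
  \<open>Env\<close> are those whose regular representations converge uniformly on the circle, and
  classes correspond to limits.\<close>

definition converges_to :: "(nat \<Rightarrow> int \<Rightarrow> ereal \<Rightarrow> complex) \<Rightarrow> (complex \<Rightarrow> int l2 cbop) \<Rightarrow> bool" where
  "converges_to s G \<longleftrightarrow> uniform_limit (sphere 0 1) (\<lambda>n. circle_rep (s n)) G sequentially"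

lemma cauchy_seqs_carrier: "s \<in> cauchy_seqs l1Z Env \<Longrightarrow> s n \<in> carrier l1Z"
  by (auto simp: cauchy_seqs_def)

lemma cauchy_seqs_converges:
  assumes s: "s \<in> cauchy_seqs l1Z Env"
  shows "\<exists>G. converges_to s G"
proof -
  have "uniformly_Cauchy_on (sphere 0 1) (\<lambda>n. circle_rep (s n))"
  proof (rule uniformly_Cauchy_onI)
    fix e :: real assume "0 < e"
    then have "\<exists>N. \<forall>m\<ge>N. \<forall>n\<ge>N. Env (s m \<ominus>\<^bsub>l1Z\<^esub> s n) < e"
      using s by (simp add: cauchy_seqs_def)
    then obtain N where "\<forall>m\<ge>N. \<forall>n\<ge>N. Env (s m \<ominus>\<^bsub>l1Z\<^esub> s n) < e" ..
    then have N: "\<And>m n. m \<ge> N \<Longrightarrow> n \<ge> N \<Longrightarrow> Env (s m \<ominus>\<^bsub>l1Z\<^esub> s n) < e" by simp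
    have "dist (circle_rep (s m) z) (circle_rep (s n) z) < e" if "m \<ge> N" "n \<ge> N" for m n z
    proof -
      note c = cauchy_seqs_carrier[OF s]
      have "dist (circle_rep (s m) z) (circle_rep (s n) z) = norm (circle_rep (\<lambda>k x. s m k x - s n k x) z)"
        by (simp add: dist_norm regular_rep_diff[OF c c])
      also have "\<dots> \<le> Env (\<lambda>k x. s m k x - s n k x)" by (rule Env_ge[OF l1Z_diff_closed[OF c c]])
      also have "\<dots> < e" using N[OF that] by (simp add: l1Z_minus[OF c])
      finally show ?thesis .
    qed
    then show "\<exists>M. \<forall>z\<in>sphere 0 1. \<forall>m\<ge>M. \<forall>n\<ge>M. dist (circle_rep (s m) z) (circle_rep (s n) z) < e" by blast
  qed
  from Cauchy_uniformly_convergent[OF this] show ?thesis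
    unfolding uniformly_convergent_on_def converges_to_def .
qed

lemma converges_toD:
  assumes "converges_to s G" "0 < e"
  shows "\<exists>N. \<forall>n\<ge>N. \<forall>z\<in>sphere 0 1. norm (circle_rep (s n) z - G z) < e"
  using assms unfolding converges_to_def uniform_limit_sequentially_iff by (auto simp: dist_norm)

lemma Env_diff_tendsto:
  assumes s: "\<And>n. s n \<in> carrier l1Z" and t: "\<And>n. t n \<in> carrier l1Z"
    and "converges_to s G" "converges_to t G" "0 < e"
  shows "\<exists>N. \<forall>m\<ge>N. \<forall>n\<ge>N. Env (s m \<ominus>\<^bsub>l1Z\<^esub> t n) < e"
proof -
  \<comment> \<open>Two quarters leave room: \<open>Env_le\<close> yields a non-strict bound by e /
    2, and a strict one by e is wanted.\<close>
  have e4: "0 < e / 4" using assms(5) by simp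
  obtain N1 N2 where N1: "\<And>n z. n \<ge> N1 \<Longrightarrow> z \<in> sphere 0 1 \<Longrightarrow> norm (circle_rep (s n) z - G z) < e / 4"
    and N2: "\<And>n z. n \<ge> N2 \<Longrightarrow> z \<in> sphere 0 1 \<Longrightarrow> norm (circle_rep (t n) z - G z) < e / 4"
    using converges_toD[OF assms(3) e4] converges_toD[OF assms(4) e4] by blast
  have "Env (s m \<ominus>\<^bsub>l1Z\<^esub> t n) < e" if "m \<ge> max N1 N2" "n \<ge> max N1 N2" for m n
  proof -
    have "Env (\<lambda>k x. s m k x - t n k x) \<le> e / 2"
    proof (rule Env_le[OF l1Z_diff_closed[OF s t]])
      fix z :: complex assume z: "z \<in> sphere 0 1"
      have "circle_rep (\<lambda>k x. s m k x - t n k x) z = (circle_rep (s m) z - G z) - (circle_rep (t n) z - G z)"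
        by (simp add: regular_rep_diff[OF s t])
      then have "norm (circle_rep (\<lambda>k x. s m k x - t n k x) z) \<le> norm (circle_rep (s m) z - G z) + norm (circle_rep (t n) z - G z)"
        by (simp only: norm_triangle_ineq4)
      then show "norm (circle_rep (\<lambda>k x. s m k x - t n k x) z) \<le> e / 2"
        using N1[of m z] N2[of n z] that z by simp
    qed
    then show ?thesis using assms(5) by (simp add: l1Z_minus[OF t])
  qed
  then show ?thesis by blast
qed

lemma converges_to_cauchy:
  assumes "\<And>n. s n \<in> carrier l1Z" "converges_to s G"
  shows "s \<in> cauchy_seqs l1Z Env"
  using assms Env_diff_tendsto[OF assms(1) assms(1) assms(2) assms(2)] by (auto simp: cauchy_seqs_def)

lemma Env_nonneg: "f \<in> carrier l1Z \<Longrightarrow> 0 \<le> Env f"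
  using order_trans[OF norm_ge_zero Env_ge] .

text \<open>Null sequences for \<open>Env\<close> are those whose regular representations tend to 0
  uniformly on the circle, so a class is determined by the common limit of its members.\<close>

lemma cauchy_class_iff:
  assumes s: "s \<in> cauchy_seqs l1Z Env" "converges_to s G"
  shows "t \<in> cauchy_class l1Z Env s \<longleftrightarrow> t \<in> cauchy_seqs l1Z Env \<and> converges_to t G"
proof (intro iffI conjI)
  assume t: "t \<in> cauchy_class l1Z Env s"
  then show tc: "t \<in> cauchy_seqs l1Z Env" by (simp add: cauchy_class_def)
  note c = cauchy_seqs_carrier[OF s(1)] cauchy_seqs_carrier[OF tc]
  have lim: "(\<lambda>n. Env (t n \<ominus>\<^bsub>l1Z\<^esub> s n)) \<longlonglongrightarrow> 0" using t by (simp add: cauchy_class_def)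
  show "converges_to t G"
    unfolding converges_to_def
  proof (rule uniform_limitI)
    fix e :: real assume "0 < e"
    then have e2: "0 < e / 2" by simp
    obtain N where N: "\<And>n z. n \<ge> N \<Longrightarrow> z \<in> sphere 0 1 \<Longrightarrow> norm (circle_rep (s n) z - G z) < e / 2"
      using converges_toD[OF s(2) e2] by blast
    show "\<forall>\<^sub>F n in sequentially. \<forall>z\<in>sphere 0 1. dist (circle_rep (t n) z) (G z) < e"
      using order_tendstoD(2)[OF lim e2] eventually_ge_at_top[of N]
    proof eventually_elim
      case (elim n)
      show ?case
      proof
        fix z :: complex assume z: "z \<in> sphere 0 1"
        have "norm (circle_rep (\<lambda>k x. t n k x - s n k x) z) < e / 2"
          by (rule le_less_trans[OF Env_ge[OF l1Z_diff_closed[OF c(2) c(1)]] elim(1)[unfolded l1Z_minus[OF c(1)]]])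
        moreover have "circle_rep (t n) z - G z = circle_rep (\<lambda>k x. t n k x - s n k x) z + (circle_rep (s n) z - G z)"
          by (simp add: regular_rep_diff[OF c(2) c(1)])
        then have "norm (circle_rep (t n) z - G z) \<le> norm (circle_rep (\<lambda>k x. t n k x - s n k x) z) + norm (circle_rep (s n) z - G z)"
          by (simp only: norm_triangle_ineq)
        ultimately show "dist (circle_rep (t n) z) (G z) < e"
          using N[OF elim(2) z] unfolding dist_norm by linarith
      qed
    qed
  qed
next
  assume t: "t \<in> cauchy_seqs l1Z Env \<and> converges_to t G"
  note c = cauchy_seqs_carrier[OF s(1)] cauchy_seqs_carrier[OF conjunct1[OF t]]
  have "(\<lambda>n. Env (t n \<ominus>\<^bsub>l1Z\<^esub> s n)) \<longlonglongrightarrow> 0"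
  proof (rule LIMSEQ_I)
    fix e :: real assume "0 < e"
    from Env_diff_tendsto[OF c(2) c(1) conjunct2[OF t] s(2) this]
    obtain N where N: "\<And>n. n \<ge> N \<Longrightarrow> Env (t n \<ominus>\<^bsub>l1Z\<^esub> s n) < e" by blast
    have "0 \<le> Env (t n \<ominus>\<^bsub>l1Z\<^esub> s n)" for n
      unfolding l1Z_minus[OF c(1)] by (rule Env_nonneg[OF l1Z_diff_closed[OF c(2) c(1)]])
    then show "\<exists>N. \<forall>n\<ge>N. norm (Env (t n \<ominus>\<^bsub>l1Z\<^esub> s n) - 0) < e"
      using N by (intro exI[of _ N]) simp
  qed
  then show "t \<in> cauchy_class l1Z Env s" using t by (simp add: cauchy_class_def)
qed

text \<open>Off the circle a limit is arbitrary, hence the choice; only the values on the circle are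
  determined, and only these are used.\<close>

definition cp_symbol :: "(nat \<Rightarrow> int \<Rightarrow> ereal \<Rightarrow> complex) set \<Rightarrow> complex \<Rightarrow> int l2 cbop" where
  "cp_symbol S = (SOME G. converges_to (class_rep S) G)"

lemma CP_simps:
  "carrier CP = cauchy_class l1Z Env ` cauchy_seqs l1Z Env"
  "S \<otimes>\<^bsub>CP\<^esub> T = cauchy_class l1Z Env (\<lambda>n. class_rep S n \<otimes>\<^bsub>l1Z\<^esub> class_rep T n)"
  "S \<oplus>\<^bsub>CP\<^esub> T = cauchy_class l1Z Env (\<lambda>n. class_rep S n \<oplus>\<^bsub>l1Z\<^esub> class_rep T n)"
  "c \<odot>\<^bsub>CP\<^esub> S = cauchy_class l1Z Env (\<lambda>n. c \<odot>\<^bsub>l1Z\<^esub> class_rep S n)"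
  "invol CP S = cauchy_class l1Z Env (\<lambda>n. invol l1Z (class_rep S n))"
  "alg_norm CP S = lim (\<lambda>n. Env (class_rep S n))"
  by (simp_all add: crossed_product_def enveloping_algebra_def seminorm_completion_def)

lemma CP_class_rep:
  assumes "S \<in> carrier CP"
  shows "class_rep S \<in> cauchy_seqs l1Z Env" "converges_to (class_rep S) (cp_symbol S)"
    "S = cauchy_class l1Z Env (class_rep S)"
proof -
  obtain s where s: "s \<in> cauchy_seqs l1Z Env" "S = cauchy_class l1Z Env s"
    using assms by (auto simp: CP_simps(1))
  obtain G where G: "converges_to s G" using cauchy_seqs_converges[OF s(1)] by blast
  have "s \<in> S" unfolding s(2) cauchy_class_iff[OF s(1) G] using s(1) G by blast
  then have "class_rep S \<in> S" unfolding class_rep_def by (rule someI[of "\<lambda>s. s \<in> S"])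
  then have r: "class_rep S \<in> cauchy_seqs l1Z Env" "converges_to (class_rep S) G"
    unfolding s(2) cauchy_class_iff[OF s(1) G] by blast+
  show "class_rep S \<in> cauchy_seqs l1Z Env" by (rule r(1))
  show "converges_to (class_rep S) (cp_symbol S)" unfolding cp_symbol_def by (rule someI[of "converges_to (class_rep S)", OF r(2)])
  have "t \<in> S \<longleftrightarrow> t \<in> cauchy_class l1Z Env (class_rep S)" for t
    unfolding cauchy_class_iff[OF r] by (subst s(2)) (rule cauchy_class_iff[OF s(1) G])
  then show "S = cauchy_class l1Z Env (class_rep S)" by blast
qed

lemma converges_to_unique:
  assumes "converges_to s G" "converges_to s H" "z \<in> sphere 0 1"
  shows "G z = H z"
proof -
  have "(\<lambda>n. circle_rep (s n) z) \<longlonglongrightarrow> G z" "(\<lambda>n. circle_rep (s n) z) \<longlonglongrightarrow> H z"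
    using assms unfolding converges_to_def by (auto intro: tendsto_uniform_limitI)
  then show ?thesis by (rule LIMSEQ_unique)
qed

text \<open>The means of producing elements: the operations of the completion act on sequences, so
  each of them follows from a limit theorem for the corresponding sequence of symbols.\<close>

lemma CP_class:
  assumes "\<And>n. s n \<in> carrier l1Z" "converges_to s G"
  shows "cauchy_class l1Z Env s \<in> carrier CP"
    "z \<in> sphere 0 1 \<Longrightarrow> cp_symbol (cauchy_class l1Z Env s) z = G z"
proof -
  let ?S = "cauchy_class l1Z Env s"
  have s: "s \<in> cauchy_seqs l1Z Env" by (rule converges_to_cauchy[OF assms])
  then show S: "?S \<in> carrier CP" by (simp add: CP_simps(1))
  have "s \<in> ?S" using s assms(2) by (simp add: cauchy_class_iff[OF s assms(2)])
  then have "class_rep ?S \<in> ?S" unfolding class_rep_def by (rule someI[of "\<lambda>t. t \<in> ?S"])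
  then have "converges_to (class_rep ?S) G" by (simp add: cauchy_class_iff[OF s assms(2)])
  then show "z \<in> sphere 0 1 \<Longrightarrow> cp_symbol ?S z = G z"
    by (rule converges_to_unique[OF CP_class_rep(2)[OF S]])
qed

lemma cp_symbol_approximation:
  assumes "S \<in> carrier CP" "0 < e"
  shows "\<exists>f\<in>carrier l1Z. \<forall>z\<in>sphere 0 1. norm (cp_symbol S z - circle_rep f z) \<le> e"
proof -
  obtain N where "\<forall>n\<ge>N. \<forall>z\<in>sphere 0 1. norm (circle_rep (class_rep S n) z - cp_symbol S z) < e"
    using converges_toD[OF CP_class_rep(2)[OF assms(1)] assms(2)] by blast
  then show ?thesis
    using cauchy_seqs_carrier[OF CP_class_rep(1)[OF assms(1)], of N]
    by (intro bexI[of _ "class_rep S N"]) (auto simp: norm_minus_commute intro: less_imp_le)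
qed

text \<open>Completeness of the model: approximations with errors 1 / (n + 1) form a sequence whose
  class has the prescribed limit.\<close>

lemma cp_symbol_surj:
  assumes "\<And>e. 0 < e \<Longrightarrow> \<exists>f\<in>carrier l1Z. \<forall>z\<in>sphere 0 1. norm (G z - circle_rep f z) \<le> e"
  shows "\<exists>S\<in>carrier CP. \<forall>z\<in>sphere 0 1. cp_symbol S z = G z"
proof -
  have "\<forall>n. \<exists>f. f \<in> carrier l1Z \<and> (\<forall>z\<in>sphere 0 1. norm (G z - circle_rep f z) \<le> inverse (real (Suc n)))"
    using assms[of "inverse (real (Suc n))" for n] by (auto simp: Bex_def)
  from choice[OF this] obtain s where s: "\<And>n. s n \<in> carrier l1Z"
    "\<And>n z. z \<in> sphere 0 1 \<Longrightarrow> norm (G z - circle_rep (s n) z) \<le> inverse (real (Suc n))" by blast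
  have "converges_to s G"
    unfolding converges_to_def
  proof (rule uniform_limitI)
    fix e :: real assume "0 < e"
    have "\<forall>\<^sub>F n in sequentially. inverse (real (Suc n)) < e"
      by (rule order_tendstoD(2)[OF LIMSEQ_inverse_real_of_nat \<open>0 < e\<close>])
    then show "\<forall>\<^sub>F n in sequentially. \<forall>z\<in>sphere 0 1. dist (circle_rep (s n) z) (G z) < e"
    proof eventually_elim
      case (elim n)
      show ?case
      proof
        fix z :: complex assume "z \<in> sphere 0 1"
        from le_less_trans[OF s(2)[OF this] elim] show "dist (circle_rep (s n) z) (G z) < e"
          unfolding dist_norm norm_minus_commute[of "circle_rep (s n) z"] .
      qed
    qed
  qed
  from CP_class[OF s(1) this] show ?thesis by blast
qed

lemma cp_symbol_inj:
  assumes "S \<in> carrier CP" "T \<in> carrier CP" "\<And>z. z \<in> sphere 0 1 \<Longrightarrow> cp_symbol S z = cp_symbol T z"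
  shows "S = T"
proof -
  have "converges_to (class_rep S) (cp_symbol T)"
    unfolding converges_to_def
    by (rule iffD1[OF uniform_limit_cong'[OF refl assms(3)] CP_class_rep(2)[OF assms(1), unfolded converges_to_def]])
  then have "cauchy_class l1Z Env (class_rep S) = cauchy_class l1Z Env (class_rep T)"
    by (intro Set.set_eqI) (simp only: cauchy_class_iff[OF CP_class_rep(1)[OF assms(1)]]
        cauchy_class_iff[OF CP_class_rep(1,2)[OF assms(2)]])
  from trans[OF CP_class_rep(3)[OF assms(1)] trans[OF this CP_class_rep(3)[OF assms(2), symmetric]]]
  show ?thesis .
qed

text \<open>Supplies the boundedness required for the product of two uniform limits, and later the
  finiteness of the supremum norm.\<close>

lemma cp_symbol_bounded:
  assumes "S \<in> carrier CP"
  shows "bounded (cp_symbol S ` sphere 0 1)"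
proof -
  obtain f where f: "f \<in> carrier l1Z" "\<And>z. z \<in> sphere 0 1 \<Longrightarrow> norm (cp_symbol S z - circle_rep f z) \<le> 1"
    using cp_symbol_approximation[OF assms, of 1] by auto
  have "norm (cp_symbol S z) \<le> l1norm f + 1" if "z \<in> sphere 0 1" for z
    using norm_triangle_ineq[of "circle_rep f z" "cp_symbol S z - circle_rep f z"] f(2)[OF that]
      norm_regular_rep_le[OF f(1), of "phase z"] by simp
  then show ?thesis unfolding bounded_iff by blast
qed

lemma CP_seq: "S \<in> carrier CP \<Longrightarrow> class_rep S n \<in> carrier l1Z"
  using cauchy_seqs_carrier CP_class_rep(1) by blast

lemma bounded_linear_cbop_scale: "bounded_linear (cbop_scale c :: 'h::complex_inner cbop \<Rightarrow> 'h cbop)"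
  by (rule bounded_linear_intro[of _ "cmod c"])
    (simp_all add: scale_simps scaleR_cbop_def mult.commute norm_cbop_scale)

context
  fixes S assumes S: "S \<in> carrier CP"
begin

lemma cp_symbol_add:
  assumes T: "T \<in> carrier CP"
  shows "S \<oplus>\<^bsub>CP\<^esub> T \<in> carrier CP" "z \<in> sphere 0 1 \<Longrightarrow> cp_symbol (S \<oplus>\<^bsub>CP\<^esub> T) z = cp_symbol S z + cp_symbol T z"
proof -
  have "converges_to (\<lambda>n. class_rep S n \<oplus>\<^bsub>l1Z\<^esub> class_rep T n) (\<lambda>z. cp_symbol S z + cp_symbol T z)"
    using CP_class_rep(2)[OF S] CP_class_rep(2)[OF T]
    unfolding converges_to_def l1Z_simps(4) regular_rep_add[OF CP_seq[OF S] CP_seq[OF T]] by (rule uniform_limit_add)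
  from CP_class[OF _ this] show "S \<oplus>\<^bsub>CP\<^esub> T \<in> carrier CP"
    "z \<in> sphere 0 1 \<Longrightarrow> cp_symbol (S \<oplus>\<^bsub>CP\<^esub> T) z = cp_symbol S z + cp_symbol T z"
    unfolding CP_simps(3) by (simp_all add: l1Z_simps(4) l1Z_add_closed(1)[OF CP_seq[OF S] CP_seq[OF T]])
qed

lemma cp_symbol_mult:
  assumes T: "T \<in> carrier CP"
  shows "S \<otimes>\<^bsub>CP\<^esub> T \<in> carrier CP" "z \<in> sphere 0 1 \<Longrightarrow> cp_symbol (S \<otimes>\<^bsub>CP\<^esub> T) z = cp_symbol S z * cp_symbol T z"
proof -
  have "converges_to (\<lambda>n. class_rep S n \<otimes>\<^bsub>l1Z\<^esub> class_rep T n) (\<lambda>z. cp_symbol S z * cp_symbol T z)"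
    using CP_class_rep(2)[OF S] CP_class_rep(2)[OF T] cp_symbol_bounded[OF S] cp_symbol_bounded[OF T]
    unfolding converges_to_def regular_rep_mult[OF CP_seq[OF S] CP_seq[OF T]] by (rule uniform_lim_mult)
  from CP_class[OF _ this] show "S \<otimes>\<^bsub>CP\<^esub> T \<in> carrier CP"
    "z \<in> sphere 0 1 \<Longrightarrow> cp_symbol (S \<otimes>\<^bsub>CP\<^esub> T) z = cp_symbol S z * cp_symbol T z"
    unfolding CP_simps(2) by (simp_all add: l1Z_mult_closed(1)[OF CP_seq[OF S] CP_seq[OF T]])
qed

lemma cp_symbol_scale:
  "c \<odot>\<^bsub>CP\<^esub> S \<in> carrier CP" "z \<in> sphere 0 1 \<Longrightarrow> cp_symbol (c \<odot>\<^bsub>CP\<^esub> S) z = cbop_scale c (cp_symbol S z)"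
proof -
  have "converges_to (\<lambda>n. c \<odot>\<^bsub>l1Z\<^esub> class_rep S n) (\<lambda>z. cbop_scale c (cp_symbol S z))"
    using bounded_linear.uniform_limit[OF bounded_linear_cbop_scale CP_class_rep(2)[OF S, unfolded converges_to_def], of c]
    unfolding converges_to_def l1Z_simps(5) regular_rep_scale[OF CP_seq[OF S]] .
  from CP_class[OF _ this] show "c \<odot>\<^bsub>CP\<^esub> S \<in> carrier CP"
    "z \<in> sphere 0 1 \<Longrightarrow> cp_symbol (c \<odot>\<^bsub>CP\<^esub> S) z = cbop_scale c (cp_symbol S z)"
    unfolding CP_simps(4) by (simp_all add: l1Z_simps(5) l1Z_scale_closed(1)[OF CP_seq[OF S]])
qed

lemma cp_symbol_invol:
  "invol CP S \<in> carrier CP" "z \<in> sphere 0 1 \<Longrightarrow> cp_symbol (invol CP S) z = cbop_adjoint (cp_symbol S z)"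
proof -
  have "converges_to (\<lambda>n. invol l1Z (class_rep S n)) (\<lambda>z. cbop_adjoint (cp_symbol S z))"
    using bounded_linear.uniform_limit[OF bounded_linear_adjoint CP_class_rep(2)[OF S, unfolded converges_to_def]]
    unfolding converges_to_def regular_rep_adjoint[OF CP_seq[OF S]] .
  from CP_class[OF _ this] show "invol CP S \<in> carrier CP"
    "z \<in> sphere 0 1 \<Longrightarrow> cp_symbol (invol CP S) z = cbop_adjoint (cp_symbol S z)"
    unfolding CP_simps(5) by (simp_all add: l1Z_invol_closed(1)[OF CP_seq[OF S]])
qed

lemma cp_symbol_norm:
  "alg_norm CP S = (SUP z\<in>sphere 0 1. norm (cp_symbol S z))"
  "bdd_above ((\<lambda>z. norm (cp_symbol S z)) ` sphere 0 1)"
proof -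
  let ?N = "SUP z\<in>sphere 0 1. norm (cp_symbol S z)"
  show bdd: "bdd_above ((\<lambda>z. norm (cp_symbol S z)) ` sphere 0 1)"
    using cp_symbol_bounded[OF S] by (auto simp: bounded_iff bdd_above_def)
  have ne: "sphere (0::complex) 1 \<noteq> {}" by (auto intro: exI[of _ 1])
  have "(\<lambda>n. Env (class_rep S n)) \<longlonglongrightarrow> ?N"
  proof (rule LIMSEQ_I)
    fix e :: real assume "0 < e"
    then have e2: "0 < e / 2" by simp
    obtain N where N: "\<And>n z. n \<ge> N \<Longrightarrow> z \<in> sphere 0 1 \<Longrightarrow> norm (circle_rep (class_rep S n) z - cp_symbol S z) < e / 2"
      using converges_toD[OF CP_class_rep(2)[OF S] e2] by blast
    have "norm (Env (class_rep S n) - ?N) < e" if "n \<ge> N" for n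
    proof -
      have "Env (class_rep S n) \<le> ?N + e / 2"
      proof (rule Env_le[OF CP_seq[OF S]])
        fix z :: complex assume z: "z \<in> sphere 0 1"
        show "norm (circle_rep (class_rep S n) z) \<le> ?N + e / 2"
          using norm_triangle_sub[of "circle_rep (class_rep S n) z" "cp_symbol S z"] N[OF that z] cSUP_upper[OF z bdd]
          by linarith
      qed
      moreover have "?N \<le> Env (class_rep S n) + e / 2"
      proof (rule cSUP_least[OF ne])
        fix z :: complex assume z: "z \<in> sphere 0 1"
        show "norm (cp_symbol S z) \<le> Env (class_rep S n) + e / 2"
          using norm_triangle_sub[of "cp_symbol S z" "circle_rep (class_rep S n) z"] N[OF that z]
            Env_ge[OF CP_seq[OF S], of "phase z" n] by (simp only: norm_minus_commute[of "cp_symbol S z"])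
      qed
      ultimately show ?thesis using \<open>0 < e\<close> by simp
    qed
    then show "\<exists>N. \<forall>n\<ge>N. norm (Env (class_rep S n) - ?N) < e" by blast
  qed
  then show "alg_norm CP S = ?N" unfolding CP_simps(6) by (rule limI)
qed

end


section \<open>From operators on the line to pairs of elements of the crossed product\<close>

section \<open>Multiplication operators on the line\<close>

lemma
  assumes m: "a \<in> borel_measurable lborel" and K: "\<And>x. cmod (a x) \<le> K"
  shows mult_op_apply: "square_integrable f \<Longrightarrow> mult_op a \<bullet>\<^sub>o abs_L2R f = abs_L2R (\<lambda>x. a x * f x)"
    and norm_mult_op_le: "norm (mult_op a) \<le> K"
proof -
  have "0 \<le> K" using order_trans[OF norm_ge_zero K] .
  have bd: "bounded (range a)" using K by (auto simp: bounded_iff)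
  have M: "L2R_mult a (abs_L2R f) = abs_L2R (\<lambda>x. a x * f x)" if "square_integrable f" for f
    using that m bd by (simp add: L2R_mult.abs_eq)
  have sq: "square_integrable (\<lambda>x. a x * f x)" if "square_integrable f" for f
    by (rule square_integrable_bounded_mult[OF m bd that])
  have nm: "norm (L2R_mult a x) \<le> K * norm x" for x
  proof -
    define f where "f = rep_L2R' x"
    have f: "square_integrable f" "x = abs_L2R f" by (simp_all add: f_def square_integrable_rep abs_rep_L2R)
    have i: "integrable lborel (\<lambda>x. (cmod (f x))\<^sup>2)" "integrable lborel (\<lambda>x. (cmod (a x * f x))\<^sup>2)"
      using f(1) sq[OF f(1)] by (simp_all add: square_integrable_def)
    have "(norm (L2R_mult a x))\<^sup>2 = (LINT x|lborel. (cmod (a x * f x))\<^sup>2)"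
      unfolding f(2) M[OF f(1)] by (rule norm_abs_L2R[OF sq[OF f(1)]])
    also have "\<dots> \<le> (LINT x|lborel. K\<^sup>2 * (cmod (f x))\<^sup>2)"
      by (rule integral_mono[OF i(2) integrable_mult_right[OF i(1)]])
        (simp add: norm_mult power_mult_distrib mult_right_mono power_mono K)
    also have "\<dots> = (K * norm x)\<^sup>2"
      unfolding f(2) power_mult_distrib norm_abs_L2R[OF f(1)] by simp
    finally show ?thesis by (rule power2_le_imp_le) (simp add: \<open>0 \<le> K\<close>)
  qed
  have ap: "mult_op a \<bullet>\<^sub>o x = L2R_mult a x" for x
    unfolding mult_op_def
  proof (rule cbop_of_bounded[OF _ _ nm])
    fix x y and c :: complex
    define f g where "f = rep_L2R' x" and "g = rep_L2R' y"
    have f: "square_integrable f" "x = abs_L2R f" and g: "square_integrable g" "y = abs_L2R g"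
      by (simp_all add: f_def g_def square_integrable_rep abs_rep_L2R)
    show "L2R_mult a (x + y) = L2R_mult a x + L2R_mult a y"
      unfolding f(2) g(2) M[OF f(1)] M[OF g(1)]
      by (simp add: plus_L2R.abs_eq f(1) g(1) sq M square_integrable_add ring_distribs)
    show "L2R_mult a (c *\<^sub>C x) = c *\<^sub>C L2R_mult a x"
      unfolding f(2) M[OF f(1)]
      by (simp add: scaleC_L2R.abs_eq f(1) sq M square_integrable_scale mult.left_commute)
  qed
  show "square_integrable f \<Longrightarrow> mult_op a \<bullet>\<^sub>o abs_L2R f = abs_L2R (\<lambda>x. a x * f x)"
    by (simp add: ap M)
  show "norm (mult_op a) \<le> K" by (rule norm_cbop_bound[OF \<open>0 \<le> K\<close>]) (simp add: ap nm)
qed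

lemma L2R_cbop_eqI:
  assumes "\<And>f. square_integrable f \<Longrightarrow> A \<bullet>\<^sub>o abs_L2R f = B \<bullet>\<^sub>o abs_L2R f"
  shows "A = B"
proof (rule cbop_eqI)
  fix x
  show "A \<bullet>\<^sub>o x = B \<bullet>\<^sub>o x" using assms[OF square_integrable_rep[of x]] by (simp add: abs_rep_L2R)
qed

lemma mult_op_one: "mult_op (\<lambda>_. 1) = 1"
  by (rule L2R_cbop_eqI) (simp add: mult_op_apply[where K = 1])

lemma mult_op_scale:
  assumes a: "a \<in> borel_measurable lborel" "\<And>x. cmod (a x) \<le> K"
  shows "mult_op (\<lambda>x. c * a x) = cbop_scale c (mult_op a)"
proof (rule L2R_cbop_eqI)
  fix f assume f: "square_integrable f"
  have "bounded (range a)" using a(2) by (auto simp: bounded_iff)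
  note sq = square_integrable_bounded_mult[OF a(1) this f]
  have "mult_op (\<lambda>x. c * a x) \<bullet>\<^sub>o abs_L2R f = abs_L2R (\<lambda>x. c * a x * f x)"
    by (rule mult_op_apply[where K = "cmod c * K", OF _ _ f])
      (use a in \<open>auto simp: norm_mult intro!: mult_left_mono\<close>)
  then show "mult_op (\<lambda>x. c * a x) \<bullet>\<^sub>o abs_L2R f = cbop_scale c (mult_op a) \<bullet>\<^sub>o abs_L2R f"
    by (simp add: mult_op_apply[OF a f] scaleC_L2R.abs_eq sq mult.assoc)
qed

context
  fixes a b :: "real \<Rightarrow> complex" and K L :: real
  assumes a: "a \<in> borel_measurable lborel" "\<And>x. cmod (a x) \<le> K"
    and b: "b \<in> borel_measurable lborel" "\<And>x. cmod (b x) \<le> L"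
begin

lemma
  shows mult_op_add: "mult_op (\<lambda>x. a x + b x) = mult_op a + mult_op b"
    and mult_op_diff: "mult_op (\<lambda>x. a x - b x) = mult_op a - mult_op b"
proof -
  have bd: "bounded (range a)" "bounded (range b)" using a(2) b(2) by (auto simp: bounded_iff)
  note sq = square_integrable_bounded_mult[OF a(1) bd(1)] square_integrable_bounded_mult[OF b(1) bd(2)]
  show "mult_op (\<lambda>x. a x + b x) = mult_op a + mult_op b"
  proof (rule L2R_cbop_eqI)
    fix f assume f: "square_integrable f"
    have "mult_op (\<lambda>x. a x + b x) \<bullet>\<^sub>o abs_L2R f = abs_L2R (\<lambda>x. (a x + b x) * f x)"
      by (rule mult_op_apply[where K = "K + L", OF _ _ f])
        (use a b in \<open>auto intro: norm_triangle_le add_mono\<close>)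
    then show "mult_op (\<lambda>x. a x + b x) \<bullet>\<^sub>o abs_L2R f = (mult_op a + mult_op b) \<bullet>\<^sub>o abs_L2R f"
      by (simp add: mult_op_apply[OF a f] mult_op_apply[OF b f] plus_L2R.abs_eq sq f ring_distribs)
  qed
  show "mult_op (\<lambda>x. a x - b x) = mult_op a - mult_op b"
  proof (rule L2R_cbop_eqI)
    fix f assume f: "square_integrable f"
    have "mult_op (\<lambda>x. a x - b x) \<bullet>\<^sub>o abs_L2R f = abs_L2R (\<lambda>x. (a x - b x) * f x)"
      by (rule mult_op_apply[where K = "K + L", OF _ _ f])
        (use a b in \<open>auto intro: order_trans[OF norm_triangle_ineq4 add_mono]\<close>)
    then show "mult_op (\<lambda>x. a x - b x) \<bullet>\<^sub>o abs_L2R f = (mult_op a - mult_op b) \<bullet>\<^sub>o abs_L2R f"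
      by (simp add: mult_op_apply[OF a f] mult_op_apply[OF b f] abs_L2R_diff sq f left_diff_distrib)
  qed
qed

end


section \<open>Conjugation by the unitaries \<open>Y\<close>\<close>

definition Y_conj :: "(complex \<Rightarrow> real) \<Rightarrow> real \<Rightarrow> int l2 cbop \<Rightarrow> int l2 cbop" where
  "Y_conj arg \<phi> A = Y_op arg \<phi> * A * Y_op arg (- \<phi>)"

context
  fixes arg :: "complex \<Rightarrow> real"
  assumes arg: "argument_choice arg"
begin

lemma Y_op_inverse: "Y_op arg (- \<phi>) * Y_op arg \<phi> = 1"
  by (simp add: Y_op_add[OF arg, symmetric] Y_op_0[OF arg])

lemma norm_Y_op_le: "norm (Y_op arg \<phi>) \<le> 1"
proof (rule norm_cbop_bound)
  fix u
  have "(norm (Y_op arg \<phi> \<bullet>\<^sub>o u))\<^sup>2 = (norm u)\<^sup>2"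
    unfolding norm_adjoint_square[of "Y_op arg \<phi>" u] Y_op_adjoint[OF arg] Y_op_inverse
    by (simp add: norm_eq_cinner)
  then show "norm (Y_op arg \<phi> \<bullet>\<^sub>o u) \<le> 1 * norm u" by (simp add: power2_eq_iff_nonneg)
qed simp

lemma Y_conj_simps:
  "Y_conj arg \<phi> (A + B) = Y_conj arg \<phi> A + Y_conj arg \<phi> B"
  "Y_conj arg \<phi> (A - B) = Y_conj arg \<phi> A - Y_conj arg \<phi> B"
  "Y_conj arg \<phi> (cbop_scale c A) = cbop_scale c (Y_conj arg \<phi> A)"
  "Y_conj arg \<phi> (cbop_adjoint A) = cbop_adjoint (Y_conj arg \<phi> A)"
  by (simp_all add: Y_conj_def algebra_simps scale_simps adjoint_mult Y_op_adjoint[OF arg])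

lemma Y_conj_mult: "Y_conj arg \<phi> (A * B) = Y_conj arg \<phi> A * Y_conj arg \<phi> B"
proof -
  have "Y_conj arg \<phi> A * Y_conj arg \<phi> B = Y_op arg \<phi> * A * (Y_op arg (- \<phi>) * Y_op arg \<phi>) * B * Y_op arg (- \<phi>)"
    by (simp only: Y_conj_def mult.assoc)
  then show ?thesis by (simp add: Y_op_inverse Y_conj_def mult.assoc)
qed

lemma Y_conj_inverse: "Y_conj arg (- \<phi>) (Y_conj arg \<phi> A) = A"
proof -
  have "Y_conj arg (- \<phi>) (Y_conj arg \<phi> A) = (Y_op arg (- \<phi>) * Y_op arg \<phi>) * A * (Y_op arg (- \<phi>) * Y_op arg (- (- \<phi>)))"
    by (simp only: Y_conj_def mult.assoc minus_minus)
  then show ?thesis using Y_op_inverse[of \<phi>] Y_op_inverse[of "- \<phi>"] by (simp add: mult.assoc)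
qed

lemma norm_Y_conj: "norm (Y_conj arg \<phi> A) = norm A"
proof -
  have le: "norm (Y_conj arg \<phi> A) \<le> norm A" for \<phi> A
  proof -
    have "norm (Y_conj arg \<phi> A) \<le> norm (Y_op arg \<phi>) * norm A * norm (Y_op arg (- \<phi>))"
      unfolding Y_conj_def by (intro order_trans[OF norm_mult_ineq] mult_right_mono norm_mult_ineq) simp
    also have "\<dots> \<le> 1 * norm A * 1" by (intro mult_mono norm_Y_op_le) auto
    finally show ?thesis by simp
  qed
  show ?thesis using le[of \<phi> A] le[of "- \<phi>" "Y_conj arg \<phi> A"] by (simp add: Y_conj_inverse)
qed

lemma shift_op_eq_Y_op: "shift_op k = Y_op arg (- of_int k)"
  using Y_op_int[OF arg, of "- k"] by (intro cbop_eqI l2_eqI) (simp add: Rep_shift_op)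

text \<open>Integral shifts belong to the group of the Y_phi and commute with it, so conjugation
  acts on the diagonal factor alone. The outcome has the shape of the symbol of b(D) e_k(M).\<close>

lemma Y_conj_shift_op: "Y_conj arg \<phi> (A * shift_op k) = Y_conj arg \<phi> A * Y_op arg (- of_int k)"
proof -
  have "Y_op arg (- of_int k) * Y_op arg (- \<phi>) = Y_op arg (- \<phi>) * Y_op arg (- of_int k)"
    by (simp only: Y_op_add[OF arg, symmetric] add.commute)
  then show ?thesis by (simp add: Y_conj_def shift_op_eq_Y_op mult.assoc)
qed

end

lemma regular_rep_finite_support:
  assumes "finite I"
  shows "regular_rep \<phi> (\<lambda>n x. if n \<in> I then f n x else 0) = (\<Sum>k\<in>I. regular_term \<phi> f k)"
proof -
  let ?g = "\<lambda>n x. if n \<in> I then f n x else 0"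
  have d0: "diag_op (\<lambda>_. 0) = (0 :: int l2 cbop)"
    using norm_diag_op_le[of "\<lambda>_. 0" 0] by simp
  have "regular_rep \<phi> ?g = (\<Sum>\<^sub>\<infinity>k\<in>I. regular_term \<phi> f k)"
    unfolding regular_rep_def by (rule infsum_cong_neutral) (auto simp: regular_term_def d0)
  then show ?thesis using assms by simp
qed

lemma regular_rep_single: "regular_rep \<phi> (single k b) = diag_op (\<lambda>j. b (ereal (of_int j - \<phi>))) * shift_op k"
  using regular_rep_finite_support[of "{k}" \<phi> "\<lambda>_. b"] by (simp add: single_def regular_term_def)

lemma cp_symbol_finite_approximation:
  assumes "S \<in> carrier CP" "0 < e"
  shows "\<exists>f\<in>carrier l1Z. \<exists>I. finite I \<and> (\<forall>z\<in>sphere 0 1.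
    norm (cp_symbol S z - circle_rep (\<lambda>n x. if n \<in> I then f n x else 0) z) \<le> e)"
proof -
  have "0 < e / 2" using assms(2) by simp
  obtain f where f: "f \<in> carrier l1Z" "\<And>z. z \<in> sphere 0 1 \<Longrightarrow> norm (cp_symbol S z - circle_rep f z) \<le> e / 2"
    using cp_symbol_approximation[OF assms(1) \<open>0 < e / 2\<close>] by blast
  obtain K :: nat where K: "(\<lambda>n x. if n \<in> {- int K..int K} then f n x else 0) \<in> carrier l1Z"
    "l1norm (\<lambda>n x. f n x - (if n \<in> {- int K..int K} then f n x else 0)) < e / 2"
    using finite_support_approximation[OF f(1) \<open>0 < e / 2\<close>] unfolding Let_def by blast
  let ?g = "\<lambda>n x. if n \<in> {- int K..int K} then f n x else 0"
  have "norm (cp_symbol S z - circle_rep ?g z) \<le> e" if z: "z \<in> sphere 0 1" for z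
  proof -
    have "norm (circle_rep f z - circle_rep ?g z) \<le> e / 2"
      using norm_regular_rep_le[OF l1Z_diff_closed[OF f(1) K(1)], of "phase z"] K(2)
      by (simp only: regular_rep_diff[OF f(1) K(1)])
    then show ?thesis
      using norm_triangle_ineq[of "cp_symbol S z - circle_rep f z" "circle_rep f z - circle_rep ?g z"] f(2)[OF z] by simp
  qed
  then show ?thesis using f(1) by (intro bexI[of _ f] exI[of _ "{- int K..int K}"]) blast+
qed

lemma cp_symbol_of_l1: "f \<in> carrier l1Z \<Longrightarrow> \<exists>S\<in>carrier CP. \<forall>z\<in>sphere 0 1. cp_symbol S z = circle_rep f z"
  by (rule cp_symbol_surj) (auto intro!: bexI[of _ f])


section \<open>The image of the boundary principal symbol\<close>

text \<open>The isomorphism is easier to write from the direct sum to the image. Closure of the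
  source appears among the assumptions because a record need not be an algebra on its
  carrier.\<close>

lemma cstar_isomorphic_inverse:
  assumes h: "h \<in> star_hom B A" and bij: "bij_betw h (carrier B) (carrier A)"
    and nrm: "\<And>x. x \<in> carrier B \<Longrightarrow> alg_norm A (h x) = alg_norm B x"
    and closed: "\<And>x y. x \<in> carrier B \<Longrightarrow> y \<in> carrier B \<Longrightarrow> x \<oplus>\<^bsub>B\<^esub> y \<in> carrier B"
      "\<And>x y. x \<in> carrier B \<Longrightarrow> y \<in> carrier B \<Longrightarrow> x \<otimes>\<^bsub>B\<^esub> y \<in> carrier B"
      "\<And>c x. x \<in> carrier B \<Longrightarrow> c \<odot>\<^bsub>B\<^esub> x \<in> carrier B" "\<And>x. x \<in> carrier B \<Longrightarrow> invol B x \<in> carrier B"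
  shows "cstar_isomorphic A B"
proof -
  define g where "g = inv_into (carrier B) h"
  have bijg: "bij_betw g (carrier A) (carrier B)" unfolding g_def by (rule bij_betw_inv_into[OF bij])
  have g: "g x \<in> carrier B" "h (g x) = x" if "x \<in> carrier A" for x
    using that bijg bij_betw_inv_into_right[OF bij] by (auto simp: g_def bij_betw_def)
  have gh: "g (h y) = y" if "y \<in> carrier B" for y
    using bij_betw_inv_into_left[OF bij that] by (simp add: g_def)
  have hs: "\<And>x y. x \<in> carrier B \<Longrightarrow> y \<in> carrier B \<Longrightarrow> h (x \<oplus>\<^bsub>B\<^esub> y) = h x \<oplus>\<^bsub>A\<^esub> h y"
    "\<And>x y. x \<in> carrier B \<Longrightarrow> y \<in> carrier B \<Longrightarrow> h (x \<otimes>\<^bsub>B\<^esub> y) = h x \<otimes>\<^bsub>A\<^esub> h y"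
    "\<And>c x. x \<in> carrier B \<Longrightarrow> h (c \<odot>\<^bsub>B\<^esub> x) = c \<odot>\<^bsub>A\<^esub> h x"
    "\<And>x. x \<in> carrier B \<Longrightarrow> h (invol B x) = invol A (h x)"
    using h by (simp_all add: star_hom_def)
  have "g (x \<oplus>\<^bsub>A\<^esub> y) = g x \<oplus>\<^bsub>B\<^esub> g y" "g (x \<otimes>\<^bsub>A\<^esub> y) = g x \<otimes>\<^bsub>B\<^esub> g y" if "x \<in> carrier A" "y \<in> carrier A" for x y
    using gh[OF closed(1)[OF g(1)[OF that(1)] g(1)[OF that(2)]]] gh[OF closed(2)[OF g(1)[OF that(1)] g(1)[OF that(2)]]]
    by (simp_all add: hs g that)
  moreover have "g (c \<odot>\<^bsub>A\<^esub> x) = c \<odot>\<^bsub>B\<^esub> g x" "g (invol A x) = invol B (g x)" if "x \<in> carrier A" for c x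
    using gh[OF closed(3)[OF g(1)[OF that]]] gh[OF closed(4)[OF g(1)[OF that]]] by (simp_all add: hs g that)
  ultimately have "g \<in> star_hom A B" using g(1) by (auto simp: star_hom_def)
  moreover have "alg_norm B (g x) = alg_norm A x" if "x \<in> carrier A" for x
    using nrm[OF g(1)[OF that]] by (simp add: g that)
  ultimately show ?thesis unfolding cstar_isomorphic_def using bijg by blast
qed

lemma operator_algebra_simps:
  "x \<otimes>\<^bsub>operator_algebra\<^esub> y = x * y" "x \<oplus>\<^bsub>operator_algebra\<^esub> y = x + y"
  "c \<odot>\<^bsub>operator_algebra\<^esub> x = cbop_scale c x" "invol operator_algebra x = cbop_adjoint x"
  by (simp_all add: operator_algebra_def cstar_generated_def)

abbreviation boundary :: "(complex \<times> int) set" where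
  "boundary \<equiv> sphere 0 1 \<times> {- 1, 1}"

lemma symbol_algebra_simps:
  "G \<otimes>\<^bsub>symbol_algebra\<^esub> H = (\<lambda>v\<in>boundary. G v * H v)" "G \<oplus>\<^bsub>symbol_algebra\<^esub> H = (\<lambda>v\<in>boundary. G v + H v)"
  "c \<odot>\<^bsub>symbol_algebra\<^esub> G = (\<lambda>v\<in>boundary. cbop_scale c (G v))" "invol symbol_algebra G = (\<lambda>v\<in>boundary. cbop_adjoint (G v))"
  "alg_norm symbol_algebra G = (SUP v\<in>boundary. norm (G v))"
  by (simp_all add: symbol_algebra_def continuous_algebra_def)

lemma symbol_algebra_extensional: "G \<in> carrier symbol_algebra \<Longrightarrow> G \<in> extensional boundary"
  by (simp add: symbol_algebra_def continuous_algebra_def)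

lemma operator_algebra_mult_op:
  "continuous_on UNIV a \<Longrightarrow> mult_op (on_line a) \<in> carrier operator_algebra"
  "continuous_on UNIV p \<Longrightarrow> (\<And>x. p (x + 2 * pi) = p x) \<Longrightarrow> mult_op p \<in> carrier operator_algebra"
  "continuous_on UNIV b \<Longrightarrow> fourier_multiplier (on_line b) \<in> carrier operator_algebra"
  unfolding operator_algebra_def
  by (rule subsetD[OF cstar_generated_superset], use C_ext_carrier in blast)+

lemma mult_op_exp_mem: "mult_op (\<lambda>x. cis (of_int k * x)) \<in> carrier operator_algebra"
proof (rule operator_algebra_mult_op(2))
  show "continuous_on UNIV (\<lambda>x. cis (of_int k * x))" by (intro continuous_intros)
  show "cis (of_int k * (x + 2 * pi)) = cis (of_int k * x)" for x
  proof -
    have "of_int k * (x + 2 * pi) = of_int k * x + 2 * pi * of_int k" by (simp add: algebra_simps)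
    then show ?thesis by (simp only: cis_mult[symmetric] cis_multiple_2pi Ints_of_int mult_1_right)
  qed
qed

lemma trig_bounded: "trig t \<Longrightarrow> \<exists>K. \<forall>x. cmod (t (cis x)) \<le> K"
proof (induction rule: trig.induct)
  case (monomial c k)
  show ?case by (auto simp: norm_mult norm_power_int)
next
  case (add f g)
  then obtain K L where "\<And>x. cmod (f (cis x)) \<le> K" "\<And>x. cmod (g (cis x)) \<le> L" by blast
  then show ?case by (intro exI[of _ "K + L"] allI norm_triangle_le add_mono)
qed

definition at_end :: "(ereal \<Rightarrow> complex) \<Rightarrow> int \<Rightarrow> complex" where
  "at_end a s = (if s = 1 then a \<infinity> else a (- \<infinity>))"

context
  fixes arg :: "complex \<Rightarrow> real" and \<gamma> :: "L2R cbop \<Rightarrow> complex \<times> int \<Rightarrow> int l2 cbop"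
  assumes arg: "argument_choice arg" and symbol: "boundary_principal_symbol arg \<gamma>"
begin

lemma gamma_star_hom: "\<gamma> \<in> star_hom operator_algebra symbol_algebra"
  using symbol by (simp add: boundary_principal_symbol_def)

lemma gamma_mult_op:
  assumes "continuous_on UNIV a" "(z, s) \<in> boundary"
  shows "\<gamma> (mult_op (on_line a)) (z, s) = cbop_scale (at_end a s) 1"
proof -
  have "a \<in> carrier C_ext" using assms(1) by (simp add: C_ext_carrier)
  then have "\<gamma> (mult_op (on_line a)) (cis (2 * pi * phase z), 1) = cbop_scale (a \<infinity>) cbop_one
      \<and> \<gamma> (mult_op (on_line a)) (cis (2 * pi * phase z), - 1) = cbop_scale (a (- \<infinity>)) cbop_one"
    using symbol unfolding boundary_principal_symbol_def by blast
  then show ?thesis using assms(2) cis_phase[of z] by (auto simp: at_end_def cbop_ops)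
qed

lemma gamma_exp:
  assumes "(z, s) \<in> boundary"
  shows "\<gamma> (mult_op (\<lambda>x. cis (of_int k * x))) (z, s) = Y_op arg (- of_int k)"
proof -
  have "s \<in> {- 1, 1}" using assms by simp
  then have "\<gamma> (mult_op (\<lambda>x. cis (of_int k * x))) (cis (2 * pi * phase z), s) = Y_op arg (- of_int k)"
    using symbol unfolding boundary_principal_symbol_def by blast
  then show ?thesis using assms cis_phase[of z] by simp
qed

lemma gamma_fourier_multiplier:
  assumes "continuous_on UNIV b" "(z, s) \<in> boundary"
  shows "\<gamma> (fourier_multiplier (on_line b)) (z, s) = Y_conj arg (phase z) (diag_op (\<lambda>j. b (ereal (of_int j - phase z))))"
proof -
  have "b \<in> carrier C_ext" "s \<in> {- 1, 1}" using assms by (simp_all add: C_ext_carrier)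
  then have "\<gamma> (fourier_multiplier (on_line b)) (cis (2 * pi * phase z), s) =
      Y_op arg (phase z) \<circ>\<^sub>o diag_op (\<lambda>j. b (ereal (of_int j - phase z))) \<circ>\<^sub>o Y_op arg (- phase z)"
    using symbol unfolding boundary_principal_symbol_def by blast
  then show ?thesis using assms cis_phase[of z] by (simp add: Y_conj_def cbop_ops)
qed

text \<open>\<open>star_hom\<close> does not ask for units; that gamma preserves the unit is read
  off from its value on multiplication by the constant 1.\<close>

lemma gamma_hom: "operator_family_hom (carrier operator_algebra) boundary \<gamma>"
proof
  show "cstar_subalgebra (carrier operator_algebra) bounded_operators"
    unfolding operator_algebra_def by (rule cstar_subalgebra_generated)
  have one: "mult_op (on_line (\<lambda>_. 1)) = 1" by (rule mult_op_one)
  show "1 \<in> carrier operator_algebra"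
    using operator_algebra_mult_op(1)[of "\<lambda>_. 1"] by (simp add: one)
  show "\<gamma> 1 v = 1" if "v \<in> boundary" for v
    using gamma_mult_op[of "\<lambda>_. 1" "fst v" "snd v"] that by (simp add: one at_end_def scale_simps)
qed (use gamma_star_hom in \<open>auto simp: star_hom_def operator_algebra_simps symbol_algebra_simps\<close>)

interpretation gam: operator_family_hom "carrier operator_algebra" boundary \<gamma>
  by (rule gamma_hom)

text \<open>The two ends are treated separately: the symbols on each circle range over a full copy
  of the crossed product, independently of the other circle.\<close>

definition has_cp_symbol :: "L2R cbop \<Rightarrow> int \<Rightarrow> bool" where
  "has_cp_symbol x s \<longleftrightarrow> (\<exists>S\<in>carrier CP. \<forall>z\<in>sphere 0 1. \<gamma> x (z, s) = Y_conj arg (phase z) (cp_symbol S z))"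

lemma has_cp_symbol_l1:
  assumes "f \<in> carrier l1Z" "\<And>z. z \<in> sphere 0 1 \<Longrightarrow> \<gamma> x (z, s) = Y_conj arg (phase z) (circle_rep f z)"
  shows "has_cp_symbol x s"
  using cp_symbol_of_l1[OF assms(1)] assms(2) unfolding has_cp_symbol_def by (metis (no_types))

context
  fixes s :: int
  assumes s: "s \<in> {- 1, 1}"
begin

lemma has_cp_symbol_closed_ops:
  assumes "x \<in> carrier operator_algebra" "has_cp_symbol x s"
  shows "has_cp_symbol (cbop_scale c x) s" "has_cp_symbol (cbop_adjoint x) s"
    "y \<in> carrier operator_algebra \<Longrightarrow> has_cp_symbol y s \<Longrightarrow> has_cp_symbol (x + y) s"
    "y \<in> carrier operator_algebra \<Longrightarrow> has_cp_symbol y s \<Longrightarrow> has_cp_symbol (x * y) s"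
proof -
  obtain S where S: "S \<in> carrier CP" "\<And>z. z \<in> sphere 0 1 \<Longrightarrow> \<gamma> x (z, s) = Y_conj arg (phase z) (cp_symbol S z)"
    using assms(2) unfolding has_cp_symbol_def by blast
  have bV: "(z, s) \<in> boundary" if "z \<in> sphere 0 1" for z using that s by simp
  show "has_cp_symbol (cbop_scale c x) s" unfolding has_cp_symbol_def
    by (intro bexI[OF _ cp_symbol_scale(1)[OF S(1), of c]] ballI)
      (simp only: cp_symbol_scale(2)[OF S(1)] gam.hom_scale[OF assms(1) bV] S(2) Y_conj_simps[OF arg])
  show "has_cp_symbol (cbop_adjoint x) s" unfolding has_cp_symbol_def
    by (intro bexI[OF _ cp_symbol_invol(1)[OF S(1)]] ballI)
      (simp only: cp_symbol_invol(2)[OF S(1)] gam.hom_adjoint[OF assms(1) bV] S(2) Y_conj_simps[OF arg])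
  assume y: "y \<in> carrier operator_algebra" "has_cp_symbol y s"
  then obtain T where T: "T \<in> carrier CP" "\<And>z. z \<in> sphere 0 1 \<Longrightarrow> \<gamma> y (z, s) = Y_conj arg (phase z) (cp_symbol T z)"
    unfolding has_cp_symbol_def by blast
  show "has_cp_symbol (x + y) s" unfolding has_cp_symbol_def
    by (intro bexI[OF _ cp_symbol_add(1)[OF S(1) T(1)]] ballI)
      (simp only: cp_symbol_add(2)[OF S(1) T(1)] gam.hom_add[OF assms(1) y(1) bV] S(2) T(2) Y_conj_simps[OF arg])
  show "has_cp_symbol (x * y) s" unfolding has_cp_symbol_def
    by (intro bexI[OF _ cp_symbol_mult(1)[OF S(1) T(1)]] ballI)
      (simp only: cp_symbol_mult(2)[OF S(1) T(1)] gam.hom_mult[OF assms(1) y(1) bV] S(2) T(2) Y_conj_mult[OF arg])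
qed

text \<open>gamma is contractive and the conjugations are isometric, so the untwisted symbols
  converge uniformly and \<open>cp_symbol_surj\<close> accepts their limit.\<close>

lemma closed_has_cp_symbol: "closed {x \<in> carrier operator_algebra. has_cp_symbol x s}"
  unfolding closed_sequential_limits
proof (intro allI impI CollectI conjI; elim conjE)
  fix xs x assume mem: "\<forall>n. xs n \<in> {x \<in> carrier operator_algebra. has_cp_symbol x s}" and lim: "xs \<longlonglongrightarrow> x"
  show x: "x \<in> carrier operator_algebra"
    using closed_sequentially[OF gam.closed_S _ lim] mem by simp
  have "\<exists>S\<in>carrier CP. \<forall>z\<in>sphere 0 1. cp_symbol S z = Y_conj arg (- phase z) (\<gamma> x (z, s))"
  proof (rule cp_symbol_surj)
    fix e :: real assume "0 < e"
    then have e2: "0 < e / 2" by simp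
    obtain n where n: "norm (x - xs n) < e / 2"
      using LIMSEQ_D[OF lim e2] by (metis norm_minus_commute order_refl)
    have xn: "xs n \<in> carrier operator_algebra" "has_cp_symbol (xs n) s" using mem by simp_all
    then obtain S where S: "S \<in> carrier CP" "\<And>z. z \<in> sphere 0 1 \<Longrightarrow> \<gamma> (xs n) (z, s) = Y_conj arg (phase z) (cp_symbol S z)"
      unfolding has_cp_symbol_def by blast
    obtain f where f: "f \<in> carrier l1Z" "\<And>z. z \<in> sphere 0 1 \<Longrightarrow> norm (cp_symbol S z - circle_rep f z) \<le> e / 2"
      using cp_symbol_approximation[OF S(1) e2] by blast
    have "norm (Y_conj arg (- phase z) (\<gamma> x (z, s)) - circle_rep f z) \<le> e" if z: "z \<in> sphere 0 1" for z
    proof -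
      have "Y_conj arg (- phase z) (\<gamma> x (z, s)) - cp_symbol S z = Y_conj arg (- phase z) (\<gamma> (x - xs n) (z, s))"
        using z s by (simp add: gam.hom_diff x xn Y_conj_simps[OF arg] S(2) Y_conj_inverse[OF arg])
      then have "norm (Y_conj arg (- phase z) (\<gamma> x (z, s)) - cp_symbol S z) \<le> norm (x - xs n)"
        using gam.norm_hom_le[OF gam.mem(8)[OF x xn(1)], of "(z, s)"] z s by (simp add: norm_Y_conj[OF arg])
      then show ?thesis
        using norm_triangle_ineq[of "Y_conj arg (- phase z) (\<gamma> x (z, s)) - cp_symbol S z" "cp_symbol S z - circle_rep f z"]
          f(2)[OF z] n by simp
    qed
    then show "\<exists>f\<in>carrier l1Z. \<forall>z\<in>sphere 0 1. norm (Y_conj arg (- phase z) (\<gamma> x (z, s)) - circle_rep f z) \<le> e"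
      using f(1) by blast
  qed
  then obtain S where S: "S \<in> carrier CP" "\<And>z. z \<in> sphere 0 1 \<Longrightarrow> cp_symbol S z = Y_conj arg (- phase z) (\<gamma> x (z, s))"
    by blast
  have "\<gamma> x (z, s) = Y_conj arg (phase z) (cp_symbol S z)" if "z \<in> sphere 0 1" for z
    unfolding S(2)[OF that] using Y_conj_inverse[OF arg, of "- phase z" "\<gamma> x (z, s)"] by simp
  then show "has_cp_symbol x s" unfolding has_cp_symbol_def using S(1) by blast
qed

text \<open>At one end the symbol is a scalar, so the coefficient of index 0 is the constant
  function with the value of \<open>a\<close> at that end, not \<open>a\<close> itself.\<close>

lemma has_cp_symbol_mult_op: "continuous_on UNIV a \<Longrightarrow> has_cp_symbol (mult_op (on_line a)) s"
proof (rule has_cp_symbol_l1)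
  assume a: "continuous_on UNIV a"
  show "single 0 (\<lambda>_. at_end a s) \<in> carrier l1Z" by (rule single_closed) simp
  fix z :: complex assume z: "z \<in> sphere 0 1"
  have d: "diag_op (\<lambda>j. c) = (cbop_scale c 1 :: int l2 cbop)" for c
    by (intro cbop_eqI l2_eqI) (simp add: Rep_diag_op[where K = "cmod c"] scaleC_l2.rep_eq)
  show "\<gamma> (mult_op (on_line a)) (z, s) = Y_conj arg (phase z) (circle_rep (single 0 (\<lambda>_. at_end a s)) z)"
    using z s by (simp add: gamma_mult_op[OF a] regular_rep_single Y_conj_shift_op[OF arg] d Y_conj_simps[OF arg] Y_op_0[OF arg])
      (simp add: Y_conj_def Y_op_add[OF arg, symmetric] Y_op_0[OF arg])
qed

lemma has_cp_symbol_fourier_multiplier: "continuous_on UNIV b \<Longrightarrow> has_cp_symbol (fourier_multiplier (on_line b)) s"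
proof (rule has_cp_symbol_l1)
  assume b: "continuous_on UNIV b"
  show "single 0 b \<in> carrier l1Z" by (rule single_closed[OF b])
  fix z :: complex assume z: "z \<in> sphere 0 1"
  then show "\<gamma> (fourier_multiplier (on_line b)) (z, s) = Y_conj arg (phase z) (circle_rep (single 0 b) z)"
    using s by (simp add: gamma_fourier_multiplier[OF b] regular_rep_single Y_conj_shift_op[OF arg] Y_op_0[OF arg])
qed

lemma has_cp_symbol_exp: "has_cp_symbol (mult_op (\<lambda>x. cis (of_int k * x))) s"
proof (rule has_cp_symbol_l1)
  show "single k (\<lambda>_. 1) \<in> carrier l1Z" by (rule single_closed) simp
  fix z :: complex assume z: "z \<in> sphere 0 1"
  have d: "diag_op (\<lambda>j. 1) = (1 :: int l2 cbop)"
    by (intro cbop_eqI l2_eqI) (simp add: Rep_diag_op[where K = 1])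
  have "Y_conj arg (phase z) 1 = 1" by (simp add: Y_conj_def Y_op_add[OF arg, symmetric] Y_op_0[OF arg])
  then show "\<gamma> (mult_op (\<lambda>x. cis (of_int k * x))) (z, s) = Y_conj arg (phase z) (circle_rep (single k (\<lambda>_. 1)) z)"
    using z s Y_conj_shift_op[OF arg, of "phase z" 1 k] by (simp add: gamma_exp regular_rep_single d)
qed

lemma has_cp_symbol_trig:
  "trig t \<Longrightarrow> mult_op (\<lambda>x. t (cis x)) \<in> {x \<in> carrier operator_algebra. has_cp_symbol x s}"
proof (induction rule: trig.induct)
  case (monomial c k)
  have "mult_op (\<lambda>x. c * cis (of_int k * x)) = cbop_scale c (mult_op (\<lambda>x. cis (of_int k * x)))"
    by (rule mult_op_scale[where K = 1]) (simp_all add: cis_mult_measurable)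
  then show ?case
    using gam.mem(4)[OF mult_op_exp_mem] has_cp_symbol_closed_ops(1)[OF mult_op_exp_mem has_cp_symbol_exp]
    by (simp add: cis_power_int)
next
  case (add f g)
  obtain K L where "\<And>x. cmod (f (cis x)) \<le> K" "\<And>x. cmod (g (cis x)) \<le> L"
    using trig_bounded[OF add.hyps(1)] trig_bounded[OF add.hyps(2)] by blast
  then have "mult_op (\<lambda>x. f (cis x) + g (cis x)) = mult_op (\<lambda>x. f (cis x)) + mult_op (\<lambda>x. g (cis x))"
    using trig_measurable[OF add.hyps(1)] trig_measurable[OF add.hyps(2)] by (intro mult_op_add) simp_all
  then show ?case using add.IH gam.mem(2) has_cp_symbol_closed_ops(3) by simp
qed

text \<open>The symbol is prescribed for exponentials only; uniform trigonometric approximation and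
  closedness reach all continuous periodic functions.\<close>

lemma has_cp_symbol_periodic:
  assumes "continuous_on UNIV p" "\<And>x. p (x + 2 * pi) = p x"
  shows "has_cp_symbol (mult_op p) s"
proof -
  have m: "p \<in> borel_measurable lborel" using borel_measurable_continuous_onI[OF assms(1)] by simp
  have "mult_op p \<in> closure {x \<in> carrier operator_algebra. has_cp_symbol x s}"
    unfolding closure_approachable
  proof (intro allI impI)
    fix e :: real assume "0 < e"
    then have "0 < e / 2" by simp
    obtain t where t: "trig t" "\<And>x. cmod (p x - t (cis x)) < e / 2"
      using periodic_trig_approximation[OF assms \<open>0 < e / 2\<close>] by blast
    have tm: "(\<lambda>x. t (cis x)) \<in> borel_measurable lborel" using trig_measurable[OF t(1)] by simp
    obtain K where K: "\<And>x. cmod (t (cis x)) \<le> K" using trig_bounded[OF t(1)] by blast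
    have pK: "cmod (p x) \<le> K + e / 2" for x
      using norm_triangle_ineq[of "t (cis x)" "p x - t (cis x)"] K[of x] t(2)[of x] by simp
    have "norm (mult_op p - mult_op (\<lambda>x. t (cis x))) \<le> e / 2"
      unfolding mult_op_diff[OF m pK tm K, symmetric]
      by (rule norm_mult_op_le) (use m tm t(2) in \<open>auto intro: less_imp_le\<close>)
    then have "dist (mult_op (\<lambda>x. t (cis x))) (mult_op p) < e"
      using \<open>0 < e\<close> by (simp add: dist_norm norm_minus_commute)
    then show "\<exists>y\<in>{x \<in> carrier operator_algebra. has_cp_symbol x s}. dist y (mult_op p) < e"
      using has_cp_symbol_trig[OF t(1)] by blast
  qed
  then show ?thesis using closed_has_cp_symbol by simp
qed

end

lemma has_cp_symbol:
  assumes "x \<in> carrier operator_algebra" "s \<in> {- 1, 1}"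
  shows "has_cp_symbol x s"
proof -
  let ?S = "{x \<in> carrier operator_algebra. has_cp_symbol x s}"
  \<comment> \<open>0 is the multiple by 0 of the identity, which is a generator with a known
    symbol.\<close>
  have z: "0 \<in> ?S"
  proof -
    have c1: "continuous_on UNIV (\<lambda>_::ereal. 1::complex)" by simp
    from operator_algebra_mult_op(1)[OF this] has_cp_symbol_closed_ops(1)[OF assms(2) _ has_cp_symbol_mult_op[OF assms(2) c1], of 0]
    show ?thesis using gam.mem(1) by (simp add: scale_simps)
  qed
  have "cstar_subalgebra ?S bounded_operators"
    unfolding cstar_subalgebra_bounded_operators_iff
    using z closed_has_cp_symbol[OF assms(2)] by (auto intro: gam.mem has_cp_symbol_closed_ops[OF assms(2)])
  then have "carrier operator_algebra \<subseteq> ?S"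
    unfolding operator_algebra_def
  proof (rule cstar_generated_least, fold operator_algebra_def)
    show "{mult_op (on_line a) | a. a \<in> carrier C_ext}
      \<union> {mult_op p | p. continuous_on UNIV p \<and> (\<forall>x. p (x + 2 * pi) = p x)}
      \<union> {fourier_multiplier (on_line b) | b. b \<in> carrier C_ext} \<subseteq> ?S"
      using operator_algebra_mult_op has_cp_symbol_mult_op[OF assms(2)]
        has_cp_symbol_periodic[OF assms(2)] has_cp_symbol_fourier_multiplier[OF assms(2)]
      by (auto simp: C_ext_carrier)
  qed
  then show ?thesis using assms(1) by blast
qed

text \<open>The operator is the sum over k in I of \<psi>(M) f_k(D) e_k(M). On each circle the first
  factor becomes the value of \<psi> at that end, the other two the conjugate of the k-th regular
  term.\<close>

lemma finite_support_lift:
  assumes f: "f \<in> carrier l1Z" and \<psi>: "continuous_on UNIV \<psi>" and "finite I"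
  shows "\<exists>x\<in>carrier operator_algebra. \<forall>z s. (z, s) \<in> boundary \<longrightarrow>
    \<gamma> x (z, s) = cbop_scale (at_end \<psi> s) (Y_conj arg (phase z) (circle_rep (\<lambda>n x. if n \<in> I then f n x else 0) z))"
proof -
  have "\<exists>x\<in>carrier operator_algebra. \<forall>z s. (z, s) \<in> boundary \<longrightarrow>
    \<gamma> x (z, s) = cbop_scale (at_end \<psi> s) (Y_conj arg (phase z) (\<Sum>k\<in>I. regular_term (phase z) f k))"
    using \<open>finite I\<close>
  proof (induction I rule: finite_induct)
    case empty
    have "\<gamma> 0 v = 0" if "v \<in> boundary" for v
      using gam.hom_scale[OF gam.one_mem that, of 0] by (simp add: scale_simps)
    moreover have "cbop_scale c 0 = (0 :: int l2 cbop)" for c by (rule cbop_eqI) (simp add: scaleC_zero_right)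
    ultimately show ?case by (intro bexI[of _ 0] gam.mem) (auto simp: Y_conj_def)
  next
    case (insert k I)
    then obtain x where x: "x \<in> carrier operator_algebra" "\<And>z s. (z, s) \<in> boundary \<Longrightarrow>
      \<gamma> x (z, s) = cbop_scale (at_end \<psi> s) (Y_conj arg (phase z) (\<Sum>k\<in>I. regular_term (phase z) f k))" by blast
    note fk = l1Z_continuous[OF f, of k]
    let ?a = "mult_op (on_line \<psi>)" and ?b = "fourier_multiplier (on_line (f k))" and ?c = "mult_op (\<lambda>x. cis (of_int k * x))"
    note mem = operator_algebra_mult_op(1)[OF \<psi>] operator_algebra_mult_op(3)[OF fk] mult_op_exp_mem[of k]
    define y where "y = ?a * (?b * ?c)"
    have y: "y \<in> carrier operator_algebra" unfolding y_def by (intro gam.mem(3) mem)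
    have "\<gamma> y (z, s) = cbop_scale (at_end \<psi> s) (Y_conj arg (phase z) (regular_term (phase z) f k))" if "(z, s) \<in> boundary" for z s
      unfolding y_def gam.hom_mult[OF mem(1) gam.mem(3)[OF mem(2,3)] that] gam.hom_mult[OF mem(2,3) that]
        gamma_mult_op[OF \<psi> that] gamma_fourier_multiplier[OF fk that] gamma_exp[OF that]
        regular_term_def Y_conj_shift_op[OF arg] by (simp add: scale_simps)
    then have "\<forall>z s. (z, s) \<in> boundary \<longrightarrow> \<gamma> (y + x) (z, s) =
        cbop_scale (at_end \<psi> s) (Y_conj arg (phase z) (\<Sum>k\<in>insert k I. regular_term (phase z) f k))"
      unfolding sum.insert[OF insert.hyps]
      by (intro allI impI) (simp only: gam.hom_add[OF y x(1)] x(2) Y_conj_simps[OF arg] scale_simps)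
    then show ?case using gam.mem(2)[OF y x(1)] by blast
  qed
  then show ?thesis unfolding regular_rep_finite_support[OF \<open>finite I\<close>] .
qed

definition symbol_pair :: "(nat \<Rightarrow> int \<Rightarrow> ereal \<Rightarrow> complex) set \<times> (nat \<Rightarrow> int \<Rightarrow> ereal \<Rightarrow> complex) set \<Rightarrow> complex \<times> int \<Rightarrow> int l2 cbop" where
  "symbol_pair P = (\<lambda>(z, s)\<in>boundary. Y_conj arg (phase z) (cp_symbol (if s = 1 then fst P else snd P) z))"

lemma symbol_pair_extensional: "symbol_pair P \<in> extensional boundary"
  unfolding symbol_pair_def by (rule restrict_extensional)

lemma symbol_pair_apply:
  "(z, s) \<in> boundary \<Longrightarrow> symbol_pair P (z, s) = Y_conj arg (phase z) (cp_symbol (if s = 1 then fst P else snd P) z)"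
  by (simp add: symbol_pair_def)

text \<open>At each end one of the cutoffs \<open>\<psi>\<close>, \<open>\<psi>'\<close> is 1 and
  the other 0, so approximations for S and T combine without interfering.
  \<open>image_closed\<close> then yields an exact preimage, and with it the continuity of
  \<open>symbol_pair (S, T)\<close> across the jump of \<open>phase\<close>.\<close>

lemma symbol_pair_lift:
  assumes "S \<in> carrier CP" "T \<in> carrier CP"
  shows "symbol_pair (S, T) \<in> \<gamma> ` carrier operator_algebra"
proof -
  obtain \<tau> where \<tau>: "continuous_on UNIV \<tau>" "\<And>x. \<tau> x \<in> {0..1} \<and> ereal_param (\<tau> x) = x"
    using ereal_param_inverse by blast
  have \<tau>_end: "\<tau> \<infinity> = 1" "\<tau> (- \<infinity>) = 0"
    using \<tau>(2)[of \<infinity>] \<tau>(2)[of "- \<infinity>"] by (auto simp: ereal_param_def split: if_splits)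
  define \<psi> where "\<psi> x = complex_of_real (\<tau> x)" for x
  define \<psi>' where "\<psi>' x = complex_of_real (1 - \<tau> x)" for x
  have \<psi>: "continuous_on UNIV \<psi>" "continuous_on UNIV \<psi>'"
    unfolding \<psi>_def \<psi>'_def by (intro continuous_intros \<tau>(1))+
  have "\<exists>x\<in>carrier operator_algebra. \<forall>v\<in>boundary. symbol_pair (S, T) v = \<gamma> x v"
  proof (rule gam.image_closed)
    fix e :: real assume "0 < e"
    obtain f I where f: "f \<in> carrier l1Z" "finite I" "\<And>z. z \<in> sphere 0 1 \<Longrightarrow>
      norm (cp_symbol S z - circle_rep (\<lambda>n x. if n \<in> I then f n x else 0) z) \<le> e"
      using cp_symbol_finite_approximation[OF assms(1) \<open>0 < e\<close>] by blast
    obtain g J where g: "g \<in> carrier l1Z" "finite J" "\<And>z. z \<in> sphere 0 1 \<Longrightarrow>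
      norm (cp_symbol T z - circle_rep (\<lambda>n x. if n \<in> J then g n x else 0) z) \<le> e"
      using cp_symbol_finite_approximation[OF assms(2) \<open>0 < e\<close>] by blast
    obtain x where x: "x \<in> carrier operator_algebra" "\<And>z s. (z, s) \<in> boundary \<Longrightarrow>
      \<gamma> x (z, s) = cbop_scale (at_end \<psi> s) (Y_conj arg (phase z) (circle_rep (\<lambda>n x. if n \<in> I then f n x else 0) z))"
      using finite_support_lift[OF f(1) \<psi>(1) f(2)] by blast
    obtain y where y: "y \<in> carrier operator_algebra" "\<And>z s. (z, s) \<in> boundary \<Longrightarrow>
      \<gamma> y (z, s) = cbop_scale (at_end \<psi>' s) (Y_conj arg (phase z) (circle_rep (\<lambda>n x. if n \<in> J then g n x else 0) z))"
      using finite_support_lift[OF g(1) \<psi>(2) g(2)] by blast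
    have "norm (symbol_pair (S, T) (z, s) - \<gamma> (x + y) (z, s)) \<le> e" if "(z, s) \<in> boundary" for z s
    proof (cases "s = 1")
      case True
      have "symbol_pair (S, T) (z, s) - \<gamma> (x + y) (z, s) =
          Y_conj arg (phase z) (cp_symbol S z - circle_rep (\<lambda>n x. if n \<in> I then f n x else 0) z)"
        unfolding symbol_pair_apply[OF that] gam.hom_add[OF x(1) y(1) that] x(2)[OF that] y(2)[OF that]
        by (simp add: True at_end_def \<psi>_def \<psi>'_def \<tau>_end scale_simps Y_conj_simps[OF arg])
      then show ?thesis using f(3)[of z] that by (simp add: norm_Y_conj[OF arg])
    next
      case False
      have "symbol_pair (S, T) (z, s) - \<gamma> (x + y) (z, s) =
          Y_conj arg (phase z) (cp_symbol T z - circle_rep (\<lambda>n x. if n \<in> J then g n x else 0) z)"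
        unfolding symbol_pair_apply[OF that] gam.hom_add[OF x(1) y(1) that] x(2)[OF that] y(2)[OF that]
        by (simp add: False at_end_def \<psi>_def \<psi>'_def \<tau>_end scale_simps Y_conj_simps[OF arg])
      then show ?thesis using g(3)[of z] that by (simp add: norm_Y_conj[OF arg])
    qed
    then show "\<exists>x\<in>carrier operator_algebra. \<forall>v\<in>boundary. norm (symbol_pair (S, T) v - \<gamma> x v) \<le> e"
      using gam.mem(2)[OF x(1) y(1)] by (metis (no_types, lifting) surj_pair)
  qed
  then obtain x where x: "x \<in> carrier operator_algebra" "\<And>v. v \<in> boundary \<Longrightarrow> symbol_pair (S, T) v = \<gamma> x v" by blast
  have "\<gamma> x \<in> carrier symbol_algebra" using gamma_star_hom x(1) by (auto simp: star_hom_def)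
  from symbol_algebra_extensional[OF this] have "symbol_pair (S, T) = \<gamma> x"
    by (intro extensionalityI[where A = boundary] x(2) symbol_pair_extensional)
  then show ?thesis using x(1) by blast
qed

lemma gamma_image: "\<gamma> ` carrier operator_algebra = symbol_pair ` (carrier CP \<times> carrier CP)"
proof (rule equalityI)
  show "symbol_pair ` (carrier CP \<times> carrier CP) \<subseteq> \<gamma> ` carrier operator_algebra"
    using symbol_pair_lift by auto
  show "\<gamma> ` carrier operator_algebra \<subseteq> symbol_pair ` (carrier CP \<times> carrier CP)"
  proof (rule image_subsetI)
    fix x assume x: "x \<in> carrier operator_algebra"
    obtain S where S: "S \<in> carrier CP" "\<And>z. z \<in> sphere 0 1 \<Longrightarrow> \<gamma> x (z, 1) = Y_conj arg (phase z) (cp_symbol S z)"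
      using has_cp_symbol[OF x, of 1] unfolding has_cp_symbol_def by blast
    obtain T where T: "T \<in> carrier CP" "\<And>z. z \<in> sphere 0 1 \<Longrightarrow> \<gamma> x (z, - 1) = Y_conj arg (phase z) (cp_symbol T z)"
      using has_cp_symbol[OF x, of "- 1"] unfolding has_cp_symbol_def by blast
    have "\<gamma> x \<in> carrier symbol_algebra" using gamma_star_hom x by (auto simp: star_hom_def)
    from symbol_algebra_extensional[OF this] symbol_pair_extensional have "\<gamma> x = symbol_pair (S, T)"
    proof (rule extensionalityI)
      fix v assume "v \<in> boundary"
      then show "\<gamma> x v = symbol_pair (S, T) v"
        by (cases v) (auto simp: symbol_pair_def S(2) T(2))
    qed
    then show "\<gamma> x \<in> symbol_pair ` (carrier CP \<times> carrier CP)" using S(1) T(1) by blast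
  qed
qed

lemma symbol_pair_inj: "inj_on symbol_pair (carrier CP \<times> carrier CP)"
proof (rule inj_onI, clarify)
  fix S T S' T' assume CP: "S \<in> carrier CP" "T \<in> carrier CP" "S' \<in> carrier CP" "T' \<in> carrier CP"
    and eq: "symbol_pair (S, T) = symbol_pair (S', T')"
  have "cp_symbol S z = cp_symbol S' z \<and> cp_symbol T z = cp_symbol T' z" if "z \<in> sphere 0 1" for z
  proof -
    have "Y_conj arg (phase z) (cp_symbol S z) = Y_conj arg (phase z) (cp_symbol S' z)"
      "Y_conj arg (phase z) (cp_symbol T z) = Y_conj arg (phase z) (cp_symbol T' z)"
      using fun_cong[OF eq, of "(z, 1)"] fun_cong[OF eq, of "(z, - 1)"] that by (simp_all add: symbol_pair_def)
    then show ?thesis by (metis Y_conj_inverse[OF arg])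
  qed
  then show "S = S' \<and> T = T'" using cp_symbol_inj CP by blast
qed

lemma norm_symbol_pair:
  assumes "S \<in> carrier CP" "T \<in> carrier CP"
  shows "(SUP v\<in>boundary. norm (symbol_pair (S, T) v)) = max (alg_norm CP S) (alg_norm CP T)"
proof -
  note bS = cp_symbol_norm(2)[OF assms(1)] and bT = cp_symbol_norm(2)[OF assms(2)]
  have app: "norm (symbol_pair (S, T) (z, s)) = norm (cp_symbol (if s = 1 then S else T) z)" if "(z, s) \<in> boundary" for z s
    by (simp add: symbol_pair_apply[OF that] norm_Y_conj[OF arg])
  have le: "norm (symbol_pair (S, T) v) \<le> max (alg_norm CP S) (alg_norm CP T)" if "v \<in> boundary" for v
  proof -
    obtain z s where v: "v = (z, s)" by (cases v)
    then have z: "z \<in> sphere 0 1" using that by simp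
    show ?thesis
      using app[of z s] that cSUP_upper[OF z bS] cSUP_upper[OF z bT]
      unfolding v cp_symbol_norm(1)[OF assms(1)] cp_symbol_norm(1)[OF assms(2)] by (simp split: if_splits)
  qed
  have bdd: "bdd_above ((\<lambda>v. norm (symbol_pair (S, T) v)) ` boundary)" using le by (rule bdd_aboveI2)
  have ne: "sphere (0::complex) 1 \<noteq> {}" by (auto intro: exI[of _ 1])
  show ?thesis
  proof (rule antisym)
    show "(SUP v\<in>boundary. norm (symbol_pair (S, T) v)) \<le> max (alg_norm CP S) (alg_norm CP T)"
      by (rule cSUP_least[OF _ le]) (use ne in auto)
    have "norm (cp_symbol S z) \<le> (SUP v\<in>boundary. norm (symbol_pair (S, T) v))" if "z \<in> sphere 0 1" for z
      using cSUP_upper[OF _ bdd, of "(z, 1)"] app[of z 1] that by simp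
    moreover have "norm (cp_symbol T z) \<le> (SUP v\<in>boundary. norm (symbol_pair (S, T) v))" if "z \<in> sphere 0 1" for z
      using cSUP_upper[OF _ bdd, of "(z, - 1)"] app[of z "- 1"] that by simp
    ultimately show "max (alg_norm CP S) (alg_norm CP T) \<le> (SUP v\<in>boundary. norm (symbol_pair (S, T) v))"
      unfolding cp_symbol_norm(1)[OF assms(1)] cp_symbol_norm(1)[OF assms(2)]
      by (intro max.boundedI cSUP_least[OF ne])
  qed
qed

lemma boundary_symbol_image_isomorphic:
  "cstar_isomorphic (image_algebra \<gamma> operator_algebra symbol_algebra) (direct_sum CP CP)"
proof (rule cstar_isomorphic_inverse[where h = symbol_pair])
  let ?A = "image_algebra \<gamma> operator_algebra symbol_algebra" and ?B = "direct_sum CP CP"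
  have cA: "carrier ?A = symbol_pair ` (carrier CP \<times> carrier CP)" by (simp add: image_algebra_def gamma_image)
  have cB: "carrier ?B = carrier CP \<times> carrier CP" by (simp add: direct_sum_def)
  show "bij_betw symbol_pair (carrier ?B) (carrier ?A)"
    unfolding cA cB by (rule inj_on_imp_bij_betw[OF symbol_pair_inj])
  show "alg_norm ?A (symbol_pair P) = alg_norm ?B P" if "P \<in> carrier ?B" for P
    using that norm_symbol_pair[of "fst P" "snd P"]
    by (auto simp: cB direct_sum_def image_algebra_def symbol_algebra_simps)
  show "P \<oplus>\<^bsub>?B\<^esub> Q \<in> carrier ?B" "P \<otimes>\<^bsub>?B\<^esub> Q \<in> carrier ?B" if "P \<in> carrier ?B" "Q \<in> carrier ?B" for P Q
    using that by (auto simp: direct_sum_def cp_symbol_add(1) cp_symbol_mult(1))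
  show "c \<odot>\<^bsub>?B\<^esub> P \<in> carrier ?B" "invol ?B P \<in> carrier ?B" if "P \<in> carrier ?B" for P c
    using that by (auto simp: direct_sum_def cp_symbol_scale(1) cp_symbol_invol(1))
  show "symbol_pair \<in> star_hom ?B ?A"
    unfolding star_hom_def
  proof (intro CollectI conjI ballI allI)
    show "symbol_pair \<in> carrier ?B \<rightarrow> carrier ?A" by (auto simp: cA cB)
  next
    fix P Q assume "P \<in> carrier ?B" "Q \<in> carrier ?B"
    then have c: "fst P \<in> carrier CP" "snd P \<in> carrier CP" "fst Q \<in> carrier CP" "snd Q \<in> carrier CP"
      by (auto simp: cB)
    show "symbol_pair (P \<oplus>\<^bsub>?B\<^esub> Q) = symbol_pair P \<oplus>\<^bsub>?A\<^esub> symbol_pair Q"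
      by (rule extensionalityI[where A = boundary])
        (auto simp: symbol_pair_def image_algebra_def symbol_algebra_simps direct_sum_def cp_symbol_add(2) c Y_conj_simps[OF arg])
    show "symbol_pair (P \<otimes>\<^bsub>?B\<^esub> Q) = symbol_pair P \<otimes>\<^bsub>?A\<^esub> symbol_pair Q"
      by (rule extensionalityI[where A = boundary])
        (auto simp: symbol_pair_def image_algebra_def symbol_algebra_simps direct_sum_def cp_symbol_mult(2) c Y_conj_mult[OF arg])
  next
    fix P d assume "P \<in> carrier ?B"
    then have c: "fst P \<in> carrier CP" "snd P \<in> carrier CP" by (auto simp: cB)
    show "symbol_pair (d \<odot>\<^bsub>?B\<^esub> P) = d \<odot>\<^bsub>?A\<^esub> symbol_pair P"
      by (rule extensionalityI[where A = boundary])
        (auto simp: symbol_pair_def image_algebra_def symbol_algebra_simps direct_sum_def cp_symbol_scale(2) c Y_conj_simps[OF arg])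
    show "symbol_pair (invol ?B P) = invol ?A (symbol_pair P)"
      by (rule extensionalityI[where A = boundary])
        (auto simp: symbol_pair_def image_algebra_def symbol_algebra_simps direct_sum_def cp_symbol_invol(2) c Y_conj_simps[OF arg])
  qed
qed

end

theorem mainTheorem2:
  fixes arg :: "complex \<Rightarrow> real"
    and \<gamma> :: "L2R cbop \<Rightarrow> complex \<times> int \<Rightarrow> int l2 cbop"
  assumes "argument_choice arg"
    and "boundary_principal_symbol arg \<gamma>"
  shows "cstar_isomorphic (image_algebra \<gamma> operator_algebra symbol_algebra)
    (direct_sum (crossed_product C_ext translation) (crossed_product C_ext translation))"
  by (rule boundary_symbol_image_isomorphic[OF assms])

end
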